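(* Let $Y_\cdot$ be a process in $D([0,T],\mathcal S_W'(\mathbb T^d))$ such that $Y_0$ is a Gaussian field on $\mathcal S_W'(\mathbb T^d)$ and, for any $G\in\mathcal S_W(\mathbb T^d)$, $$M_t(G)=Y_t(G)-Y_0(G)-\phi'(\rho)\int_0^tY_s(\nabla A\nabla_WG)\,ds$$ is a martingale of quadratic variation $$\langle M_t(G)\rangle=2t\,\chi(\rho)\phi'(\rho)\sum_{j=1}^d\int_{\mathbb T^d}a_{jj}\,(\partial_{W_j}G)^2\,d(x^j\otimes W_j).$$ Then $Y_t$ is the unique $\mathcal S_W'(\mathbb T^d)$-solution of the stochastic differential equation $$dY_t=\phi'(\rho)\nabla A\nabla_WY_t\,dt+\sqrt{2\chi(\rho)\phi'(\rho)A}\;dN_t,$$ where $N_t$ is a mean-zero $\mathcal S_W'(\mathbb T^d)$-valued martingale with quadratic variation $\langle N(G)\rangle_t=t\sum_{j=1}^d\int_{\mathbb T^d}[\partial_{W_j}G]^2\,d(x^j\otimes W_j)$. Moreover, $Y_t$ is a Gaussian process.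
   Context: $T>0$, $\rho\in(0,1]$, $b>-1/2$, $\chi(\rho)=\rho(1-\rho)$, $\phi(\rho)=\rho+b\rho^2$, $\phi'(\rho)=1+2b\rho$. **Torus and $W$.** $\mathbb T^d=(\mathbb R/\mathbb Z)^d$, $\mathbb T=\mathbb T^1$, $\mathbb T^d_N=(\mathbb Z/N\mathbb Z)^d$, $d\ge1$; $e_1,\dots,e_d$ is the canonical basis. $W(x)=\sum_{k=1}^dW_k(x_k)$ where each $W_k:\mathbb R\to\mathbb R$ is strictly increasing, càdlàg, and $W_k(u+1)-W_k(u)=W_k(1)-W_k(0)$ for all $u$. $d(x^j\otimes W_j)$ is the product measure $dx_1\cdots dx_{j-1}\,dW_j\,dx_{j+1}\cdots dx_d$ on $\mathbb T^d$, and $L^2_{x^j\otimes W_j}(\mathbb T^d)$ its $L^2$ space. $\partial_{W_k}f(x)=\lim_{\epsilon\to0}\frac{f(x+\epsilon e_k)-f(x)}{W_k(x_k+\epsilon)-W_k(x_k)}$ when the limit exists and is finite; $\nabla_W=(\partial_{W_1},\dots,\partial_{W_d})$. **The operator $\mathcal L_W=\nabla\nabla_W$ and the space $\mathcal S_W(\mathbb T^d)$.** For each $k$, $\mathcal L_{W_k}=\partial_{x_k}\partial_{W_k}$ acts on the domain $\mathcal D_{W_k}\subset L^2(\mathbb T)$ of functions $f(x)=a+cW_k(x)+\int_{(0,x]}W_k(dy)\int_0^y\mathfrak f(z)dz$ with $a,c\in\mathbb R$, $\mathfrak f\in L^2(\mathbb T)$, $\int_0^1\mathfrak f=0$ and $\int_{(0,1]}W_k(dy)\{c+\int_0^y\mathfrak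 f(z)dz\}=0$, and $\mathcal L_{W_k}f=\mathfrak f$. It is known that $\mathcal L_{W_k}$ has a countable complete orthonormal system of eigenvectors $\mathcal A_{W_k}$ in $L^2(\mathbb T)$. Let $\mathcal A_W=\{\prod_kf_k(x_k):f_k\in\mathcal A_{W_k}\}$ and $\mathbb D_W=\mathrm{span}(\mathcal A_W)$. $\mathcal A_W=\{\varphi_j\}_{j\ge1}$ is a complete orthonormal system of $L^2(\mathbb T^d)$, with $-\sum_k\mathcal L_{W_k}\varphi_j=\alpha_j\varphi_j$, enumerated so that $0=\alpha_1\le\alpha_2\le\cdots\to\infty$ (finite multiplicities). Put $\lambda_j=1+\alpha_j$, let $\mathbb P_k$ be the orthogonal projection on the span of $\varphi_k$, and for $n\in\mathbb N$ (including $0$) let $\|f\|_n^2=\sum_{k\ge1}\|\mathbb P_kf\|^2\lambda_k^{2n}k^{2n}$, where $\|\cdot\|$ is the $L^2(\mathbb T^d)$ norm. $\mathcal S_n$ is the completion of $\mathbb D_W$ under $\|\cdot\|_n$, and $\mathcal S_W(\mathbb T^d)=\bigcap_{n\ge0}\mathcal S_n$, with the metric $\sum_n2^{-n}\|f-g\|_n/(1+\|f-g\|_n)$; it is a countably Hilbert nuclear Fréchet space. $\mathcal S_W'(\mathbb T^d)$ is its topological dual with the strong topology. **Environment.** $(\Omega,\mathcal F,\mu)$ is a standard probability space, $\{T_x\}_{x\in\mathbb Z^d}$ a group of measurable, $\mu$-preserving transformations of $\Omega$ ($T_0=I$, $T_xT_y=T_{x+y}$), ergodic. $a_1,\dots,a_d:\Omega\to\mathbb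 R$ are measurable with $\theta^{-1}\le a_j\le\theta$ for some $\theta>0$. $A^N=\mathrm{diag}(a_1^N,\dots,a_d^N)$ with $a^N_j(x)=a^N_{jj}(x)=a_j(T_x\omega)$ for $x\in\mathbb T^d_N=\{0,\dots,N-1\}^d$. **Homogenized matrix $A$.** $H_{1,W}(\mathbb T^d)$ is the completion of $\mathbb D_W$ for the norm squared $\|f\|^2+\sum_j\|\partial_{W_j}f\|^2_{L^2_{x^j\otimes W_j}}$, with $\partial_{W_j}$ extended by continuity. A function $v$ on $N^{-1}\mathbb T^d_N$ is identified with its interpolant $v^*$ on $\mathbb T^d$, which in each cell is, in each coordinate $x_k$ separately, affine in $W_k(x_k)$. $\partial^N_{W_j}v(x/N)=\frac{v((x+e_j)/N)-v(x/N)}{W((x+e_j)/N)-W(x/N)}$. For $\lambda>0$ and $f$ a bounded linear functional on $H_{1,W}(\mathbb T^d)$, the weak solution $u_N$ of $\lambda u_N-\nabla^NA^N\nabla^N_Wu_N=f$ is defined by $\frac{\lambda}{N^d}\sum_xu_Nv+\frac1{N^{d-1}}\sum_j\sum_xa^N_{jj}(x)\,\partial^N_{W_j}u_N\,\partial^N_{W_j}v\,[W((x+e_j)/N)-W(x/N)]=f(v^* )$ for all $v$ on $N^{-1}\mathbb T_N^d$; the weak solution $u_0\in H_{1,W}(\mathbb T^d)$ of $\lambda u_0-\nabla A\nabla_Wu_0=f$ is defined by $\lambda\int u_0v\,dx+\sum_j\int a_{jj}\partial_{W_j}u_0\,\partial_{W_j}v\,d(x^j\otimes W_j)=f(v)$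 for all $v\in H_{1,W}(\mathbb T^d)$. The diagonal matrix $A=\mathrm{diag}(a_{11},\dots,a_{dd})$ is the homogenization of $A^N$ if, for every such $\lambda,f$, $u_N\to u_0$ weakly in $H_{1,W}(\mathbb T^d)$ and $a_j^N\partial^N_{W_j}u_N\to a_{jj}\partial_{W_j}u_0$ weakly in $L^2_{x^j\otimes W_j}(\mathbb T^d)$ (the left side being extended as constant on cells) for each $j$. It is taken as known (from earlier work) that $\mu$-a.s. $A^N$ has a homogenization $A$ not depending on $\omega$, with constant positive diagonal entries; $A$ denotes this matrix, and $\nabla A\nabla_WG=\sum_ja_{jj}\partial_{x_j}\partial_{W_j}G$. **Solutions.** $\sqrt{2\chi(\rho)\phi'(\rho)A}\,dN_t$ denotes the differential of the $\mathcal S_W'(\mathbb T^d)$-valued martingale $M_t$ obtained by weighting direction $j$ of $N_t$ with $\sqrt{2\chi(\rho)\phi'(\rho)a_{jj}}$, i.e. a mean-zero martingale with $M_0=0$ and $\langle M(G)\rangle_t=2t\chi(\rho)\phi'(\rho)\sum_j\int a_{jj}(\partial_{W_j}G)^2d(x^j\otimes W_j)$. An $\mathcal S_W'(\mathbb T^d)$-solution is a progressively measurable, adapted $\mathcal S_W'(\mathbb T^d)$-valued process with, a.s., $Y_t(G)=Y_0(G)+\phi'(\rho)\int_0^tY_s(\nabla A\nabla_WG)ds+M_t(G)$ for all $G\in\mathcal S_W(\mathbb T^d)$ and all $t$. *)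

theory Defs
  imports "HOL-Probability.Probability"
begin

section \<open>Torus functions, the measures and the derivatives\<close>

text \<open>Functions on the torus are functions on \<open>real ^ 'd\<close> (or \<open>real\<close>) with period 1 in every
  coordinate; measures on the torus live on the fundamental domain \<open>(0,1]^d\<close>. Elements of
  \<open>L\<^sup>2\<close> spaces are represented by Borel functions; all notions below that speak about such
  elements are insensitive to changes on null sets.\<close>

definition cube :: "(real ^ 'd::finite) set" where
  "cube = {x. \<forall>k. 0 < x $ k \<and> x $ k \<le> 1}"

definition torus_fun :: "(real ^ 'd::finite \<Rightarrow> real) \<Rightarrow> bool" where
  "torus_fun f \<longleftrightarrow> (\<forall>x k. f (x + axis k 1) = f x)"

definition torus_measure :: "(real ^ 'd::finite) measure" where
  "torus_measure = restrict_space lborel cube"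

text \<open>The measure \<open>d(x^j \<otimes> W_j)\<close>; \<open>interval_measure (W j)\<close> is the Stieltjes measure \<open>dW_j\<close>.\<close>

definition dir_measure :: "('d::finite \<Rightarrow> real \<Rightarrow> real) \<Rightarrow> 'd \<Rightarrow> (real ^ 'd) measure" where
  "dir_measure W j =
     restrict_space
       (distr (\<Pi>\<^sub>M k\<in>UNIV. if k = j then interval_measure (W j) else lborel) borel (\<lambda>f. \<chi> k. f k))
       cube"

definition L2 :: "(real ^ 'd::finite) measure \<Rightarrow> (real ^ 'd \<Rightarrow> real) set" where
  "L2 m = {f. torus_fun f \<and> f \<in> borel_measurable borel \<and> integrable m (\<lambda>x. (f x)\<^sup>2)}"

definition L2_norm_of :: "(real ^ 'd::finite) measure \<Rightarrow> (real ^ 'd \<Rightarrow> real) \<Rightarrow> real" where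
  "L2_norm_of m f = sqrt (\<integral>x. (f x)\<^sup>2 \<partial>m)"

definition conductance :: "('d::finite \<Rightarrow> real \<Rightarrow> real) \<Rightarrow> bool" where
  "conductance W \<longleftrightarrow>
     (\<forall>k. strict_mono (W k)
        \<and> (\<forall>u. continuous (at_right u) (W k)) \<and> (\<forall>u. \<exists>l. (W k \<longlongrightarrow> l) (at_left u))
        \<and> (\<forall>u. W k (u + 1) - W k u = W k 1 - W k 0))"

definition partial_W :: "('d::finite \<Rightarrow> real \<Rightarrow> real) \<Rightarrow> 'd \<Rightarrow> (real ^ 'd \<Rightarrow> real) \<Rightarrow> real ^ 'd \<Rightarrow> real" where
  "partial_W W k f x =
     Lim (at 0) (\<lambda>\<epsilon>. (f (x + \<epsilon> *\<^sub>R axis k 1) - f x) / (W k (x $ k + \<epsilon>) - W k (x $ k)))"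

section \<open>The operator and its eigenfunctions\<close>

definition L2_circle :: "(real \<Rightarrow> real) set" where
  "L2_circle = {f. (\<forall>u. f (u + 1) = f u) \<and> f \<in> borel_measurable borel
                  \<and> set_integrable lborel {0<..1} (\<lambda>u. (f u)\<^sup>2)}"

definition ip_circle :: "(real \<Rightarrow> real) \<Rightarrow> (real \<Rightarrow> real) \<Rightarrow> real" where
  "ip_circle f g = (LBINT u:{0<..1}. f u * g u)"

text \<open>\<open>LW_graph w f g\<close>: \<open>f\<close> lies in the domain of \<open>\<L>_w = \<partial>_x \<partial>_w\<close> and \<open>\<L>_w f = g\<close>.\<close>

definition LW_graph :: "(real \<Rightarrow> real) \<Rightarrow> (real \<Rightarrow> real) \<Rightarrow> (real \<Rightarrow> real) \<Rightarrow> bool" where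
  "LW_graph w f g \<longleftrightarrow>
     (\<forall>u. f (u + 1) = f u) \<and> g \<in> L2_circle \<and> (LBINT z:{0<..1}. g z) = 0 \<and>
     (\<exists>a c. (LINT y:{0<..1}|interval_measure w. c + (LBINT z:{0<..y}. g z)) = 0 \<and>
            (\<forall>x\<in>{0..1}. f x = a + c * w x
                 + (LINT y:{0<..x}|interval_measure w. (LBINT z:{0<..y}. g z))))"

text \<open>\<open>eigenbasis w S\<close>: \<open>S\<close> is a countable complete orthonormal system of eigenvectors of
  \<open>\<L>_w\<close> in \<open>L\<^sup>2(\<T>)\<close>.\<close>

definition eigenbasis :: "(real \<Rightarrow> real) \<Rightarrow> (real \<Rightarrow> real) set \<Rightarrow> bool" where
  "eigenbasis w S \<longleftrightarrow>
     countable S \<and> S \<subseteq> L2_circle \<and>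
     (\<forall>f\<in>S. \<exists>\<nu>. LW_graph w f (\<lambda>u. \<nu> * f u)) \<and>
     (\<forall>f\<in>S. \<forall>g\<in>S. ip_circle f g = (if f = g then 1 else 0)) \<and>
     (\<forall>h\<in>L2_circle. (\<forall>f\<in>S. ip_circle h f = 0) \<longrightarrow> (AE u in lborel. h u = 0))"

definition AW :: "('d::finite \<Rightarrow> (real \<Rightarrow> real) set) \<Rightarrow> (real ^ 'd \<Rightarrow> real) set" where
  "AW E = {\<lambda>x. \<Prod>k\<in>UNIV. f k (x $ k) | f. \<forall>k. f k \<in> E k}"

definition DW :: "('d::finite \<Rightarrow> (real \<Rightarrow> real) set) \<Rightarrow> (real ^ 'd \<Rightarrow> real) set" where
  "DW E = {\<lambda>x. \<Sum>g\<in>G. c g * g x | G c. finite G \<and> G \<subseteq> AW E}"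

text \<open>\<open>\<L>_{W_k}\<close> acting on the \<open>k\<close>-th variable of a function on the torus.\<close>

definition LW_dir :: "('d::finite \<Rightarrow> real \<Rightarrow> real) \<Rightarrow> 'd \<Rightarrow> (real ^ 'd \<Rightarrow> real) \<Rightarrow> (real ^ 'd \<Rightarrow> real) \<Rightarrow> bool" where
  "LW_dir W k f g \<longleftrightarrow> f \<in> L2 torus_measure \<and> g \<in> L2 torus_measure \<and>
     (\<forall>x. LW_graph (W k) (\<lambda>u. f (\<chi> i. if i = k then u else x $ i))
                         (\<lambda>u. g (\<chi> i. if i = k then u else x $ i)))"

text \<open>\<open>\<phi>\<close> enumerates \<open>AW E\<close> (indices from 1) by increasing eigenvalues \<open>\<alpha>\<close> of \<open>-\<Sum>_k \<L>_{W_k}\<close>;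
  the values \<open>\<phi> 0\<close>, \<open>\<alpha> 0\<close> are irrelevant.\<close>

definition spectral_enumeration ::
  "('d::finite \<Rightarrow> real \<Rightarrow> real) \<Rightarrow> ('d \<Rightarrow> (real \<Rightarrow> real) set) \<Rightarrow> (nat \<Rightarrow> real ^ 'd \<Rightarrow> real) \<Rightarrow> (nat \<Rightarrow> real) \<Rightarrow> bool" where
  "spectral_enumeration W E \<phi> \<alpha> \<longleftrightarrow>
     bij_betw \<phi> {1..} (AW E) \<and>
     (\<forall>j\<ge>1. \<exists>g. (\<forall>k. LW_dir W k (\<phi> j) (g k)) \<and>
               (AE x in torus_measure. - (\<Sum>k\<in>UNIV. g k x) = \<alpha> j * \<phi> j x)) \<and>
     \<alpha> 1 = 0 \<and> (\<forall>i j. 1 \<le> i \<and> i \<le> j \<longrightarrow> \<alpha> i \<le> \<alpha> j) \<and> filterlim \<alpha> at_top sequentially"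

section \<open>The nuclear space and its dual\<close>

definition Proj :: "(nat \<Rightarrow> real ^ 'd::finite \<Rightarrow> real) \<Rightarrow> nat \<Rightarrow> (real ^ 'd \<Rightarrow> real) \<Rightarrow> real ^ 'd \<Rightarrow> real" where
  "Proj \<phi> k f = (\<lambda>x. (\<integral>y. f y * \<phi> k y \<partial>torus_measure) * \<phi> k x)"

definition norm_n :: "(nat \<Rightarrow> real ^ 'd::finite \<Rightarrow> real) \<Rightarrow> (nat \<Rightarrow> real) \<Rightarrow> nat \<Rightarrow> (real ^ 'd \<Rightarrow> real) \<Rightarrow> real" where
  "norm_n \<phi> \<alpha> n f =
     sqrt (\<Sum>\<^sub>\<infinity>k\<in>{1..}. (L2_norm_of torus_measure (Proj \<phi> k f))\<^sup>2 * (1 + \<alpha> k) ^ (2 * n) * real k ^ (2 * n))"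

text \<open>Since \<open>\<parallel>f\<parallel> \<le> \<parallel>f\<parallel>_n\<close>, the completion \<open>\<S>_n\<close> of \<open>\<D>_W\<close> is realised inside
  \<open>L\<^sup>2\<close>: it consists of the \<open>L\<^sup>2\<close> limits of the sequences in \<open>\<D>_W\<close> that are Cauchy for
  \<open>\<parallel>\<cdot>\<parallel>_n\<close>.\<close>

definition Sn ::
  "('d::finite \<Rightarrow> (real \<Rightarrow> real) set) \<Rightarrow> (nat \<Rightarrow> real ^ 'd \<Rightarrow> real) \<Rightarrow> (nat \<Rightarrow> real) \<Rightarrow> nat \<Rightarrow> (real ^ 'd \<Rightarrow> real) set" where
  "Sn E \<phi> \<alpha> n = {f \<in> L2 torus_measure. \<exists>u. (\<forall>i. u i \<in> DW E) \<and>
      (\<forall>\<epsilon>>0. \<exists>I. \<forall>i\<ge>I. \<forall>j\<ge>I. norm_n \<phi> \<alpha> n (\<lambda>x. u i x - u j x) < \<epsilon>) \<and>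
      (\<lambda>i. L2_norm_of torus_measure (\<lambda>x. u i x - f x)) \<longlonglongrightarrow> 0}"

definition SW ::
  "('d::finite \<Rightarrow> (real \<Rightarrow> real) set) \<Rightarrow> (nat \<Rightarrow> real ^ 'd \<Rightarrow> real) \<Rightarrow> (nat \<Rightarrow> real) \<Rightarrow> (real ^ 'd \<Rightarrow> real) set" where
  "SW E \<phi> \<alpha> = (\<Inter>n. Sn E \<phi> \<alpha> n)"

definition dist_SW ::
  "(nat \<Rightarrow> real ^ 'd::finite \<Rightarrow> real) \<Rightarrow> (nat \<Rightarrow> real) \<Rightarrow> (real ^ 'd \<Rightarrow> real) \<Rightarrow> (real ^ 'd \<Rightarrow> real) \<Rightarrow> real" where
  "dist_SW \<phi> \<alpha> f g =
     (\<Sum>n. (1 / 2 ^ n) * (norm_n \<phi> \<alpha> n (\<lambda>x. f x - g x) / (1 + norm_n \<phi> \<alpha> n (\<lambda>x. f x - g x))))"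

text \<open>Continuity makes the functionals constant on almost-everywhere classes, because functions
  that agree almost everywhere have distance 0. Functionals are \<open>undefined\<close> off \<open>SW\<close>, so that
  equality in the dual is equality of functions.\<close>

definition SW_dual ::
  "('d::finite \<Rightarrow> (real \<Rightarrow> real) set) \<Rightarrow> (nat \<Rightarrow> real ^ 'd \<Rightarrow> real) \<Rightarrow> (nat \<Rightarrow> real) \<Rightarrow> ((real ^ 'd \<Rightarrow> real) \<Rightarrow> real) set" where
  "SW_dual E \<phi> \<alpha> = {l \<in> extensional (SW E \<phi> \<alpha>).
     (\<forall>f\<in>SW E \<phi> \<alpha>. \<forall>g\<in>SW E \<phi> \<alpha>. l (\<lambda>x. f x + g x) = l f + l g) \<and>
     (\<forall>f\<in>SW E \<phi> \<alpha>. \<forall>c. l (\<lambda>x. c * f x) = c * l f) \<and>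
     (\<forall>f\<in>SW E \<phi> \<alpha>. \<forall>\<epsilon>>0. \<exists>\<delta>>0. \<forall>g\<in>SW E \<phi> \<alpha>. dist_SW \<phi> \<alpha> f g < \<delta> \<longrightarrow> \<bar>l f - l g\<bar> < \<epsilon>)}"

definition SW_bounded ::
  "('d::finite \<Rightarrow> (real \<Rightarrow> real) set) \<Rightarrow> (nat \<Rightarrow> real ^ 'd \<Rightarrow> real) \<Rightarrow> (nat \<Rightarrow> real) \<Rightarrow> (real ^ 'd \<Rightarrow> real) set \<Rightarrow> bool" where
  "SW_bounded E \<phi> \<alpha> B \<longleftrightarrow> B \<subseteq> SW E \<phi> \<alpha> \<and> (\<forall>n. bdd_above (norm_n \<phi> \<alpha> n ` B))"

text \<open>Strong topology: uniform convergence on bounded sets.\<close>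

definition strong_open ::
  "('d::finite \<Rightarrow> (real \<Rightarrow> real) set) \<Rightarrow> (nat \<Rightarrow> real ^ 'd \<Rightarrow> real) \<Rightarrow> (nat \<Rightarrow> real) \<Rightarrow> ((real ^ 'd \<Rightarrow> real) \<Rightarrow> real) set \<Rightarrow> bool" where
  "strong_open E \<phi> \<alpha> U \<longleftrightarrow> U \<subseteq> SW_dual E \<phi> \<alpha> \<and>
     (\<forall>l\<in>U. \<exists>B \<epsilon>. SW_bounded E \<phi> \<alpha> B \<and> \<epsilon> > 0 \<and>
        (\<forall>l'\<in>SW_dual E \<phi> \<alpha>. (\<forall>f\<in>B. \<bar>l' f - l f\<bar> < \<epsilon>) \<longrightarrow> l' \<in> U))"

definition strong_topology ::
  "('d::finite \<Rightarrow> (real \<Rightarrow> real) set) \<Rightarrow> (nat \<Rightarrow> real ^ 'd \<Rightarrow> real) \<Rightarrow> (nat \<Rightarrow> real) \<Rightarrow> ((real ^ 'd \<Rightarrow> real) \<Rightarrow> real) topology" where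
  "strong_topology E \<phi> \<alpha> = topology (strong_open E \<phi> \<alpha>)"

lemma SW_bounded_Un:
  assumes "SW_bounded E \<phi> \<alpha> B" "SW_bounded E \<phi> \<alpha> C"
  shows "SW_bounded E \<phi> \<alpha> (B \<union> C)"
  using assms by (auto simp: SW_bounded_def image_Un)

lemma istopology_strong_open: "istopology (strong_open E \<phi> \<alpha>)"
  unfolding istopology_def
proof (intro conjI allI impI)
  fix S U assume S: "strong_open E \<phi> \<alpha> S" and U: "strong_open E \<phi> \<alpha> U"
  show "strong_open E \<phi> \<alpha> (S \<inter> U)"
    unfolding strong_open_def
  proof (intro conjI ballI)
    show "S \<inter> U \<subseteq> SW_dual E \<phi> \<alpha>" using S by (auto simp: strong_open_def)
    fix l assume l: "l \<in> S \<inter> U"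
    obtain B e where B: "SW_bounded E \<phi> \<alpha> B" "e > 0"
      "\<And>l'. l' \<in> SW_dual E \<phi> \<alpha> \<Longrightarrow> (\<forall>f\<in>B. \<bar>l' f - l f\<bar> < e) \<Longrightarrow> l' \<in> S"
      using S l unfolding strong_open_def by (metis IntD1)
    obtain C e' where C: "SW_bounded E \<phi> \<alpha> C" "e' > 0"
      "\<And>l'. l' \<in> SW_dual E \<phi> \<alpha> \<Longrightarrow> (\<forall>f\<in>C. \<bar>l' f - l f\<bar> < e') \<Longrightarrow> l' \<in> U"
      using U l unfolding strong_open_def by (metis IntD2)
    show "\<exists>B \<epsilon>. SW_bounded E \<phi> \<alpha> B \<and> \<epsilon> > 0 \<and>
        (\<forall>l'\<in>SW_dual E \<phi> \<alpha>. (\<forall>f\<in>B. \<bar>l' f - l f\<bar> < \<epsilon>) \<longrightarrow> l' \<in> S \<inter> U)"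
      using B C SW_bounded_Un[OF B(1) C(1)]
      by (intro exI[of _ "B \<union> C"] exI[of _ "min e e'"]) auto
  qed
next
  fix K assume "\<forall>U\<in>K. strong_open E \<phi> \<alpha> U"
  then show "strong_open E \<phi> \<alpha> (\<Union>K)"
    unfolding strong_open_def by (meson Union_iff Union_least)
qed

lemma openin_strong_topology [simp]: "openin (strong_topology E \<phi> \<alpha>) = strong_open E \<phi> \<alpha>"
  by (simp add: strong_topology_def istopology_strong_open)

text \<open>The \<open>\<sigma>\<close>-algebra generated by the evaluations; as \<open>SW\<close> is a nuclear Frechet space, it is the
  Borel \<open>\<sigma>\<close>-algebra of the strong topology.\<close>

definition SW_dual_M ::
  "('d::finite \<Rightarrow> (real \<Rightarrow> real) set) \<Rightarrow> (nat \<Rightarrow> real ^ 'd \<Rightarrow> real) \<Rightarrow> (nat \<Rightarrow> real) \<Rightarrow> ((real ^ 'd \<Rightarrow> real) \<Rightarrow> real) measure" where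
  "SW_dual_M E \<phi> \<alpha> = sigma (SW_dual E \<phi> \<alpha>)
     {{l \<in> SW_dual E \<phi> \<alpha>. l G \<in> A} | G A. G \<in> SW E \<phi> \<alpha> \<and> A \<in> sets borel}"

text \<open>Paths in \<open>D([0,T], \<S>_W')\<close>.\<close>

definition cadlag_path ::
  "real \<Rightarrow> ('d::finite \<Rightarrow> (real \<Rightarrow> real) set) \<Rightarrow> (nat \<Rightarrow> real ^ 'd \<Rightarrow> real) \<Rightarrow> (nat \<Rightarrow> real) \<Rightarrow>
    (real \<Rightarrow> (real ^ 'd \<Rightarrow> real) \<Rightarrow> real) \<Rightarrow> bool" where
  "cadlag_path T E \<phi> \<alpha> y \<longleftrightarrow>
     (\<forall>t\<in>{0..T}. y t \<in> SW_dual E \<phi> \<alpha>) \<and>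
     (\<forall>t\<in>{0..<T}. limitin (strong_topology E \<phi> \<alpha>) y (y t) (at_right t)) \<and>
     (\<forall>t\<in>{0<..T}. \<exists>l. limitin (strong_topology E \<phi> \<alpha>) y l (at_left t))"

section \<open>The energy space and the divergence-form operator\<close>

text \<open>The completion of \<open>\<D>_W\<close> for the norm \<open>\<parallel>f\<parallel>\<^sup>2 + \<Sum>_j \<parallel>\<partial>_{W_j} f\<parallel>\<^sup>2\<close> is the closure
  of the graph of the gradient in \<open>L\<^sup>2 \<times> \<Prod>_j L\<^sup>2_{x^j \<otimes> W_j}\<close>; the second component \<open>g\<close>
  is the extension by continuity of the gradient.\<close>

definition H1_graph ::
  "('d::finite \<Rightarrow> real \<Rightarrow> real) \<Rightarrow> ('d \<Rightarrow> (real \<Rightarrow> real) set) \<Rightarrow> (real ^ 'd \<Rightarrow> real) \<Rightarrow> ('d \<Rightarrow> real ^ 'd \<Rightarrow> real) \<Rightarrow> bool" where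
  "H1_graph W E f g \<longleftrightarrow> f \<in> L2 torus_measure \<and> (\<forall>j. g j \<in> L2 (dir_measure W j)) \<and>
     (\<exists>u. (\<forall>i. u i \<in> DW E) \<and>
        (\<lambda>i. L2_norm_of torus_measure (\<lambda>x. u i x - f x)) \<longlonglongrightarrow> 0 \<and>
        (\<forall>j. (\<lambda>i. L2_norm_of (dir_measure W j) (\<lambda>x. partial_W W j (u i) x - g j x)) \<longlonglongrightarrow> 0))"

definition H1 :: "('d::finite \<Rightarrow> real \<Rightarrow> real) \<Rightarrow> ('d \<Rightarrow> (real \<Rightarrow> real) set) \<Rightarrow> (real ^ 'd \<Rightarrow> real) set" where
  "H1 W E = {f. \<exists>g. H1_graph W E f g}"

definition grad_W ::
  "('d::finite \<Rightarrow> real \<Rightarrow> real) \<Rightarrow> ('d \<Rightarrow> (real \<Rightarrow> real) set) \<Rightarrow> (real ^ 'd \<Rightarrow> real) \<Rightarrow> 'd \<Rightarrow> real ^ 'd \<Rightarrow> real" where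
  "grad_W W E f = (SOME g. H1_graph W E f g)"

definition H1_norm :: "('d::finite \<Rightarrow> real \<Rightarrow> real) \<Rightarrow> ('d \<Rightarrow> (real \<Rightarrow> real) set) \<Rightarrow> (real ^ 'd \<Rightarrow> real) \<Rightarrow> real" where
  "H1_norm W E f = sqrt ((L2_norm_of torus_measure f)\<^sup>2
                       + (\<Sum>j\<in>UNIV. (L2_norm_of (dir_measure W j) (grad_W W E f j))\<^sup>2))"

definition H1_functional ::
  "('d::finite \<Rightarrow> real \<Rightarrow> real) \<Rightarrow> ('d \<Rightarrow> (real \<Rightarrow> real) set) \<Rightarrow> ((real ^ 'd \<Rightarrow> real) \<Rightarrow> real) \<Rightarrow> bool" where
  "H1_functional W E f \<longleftrightarrow>
     (\<forall>u\<in>H1 W E. \<forall>v\<in>H1 W E. f (\<lambda>x. u x + v x) = f u + f v) \<and>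
     (\<forall>u\<in>H1 W E. \<forall>c. f (\<lambda>x. c * u x) = c * f u) \<and>
     (\<exists>C. \<forall>u\<in>H1 W E. \<bar>f u\<bar> \<le> C * H1_norm W E u)"

text \<open>The extension of \<open>\<L>_{W_k} = \<partial>_{x_k} \<partial>_{W_k}\<close> from \<open>\<D>_W\<close> to \<open>\<S>_W\<close> by continuity.\<close>

definition LW_ext ::
  "('d::finite \<Rightarrow> real \<Rightarrow> real) \<Rightarrow> ('d \<Rightarrow> (real \<Rightarrow> real) set) \<Rightarrow> (nat \<Rightarrow> real ^ 'd \<Rightarrow> real) \<Rightarrow> (nat \<Rightarrow> real) \<Rightarrow>
    'd \<Rightarrow> (real ^ 'd \<Rightarrow> real) \<Rightarrow> real ^ 'd \<Rightarrow> real" where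
  "LW_ext W E \<phi> \<alpha> k G = (SOME H. H \<in> SW E \<phi> \<alpha> \<and>
     (\<exists>u v. (\<forall>i. u i \<in> DW E \<and> v i \<in> SW E \<phi> \<alpha> \<and> LW_dir W k (u i) (v i)) \<and>
            (\<lambda>i. dist_SW \<phi> \<alpha> (u i) G) \<longlonglongrightarrow> 0 \<and> (\<lambda>i. dist_SW \<phi> \<alpha> (v i) H) \<longlonglongrightarrow> 0))"

definition div_form ::
  "('d::finite \<Rightarrow> real \<Rightarrow> real) \<Rightarrow> ('d \<Rightarrow> (real \<Rightarrow> real) set) \<Rightarrow> (nat \<Rightarrow> real ^ 'd \<Rightarrow> real) \<Rightarrow> (nat \<Rightarrow> real) \<Rightarrow>
    ('d \<Rightarrow> real) \<Rightarrow> (real ^ 'd \<Rightarrow> real) \<Rightarrow> real ^ 'd \<Rightarrow> real" where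
  "div_form W E \<phi> \<alpha> A G = (\<lambda>x. \<Sum>k\<in>UNIV. A k * LW_ext W E \<phi> \<alpha> k G x)"

section \<open>Random environment and homogenization\<close>

text \<open>A standard probability space is a probability measure on the Borel sets of a Polish space.\<close>

definition random_environment ::
  "'e::polish_space measure \<Rightarrow> (int ^ 'd::finite \<Rightarrow> 'e \<Rightarrow> 'e) \<Rightarrow> ('d \<Rightarrow> 'e \<Rightarrow> real) \<Rightarrow> real \<Rightarrow> bool" where
  "random_environment \<mu> \<tau> a \<theta> \<longleftrightarrow>
     prob_space \<mu> \<and> sets \<mu> = sets borel \<and>
     \<tau> 0 = id \<and> (\<forall>x y. \<tau> (x + y) = \<tau> x \<circ> \<tau> y) \<and>
     (\<forall>x. \<tau> x \<in> measurable \<mu> \<mu> \<and> distr \<mu> \<mu> (\<tau> x) = \<mu>) \<and>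
     (\<forall>B\<in>sets \<mu>. (\<forall>x. \<tau> x -` B = B) \<longrightarrow> measure \<mu> B = 0 \<or> measure \<mu> B = 1) \<and>
     \<theta> > 0 \<and> (\<forall>j. a j \<in> borel_measurable \<mu> \<and> (\<forall>\<omega>. inverse \<theta> \<le> a j \<omega> \<and> a j \<omega> \<le> \<theta>))"

text \<open>Functions on \<open>N\<^sup>-\<^sup>1 \<T>^d_N\<close> are functions \<open>v\<close> on \<open>\<int>^d\<close> with period \<open>N\<close>, the value
  \<open>v x\<close> belonging to the point \<open>x/N\<close>.\<close>

definition lattice_fun :: "nat \<Rightarrow> (int ^ 'd::finite \<Rightarrow> real) \<Rightarrow> bool" where
  "lattice_fun N v \<longleftrightarrow> (\<forall>x k. v (x + axis k (int N)) = v x)"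

definition lattice_box :: "nat \<Rightarrow> (int ^ 'd::finite) set" where
  "lattice_box N = {x. \<forall>k. 0 \<le> x $ k \<and> x $ k < int N}"

definition grid_pt :: "nat \<Rightarrow> int ^ 'd::finite \<Rightarrow> real ^ 'd" where
  "grid_pt N x = (\<chi> k. real_of_int (x $ k) / real N)"

definition W_total :: "('d::finite \<Rightarrow> real \<Rightarrow> real) \<Rightarrow> real ^ 'd \<Rightarrow> real" where
  "W_total W y = (\<Sum>k\<in>UNIV. W k (y $ k))"

definition W_incr :: "('d::finite \<Rightarrow> real \<Rightarrow> real) \<Rightarrow> nat \<Rightarrow> 'd \<Rightarrow> int ^ 'd \<Rightarrow> real" where
  "W_incr W N j x = W_total W (grid_pt N (x + axis j 1)) - W_total W (grid_pt N x)"

definition disc_partial_W :: "('d::finite \<Rightarrow> real \<Rightarrow> real) \<Rightarrow> nat \<Rightarrow> 'd \<Rightarrow> (int ^ 'd \<Rightarrow> real) \<Rightarrow> int ^ 'd \<Rightarrow> real" where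
  "disc_partial_W W N j v x = (v (x + axis j 1) - v x) / W_incr W N j x"

text \<open>\<open>cell N y\<close> is the \<open>x\<close> with \<open>y\<close> in \<open>\<Prod>_k (x_k/N, (x_k+1)/N]\<close>. Cells are closed on
  the right because \<open>W((x+e_j)/N) - W(x/N)\<close> is the \<open>dW_j\<close>-mass of \<open>(x_j/N, (x_j+1)/N]\<close>, so
  that an atom of \<open>dW_j\<close> at a grid point belongs to the cell on its left.\<close>

definition cell :: "nat \<Rightarrow> real ^ 'd::finite \<Rightarrow> int ^ 'd" where
  "cell N y = (\<chi> k. \<lceil>real N * y $ k\<rceil> - 1)"

text \<open>The interpolant \<open>v\<^sup>*\<close>: affine in \<open>W_k(y_k)\<close> in each coordinate separately, with the
  prescribed values at the \<open>2^d\<close> corners of the cell.\<close>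

definition interpolant :: "('d::finite \<Rightarrow> real \<Rightarrow> real) \<Rightarrow> nat \<Rightarrow> (int ^ 'd \<Rightarrow> real) \<Rightarrow> real ^ 'd \<Rightarrow> real" where
  "interpolant W N v y =
     (let x = cell N y;
          s = (\<lambda>k. (W k (y $ k) - W k (real_of_int (x $ k) / real N)) /
                   (W k (real_of_int (x $ k + 1) / real N) - W k (real_of_int (x $ k) / real N)))
      in \<Sum>S\<in>Pow UNIV. v (x + (\<chi> k. if k \<in> S then 1 else 0)) *
           (\<Prod>k\<in>UNIV. if k \<in> S then s k else 1 - s k))"

definition disc_weak_solution ::
  "('d::finite \<Rightarrow> real \<Rightarrow> real) \<Rightarrow> nat \<Rightarrow> ('d \<Rightarrow> int ^ 'd \<Rightarrow> real) \<Rightarrow> real \<Rightarrow> ((real ^ 'd \<Rightarrow> real) \<Rightarrow> real) \<Rightarrow>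
    (int ^ 'd \<Rightarrow> real) \<Rightarrow> bool" where
  "disc_weak_solution W N a r f u \<longleftrightarrow> lattice_fun N u \<and>
     (\<forall>v. lattice_fun N v \<longrightarrow>
        r / real N ^ CARD('d) * (\<Sum>x\<in>lattice_box N. u x * v x) +
        1 / real N ^ (CARD('d) - 1) *
          (\<Sum>j\<in>UNIV. \<Sum>x\<in>lattice_box N.
             a j x * disc_partial_W W N j u x * disc_partial_W W N j v x * W_incr W N j x)
        = f (interpolant W N v))"

definition weak_solution ::
  "('d::finite \<Rightarrow> real \<Rightarrow> real) \<Rightarrow> ('d \<Rightarrow> (real \<Rightarrow> real) set) \<Rightarrow> ('d \<Rightarrow> real) \<Rightarrow> real \<Rightarrow>
    ((real ^ 'd \<Rightarrow> real) \<Rightarrow> real) \<Rightarrow> (real ^ 'd \<Rightarrow> real) \<Rightarrow> bool" where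
  "weak_solution W E A r f u \<longleftrightarrow> u \<in> H1 W E \<and>
     (\<forall>v\<in>H1 W E.
        r * (\<integral>x. u x * v x \<partial>torus_measure) +
        (\<Sum>j\<in>UNIV. \<integral>x. A j * grad_W W E u j x * grad_W W E v j x \<partial>dir_measure W j) = f v)"

text \<open>\<open>a N j x\<close> is \<open>a^N_j(x)\<close>. The weak solutions are unique, so they may be quantified
  existentially.\<close>

definition homogenization ::
  "('d::finite \<Rightarrow> real \<Rightarrow> real) \<Rightarrow> ('d \<Rightarrow> (real \<Rightarrow> real) set) \<Rightarrow> (nat \<Rightarrow> 'd \<Rightarrow> int ^ 'd \<Rightarrow> real) \<Rightarrow> ('d \<Rightarrow> real) \<Rightarrow> bool" where
  "homogenization W E a A \<longleftrightarrow>
     (\<forall>r f. r > 0 \<and> H1_functional W E f \<longrightarrow>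
       (\<exists>u u0. (\<forall>N\<ge>1. disc_weak_solution W N (a N) r f (u N)) \<and> weak_solution W E A r f u0 \<and>
          (\<forall>h. H1_functional W E h \<longrightarrow> (\<lambda>N. h (interpolant W N (u N))) \<longlonglongrightarrow> h u0) \<and>
          (\<forall>j. \<forall>h\<in>L2 (dir_measure W j).
             (\<lambda>N. \<integral>y. a N j (cell N y) * disc_partial_W W N j (u N) (cell N y) * h y
                    \<partial>dir_measure W j)
             \<longlonglongrightarrow> (\<integral>y. A j * grad_W W E u0 j y * h y \<partial>dir_measure W j))))"

section \<open>Martingales and Gaussian families\<close>

definition martingale :: "'a measure \<Rightarrow> real \<Rightarrow> (real \<Rightarrow> 'a measure) \<Rightarrow> (real \<Rightarrow> 'a \<Rightarrow> real) \<Rightarrow> bool" where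
  "martingale P T F X \<longleftrightarrow>
     (\<forall>t\<in>{0..T}. X t \<in> borel_measurable (F t) \<and> integrable P (X t)) \<and>
     (\<forall>s t. 0 \<le> s \<and> s \<le> t \<and> t \<le> T \<longrightarrow> (AE \<omega> in P. real_cond_exp P (F s) (X t) \<omega> = X s \<omega>))"

definition partition_of :: "real \<Rightarrow> real list \<Rightarrow> bool" where
  "partition_of t p \<longleftrightarrow> p \<noteq> [] \<and> sorted p \<and> hd p = 0 \<and> last p = t"

text \<open>Quadratic variation: the limit in probability of the sums of squared increments as the mesh
  of the partition tends to 0.\<close>

definition quadratic_variation ::
  "'a measure \<Rightarrow> real \<Rightarrow> (real \<Rightarrow> 'a \<Rightarrow> real) \<Rightarrow> (real \<Rightarrow> 'a \<Rightarrow> real) \<Rightarrow> bool" where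
  "quadratic_variation P T X Q \<longleftrightarrow>
     (\<forall>t\<in>{0..T}. \<forall>\<epsilon>>0. \<forall>\<eta>>0. \<exists>\<delta>>0. \<forall>p.
        partition_of t p \<and> (\<forall>i < length p - 1. p ! Suc i - p ! i < \<delta>) \<longrightarrow>
        measure P {\<omega>\<in>space P. \<bar>(\<Sum>i < length p - 1. (X (p ! Suc i) \<omega> - X (p ! i) \<omega>)\<^sup>2) - Q t \<omega>\<bar> > \<epsilon>} < \<eta>)"

text \<open>Gaussian variables may be degenerate.\<close>

definition gaussian_rv :: "'a measure \<Rightarrow> ('a \<Rightarrow> real) \<Rightarrow> bool" where
  "gaussian_rv P X \<longleftrightarrow> X \<in> borel_measurable P \<and>
     (\<exists>m. (AE \<omega> in P. X \<omega> = m) \<or>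
          (\<exists>\<sigma>>0. distributed P lborel X (\<lambda>x. ennreal (normal_density m \<sigma> x))))"

definition gaussian_family :: "'a measure \<Rightarrow> 'i set \<Rightarrow> ('i \<Rightarrow> 'a \<Rightarrow> real) \<Rightarrow> bool" where
  "gaussian_family P I X \<longleftrightarrow>
     (\<forall>J c. finite J \<and> J \<subseteq> I \<longrightarrow> gaussian_rv P (\<lambda>\<omega>. \<Sum>i\<in>J. c i * X i \<omega>))"

section \<open>The stochastic differential equation\<close>

definition chi :: "real \<Rightarrow> real" where "chi \<rho> = \<rho> * (1 - \<rho>)"

definition phi :: "real \<Rightarrow> real \<Rightarrow> real" where "phi b \<rho> = \<rho> + b * \<rho>\<^sup>2"

definition phi' :: "real \<Rightarrow> real \<Rightarrow> real" where "phi' b \<rho> = 1 + 2 * b * \<rho>"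

lemma phi_deriv: "(phi b has_real_derivative phi' b \<rho>) (at \<rho>)"
  unfolding phi_def phi'_def by (auto intro!: derivative_eq_intros)

text \<open>\<open>t, \<omega> \<mapsto> Y_t - Y_0 - \<kappa> \<integral>_0^t Y_s(\<nabla>A\<nabla>_W \<cdot>) ds\<close>.\<close>

definition mart_part ::
  "('d::finite \<Rightarrow> real \<Rightarrow> real) \<Rightarrow> ('d \<Rightarrow> (real \<Rightarrow> real) set) \<Rightarrow> (nat \<Rightarrow> real ^ 'd \<Rightarrow> real) \<Rightarrow> (nat \<Rightarrow> real) \<Rightarrow>
    ('d \<Rightarrow> real) \<Rightarrow> real \<Rightarrow> (real \<Rightarrow> 'a \<Rightarrow> (real ^ 'd \<Rightarrow> real) \<Rightarrow> real) \<Rightarrow>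
    real \<Rightarrow> 'a \<Rightarrow> (real ^ 'd \<Rightarrow> real) \<Rightarrow> real" where
  "mart_part W E \<phi> \<alpha> A \<kappa> Y t \<omega> =
     (\<lambda>G\<in>SW E \<phi> \<alpha>. Y t \<omega> G - Y 0 \<omega> G - \<kappa> * (LBINT s:{0..t}. Y s \<omega> (div_form W E \<phi> \<alpha> A G)))"

text \<open>Mean-zero \<open>\<S>_W'\<close>-valued martingale started at 0 whose quadratic variation at \<open>G\<close> is
  \<open>t \<Sum>_j \<integral> (\<sigma>_j \<partial>_{W_j} G)\<^sup>2 d(x^j \<otimes> W_j)\<close>. For \<open>\<sigma> = 1\<close> this is the noise \<open>N\<close>; in general it is
  the integral of \<open>\<sigma> dN\<close>, that is, direction \<open>j\<close> of \<open>N\<close> is weighted with \<open>\<sigma>_j\<close>.\<close>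

definition driving_martingale ::
  "'a measure \<Rightarrow> real \<Rightarrow> (real \<Rightarrow> 'a measure) \<Rightarrow> ('d::finite \<Rightarrow> real \<Rightarrow> real) \<Rightarrow> ('d \<Rightarrow> (real \<Rightarrow> real) set) \<Rightarrow>
    (nat \<Rightarrow> real ^ 'd \<Rightarrow> real) \<Rightarrow> (nat \<Rightarrow> real) \<Rightarrow> ('d \<Rightarrow> real) \<Rightarrow>
    (real \<Rightarrow> 'a \<Rightarrow> (real ^ 'd \<Rightarrow> real) \<Rightarrow> real) \<Rightarrow> bool" where
  "driving_martingale P T F W E \<phi> \<alpha> \<sigma> M \<longleftrightarrow>
     (\<forall>t\<in>{0..T}. M t \<in> measurable (F t) (SW_dual_M E \<phi> \<alpha>)) \<and>
     (\<forall>G\<in>SW E \<phi> \<alpha>.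
        (AE \<omega> in P. M 0 \<omega> G = 0) \<and>
        martingale P T F (\<lambda>t \<omega>. M t \<omega> G) \<and>
        (\<forall>t\<in>{0..T}. (\<integral>\<omega>. M t \<omega> G \<partial>P) = 0) \<and>
        quadratic_variation P T (\<lambda>t \<omega>. M t \<omega> G)
          (\<lambda>t \<omega>. t * (\<Sum>j\<in>UNIV. \<integral>x. (\<sigma> j * grad_W W E G j x)\<^sup>2 \<partial>dir_measure W j)))"

definition progressively_measurable ::
  "real \<Rightarrow> (real \<Rightarrow> 'a measure) \<Rightarrow> 'b measure \<Rightarrow> (real \<Rightarrow> 'a \<Rightarrow> 'b) \<Rightarrow> bool" where
  "progressively_measurable T F N Y \<longleftrightarrow>
     (\<forall>t\<in>{0..T}. (\<lambda>(s, \<omega>). Y s \<omega>) \<in> measurable (restrict_space borel {0..t} \<Otimes>\<^sub>M F t) N)"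

text \<open>\<open>Y\<close> is an \<open>\<S>_W'\<close>-solution of \<open>dY = \<kappa> \<nabla>A\<nabla>_W Y dt + \<sigma> dN\<close>, the differential \<open>\<sigma> dN\<close> being
  that of \<open>M\<close>.\<close>

definition SDE_solution ::
  "'a measure \<Rightarrow> real \<Rightarrow> (real \<Rightarrow> 'a measure) \<Rightarrow> ('d::finite \<Rightarrow> real \<Rightarrow> real) \<Rightarrow> ('d \<Rightarrow> (real \<Rightarrow> real) set) \<Rightarrow>
    (nat \<Rightarrow> real ^ 'd \<Rightarrow> real) \<Rightarrow> (nat \<Rightarrow> real) \<Rightarrow> ('d \<Rightarrow> real) \<Rightarrow> real \<Rightarrow> ('d \<Rightarrow> real) \<Rightarrow>
    (real \<Rightarrow> 'a \<Rightarrow> (real ^ 'd \<Rightarrow> real) \<Rightarrow> real) \<Rightarrow> (real \<Rightarrow> 'a \<Rightarrow> (real ^ 'd \<Rightarrow> real) \<Rightarrow> real) \<Rightarrow> bool" where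
  "SDE_solution P T F W E \<phi> \<alpha> A \<kappa> \<sigma> M Y \<longleftrightarrow>
     driving_martingale P T F W E \<phi> \<alpha> \<sigma> M \<and>
     (\<forall>t\<in>{0..T}. Y t \<in> measurable (F t) (SW_dual_M E \<phi> \<alpha>)) \<and>
     progressively_measurable T F (SW_dual_M E \<phi> \<alpha>) Y \<and>
     (AE \<omega> in P. \<forall>G\<in>SW E \<phi> \<alpha>. \<forall>t\<in>{0..T}.
        set_integrable lborel {0..t} (\<lambda>s. Y s \<omega> (div_form W E \<phi> \<alpha> A G)) \<and>
        Y t \<omega> G = Y 0 \<omega> G + \<kappa> * (LBINT s:{0..t}. Y s \<omega> (div_form W E \<phi> \<alpha> A G)) + M t \<omega> G)"

end

theory Submission
  imports Defs
begin

text \<open>In the spectral coordinates \<open>\<phi>_k\<close> the equation decouples into scalar equations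
  \<open>dy = \<beta> y dt + dm\<close>. The difference of two solutions with the same noise solves a linear Volterra
  equation, hence vanishes; and \<open>y_t\<close> is the limit of its implicit Euler approximations, which are
  linear combinations of \<open>y_0\<close> and of increments of \<open>m\<close>. So \<open>Y\<close> is Gaussian as soon as \<open>Y_0\<close> and
  \<open>M\<close> are jointly Gaussian, that is, as soon as the increments of each \<open>M(G)\<close> are Gaussian and
  independent of the past. This is Levy's characterisation: since \<open>iexp x\<close> is
  close to \<open>(1 + i x) exp (- x^2/2)\<close>, the character of an increment is close to
  \<open>\<Prod>(1 + i u \<Delta>M) exp (- u^2/2 \<Sum>(\<Delta>M)^2)\<close>, where the product, stopped once the sum of squares or
  \<open>M\<close> itself exceeds a fixed level, has expectation 1 and is bounded up to one factor.\<close>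

section \<open>Real martingales\<close>

text \<open>Three features of the hypotheses shape the argument: each M(G) is merely integrable, its
  paths are not known to be continuous, and its quadratic variation is a limit in probability along
  deterministic partitions. Hence everything is estimated along one fine partition. The truncation
  (|x| - R)^+ takes over the role of second moments, and the smallness of all increments is read off
  from the quadratic variation being a deterministic linear function of time. Cross variations never
  occur: M(G) is linear in G, so a combination of martingales of the family is again one of them,
  and the theorem for a single martingale yields joint Gaussianity. On the analytic side, test
  functions are functions and not classes, and the operator on \<open>SW\<close> is a choice. Both
  are handled by working with Fourier coefficients, since a continuous functional depends on nothing
  else. Time integrals of a path are again continuous functionals because a cadlag path is bounded
  by one single norm, uniformly in time.\<close>

lemma norm_integral_le:
  fixes f :: "'a \<Rightarrow> 'b::{banach,second_countable_topology}"
  assumes f: "integrable M f" and g: "integrable M g" and le: "\<And>x. x \<in> space M \<Longrightarrow> norm (f x) \<le> g x"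
  shows "norm (\<integral>x. f x \<partial>M) \<le> (\<integral>x. g x \<partial>M)"
  by (rule order_trans[OF integral_norm_bound integral_mono]) (use assms in auto)

locale filtered_prob_space = prob_space P for P :: "'a measure" +
  fixes T :: real and F :: "real \<Rightarrow> 'a measure"
  assumes filtration: "filtration (space P) F"
    and subalg: "\<And>t. t \<in> {0..T} \<Longrightarrow> subalgebra P (F t)"
begin

lemma measurable_F_mono:
  "s \<le> t \<Longrightarrow> f \<in> measurable (F s) N \<Longrightarrow> f \<in> measurable (F t) N"
  using filtration.space_F[OF filtration] filtration.sets_F_mono[OF filtration, of s t]
  by (auto simp: measurable_def)

lemma measurable_F_P: "t \<in> {0..T} \<Longrightarrow> f \<in> measurable (F t) N \<Longrightarrow> f \<in> measurable P N"
  using subalg measurable_from_subalg by blast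

lemma space_F: "space (F t) = space P"
  using filtration.space_F[OF filtration] .

end

locale real_martingale = filtered_prob_space P T F for P :: "'a measure" and T F +
  fixes X :: "real \<Rightarrow> 'a \<Rightarrow> real"
  assumes mart: "martingale P T F X"
begin

lemma X_measurable_F: "t \<in> {0..T} \<Longrightarrow> X t \<in> borel_measurable (F t)"
  using mart by (auto simp: martingale_def)

lemma X_integrable [simp, intro]: "t \<in> {0..T} \<Longrightarrow> integrable P (X t)"
  using mart by (auto simp: martingale_def)

lemma X_measurable: "t \<in> {0..T} \<Longrightarrow> X t \<in> borel_measurable P"
  by (intro borel_measurable_integrable X_integrable)

lemma integrable_bounded_mult:
  fixes V :: "'a \<Rightarrow> 'c::{real_normed_field, banach, second_countable_topology}"
  assumes V: "V \<in> borel_measurable P" and B: "\<And>\<omega>. \<omega> \<in> space P \<Longrightarrow> norm (V \<omega>) \<le> B"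
    and f: "integrable P (f :: 'a \<Rightarrow> 'c)"
  shows "integrable P (\<lambda>\<omega>. V \<omega> * f \<omega>)"
proof (rule Bochner_Integration.integrable_bound)
  show "integrable P (\<lambda>\<omega>. B * norm (f \<omega>))" using f by auto
  show "(\<lambda>\<omega>. V \<omega> * f \<omega>) \<in> borel_measurable P" using V f by measurable
  show "AE x in P. norm (V x * f x) \<le> norm (B * norm (f x))"
  proof (rule AE_I2)
    fix x assume x: "x \<in> space P"
    have "norm (V x * f x) \<le> B * norm (f x)"
      by (simp add: norm_mult B[OF x] mult_right_mono)
    also have "\<dots> \<le> norm (B * norm (f x))" by simp
    finally show "norm (V x * f x) \<le> norm (B * norm (f x))" .
  qed
qed

text \<open>Testing against bounded weights from the past is the form in which the martingale
  property is used later; X is only integrable, so an unbounded weight could destroy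
  integrability.\<close>

lemma increment_mean_real:
  fixes V :: "'a \<Rightarrow> real"
  assumes st: "0 \<le> s" "s \<le> t" "t \<le> T" and V: "V \<in> borel_measurable (F s)"
    and B: "\<And>\<omega>. \<omega> \<in> space P \<Longrightarrow> \<bar>V \<omega>\<bar> \<le> B"
  shows "(\<integral>\<omega>. V \<omega> * (X t \<omega> - X s \<omega>) \<partial>P) = 0"
proof -
  have s: "s \<in> {0..T}" and t: "t \<in> {0..T}" using st by auto
  interpret S: finite_measure_subalgebra P "F s"
    by unfold_locales (rule subalg[OF s])
  have VP: "V \<in> borel_measurable P" using measurable_F_P[OF s V] .
  have it: "integrable P (\<lambda>\<omega>. V \<omega> * X t \<omega>)" and iss: "integrable P (\<lambda>\<omega>. V \<omega> * X s \<omega>)"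
    using integrable_bounded_mult[OF VP, of B] B s t by auto
  have AE: "AE \<omega> in P. real_cond_exp P (F s) (X t) \<omega> = X s \<omega>"
    using mart st by (auto simp: martingale_def)
  have "(\<integral>\<omega>. V \<omega> * X t \<omega> \<partial>P) = (\<integral>\<omega>. V \<omega> * real_cond_exp P (F s) (X t) \<omega> \<partial>P)"
    by (rule S.real_cond_exp_intg(2)[symmetric]) (use it V X_measurable[OF t] in auto)
  also have "\<dots> = (\<integral>\<omega>. V \<omega> * X s \<omega> \<partial>P)"
    by (rule integral_cong_AE) (use AE VP X_measurable[OF s] in auto)
  finally show ?thesis using it iss by (simp add: algebra_simps)
qed

lemma increment_mean_complex:
  fixes V :: "'a \<Rightarrow> complex"
  assumes st: "0 \<le> s" "s \<le> t" "t \<le> T" and V: "V \<in> borel_measurable (F s)"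
    and B: "\<And>\<omega>. \<omega> \<in> space P \<Longrightarrow> cmod (V \<omega>) \<le> B"
  shows "integrable P (\<lambda>\<omega>. V \<omega> * of_real (X t \<omega> - X s \<omega>))"
    and "(\<integral>\<omega>. V \<omega> * of_real (X t \<omega> - X s \<omega>) \<partial>P) = 0"
proof -
  have s: "s \<in> {0..T}" and t: "t \<in> {0..T}" using st by auto
  have VP: "V \<in> borel_measurable P" using measurable_F_P[OF s V] .
  have "integrable P (\<lambda>\<omega>. complex_of_real (X t \<omega> - X s \<omega>))"
    using s t by auto
  then show i: "integrable P (\<lambda>\<omega>. V \<omega> * of_real (X t \<omega> - X s \<omega>))"
    using integrable_bounded_mult[OF VP B] by auto
  have "Re (\<integral>\<omega>. V \<omega> * of_real (X t \<omega> - X s \<omega>) \<partial>P) = (\<integral>\<omega>. Re (V \<omega>) * (X t \<omega> - X s \<omega>) \<partial>P)"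
    using integral_Re[OF i] by simp
  also have "\<dots> = 0"
    by (rule increment_mean_real[OF st, of _ B])
       (use V B in \<open>auto intro: order_trans[OF abs_Re_le_cmod]\<close>)
  finally have re: "Re (\<integral>\<omega>. V \<omega> * of_real (X t \<omega> - X s \<omega>) \<partial>P) = 0" .
  have "Im (\<integral>\<omega>. V \<omega> * of_real (X t \<omega> - X s \<omega>) \<partial>P) = (\<integral>\<omega>. Im (V \<omega>) * (X t \<omega> - X s \<omega>) \<partial>P)"
    using integral_Im[OF i] by simp
  also have "\<dots> = 0"
    by (rule increment_mean_real[OF st, of _ B])
       (use V B in \<open>auto intro: order_trans[OF abs_Im_le_cmod]\<close>)
  finally show "(\<integral>\<omega>. V \<omega> * of_real (X t \<omega> - X s \<omega>) \<partial>P) = 0"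
    using re by (simp add: complex_eq_iff)
qed

text \<open>The convex function (|x| - R)^+. Its mean along X tends to 0 as R grows, by
  integrability alone, which makes it the substitute for a second moment in the maximal inequality
  and in the stopping estimates.\<close>

definition excess :: "real \<Rightarrow> real \<Rightarrow> real" where
  "excess R x = max 0 (\<bar>x\<bar> - R)"

lemma excess_integrable: "t \<in> {0..T} \<Longrightarrow> integrable P (\<lambda>\<omega>. excess R (X t \<omega>))"
  unfolding excess_def by (intro integrable_max) auto

lemma excess_nonneg [simp]: "0 \<le> excess R x"
  by (simp add: excess_def)

lemma excess_submartingale:
  fixes V :: "'a \<Rightarrow> real"
  assumes st: "0 \<le> s" "s \<le> t" "t \<le> T" and V: "V \<in> borel_measurable (F s)"
    and B: "\<And>\<omega>. \<omega> \<in> space P \<Longrightarrow> 0 \<le> V \<omega> \<and> V \<omega> \<le> B"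
  shows "integrable P (\<lambda>\<omega>. V \<omega> * (excess R (X t \<omega>) - excess R (X s \<omega>)))"
    and "(\<integral>\<omega>. V \<omega> * (excess R (X t \<omega>) - excess R (X s \<omega>)) \<partial>P) \<ge> 0"
proof -
  have s: "s \<in> {0..T}" and t: "t \<in> {0..T}" using st by auto
  have VP: "V \<in> borel_measurable P" using measurable_F_P[OF s V] .
  show i: "integrable P (\<lambda>\<omega>. V \<omega> * (excess R (X t \<omega>) - excess R (X s \<omega>)))"
    by (rule integrable_bounded_mult[OF VP, of B]) (use B excess_integrable s t in auto)
  \<comment> \<open>A subgradient of \<open>excess R\<close>: the convex increment dominates the
    increment of X times a bounded function of the past, and that product has mean 0.\<close>
  define D where "D x = (if \<bar>x\<bar> > R then sgn x else 0)" for x :: real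
  have D: "excess R x - excess R y \<ge> D y * (x - y)" for x y
    by (auto simp: excess_def D_def sgn_if max_def abs_if split: if_splits)
  have [measurable]: "D \<in> borel_measurable borel"
    unfolding D_def by measurable
  have VDm: "(\<lambda>\<omega>. V \<omega> * D (X s \<omega>)) \<in> borel_measurable (F s)"
    using V X_measurable_F[OF s] by measurable
  have VDb: "\<bar>V \<omega> * D (X s \<omega>)\<bar> \<le> B" if "\<omega> \<in> space P" for \<omega>
    using B[OF that] by (auto simp: D_def abs_mult sgn_if)
  have "0 = (\<integral>\<omega>. (V \<omega> * D (X s \<omega>)) * (X t \<omega> - X s \<omega>) \<partial>P)"
    by (rule increment_mean_real[OF st VDm VDb, symmetric])
  also have "\<dots> \<le> (\<integral>\<omega>. V \<omega> * (excess R (X t \<omega>) - excess R (X s \<omega>)) \<partial>P)"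
  proof (rule integral_mono[OF _ i])
    show "integrable P (\<lambda>\<omega>. (V \<omega> * D (X s \<omega>)) * (X t \<omega> - X s \<omega>))"
      by (rule integrable_bounded_mult[of _ B])
         (use measurable_F_P[OF s VDm] VDb s t in auto)
    show "V \<omega> * D (X s \<omega>) * (X t \<omega> - X s \<omega>) \<le> V \<omega> * (excess R (X t \<omega>) - excess R (X s \<omega>))"
      if "\<omega> \<in> space P" for \<omega>
      using mult_left_mono[OF D[of "X s \<omega>" "X t \<omega>"], of "V \<omega>"] B[OF that] by (simp add: mult.assoc)
  qed
  finally show "(\<integral>\<omega>. V \<omega> * (excess R (X t \<omega>) - excess R (X s \<omega>)) \<partial>P) \<ge> 0" .
qed

end

text \<open>\<open>I j\<close> says that the path still runs at index j. The recursion freezes the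
  path for good at the first failure of I only if I is decreasing, which the lemmas below
  assume.\<close>

fun stopped :: "(nat \<Rightarrow> bool) \<Rightarrow> (nat \<Rightarrow> real) \<Rightarrow> nat \<Rightarrow> real" where
  "stopped I x 0 = x 0"
| "stopped I x (Suc j) = (if I j then x (Suc j) else stopped I x j)"

lemma stopped_eq:
  assumes dec: "\<And>i j. i \<le> j \<Longrightarrow> I j \<Longrightarrow> I i"
  shows "(\<And>j. j < i \<Longrightarrow> I j) \<Longrightarrow> \<not> I i \<Longrightarrow> i \<le> m \<Longrightarrow> stopped I x m = x i"
proof (induction m)
  case 0
  then show ?case by simp
next
  case (Suc m)
  show ?case
  proof (cases "i = Suc m")
    case True
    then show ?thesis using Suc.prems(1)[of m] by simp
  next
    case False
    then have "i \<le> m" using Suc.prems by simp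
    then have "\<not> I m" using dec[of i m] Suc.prems(2) by auto
    then show ?thesis using Suc \<open>i \<le> m\<close> by simp
  qed
qed

text \<open>Exhibits what stopping removes as a sum of increments with weights that are known before
  each step; optional stopping then needs only a one-step inequality.\<close>

lemma stopped_telescope:
  assumes dec: "\<And>i j. i \<le> j \<Longrightarrow> I j \<Longrightarrow> I i"
  shows "g (x m) - g (stopped I x m) = (\<Sum>j<m. if I j then 0 else g (x (Suc j)) - g (x j) :: real)"
proof (induction m)
  case 0
  show ?case by simp
next
  case (Suc m)
  show ?case
  proof (cases "I m")
    case True
    then have "\<And>j. j < Suc m \<Longrightarrow> I j"
      using dec by (metis less_Suc_eq_le)
    with True show ?thesis by simp
  next
    case False
    then show ?thesis using Suc by simp
  qed
qed

section \<open>Stopping and the maximal inequality\<close>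

context real_martingale
begin

text \<open>Optional stopping for the submartingale \<open>excess R\<close>: each discarded
  increment is multiplied by the indicator of having stopped, which the past decides, so its mean is
  nonnegative.\<close>

lemma stopped_excess_le:
  assumes mono: "mono_on {..m} p" and p: "\<And>j. j \<le> m \<Longrightarrow> p j \<in> {0..T}"
    and I: "\<And>j. j < m \<Longrightarrow> Measurable.pred (F (p j)) (I j)"
    and anti: "\<And>\<omega> i j. i \<le> j \<Longrightarrow> I j \<omega> \<Longrightarrow> I i \<omega>"
  shows "integrable P (\<lambda>\<omega>. excess R (stopped (\<lambda>j. I j \<omega>) (\<lambda>j. X (p j) \<omega>) m))"
    and "(\<integral>\<omega>. excess R (stopped (\<lambda>j. I j \<omega>) (\<lambda>j. X (p j) \<omega>) m) \<partial>P) \<le> (\<integral>\<omega>. excess R (X (p m) \<omega>) \<partial>P)"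
proof -
  define V where "V j \<omega> = (if I j \<omega> then 0 else 1 :: real)" for j \<omega>
  have eq: "excess R (stopped (\<lambda>j. I j \<omega>) (\<lambda>j. X (p j) \<omega>) m)
     = excess R (X (p m) \<omega>) - (\<Sum>j<m. V j \<omega> * (excess R (X (p (Suc j)) \<omega>) - excess R (X (p j) \<omega>)))" for \<omega>
  proof -
    have "(\<Sum>j<m. V j \<omega> * (excess R (X (p (Suc j)) \<omega>) - excess R (X (p j) \<omega>)))
       = (\<Sum>j<m. if I j \<omega> then 0 else excess R (X (p (Suc j)) \<omega>) - excess R (X (p j) \<omega>))"
      by (rule sum.cong) (auto simp: V_def)
    then show ?thesis
      using stopped_telescope[of "\<lambda>j. I j \<omega>" "excess R" "\<lambda>j. X (p j) \<omega>" m] anti[of _ _ \<omega>] by simp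
  qed
  have V: "integrable P (\<lambda>\<omega>. V j \<omega> * (excess R (X (p (Suc j)) \<omega>) - excess R (X (p j) \<omega>)))"
    "(\<integral>\<omega>. V j \<omega> * (excess R (X (p (Suc j)) \<omega>) - excess R (X (p j) \<omega>)) \<partial>P) \<ge> 0" if j: "j < m" for j
  proof -
    have le: "0 \<le> p j" "p j \<le> p (Suc j)" "p (Suc j) \<le> T"
      using p[of j] p[of "Suc j"] j mono by (auto simp: mono_on_def)
    have "V j \<in> borel_measurable (F (p j))"
      using I[OF j] unfolding V_def by measurable
    then show "integrable P (\<lambda>\<omega>. V j \<omega> * (excess R (X (p (Suc j)) \<omega>) - excess R (X (p j) \<omega>)))"
      "(\<integral>\<omega>. V j \<omega> * (excess R (X (p (Suc j)) \<omega>) - excess R (X (p j) \<omega>)) \<partial>P) \<ge> 0"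
      using excess_submartingale[OF le, of "V j" 1 R] by (auto simp: V_def)
  qed
  show "integrable P (\<lambda>\<omega>. excess R (stopped (\<lambda>j. I j \<omega>) (\<lambda>j. X (p j) \<omega>) m))"
    unfolding eq using V(1) excess_integrable[OF p[of m]]
    by (intro Bochner_Integration.integrable_diff Bochner_Integration.integrable_sum) auto
  have "(\<integral>\<omega>. excess R (stopped (\<lambda>j. I j \<omega>) (\<lambda>j. X (p j) \<omega>) m) \<partial>P)
     = (\<integral>\<omega>. excess R (X (p m) \<omega>) \<partial>P)
       - (\<Sum>j<m. \<integral>\<omega>. V j \<omega> * (excess R (X (p (Suc j)) \<omega>) - excess R (X (p j) \<omega>)) \<partial>P)"
    unfolding eq using V(1) excess_integrable[OF p[of m]]
    by (subst Bochner_Integration.integral_diff) (auto simp: Bochner_Integration.integral_sum)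
  also have "\<dots> \<le> (\<integral>\<omega>. excess R (X (p m) \<omega>) \<partial>P)"
    using sum_nonneg[of "{..<m}", OF V(2)] by simp
  finally show "(\<integral>\<omega>. excess R (stopped (\<lambda>j. I j \<omega>) (\<lambda>j. X (p j) \<omega>) m) \<partial>P) \<le> (\<integral>\<omega>. excess R (X (p m) \<omega>) \<partial>P)" .
qed

lemma excess_tendsto_0:
  assumes t: "t \<in> {0..T}"
  shows "((\<lambda>R. \<integral>\<omega>. excess R (X t \<omega>) \<partial>P) \<longlongrightarrow> 0) at_top"
proof -
  have "((\<lambda>R. \<integral>\<omega>. excess R (X t \<omega>) \<partial>P) \<longlongrightarrow> (\<integral>\<omega>. 0 \<partial>P)) at_top"
  proof (rule integral_dominated_convergence_at_top[where w = "\<lambda>\<omega>. \<bar>X t \<omega>\<bar>"])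
    show "\<forall>\<^sub>F R in at_top. AE \<omega> in P. norm (excess R (X t \<omega>)) \<le> \<bar>X t \<omega>\<bar>"
      using eventually_ge_at_top[of 0] by eventually_elim (auto simp: excess_def)
    show "AE \<omega> in P. ((\<lambda>R. excess R (X t \<omega>)) \<longlongrightarrow> 0) at_top"
    proof (rule AE_I2)
      fix \<omega>
      have "\<forall>\<^sub>F R in at_top. excess R (X t \<omega>) = 0"
        using eventually_ge_at_top[of "\<bar>X t \<omega>\<bar>"] by eventually_elim (auto simp: excess_def)
      then show "((\<lambda>R. excess R (X t \<omega>)) \<longlongrightarrow> 0) at_top" by (rule tendsto_eventually)
    qed
  qed (use t excess_integrable borel_measurable_integrable in auto)
  then show ?thesis by simp
qed

text \<open>Doob's maximal inequality, in the sharper form that makes \<open>K * P(max > K)\<close> vanish as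
  \<open>K \<rightarrow> \<infinity>\<close> for a martingale that is merely integrable.\<close>

lemma maximal_inequality:
  fixes p :: "nat \<Rightarrow> real"
  assumes mono: "mono_on {..m} p" and p: "\<And>j. j \<le> m \<Longrightarrow> p j \<in> {0..T}" and K: "K > 0"
  shows "K * measure P {\<omega>\<in>space P. \<exists>i\<le>m. \<bar>X (p i) \<omega>\<bar> > K} \<le> 2 * (\<integral>\<omega>. excess (K/2) (X (p m) \<omega>) \<partial>P)"
proof -
  define I where "I j \<omega> \<longleftrightarrow> (\<forall>i\<le>j. i \<le> m \<longrightarrow> \<bar>X (p i) \<omega>\<bar> \<le> K)" for j and \<omega> :: 'a
  define Z where "Z \<omega> = stopped (\<lambda>j. I j \<omega>) (\<lambda>j. X (p j) \<omega>) m" for \<omega>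
  have anti: "I i \<omega>" if "i \<le> j" "I j \<omega>" for i j \<omega>
    using that by (auto simp: I_def)
  have pred: "Measurable.pred (F (p j)) (I j)" if "j < m" for j
  proof -
    have [measurable]: "X (p i) \<in> borel_measurable (F (p j))" if "i \<le> j" for i
      using X_measurable_F[of "p i"] measurable_F_mono[of "p i" "p j"] mono p that \<open>j < m\<close>
      by (auto simp: mono_on_def)
    have "I j = (\<lambda>\<omega>. \<forall>i\<in>{..j}. \<bar>X (p i) \<omega>\<bar> \<le> K)"
      using that by (auto simp: I_def fun_eq_iff)
    then show ?thesis by simp
  qed
  have int: "integrable P (\<lambda>\<omega>. excess (K/2) (Z \<omega>))"
    and le: "(\<integral>\<omega>. excess (K/2) (Z \<omega>) \<partial>P) \<le> (\<integral>\<omega>. excess (K/2) (X (p m) \<omega>) \<partial>P)"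
    unfolding Z_def using stopped_excess_le[where I = I, OF mono p pred anti] by auto
  have [measurable]: "X (p i) \<in> borel_measurable P" if "i \<le> m" for i
    using X_measurable p that by auto
  have m: "{\<omega>\<in>space P. \<exists>i\<le>m. \<bar>X (p i) \<omega>\<bar> > K} \<in> sets P"
  proof -
    have "{\<omega>\<in>space P. \<exists>i\<in>{..m}. \<bar>X (p i) \<omega>\<bar> > K} \<in> sets P" by measurable
    then show ?thesis by (simp add: Bex_def)
  qed
  have "K * measure P {\<omega>\<in>space P. \<exists>i\<le>m. \<bar>X (p i) \<omega>\<bar> > K}
     = (\<integral>\<omega>. K * indicator {\<omega>\<in>space P. \<exists>i\<le>m. \<bar>X (p i) \<omega>\<bar> > K} \<omega> \<partial>P)"
    using m by simp
  also have "\<dots> \<le> (\<integral>\<omega>. 2 * excess (K/2) (Z \<omega>) \<partial>P)"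
  proof (rule integral_mono)
    show "integrable P (\<lambda>\<omega>. K * indicator {\<omega>\<in>space P. \<exists>i\<le>m. \<bar>X (p i) \<omega>\<bar> > K} \<omega>)"
      using m by (simp add: emeasure_eq_measure)
    show "integrable P (\<lambda>\<omega>. 2 * excess (K/2) (Z \<omega>))" using int by simp
    show "K * indicator {\<omega>\<in>space P. \<exists>i\<le>m. \<bar>X (p i) \<omega>\<bar> > K} \<omega> \<le> 2 * excess (K/2) (Z \<omega>)" for \<omega>
    proof (cases "\<exists>i\<le>m. \<bar>X (p i) \<omega>\<bar> > K")
      case True
      define i where "i = (LEAST i. i \<le> m \<and> \<bar>X (p i) \<omega>\<bar> > K)"
      have i: "i \<le> m" "\<bar>X (p i) \<omega>\<bar> > K"
        using LeastI_ex[OF True] by (auto simp: i_def)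
      have less: "\<bar>X (p j) \<omega>\<bar> \<le> K" if "j < i" for j
        using not_less_Least[of j "\<lambda>i. i \<le> m \<and> \<bar>X (p i) \<omega>\<bar> > K"] that i by (auto simp: i_def)
      have "Z \<omega> = X (p i) \<omega>"
        unfolding Z_def
        by (rule stopped_eq[where I = "\<lambda>j. I j \<omega>"]) (use anti i less in \<open>auto simp: I_def not_le\<close>)
      \<comment> \<open>At the first exceedance |Z| lies above K, so its excess over K/2 lies above
        K/2; halving the level is the origin of the factor 2.\<close>
      then have "2 * excess (K/2) (Z \<omega>) \<ge> K"
        using i by (auto simp: excess_def)
      then show ?thesis using K by (auto simp: indicator_def)
    qed (auto simp: indicator_def)
  qed
  also have "\<dots> \<le> 2 * (\<integral>\<omega>. excess (K/2) (X (p m) \<omega>) \<partial>P)" using le by simp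
  finally show ?thesis .
qed

end

section \<open>Levy's characterisation\<close>

text \<open>For a martingale increment the factor 1 + i x has conditional mean exactly 1, which the
  character does not have, and its modulus is still controlled by half of the square.\<close>

lemma norm_one_plus_ii_le: "cmod (1 + \<i> * of_real x) \<le> exp (x\<^sup>2 / 2)"
proof (rule power2_le_imp_le)
  have "(cmod (1 + \<i> * of_real x))\<^sup>2 = 1 + x\<^sup>2" by (simp add: cmod_power2)
  also have "\<dots> \<le> exp (x\<^sup>2)" by (rule exp_ge_add_one_self)
  also have "\<dots> = (exp (x\<^sup>2 / 2))\<^sup>2" by (simp add: power2_eq_square flip: exp_add)
  finally show "(cmod (1 + \<i> * of_real x))\<^sup>2 \<le> (exp (x\<^sup>2 / 2))\<^sup>2" .
qed simp

lemma norm_prod_one_plus_ii_le: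
  fixes m :: nat and x :: "nat \<Rightarrow> real"
  shows
  "cmod (\<Prod>j<m. 1 + \<i> * of_real (x j)) \<le> exp ((\<Sum>j<m. (x j)\<^sup>2) / 2)"
proof -
  have "cmod (\<Prod>j<m. 1 + \<i> * of_real (x j)) \<le> (\<Prod>j<m. exp ((x j)\<^sup>2 / 2))"
    unfolding prod_norm[symmetric] by (intro prod_mono conjI norm_one_plus_ii_le) simp
  also have "\<dots> = exp ((\<Sum>j<m. (x j)\<^sup>2) / 2)"
    by (simp add: sum_divide_distrib exp_sum)
  finally show ?thesis .
qed

text \<open>The logarithm of 1 + i x is i x + x^2/2 up to third order. With z denoting this
  exponent, the constant 4 is 27/8 + 5/8: the first is the Taylor remainder of exp, using |z| \<le>
  3/2 |x| and |Re z| \<le> 1/2, the second comes from the terms i x^3/2 and x^4/8 of z^2/2.\<close>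

lemma one_plus_ii_approx:
  fixes x :: real
  assumes "\<bar>x\<bar> \<le> 1"
  shows "cmod (1 + \<i> * of_real x - exp (\<i> * of_real x + of_real (x\<^sup>2 / 2))) \<le> 4 * \<bar>x\<bar> ^ 3"
proof -
  define z where "z = \<i> * complex_of_real x + of_real (x\<^sup>2 / 2)"
  have x2: "x\<^sup>2 \<le> \<bar>x\<bar>" using assms
    by (metis abs_ge_zero mult_left_le power2_abs power2_eq_square)
  have z: "cmod z \<le> 3/2 * \<bar>x\<bar>"
  proof -
    have "cmod z \<le> \<bar>x\<bar> + x\<^sup>2 / 2" unfolding z_def
      by (rule norm_triangle_le) (simp add: norm_mult norm_power norm_divide)
    then show ?thesis using x2 by simp
  qed
  have "cmod (exp z - (\<Sum>k\<le>2. z ^ k / fact k)) \<le> exp \<bar>Re z\<bar> * cmod z ^ Suc 2 / fact 2"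
    by (rule Taylor_exp)
  moreover have "exp \<bar>Re z\<bar> \<le> 2"
  proof -
    have "\<bar>Re z\<bar> \<le> 1/2" using x2 assms by (simp add: z_def)
    then have "exp \<bar>Re z\<bar> \<le> exp (1/2::real)" by simp
    also have "\<dots> \<le> 1 + 1/2 + (1/2)\<^sup>2" by (rule exp_bound) auto
    also have "\<dots> \<le> (2::real)" by (simp add: power2_eq_square)
    finally show ?thesis .
  qed
  moreover have "cmod z ^ 3 \<le> (3/2 * \<bar>x\<bar>) ^ 3" using z by (rule power_mono) simp
  ultimately have 1: "cmod (exp z - (\<Sum>k\<le>2. z ^ k / fact k)) \<le> 27/8 * \<bar>x\<bar> ^ 3"
    using mult_mono[of "exp \<bar>Re z\<bar>" 2 "cmod z ^ 3" "(3/2 * \<bar>x\<bar>) ^ 3"]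
    by (simp add: power_mult_distrib eval_nat_numeral)
  have sum: "(\<Sum>k\<le>2. z ^ k / fact k) = 1 + \<i> * of_real x + (\<i> * of_real (x ^ 3 / 2) + of_real (x ^ 4 / 8))"
    by (simp add: z_def eval_nat_numeral complex_eq_iff) (simp add: field_simps)
  have "cmod (\<i> * of_real (x ^ 3 / 2) + of_real (x ^ 4 / 8)) \<le> \<bar>x\<bar>^3 / 2 + \<bar>x\<bar> ^ 4 / 8"
    by (rule norm_triangle_le) (simp add: norm_mult norm_power norm_divide power_abs)
  also have "\<bar>x\<bar> ^ 4 \<le> \<bar>x\<bar> ^ 3" using assms by (intro power_decreasing) auto
  finally have 2: "cmod (\<i> * of_real (x ^ 3 / 2) + of_real (x ^ 4 / 8)) \<le> 5/8 * \<bar>x\<bar>^3" by simp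
  have "1 + \<i> * of_real x - exp z = - (exp z - (\<Sum>k\<le>2. z ^ k / fact k)) - (\<i> * of_real (x ^ 3 / 2) + of_real (x ^ 4 / 8))"
    unfolding sum by simp
  also have "cmod \<dots> \<le> 4 * \<bar>x\<bar> ^ 3"
    using 1 2 norm_triangle_ineq4[of "- (exp z - (\<Sum>k\<le>2. z ^ k / fact k))" "\<i> * of_real (x ^ 3 / 2) + of_real (x ^ 4 / 8)"]
    unfolding norm_minus_cancel by linarith
  finally show ?thesis by (simp add: z_def)
qed

lemma prod_one_plus_ii_approx:
  fixes x :: "nat \<Rightarrow> real"
  assumes "\<And>j. j < m \<Longrightarrow> \<bar>x j\<bar> \<le> 1"
  shows "cmod ((\<Prod>j<m. 1 + \<i> * of_real (x j)) - exp (\<i> * of_real (\<Sum>j<m. x j) + of_real ((\<Sum>j<m. (x j)\<^sup>2) / 2)))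
    \<le> exp ((\<Sum>j<m. (x j)\<^sup>2) / 2) * (4 * (\<Sum>j<m. \<bar>x j\<bar> ^ 3))"
  using assms
proof (induction m)
  case 0
  show ?case by simp
next
  case (Suc m)
  define a where "a = (\<Prod>j<m. 1 + \<i> * complex_of_real (x j))"
  define b where "b = exp (\<i> * complex_of_real (\<Sum>j<m. x j) + of_real ((\<Sum>j<m. (x j)\<^sup>2) / 2))"
  define c where "c = 1 + \<i> * complex_of_real (x m)"
  define d where "d = exp (\<i> * complex_of_real (x m) + of_real ((x m)\<^sup>2 / 2))"
  define S where "S = (\<Sum>j<m. (x j)\<^sup>2)"
  have IH: "cmod (a - b) \<le> exp (S / 2) * (4 * (\<Sum>j<m. \<bar>x j\<bar> ^ 3))"
    using Suc unfolding a_def b_def S_def by simp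
  have c: "cmod c \<le> exp ((x m)\<^sup>2 / 2)" unfolding c_def by (rule norm_one_plus_ii_le)
  have cd: "cmod (c - d) \<le> 4 * \<bar>x m\<bar> ^ 3"
    unfolding c_def d_def using Suc.prems by (intro one_plus_ii_approx) simp
  have b: "cmod b = exp (S / 2)" by (simp add: b_def S_def)
  have e1: "exp (S / 2 + (x m)\<^sup>2 / 2) = exp (S / 2) * exp ((x m)\<^sup>2 / 2)" by (rule exp_add)
  \<comment> \<open>One factor is exchanged at a time: the old error is multiplied by |c| \<le> exp
    (x_m^2/2), the new one by |b| = exp (S/2), so the exponential of half the sum of squares
    reproduces itself.\<close>
  have "cmod (a * c - b * d) = cmod ((a - b) * c + b * (c - d))" by (simp add: algebra_simps)
  also have "\<dots> \<le> cmod (a - b) * cmod c + cmod b * cmod (c - d)"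
    by (rule order_trans[OF norm_triangle_ineq]) (simp add: norm_mult)
  also have "\<dots> \<le> exp (S / 2) * (4 * (\<Sum>j<m. \<bar>x j\<bar> ^ 3)) * exp ((x m)\<^sup>2 / 2) + exp (S / 2) * (4 * \<bar>x m\<bar> ^ 3)"
    using IH c cd b by (intro add_mono mult_mono) (auto intro!: sum_nonneg mult_nonneg_nonneg)
  also have "\<dots> \<le> exp (S / 2) * (4 * (\<Sum>j<m. \<bar>x j\<bar> ^ 3)) * exp ((x m)\<^sup>2 / 2)
      + exp (S / 2) * (4 * \<bar>x m\<bar> ^ 3) * exp ((x m)\<^sup>2 / 2)"
    using mult_left_mono[of 1 "exp ((x m)\<^sup>2 / 2)" "exp (S / 2) * (4 * \<bar>x m\<bar> ^ 3)"] by simp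
  also have "\<dots> = exp ((\<Sum>j<Suc m. (x j)\<^sup>2) / 2) * (4 * (\<Sum>j<Suc m. \<bar>x j\<bar> ^ 3))"
    by (simp add: S_def[symmetric] add_divide_distrib e1 algebra_simps)
  finally have *: "cmod (a * c - b * d) \<le> exp ((\<Sum>j<Suc m. (x j)\<^sup>2) / 2) * (4 * (\<Sum>j<Suc m. \<bar>x j\<bar> ^ 3))" .
  have ac: "a * c = (\<Prod>j<Suc m. 1 + \<i> * of_real (x j))" by (simp add: a_def c_def)
  have bd: "b * d = exp (\<i> * of_real (\<Sum>j<Suc m. x j) + of_real ((\<Sum>j<Suc m. (x j)\<^sup>2) / 2))"
    by (simp add: b_def d_def add_divide_distrib algebra_simps flip: exp_add)
  show ?case using * unfolding ac bd .
qed

text \<open>All increments before the exit have squares summing to at most C. The increment made at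
  the exit is not covered by this bound; it is paid for by the modulus of the stopped value, and
  this is why the level K for |x j| belongs to the stopping rule.\<close>

lemma stopped_prod_bound:
  fixes x :: "nat \<Rightarrow> real"
  assumes dec: "\<And>i j. i \<le> j \<Longrightarrow> I j \<Longrightarrow> I i" and C: "C \<ge> 0" and K: "K \<ge> 0"
    and I: "\<And>j. I j \<Longrightarrow> (\<Sum>i<j. (x (Suc i) - x i)\<^sup>2) \<le> C \<and> \<bar>x j\<bar> \<le> K"
  shows "I m \<Longrightarrow> cmod (\<Prod>j<m. 1 + \<i> * of_real (u * (if I j then x (Suc j) - x j else 0))) \<le> exp (u\<^sup>2 * C / 2)"
    and "cmod (\<Prod>j<m. 1 + \<i> * of_real (u * (if I j then x (Suc j) - x j else 0)))
      \<le> exp (u\<^sup>2 * C / 2) * (1 + \<bar>u\<bar> * (K + \<bar>stopped I x m\<bar>))"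
proof -
  show 1: "cmod (\<Prod>j<m. 1 + \<i> * of_real (u * (if I j then x (Suc j) - x j else 0))) \<le> exp (u\<^sup>2 * C / 2)"
    if m: "I m" for m
  proof -
    have "(\<Sum>j<m. (u * (if I j then x (Suc j) - x j else 0))\<^sup>2) \<le> (\<Sum>j<m. u\<^sup>2 * (x (Suc j) - x j)\<^sup>2)"
      by (rule sum_mono) (auto simp: power_mult_distrib)
    also have "\<dots> \<le> u\<^sup>2 * C"
      unfolding sum_distrib_left[symmetric] using I[OF m] by (intro mult_left_mono) auto
    finally show ?thesis
      by (intro order_trans[OF norm_prod_one_plus_ii_le]) simp
  qed
  show "cmod (\<Prod>j<m. 1 + \<i> * of_real (u * (if I j then x (Suc j) - x j else 0)))
      \<le> exp (u\<^sup>2 * C / 2) * (1 + \<bar>u\<bar> * (K + \<bar>stopped I x m\<bar>))"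
  proof (induction m)
    case 0
    have "1 \<le> exp (u\<^sup>2 * C / 2) * (1 + \<bar>u\<bar> * (K + \<bar>x 0\<bar>))"
      using C K mult_mono[of 1 "exp (u\<^sup>2 * C / 2)" 1 "1 + \<bar>u\<bar> * (K + \<bar>x 0\<bar>)"] by simp
    then show ?case by simp
  next
    case (Suc m)
    show ?case
    proof (cases "I m")
      case True
      have "cmod (1 + \<i> * of_real (u * (x (Suc m) - x m))) \<le> 1 + \<bar>u\<bar> * \<bar>x (Suc m) - x m\<bar>"
        by (rule norm_triangle_le) (simp add: norm_mult abs_mult flip: of_real_diff)
      also have "\<dots> \<le> 1 + \<bar>u\<bar> * (K + \<bar>x (Suc m)\<bar>)"
        using I[OF True] by (intro add_left_mono mult_left_mono) auto
      finally have "cmod (1 + \<i> * of_real (u * (x (Suc m) - x m))) \<le> 1 + \<bar>u\<bar> * (K + \<bar>x (Suc m)\<bar>)" .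
      then show ?thesis using 1[OF True] True
        by (auto simp: norm_mult simp del: of_real_mult of_real_diff intro!: mult_mono)
    next
      case False
      then show ?thesis using Suc by simp
    qed
  qed
qed

section \<open>Characters of increments along a partition\<close>

context real_martingale
begin

text \<open>The product is a martingale by construction, since each factor is 1 plus a
  past-measurable multiple of an increment; the work lies in checking that these multiples are
  bounded.\<close>

lemma integral_product_martingale:
  fixes p :: "nat \<Rightarrow> real" and V :: "'a \<Rightarrow> complex" and u :: real
  assumes mono: "mono_on {..m} p" and p: "\<And>j. j \<le> m \<Longrightarrow> p j \<in> {0..T}"
    and I: "\<And>j. j < m \<Longrightarrow> Measurable.pred (F (p j)) (I j)"
    and anti: "\<And>\<omega> i j. i \<le> j \<Longrightarrow> I j \<omega> \<Longrightarrow> I i \<omega>"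
    and C: "C \<ge> 0" and K: "K \<ge> 0"
    and IC: "\<And>j \<omega>. I j \<omega> \<Longrightarrow> (\<Sum>i<j. (X (p (Suc i)) \<omega> - X (p i) \<omega>)\<^sup>2) \<le> C \<and> \<bar>X (p j) \<omega>\<bar> \<le> K"
    and V: "V \<in> borel_measurable (F (p 0))" and V1: "\<And>\<omega>. \<omega> \<in> space P \<Longrightarrow> cmod (V \<omega>) \<le> 1"
  defines "L \<equiv> \<lambda>k \<omega>. \<Prod>j<k. 1 + \<i> * complex_of_real (u * (if I j \<omega> then X (p (Suc j)) \<omega> - X (p j) \<omega> else 0))"
  shows "k \<le> m \<Longrightarrow> L k \<in> borel_measurable (F (p k)) \<and> integrable P (\<lambda>\<omega>. V \<omega> * L k \<omega>)
     \<and> (\<integral>\<omega>. V \<omega> * L k \<omega> \<partial>P) = (\<integral>\<omega>. V \<omega> \<partial>P)"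
proof (induction k)
  case 0
  have "V \<in> borel_measurable P" using measurable_F_P[OF p V] by simp
  then have "integrable P V" using V1 by (intro integrable_const_bound[of _ 1]) auto
  then show ?case by (simp add: L_def)
next
  case (Suc k)
  then have k: "k < m" "k \<le> m" and IH: "L k \<in> borel_measurable (F (p k))" "integrable P (\<lambda>\<omega>. V \<omega> * L k \<omega>)"
     "(\<integral>\<omega>. V \<omega> * L k \<omega> \<partial>P) = (\<integral>\<omega>. V \<omega> \<partial>P)" by auto
  have le: "0 \<le> p k" "p k \<le> p (Suc k)" "p (Suc k) \<le> T" "p 0 \<le> p k"
    using p[of k] p[of "Suc k"] k mono by (auto simp: mono_on_def)
  have pk: "p k \<in> {0..T}" "p (Suc k) \<in> {0..T}" using p k by auto
  \<comment> \<open>The new factor differs from 1 only where \<open>I k\<close> holds, and there the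
    product so far is bounded by exp (u^2 C/2); so D is an admissible weight although
    \<open>L k\<close> itself may be unbounded.\<close>
  define D where "D \<omega> = V \<omega> * (L k \<omega> * (\<i> * of_real u * (if I k \<omega> then 1 else 0)))" for \<omega>
  have [measurable]: "V \<in> borel_measurable (F (p k))" "L k \<in> borel_measurable (F (p k))"
    "Measurable.pred (F (p k)) (I k)"
    using measurable_F_mono[OF le(4) V] IH I k by auto
  have Dm: "D \<in> borel_measurable (F (p k))" unfolding D_def by measurable
  have Db: "cmod (D \<omega>) \<le> exp (u\<^sup>2 * C / 2) * \<bar>u\<bar>" if w: "\<omega> \<in> space P" for \<omega>
  proof (cases "I k \<omega>")
    case True
    have "cmod (L k \<omega>) \<le> exp (u\<^sup>2 * C / 2)"
      unfolding L_def by (rule stopped_prod_bound(1)[where K = K]) (use anti C K IC True in auto)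
    then have "cmod (V \<omega>) * (cmod (L k \<omega>) * \<bar>u\<bar>) \<le> 1 * (exp (u\<^sup>2 * C / 2) * \<bar>u\<bar>)"
      using V1[OF w] by (intro mult_mono) auto
    then show ?thesis using True by (simp add: D_def norm_mult)
  qed (simp add: D_def)
  have split: "V \<omega> * L (Suc k) \<omega> = V \<omega> * L k \<omega> + D \<omega> * of_real (X (p (Suc k)) \<omega> - X (p k) \<omega>)" for \<omega>
    by (simp add: L_def D_def algebra_simps)
  have [measurable]: "X (p k) \<in> borel_measurable (F (p (Suc k)))" "X (p (Suc k)) \<in> borel_measurable (F (p (Suc k)))"
    "L k \<in> borel_measurable (F (p (Suc k)))" "Measurable.pred (F (p (Suc k))) (I k)"
    using X_measurable_F[OF pk(1)] X_measurable_F[OF pk(2)] IH(1) I[OF k(1)]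
    by (auto intro: measurable_F_mono[OF le(2)])
  have "(\<lambda>\<omega>. L k \<omega> * (1 + \<i> * complex_of_real (u * (if I k \<omega> then X (p (Suc k)) \<omega> - X (p k) \<omega> else 0)))) \<in> borel_measurable (F (p (Suc k)))"
    by measurable
  then have "L (Suc k) \<in> borel_measurable (F (p (Suc k)))"
    by (simp add: L_def lessThan_Suc mult.commute)
  then show ?case
    unfolding split using IH increment_mean_complex[OF le(1-3) Dm Db] by auto
qed

text \<open>Off an exceptional event the product equals exp (i u S + u^2 Q/2) up to O(\<delta>); on
  it only the a priori bounds are available. The three error terms account for the Taylor expansion
  and the deviation of the sum of squares (\<delta>), for the failure of the partition (\<eta>), and
  for X leaving [-K, K] (e). In the last one 4 + 4 |u| comes from the probability of leaving and the
  remaining |u| from the size of the factor at the exit.\<close>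

lemma partition_estimate:
  fixes p :: "nat \<Rightarrow> real" and V :: "'a \<Rightarrow> complex" and u :: real
  assumes mono: "mono_on {..m} p" and p: "\<And>j. j \<le> m \<Longrightarrow> p j \<in> {0..T}"
    and V: "V \<in> borel_measurable (F (p 0))" and V1: "\<And>\<omega>. \<omega> \<in> space P \<Longrightarrow> cmod (V \<omega>) \<le> 1"
    and Q: "Q \<ge> 0" and \<delta>: "0 < \<delta>" "\<delta> \<le> 1" "\<bar>u\<bar> * \<delta> \<le> 1" and K: "K \<ge> 1"
    and bad: "measure P {\<omega>\<in>space P. \<bar>(\<Sum>j<m. (X (p (Suc j)) \<omega> - X (p j) \<omega>)\<^sup>2) - Q\<bar> > \<delta>
         \<or> (\<exists>j<m. \<bar>X (p (Suc j)) \<omega> - X (p j) \<omega>\<bar> > \<delta>)} \<le> \<eta>"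
  defines "L \<equiv> exp (u\<^sup>2 * (Q + 1) / 2)" and "e \<equiv> \<integral>\<omega>. excess (K/2) (X (p m) \<omega>) \<partial>P"
  shows "cmod ((\<integral>\<omega>. V \<omega> * iexp (u * (X (p m) \<omega> - X (p 0) \<omega>)) * of_real (exp (u\<^sup>2 * Q / 2)) \<partial>P) - (\<integral>\<omega>. V \<omega> \<partial>P))
    \<le> L * (u\<^sup>2 / 2 + 4 * \<bar>u\<bar> ^ 3 * (Q + 1)) * \<delta> + L * (2 + 2 * \<bar>u\<bar> * K) * \<eta> + L * (4 + 5 * \<bar>u\<bar>) * e"
proof -
  \<comment> \<open>As \<delta> \<le> 1, the sum of squares stays below Q + 1 on the good event, so
    stopping never intervenes there.\<close>
  define C where "C = Q + 1"
  define \<xi> where "\<xi> j \<omega> = X (p (Suc j)) \<omega> - X (p j) \<omega>" for j \<omega>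
  define I where "I j \<omega> \<longleftrightarrow> (\<forall>i\<le>j. i \<le> m \<longrightarrow> (\<Sum>l<i. (\<xi> l \<omega>)\<^sup>2) \<le> C \<and> \<bar>X (p i) \<omega>\<bar> \<le> K) \<and> j \<le> m" for j \<omega>
  define Z where "Z \<omega> = stopped (\<lambda>j. I j \<omega>) (\<lambda>j. X (p j) \<omega>) m" for \<omega>
  define \<Theta> where "\<Theta> \<omega> = (\<Prod>j<m. 1 + \<i> * complex_of_real (u * (if I j \<omega> then X (p (Suc j)) \<omega> - X (p j) \<omega> else 0)))" for \<omega>
  have C: "C \<ge> 0" using Q by (simp add: C_def)
  have anti: "I i \<omega>" if "i \<le> j" "I j \<omega>" for i j \<omega>
    using that by (auto simp: I_def)
  have IC: "(\<Sum>i<j. (X (p (Suc i)) \<omega> - X (p i) \<omega>)\<^sup>2) \<le> C \<and> \<bar>X (p j) \<omega>\<bar> \<le> K" if "I j \<omega>" for j \<omega>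
    using that by (auto simp: I_def \<xi>_def)
  have XF: "X (p i) \<in> borel_measurable (F (p j))" if "i \<le> j" "j \<le> m" for i j
    using that X_measurable_F[of "p i"] p[of i] mono
    by (intro measurable_F_mono[of "p i" "p j"]) (auto simp: mono_on_def)
  have pred: "Measurable.pred (F (p j)) (I j)" if j: "j < m" for j
  proof -
    have [measurable]: "X (p i) \<in> borel_measurable (F (p j))" if "i \<in> {..j}" for i
      using XF that j by auto
    have [measurable]: "(\<lambda>\<omega>. \<Sum>l<i. (\<xi> l \<omega>)\<^sup>2) \<in> borel_measurable (F (p j))" if "i \<in> {..j}" for i
      unfolding \<xi>_def using that XF j
      by (intro borel_measurable_sum borel_measurable_power borel_measurable_diff) auto
    have "I j = (\<lambda>\<omega>. \<forall>i\<in>{..j}. (\<Sum>l<i. (\<xi> l \<omega>)\<^sup>2) \<le> C \<and> \<bar>X (p i) \<omega>\<bar> \<le> K)"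
      using j by (auto simp: I_def fun_eq_iff)
    then show ?thesis by simp
  qed
  have K0: "K \<ge> 0" using K by simp
  have \<Theta>int: "integrable P (\<lambda>\<omega>. V \<omega> * \<Theta> \<omega>)" and \<Theta>eq: "(\<integral>\<omega>. V \<omega> * \<Theta> \<omega> \<partial>P) = (\<integral>\<omega>. V \<omega> \<partial>P)"
    using integral_product_martingale[where I = I and u = u and k = m, OF mono p pred _ C K0 _ V V1] anti IC
    unfolding \<Theta>_def by auto
  have Zex: "integrable P (\<lambda>\<omega>. excess K (Z \<omega>))"
    "(\<integral>\<omega>. excess K (Z \<omega>) \<partial>P) \<le> (\<integral>\<omega>. excess K (X (p m) \<omega>) \<partial>P)"
    unfolding Z_def using stopped_excess_le[where I = I and R = K, OF mono p pred] anti by blast+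
  have XP [measurable]: "X (p i) \<in> borel_measurable P" if "i \<le> m" for i
    using X_measurable p that by auto
  define B1 where "B1 = {\<omega>\<in>space P. \<bar>(\<Sum>j<m. (\<xi> j \<omega>)\<^sup>2) - Q\<bar> > \<delta> \<or> (\<exists>j<m. \<bar>\<xi> j \<omega>\<bar> > \<delta>)}"
  define B2 where "B2 = {\<omega>\<in>space P. \<exists>i\<le>m. \<bar>X (p i) \<omega>\<bar> > K}"
  have \<xi>P [measurable]: "\<xi> j \<in> borel_measurable P" if "j < m" for j
    unfolding \<xi>_def using XP[of "Suc j"] XP[of j] that by auto
  have B1s [measurable]: "B1 \<in> sets P"
  proof -
    have "{\<omega>\<in>space P. \<bar>(\<Sum>j\<in>{..<m}. (\<xi> j \<omega>)\<^sup>2) - Q\<bar> > \<delta> \<or> (\<exists>j\<in>{..<m}. \<bar>\<xi> j \<omega>\<bar> > \<delta>)} \<in> sets P"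
      by measurable
    then show ?thesis by (simp add: B1_def Bex_def)
  qed
  have B2s [measurable]: "B2 \<in> sets P"
  proof -
    have "{\<omega>\<in>space P. \<exists>i\<in>{..m}. \<bar>X (p i) \<omega>\<bar> > K} \<in> sets P" by measurable
    then show ?thesis by (simp add: B2_def Bex_def)
  qed
  define B where "B = B1 \<union> B2"
  have [measurable]: "B \<in> sets P" by (simp add: B_def)
  have e0: "e \<ge> 0" unfolding e_def by (rule integral_nonneg_AE) auto
  have PB: "measure P B \<le> \<eta> + 2 * e / K"
  proof -
    have "measure P B \<le> measure P B1 + measure P B2"
      unfolding B_def by (rule measure_Un_le) auto
    moreover have "measure P B1 \<le> \<eta>" using bad by (simp add: B1_def \<xi>_def)
    moreover have "measure P B2 \<le> 2 * e / K"
      using maximal_inequality[OF mono p, of K] K by (simp add: B2_def e_def field_simps)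
    ultimately show ?thesis by simp
  qed
  have L1: "L \<ge> 1" unfolding L_def using Q by simp
  have LQ: "exp (u\<^sup>2 * Q / 2) \<le> L" unfolding L_def by (simp add: mult_left_mono)
  have LC: "L = exp (u\<^sup>2 * C / 2)" by (simp add: L_def C_def)
  define \<gamma> where "\<gamma> = L * (u\<^sup>2 / 2 + 4 * \<bar>u\<bar> ^ 3 * C) * \<delta>"
  have \<gamma>0: "\<gamma> \<ge> 0" unfolding \<gamma>_def using L1 C \<delta> by (intro mult_nonneg_nonneg add_nonneg_nonneg) auto
  define S where "S \<omega> = X (p m) \<omega> - X (p 0) \<omega>" for \<omega>
  have S: "S \<omega> = (\<Sum>j<m. \<xi> j \<omega>)" for \<omega>
    unfolding S_def \<xi>_def using sum_lessThan_telescope[of "\<lambda>j. X (p j) \<omega>" m] by simp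
  define D where "D \<omega> = V \<omega> * iexp (u * S \<omega>) * of_real (exp (u\<^sup>2 * Q / 2)) - V \<omega> * \<Theta> \<omega>" for \<omega>
  define bnd where "bnd \<omega> = \<gamma> + L * (2 + 2 * \<bar>u\<bar> * K) * indicator B \<omega> + L * \<bar>u\<bar> * excess K (Z \<omega>)" for \<omega>
  have D: "cmod (D \<omega>) \<le> bnd \<omega>" if w: "\<omega> \<in> space P" for \<omega>
  proof (cases "\<omega> \<in> B")
    case True
    have "cmod (\<Theta> \<omega>) \<le> L * (1 + \<bar>u\<bar> * (K + \<bar>Z \<omega>\<bar>))"
      unfolding \<Theta>_def LC Z_def by (rule stopped_prod_bound(2)) (use anti C K0 IC in auto)
    \<comment> \<open>The constant part K is multiplied by the small probability of B; only the
      excess remains unbounded, and its mean is small.\<close>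
    also have "\<bar>Z \<omega>\<bar> \<le> K + excess K (Z \<omega>)" by (simp add: excess_def)
    finally have \<Theta>b: "cmod (\<Theta> \<omega>) \<le> L * (1 + \<bar>u\<bar> * (K + (K + excess K (Z \<omega>))))"
      using L1 by (simp add: mult_left_mono)
    have "cmod (V \<omega> * iexp (u * S \<omega>) * of_real (exp (u\<^sup>2 * Q / 2))) \<le> 1 * 1 * L"
      unfolding norm_mult using V1[OF w] LQ by (intro mult_mono) auto
    moreover have "cmod (V \<omega> * \<Theta> \<omega>) \<le> 1 * (L * (1 + \<bar>u\<bar> * (K + (K + excess K (Z \<omega>)))))"
      unfolding norm_mult using V1[OF w] \<Theta>b by (intro mult_mono) auto
    ultimately have "cmod (D \<omega>) \<le> L + L * (1 + \<bar>u\<bar> * (K + (K + excess K (Z \<omega>))))"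
      unfolding D_def by (intro order_trans[OF norm_triangle_ineq4]) simp
    then show ?thesis using True \<gamma>0 by (simp add: bnd_def algebra_simps)
  next
    case False
    define q where "q = (\<Sum>j<m. (\<xi> j \<omega>)\<^sup>2)"
    have q: "\<bar>q - Q\<bar> \<le> \<delta>" and \<xi>: "\<And>j. j < m \<Longrightarrow> \<bar>\<xi> j \<omega>\<bar> \<le> \<delta>" and XK: "\<And>i. i \<le> m \<Longrightarrow> \<bar>X (p i) \<omega>\<bar> \<le> K"
      using False w unfolding B_def B1_def B2_def q_def not_less[symmetric] by blast+
    have qC: "q \<le> C" using q \<delta> by (simp add: C_def)
    have Ij: "I j \<omega>" if "j \<le> m" for j
    proof -
      have "(\<Sum>l<i. (\<xi> l \<omega>)\<^sup>2) \<le> C" if "i \<le> m" for i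
        using qC sum_mono2[of "{..<m}" "{..<i}" "\<lambda>l. (\<xi> l \<omega>)\<^sup>2"] that by (auto simp: q_def)
      then show ?thesis using XK that by (auto simp: I_def)
    qed
    have \<Theta>1: "\<Theta> \<omega> = (\<Prod>j<m. 1 + \<i> * complex_of_real (u * \<xi> j \<omega>))"
      unfolding \<Theta>_def \<xi>_def using Ij by (intro prod.cong) auto
    have ub: "\<bar>u * \<xi> j \<omega>\<bar> \<le> 1" if "j < m" for j
      using \<delta>(3) mult_left_mono[OF \<xi>[OF that], of "\<bar>u\<bar>"] by (simp add: abs_mult)
    have cube: "(\<Sum>j<m. \<bar>u * \<xi> j \<omega>\<bar> ^ 3) \<le> \<bar>u\<bar> ^ 3 * (\<delta> * C)"
    proof -
      have "(\<Sum>j<m. \<bar>u * \<xi> j \<omega>\<bar> ^ 3) \<le> (\<Sum>j<m. \<bar>u\<bar> ^ 3 * (\<delta> * (\<xi> j \<omega>)\<^sup>2))"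
      proof (rule sum_mono)
        fix j assume "j \<in> {..<m}"
        then have "\<bar>\<xi> j \<omega>\<bar> * (\<xi> j \<omega>)\<^sup>2 \<le> \<delta> * (\<xi> j \<omega>)\<^sup>2"
          using \<xi> by (intro mult_right_mono) auto
        moreover have "\<bar>\<xi> j \<omega>\<bar> ^ 3 = \<bar>\<xi> j \<omega>\<bar> * (\<xi> j \<omega>)\<^sup>2"
          by (simp add: power2_eq_square power3_eq_cube)
        ultimately show "\<bar>u * \<xi> j \<omega>\<bar> ^ 3 \<le> \<bar>u\<bar> ^ 3 * (\<delta> * (\<xi> j \<omega>)\<^sup>2)"
          by (simp add: abs_mult power_mult_distrib mult_left_mono)
      qed
      also have "\<dots> = \<bar>u\<bar> ^ 3 * (\<delta> * q)" by (simp add: q_def sum_distrib_left)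
      also have "\<dots> \<le> \<bar>u\<bar> ^ 3 * (\<delta> * C)" using qC \<delta> by (intro mult_left_mono) auto
      finally show ?thesis .
    qed
    have sq: "(\<Sum>j<m. (u * \<xi> j \<omega>)\<^sup>2) = u\<^sup>2 * q"
      by (simp add: q_def power_mult_distrib sum_distrib_left)
    have sm: "(\<Sum>j<m. u * \<xi> j \<omega>) = u * S \<omega>" by (simp add: S sum_distrib_left)
    have Lq: "exp (u\<^sup>2 * q / 2) \<le> L" unfolding LC using qC by (simp add: mult_left_mono)
    have 1: "cmod (\<Theta> \<omega> - exp (\<i> * of_real (u * S \<omega>) + of_real (u\<^sup>2 * q / 2))) \<le> L * (4 * (\<bar>u\<bar> ^ 3 * (\<delta> * C)))"
    proof -
      have "cmod (\<Theta> \<omega> - exp (\<i> * of_real (u * S \<omega>) + of_real (u\<^sup>2 * q / 2)))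
         \<le> exp (u\<^sup>2 * q / 2) * (4 * (\<Sum>j<m. \<bar>u * \<xi> j \<omega>\<bar> ^ 3))"
        using prod_one_plus_ii_approx[of m "\<lambda>j. u * \<xi> j \<omega>", OF ub] unfolding \<Theta>1 sq sm by simp
      also have "\<dots> \<le> L * (4 * (\<bar>u\<bar> ^ 3 * (\<delta> * C)))"
        using Lq cube L1 by (intro mult_mono) (auto intro!: sum_nonneg mult_nonneg_nonneg)
      finally show ?thesis .
    qed
    have 2: "\<bar>exp (u\<^sup>2 * Q / 2) - exp (u\<^sup>2 * q / 2)\<bar> \<le> L * (u\<^sup>2 / 2 * \<delta>)"
    proof -
      have *: "\<bar>exp a - exp b\<bar> \<le> exp (max a b) * \<bar>a - b\<bar>" for a b :: real
      proof -
        have *: "exp a - exp b \<le> exp a * (a - b)" for a b :: real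
        proof -
          have "exp a * (1 + (b - a)) \<le> exp a * exp (b - a)"
            by (intro mult_left_mono exp_ge_add_one_self) auto
          then show ?thesis by (simp add: algebra_simps flip: exp_add)
        qed
        show ?thesis using *[of a b] *[of b a]
          by (cases "a \<le> b") (auto simp: max_def abs_if)
      qed
      have "\<bar>exp (u\<^sup>2 * Q / 2) - exp (u\<^sup>2 * q / 2)\<bar> \<le> exp (max (u\<^sup>2 * Q / 2) (u\<^sup>2 * q / 2)) * \<bar>u\<^sup>2 * Q / 2 - u\<^sup>2 * q / 2\<bar>"
        by (rule *)
      also have "\<dots> \<le> L * (u\<^sup>2 / 2 * \<delta>)"
      proof (rule mult_mono)
        show "exp (max (u\<^sup>2 * Q / 2) (u\<^sup>2 * q / 2)) \<le> L" using Lq LQ by (simp add: max_def)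
        have "\<bar>u\<^sup>2 * Q / 2 - u\<^sup>2 * q / 2\<bar> = u\<^sup>2 / 2 * \<bar>q - Q\<bar>"
          by (simp add: abs_mult abs_minus_commute flip: right_diff_distrib diff_divide_distrib)
        also have "\<dots> \<le> u\<^sup>2 / 2 * \<delta>" using q by (intro mult_left_mono) auto
        finally show "\<bar>u\<^sup>2 * Q / 2 - u\<^sup>2 * q / 2\<bar> \<le> u\<^sup>2 / 2 * \<delta>" .
      qed (use L1 in auto)
      finally show ?thesis .
    qed
    \<comment> \<open>Two independent errors: the prescribed Q against the realised sum of squares
      q, and the product against its exponential approximation.\<close>
    have split: "D \<omega> = V \<omega> * (iexp (u * S \<omega>) * of_real (exp (u\<^sup>2 * Q / 2) - exp (u\<^sup>2 * q / 2))
       - (\<Theta> \<omega> - exp (\<i> * of_real (u * S \<omega>) + of_real (u\<^sup>2 * q / 2))))"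
      by (simp add: D_def exp_add algebra_simps exp_of_real[symmetric])
    have "cmod (D \<omega>) \<le> 1 * (L * (u\<^sup>2 / 2 * \<delta>) + L * (4 * (\<bar>u\<bar> ^ 3 * (\<delta> * C))))"
      unfolding split norm_mult[of "V \<omega>"]
    proof (rule mult_mono[OF V1[OF w]])
      have "cmod (iexp (u * S \<omega>) * of_real (exp (u\<^sup>2 * Q / 2) - exp (u\<^sup>2 * q / 2))) \<le> L * (u\<^sup>2 / 2 * \<delta>)"
        using 2 unfolding norm_mult norm_of_real norm_exp_i_times by (simp only: mult_1)
      then show "cmod (iexp (u * S \<omega>) * of_real (exp (u\<^sup>2 * Q / 2) - exp (u\<^sup>2 * q / 2))
         - (\<Theta> \<omega> - exp (\<i> * of_real (u * S \<omega>) + of_real (u\<^sup>2 * q / 2))))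
        \<le> L * (u\<^sup>2 / 2 * \<delta>) + L * (4 * (\<bar>u\<bar> ^ 3 * (\<delta> * C)))"
        using 1 by (rule order_trans[OF norm_triangle_ineq4 add_mono])
    qed auto
    also have "\<dots> = \<gamma>" by (simp add: \<gamma>_def algebra_simps)
    also have "\<dots> \<le> bnd \<omega>" using False L1 by (simp add: bnd_def)
    finally show ?thesis .
  qed
  have VP: "V \<in> borel_measurable P" using measurable_F_P[OF p V] by simp
  have SP [measurable]: "S \<in> borel_measurable P" unfolding S_def using XP[of m] XP[of 0] by auto
  have i1: "integrable P (\<lambda>\<omega>. V \<omega> * iexp (u * S \<omega>) * of_real (exp (u\<^sup>2 * Q / 2)))"
  proof (rule integrable_mult_left, rule integrable_const_bound[of _ 1])
    show "AE x in P. cmod (V x * iexp (u * S x)) \<le> 1"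
      using V1 by (intro AE_I2) (simp add: norm_mult)
  qed (use VP in measurable)
  have "integrable P bnd"
    unfolding bnd_def using Zex(1) by (intro Bochner_Integration.integrable_add integrable_mult_right) (auto simp: emeasure_eq_measure)
  have "cmod ((\<integral>\<omega>. V \<omega> * iexp (u * S \<omega>) * of_real (exp (u\<^sup>2 * Q / 2)) \<partial>P) - (\<integral>\<omega>. V \<omega> \<partial>P))
    = cmod (\<integral>\<omega>. D \<omega> \<partial>P)"
    unfolding D_def \<Theta>eq[symmetric] using i1 \<Theta>int by (subst Bochner_Integration.integral_diff) auto
  also have "\<dots> \<le> (\<integral>\<omega>. bnd \<omega> \<partial>P)"
  proof (rule norm_integral_le)
    show "integrable P D"
      unfolding D_def by (intro Bochner_Integration.integrable_diff i1 \<Theta>int)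
  qed (use D \<open>integrable P bnd\<close> in auto)
  also have "\<dots> = \<gamma> + L * (2 + 2 * \<bar>u\<bar> * K) * measure P B + L * \<bar>u\<bar> * (\<integral>\<omega>. excess K (Z \<omega>) \<partial>P)"
    unfolding bnd_def using Zex(1) by (simp add: emeasure_eq_measure prob_space)
  finally have main: "cmod ((\<integral>\<omega>. V \<omega> * iexp (u * S \<omega>) * of_real (exp (u\<^sup>2 * Q / 2)) \<partial>P) - (\<integral>\<omega>. V \<omega> \<partial>P))
     \<le> \<gamma> + L * (2 + 2 * \<bar>u\<bar> * K) * measure P B + L * \<bar>u\<bar> * (\<integral>\<omega>. excess K (Z \<omega>) \<partial>P)" .
  have "(\<integral>\<omega>. excess K (X (p m) \<omega>) \<partial>P) \<le> e"
    unfolding e_def using excess_integrable[OF p[of m]] K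
    by (intro integral_mono) (auto simp: excess_def)
  then have E1: "L * \<bar>u\<bar> * (\<integral>\<omega>. excess K (Z \<omega>) \<partial>P) \<le> L * \<bar>u\<bar> * e"
    using Zex(2) L1 by (intro mult_left_mono) auto
  have E2: "L * (2 + 2 * \<bar>u\<bar> * K) * measure P B \<le> L * (2 + 2 * \<bar>u\<bar> * K) * (\<eta> + 2 * e / K)"
    using PB L1 K by (intro mult_left_mono) auto
  \<comment> \<open>The bound for the product grows linearly in K, but the probability of leaving is
    at most 2 e / K; the two cancel, which is what the form of the maximal inequality with the
    excess on its right is for.\<close>
  have "(2 + 2 * \<bar>u\<bar> * K) * (2 * e / K) = 4 * e / K + 4 * \<bar>u\<bar> * e" using K by (simp add: field_simps)
  also have "4 * e / K \<le> 4 * e" using K mult_right_mono[OF K e0] by (simp add: divide_le_eq mult.commute)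
  finally have "(2 + 2 * \<bar>u\<bar> * K) * (2 * e / K) \<le> (4 + 4 * \<bar>u\<bar>) * e" by (simp add: algebra_simps)
  then have "L * ((2 + 2 * \<bar>u\<bar> * K) * (2 * e / K)) \<le> L * ((4 + 4 * \<bar>u\<bar>) * e)"
    using L1 by (intro mult_left_mono) auto
  moreover have "L * (2 + 2 * \<bar>u\<bar> * K) * (\<eta> + 2 * e / K)
      = L * (2 + 2 * \<bar>u\<bar> * K) * \<eta> + L * ((2 + 2 * \<bar>u\<bar> * K) * (2 * e / K))"
    by (simp only: distrib_left[of _ \<eta>] mult.assoc)
  moreover have "L * (4 + 5 * \<bar>u\<bar>) * e = L * ((4 + 4 * \<bar>u\<bar>) * e) + L * \<bar>u\<bar> * e"
    by (simp add: algebra_simps)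
  ultimately show ?thesis
    using main E1 E2 unfolding \<gamma>_def S_def C_def by linarith
qed

end

lemma sum_le_three_parts:
  fixes a b c e :: real
  shows "a \<le> e / 3 \<Longrightarrow> b \<le> e / 3 \<Longrightarrow> c \<le> e / 3 \<Longrightarrow> a + b + c \<le> e"
  by simp

section \<open>From the quadratic variation to the law of an increment\<close>

context real_martingale
begin

text \<open>Small increments are obtained without continuity of paths. Inside a block of length (t -
  s)/N the square of one increment is at most the growth of the sum of squares over the block, and
  that is close to the deterministic number c (t - s)/N. As the quadratic variation refers to
  partitions that start at 0, sums over parts of [s, t] are written as differences of sums from
  0.\<close>

lemma quadratic_variation_partition:
  assumes qv: "quadratic_variation P T X (\<lambda>t \<omega>. c * t)" and c: "c \<ge> 0"
    and st: "0 \<le> s" "s < t" "t \<le> T" and \<delta>: "\<delta> > 0" and \<eta>: "\<eta> > 0"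
  obtains m p where "p 0 = s" "p m = t" "mono_on {..m} p" "\<And>j. j \<le> m \<Longrightarrow> p j \<in> {0..T}"
    "measure P {\<omega>\<in>space P. \<bar>(\<Sum>j<m. (X (p (Suc j)) \<omega> - X (p j) \<omega>)\<^sup>2) - c * (t - s)\<bar> > \<delta>
         \<or> (\<exists>j<m. \<bar>X (p (Suc j)) \<omega> - X (p j) \<omega>\<bar> > \<delta>)} \<le> \<eta>"
proof -
  obtain N where N: "N > 0" "c * (t - s) / real N < \<delta>\<^sup>2 / 2"
  proof -
    have pos: "\<delta>\<^sup>2 / 2 > 0" using \<delta> by simp
    obtain N where "c * (t - s) < real N * (\<delta>\<^sup>2 / 2)"
      using reals_Archimedean3[OF pos, rule_format, of "c * (t - s)"] by (rule exE)
    also have "\<dots> \<le> real (Suc N) * (\<delta>\<^sup>2 / 2)" by (intro mult_right_mono) auto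
    finally show ?thesis
      using that[of "Suc N"] by (simp add: pos_divide_less_eq mult.commute del: of_nat_Suc)
  qed
  \<comment> \<open>One half of \<delta>^2 is reserved for c (t - s)/N, the other half for 2
    \<epsilon>, the error of a difference of two sums; 2 \<epsilon> \<le> \<delta> serves the sum
    over the whole of [s, t].\<close>
  define \<epsilon> where "\<epsilon> = min (\<delta> / 2) (\<delta>\<^sup>2 / 4)"
  have \<epsilon>: "\<epsilon> > 0" "2 * \<epsilon> \<le> \<delta>" "4 * \<epsilon> \<le> \<delta>\<^sup>2" using \<delta> by (auto simp: \<epsilon>_def min_def)
  define r where "r k = s + real k * (t - s) / real N" for k :: nat
  have r: "r k \<in> {0..T}" if "k \<le> N" for k
  proof -
    have "real k * (t - s) / real N \<le> 1 * (t - s)"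
      using that N st by (simp add: divide_le_eq mult_right_mono mult.commute)
    then show ?thesis using st by (auto simp: r_def)
  qed
  \<comment> \<open>The probability \<eta> is shared equally among the N + 1 times r 0, ..., r N, in
    view of the union bound at the end.\<close>
  have "\<forall>k\<in>{..N}. \<exists>d>0. \<forall>q. partition_of (r k) q \<and> (\<forall>i < length q - 1. q ! Suc i - q ! i < d) \<longrightarrow>
        measure P {\<omega>\<in>space P. \<bar>(\<Sum>i < length q - 1. (X (q ! Suc i) \<omega> - X (q ! i) \<omega>)\<^sup>2) - c * r k\<bar> > \<epsilon>} < \<eta> / (N + 1)"
    using qv r \<epsilon>(1) \<eta> unfolding quadratic_variation_def by auto
  from bchoice[OF this] obtain d where d': "\<forall>k\<in>{..N}. d k > 0 \<and> (\<forall>q. partition_of (r k) q \<and> (\<forall>i < length q - 1. q ! Suc i - q ! i < d k) \<longrightarrow>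
        measure P {\<omega>\<in>space P. \<bar>(\<Sum>i < length q - 1. (X (q ! Suc i) \<omega> - X (q ! i) \<omega>)\<^sup>2) - c * r k\<bar> > \<epsilon>} < \<eta> / (N + 1))"
    by (rule exE)
  have d: "d k > 0"
    "partition_of (r k) q \<Longrightarrow> (\<And>i. i < length q - 1 \<Longrightarrow> q ! Suc i - q ! i < d k) \<Longrightarrow>
        measure P {\<omega>\<in>space P. \<bar>(\<Sum>i < length q - 1. (X (q ! Suc i) \<omega> - X (q ! i) \<omega>)\<^sup>2) - c * r k\<bar> > \<epsilon>} < \<eta> / (N + 1)"
    if "k \<le> N" for k q
    using bspec[OF d', of k] that by simp_all
  define D where "D = Min (d ` {..N})"
  have D: "D > 0" "\<And>k. k \<le> N \<Longrightarrow> D \<le> d k" using d(1) by (auto simp: D_def)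
  have T0: "T > 0" using st by simp
  obtain n where n: "n > 0" "T / real n < D"
  proof -
    obtain n where "T < real n * D"
      using reals_Archimedean3[OF D(1), rule_format, of T] by (rule exE)
    also have "\<dots> \<le> real (Suc n) * D" using D by (intro mult_right_mono) auto
    finally show ?thesis
      using that[of "Suc n"] by (simp add: pos_divide_less_eq mult.commute del: of_nat_Suc)
  qed
  \<comment> \<open>One grid for all block ends: n equal steps from 0 to s, then n equal steps per
    block. Truncated subtraction makes the second term vanish up to index n. If s = 0, the first n +
    1 points coincide, which \<open>partition_of\<close> permits.\<close>
  define g where "g i = s * real (min i n) / real n + real (i - n) * (t - s) / (real n * real N)" for i
  have g0: "g 0 = 0" by (simp add: g_def)
  have gn: "g (n + k * n) = r k" for k
    using n N by (simp add: g_def r_def)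
  have gstep: "g (Suc i) - g i \<in> {0..<D}" for i
  proof -
    have "g (Suc i) - g i = (if i < n then s / real n else (t - s) / (real n * real N))"
    proof (cases "i < n")
      case True
      then have "min (Suc i) n = Suc i" "min i n = i" "Suc i - n = 0" "i - n = 0" by auto
      then have "g (Suc i) - g i = (s * real (Suc i) - s * real i) / real n"
        by (simp only: g_def diff_divide_distrib)
      also have "s * real (Suc i) - s * real i = s" by (simp add: algebra_simps)
      finally show ?thesis using True by simp
    next
      case False
      then have "min (Suc i) n = n" "min i n = n" "Suc i - n = Suc (i - n)" by auto
      then have "g (Suc i) - g i = (real (Suc (i - n)) * (t - s) - real (i - n) * (t - s)) / (real n * real N)"
        by (simp only: g_def diff_divide_distrib)
      also have "real (Suc (i - n)) * (t - s) - real (i - n) * (t - s) = t - s" by (simp add: algebra_simps)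
      finally show ?thesis using False by simp
    qed
    moreover have "s / real n \<le> T / real n" using st n by (intro divide_right_mono) auto
    moreover have "(t - s) / (real n * real N) \<le> (t - s) / (real n * 1)"
      using st n N by (intro divide_left_mono mult_left_mono) auto
    moreover have "(t - s) / (real n * 1) \<le> T / real n" using st n by (simp add: divide_right_mono)
    moreover have "0 \<le> s / real n" "0 \<le> (t - s) / (real n * real N)" using st by auto
    ultimately show ?thesis using n(2) by (auto split: if_splits)
  qed
  have "g i \<le> g (Suc i)" for i using gstep[of i] by simp
  then have gmono: "g i \<le> g j" if "i \<le> j" for i j
    using lift_Suc_mono_le[of g, OF _ that] by blast
  have grange: "g j \<in> {0..T}" if "j \<le> n + N * n" for j
    using gmono[of 0 j] gmono[OF that] g0 gn[of N] r[of N] by auto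
  define A where "A k \<omega> = (\<Sum>i<n + k * n. (X (g (Suc i)) \<omega> - X (g i) \<omega>)\<^sup>2)" for k \<omega>
  define bad where "bad k = {\<omega>\<in>space P. \<bar>A k \<omega> - c * r k\<bar> > \<epsilon>}" for k
  have bad: "measure P (bad k) < \<eta> / (N + 1)" if k: "k \<le> N" for k
  proof -
    define q where "q = map g [0..<Suc (n + k * n)]"
    have len: "length q - 1 = n + k * n" by (simp add: q_def)
    have nth: "q ! i = g i" if "i \<le> n + k * n" for i
      using that by (simp add: q_def nth_append del: upt_Suc)
    have "partition_of (r k) q"
      unfolding partition_of_def
    proof (intro conjI)
      show "sorted q" unfolding q_def sorted_map
        by (rule sorted_wrt_mono_rel[OF _ sorted_upt]) (auto intro: gmono)
      show "hd q = 0" using nth[of 0] g0 by (simp add: q_def hd_conv_nth del: upt_Suc)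
      show "last q = r k" using gn[of k] by (simp add: q_def)
    qed (simp add: q_def)
    moreover have "q ! Suc i - q ! i < d k" if "i < length q - 1" for i
      using that gstep[of i] D(2)[OF k] nth[of i] nth[of "Suc i"] unfolding len by simp
    ultimately have "measure P {\<omega>\<in>space P. \<bar>(\<Sum>i < length q - 1. (X (q ! Suc i) \<omega> - X (q ! i) \<omega>)\<^sup>2) - c * r k\<bar> > \<epsilon>} < \<eta> / (N + 1)"
      by (rule d(2)[OF k])
    moreover have "(\<Sum>i < length q - 1. (X (q ! Suc i) \<omega> - X (q ! i) \<omega>)\<^sup>2) = A k \<omega>" for \<omega>
      unfolding A_def len by (intro sum.cong) (auto simp: nth)
    ultimately show ?thesis by (simp add: bad_def)
  qed
  have [measurable]: "bad k \<in> sets P" if k: "k \<le> N" for k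
  proof -
    have "k * n \<le> N * n" using k by simp
    have "A k \<in> borel_measurable P"
      unfolding A_def
    proof (intro borel_measurable_sum borel_measurable_power borel_measurable_diff)
      fix i assume "i \<in> {..<n + k * n}"
      then have "i < n + k * n" by simp
      then have "i < n + N * n" using \<open>k * n \<le> N * n\<close> by linarith
      then show "X (g (Suc i)) \<in> borel_measurable P" "X (g i) \<in> borel_measurable P"
        using X_measurable grange by auto
    qed
    then show ?thesis unfolding bad_def by measurable
  qed
  define p where "p j = g (n + j)" for j
  define m where "m = N * n"
  have sub: "{\<omega>\<in>space P. \<bar>(\<Sum>j<m. (X (p (Suc j)) \<omega> - X (p j) \<omega>)\<^sup>2) - c * (t - s)\<bar> > \<delta>
         \<or> (\<exists>j<m. \<bar>X (p (Suc j)) \<omega> - X (p j) \<omega>\<bar> > \<delta>)} \<subseteq> (\<Union>k\<in>{..N}. bad k)"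
  proof (rule subsetI, rule ccontr)
    fix \<omega> assume w: "\<omega> \<in> {\<omega>\<in>space P. \<bar>(\<Sum>j<m. (X (p (Suc j)) \<omega> - X (p j) \<omega>)\<^sup>2) - c * (t - s)\<bar> > \<delta>
         \<or> (\<exists>j<m. \<bar>X (p (Suc j)) \<omega> - X (p j) \<omega>\<bar> > \<delta>)}" and "\<omega> \<notin> (\<Union>k\<in>{..N}. bad k)"
    then have Ak: "\<bar>A k \<omega> - c * r k\<bar> \<le> \<epsilon>" if "k \<le> N" for k
      using that by (auto simp: bad_def not_less)
    have seg: "(\<Sum>j\<in>{k * n..<l * n}. (X (p (Suc j)) \<omega> - X (p j) \<omega>)\<^sup>2) = A l \<omega> - A k \<omega>" if "k \<le> l" for k l
    proof -
      have "(\<Sum>j\<in>{k * n..<l * n}. (X (p (Suc j)) \<omega> - X (p j) \<omega>)\<^sup>2)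
         = (\<Sum>i\<in>{k * n + n..<l * n + n}. (X (g (Suc i)) \<omega> - X (g i) \<omega>)\<^sup>2)"
        using sum.shift_bounds_nat_ivl[of "\<lambda>i. (X (g (Suc i)) \<omega> - X (g i) \<omega>)\<^sup>2" "k * n" n "l * n"]
        by (simp add: p_def add.commute)
      also have "\<dots> = A l \<omega> - A k \<omega>"
        using sum_diff_nat_ivl[of 0 "k * n + n" "l * n + n" "\<lambda>i. (X (g (Suc i)) \<omega> - X (g i) \<omega>)\<^sup>2"] that
        by (simp add: A_def atLeast0LessThan add.commute)
      finally show ?thesis .
    qed
    have "(\<Sum>j<m. (X (p (Suc j)) \<omega> - X (p j) \<omega>)\<^sup>2) = A N \<omega> - A 0 \<omega>"
      using seg[of 0 N] by (simp add: m_def atLeast0LessThan)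
    moreover have "r N = t" "r 0 = s" using N(1) by (auto simp: r_def)
    then have "c * (t - s) = c * r N - c * r 0" by (simp add: right_diff_distrib)
    ultimately have "\<bar>(\<Sum>j<m. (X (p (Suc j)) \<omega> - X (p j) \<omega>)\<^sup>2) - c * (t - s)\<bar> \<le> \<delta>"
      using Ak[of N] Ak[of 0] \<epsilon>(2) by linarith
    moreover have "\<bar>X (p (Suc j)) \<omega> - X (p j) \<omega>\<bar> \<le> \<delta>" if j: "j < m" for j
    proof -
      define k where "k = j div n"
      have k: "k < N" using j n by (simp add: k_def m_def less_mult_imp_div_less)
      have jk: "j \<in> {k * n..<Suc k * n}"
        using n by (simp add: k_def div_times_less_eq_dividend dividend_less_div_times add.commute)
      have "(X (p (Suc j)) \<omega> - X (p j) \<omega>)\<^sup>2 \<le> (\<Sum>j\<in>{k * n..<Suc k * n}. (X (p (Suc j)) \<omega> - X (p j) \<omega>)\<^sup>2)"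
        using jk by (intro member_le_sum) auto
      also have "\<dots> = A (Suc k) \<omega> - A k \<omega>" by (rule seg) simp
      also have "\<dots> \<le> c * r (Suc k) - c * r k + 2 * \<epsilon>"
        using Ak[of "Suc k"] Ak[of k] k by linarith
      also have "c * r (Suc k) - c * r k = c * (t - s) / real N"
      proof -
        have "r (Suc k) - r k = (t - s) / real N"
          by (simp add: r_def distrib_right add_divide_distrib)
        then show ?thesis by (simp flip: right_diff_distrib)
      qed
      finally have "\<bar>X (p (Suc j)) \<omega> - X (p j) \<omega>\<bar>\<^sup>2 \<le> \<delta>\<^sup>2"
        using N(2) \<epsilon>(3) unfolding power2_abs by linarith
      then show ?thesis by (rule power2_le_imp_le) (use \<delta> in simp)
    qed
    ultimately show False using w unfolding not_less[symmetric] by blast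
  qed
  have "measure P {\<omega>\<in>space P. \<bar>(\<Sum>j<m. (X (p (Suc j)) \<omega> - X (p j) \<omega>)\<^sup>2) - c * (t - s)\<bar> > \<delta>
         \<or> (\<exists>j<m. \<bar>X (p (Suc j)) \<omega> - X (p j) \<omega>\<bar> > \<delta>)} \<le> measure P (\<Union>k\<in>{..N}. bad k)"
    by (rule finite_measure_mono[OF sub]) auto
  also have "\<dots> \<le> (\<Sum>k\<in>{..N}. measure P (bad k))"
    by (rule measure_UNION_le) auto
  also have "\<dots> \<le> (\<Sum>k\<in>{..N}. \<eta> / (N + 1))"
    using bad by (intro sum_mono less_imp_le) auto
  also have "\<dots> = \<eta>" by simp
  finally show ?thesis
    using gn[of 0] gn[of N] N grange gmono
    by (intro that[of p m]) (auto simp: p_def m_def r_def mono_on_def)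
qed

text \<open>McLeish's proof of the martingale central limit theorem needs neither stochastic integrals
  nor square integrability.\<close>

theorem levy_characterisation:
  fixes V :: "'a \<Rightarrow> complex"
  assumes qv: "quadratic_variation P T X (\<lambda>t \<omega>. c * t)" and c: "c \<ge> 0"
    and st: "0 \<le> s" "s \<le> t" "t \<le> T"
    and V: "V \<in> borel_measurable (F s)" and V1: "\<And>\<omega>. \<omega> \<in> space P \<Longrightarrow> cmod (V \<omega>) \<le> 1"
  shows "(\<integral>\<omega>. V \<omega> * iexp (u * (X t \<omega> - X s \<omega>)) \<partial>P) = of_real (exp (- (u\<^sup>2 * (c * (t - s)) / 2))) * (\<integral>\<omega>. V \<omega> \<partial>P)"
proof (cases "s = t")
  case False
  then have st': "s < t" using st by simp
  define Q where "Q = c * (t - s)"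
  have Q: "Q \<ge> 0" using c st by (simp add: Q_def)
  define L where "L = exp (u\<^sup>2 * (Q + 1) / 2)"
  have L1: "L \<ge> 1" using Q by (simp add: L_def)
  define J where "J = (\<integral>\<omega>. V \<omega> * iexp (u * (X t \<omega> - X s \<omega>)) * of_real (exp (u\<^sup>2 * Q / 2)) \<partial>P) - (\<integral>\<omega>. V \<omega> \<partial>P)"
  have "cmod J \<le> \<epsilon>" if \<epsilon>: "\<epsilon> > 0" for \<epsilon>
  proof -
    have pos4: "0 < L * (4 + 5 * \<bar>u\<bar>)" using L1 by (intro mult_pos_pos) auto
    have "\<forall>\<^sub>F R in at_top. (\<integral>\<omega>. excess R (X t \<omega>) \<partial>P) < \<epsilon> / 3 / (L * (4 + 5 * \<bar>u\<bar>))"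
      using st pos4 \<epsilon> by (intro order_tendstoD(2)[OF excess_tendsto_0]) auto
    then obtain R where R: "\<And>r. r \<ge> R \<Longrightarrow> (\<integral>\<omega>. excess r (X t \<omega>) \<partial>P) < \<epsilon> / 3 / (L * (4 + 5 * \<bar>u\<bar>))"
      unfolding eventually_at_top_linorder by auto
    \<comment> \<open>K is fixed first: the coefficient b of the probability of failure depends on
      it, whereas the coefficient of e does not. Then \<delta> is chosen, and finally the partition
      with failure probability \<epsilon>/(3 b).\<close>
    define K where "K = max 1 (2 * R)"
    have K: "K \<ge> 1" and e: "(\<integral>\<omega>. excess (K/2) (X t \<omega>) \<partial>P) < \<epsilon> / 3 / (L * (4 + 5 * \<bar>u\<bar>))"
      using R[of "K/2"] by (auto simp: K_def)
    define a where "a = L * (u\<^sup>2 / 2 + 4 * \<bar>u\<bar> ^ 3 * (Q + 1))"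
    have a: "a \<ge> 0" unfolding a_def using L1 Q by (intro mult_nonneg_nonneg add_nonneg_nonneg) auto
    define \<delta> where "\<delta> = min 1 (min (1 / (\<bar>u\<bar> + 1)) (\<epsilon> / 3 / (a + 1)))"
    have d1: "0 < \<delta>" "\<delta> \<le> 1" "\<delta> \<le> 1 / (\<bar>u\<bar> + 1)" "\<delta> \<le> \<epsilon> / 3 / (a + 1)"
      using \<epsilon> a by (auto simp: \<delta>_def)
    have "\<bar>u\<bar> * \<delta> \<le> \<bar>u\<bar> * (1 / (\<bar>u\<bar> + 1))" using d1 by (intro mult_left_mono) auto
    then have d2: "\<bar>u\<bar> * \<delta> \<le> 1" by (rule order_trans) (simp add: divide_le_eq)
    have "a * \<delta> \<le> a * (\<epsilon> / 3 / (a + 1))" using d1 a by (intro mult_left_mono) auto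
    also have "\<dots> = (a / (a + 1)) * (\<epsilon> / 3)" by simp
    also have "\<dots> \<le> 1 * (\<epsilon> / 3)" using a \<epsilon> by (intro mult_right_mono) (auto simp: divide_le_eq)
    finally have d3: "a * \<delta> \<le> \<epsilon> / 3" by simp
    define b where "b = L * (2 + 2 * \<bar>u\<bar> * K)"
    have b: "b > 0" unfolding b_def using L1 K by (intro mult_pos_pos add_pos_nonneg) auto
    have eb: "\<epsilon> / 3 / b > 0" using \<epsilon> b by simp
    obtain m p where p: "p 0 = s" "p m = t" "mono_on {..m} p" "\<And>j. j \<le> m \<Longrightarrow> p j \<in> {0..T}"
      "measure P {\<omega>\<in>space P. \<bar>(\<Sum>j<m. (X (p (Suc j)) \<omega> - X (p j) \<omega>)\<^sup>2) - c * (t - s)\<bar> > \<delta>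
         \<or> (\<exists>j<m. \<bar>X (p (Suc j)) \<omega> - X (p j) \<omega>\<bar> > \<delta>)} \<le> \<epsilon> / 3 / b"
    proof (rule quadratic_variation_partition[OF qv c st(1) st' st(3) d1(1) eb])
      fix m :: nat and p :: "nat \<Rightarrow> real"
      assume "p 0 = s" "p m = t" "mono_on {..m} p" "\<And>j. j \<le> m \<Longrightarrow> p j \<in> {0..T}"
      "measure P {\<omega>\<in>space P. \<bar>(\<Sum>j<m. (X (p (Suc j)) \<omega> - X (p j) \<omega>)\<^sup>2) - c * (t - s)\<bar> > \<delta>
         \<or> (\<exists>j<m. \<bar>X (p (Suc j)) \<omega> - X (p j) \<omega>\<bar> > \<delta>)} \<le> \<epsilon> / 3 / b"
      then show thesis by (rule that)
    qed
    have Vp: "V \<in> borel_measurable (F (p 0))" using V p(1) by simp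
    have "cmod J \<le> a * \<delta> + b * (\<epsilon> / 3 / b) + L * (4 + 5 * \<bar>u\<bar>) * (\<integral>\<omega>. excess (K/2) (X t \<omega>) \<partial>P)"
      using partition_estimate[OF p(3,4) Vp V1 Q d1(1,2) d2 K p(5)[folded Q_def]]
      unfolding p(1,2) J_def a_def[symmetric] b_def[symmetric] L_def[symmetric] .
    also have "\<dots> \<le> \<epsilon>"
    proof (rule sum_le_three_parts[OF d3])
      show "b * (\<epsilon> / 3 / b) \<le> \<epsilon> / 3" using b by simp
      show "L * (4 + 5 * \<bar>u\<bar>) * (\<integral>\<omega>. excess (K/2) (X t \<omega>) \<partial>P) \<le> \<epsilon> / 3"
        using less_imp_le[OF e] pos4 unfolding pos_le_divide_eq[OF pos4] by (simp only: mult.commute)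
    qed
    finally show ?thesis .
  qed
  then have "J = 0" by (metis dense_ge norm_le_zero_iff)
  then have *: "(\<integral>\<omega>. V \<omega> * iexp (u * (X t \<omega> - X s \<omega>)) \<partial>P) * of_real (exp (u\<^sup>2 * Q / 2)) = (\<integral>\<omega>. V \<omega> \<partial>P)"
    unfolding J_def by simp
  have "of_real (exp (u\<^sup>2 * Q / 2)) * of_real (exp (- (u\<^sup>2 * Q / 2))) = (1 :: complex)"
    by (simp flip: of_real_mult exp_add)
  then show ?thesis unfolding Q_def[symmetric] *[symmetric] by (simp add: algebra_simps)
qed simp

end

section \<open>Gaussian families\<close>

lemma (in prob_space) char_std_normal:
  assumes "distributed M lborel Z (\<lambda>x. ennreal (std_normal_density x))"
  shows "(\<integral>\<omega>. iexp (t * Z \<omega>) \<partial>M) = of_real (exp (- (t\<^sup>2) / 2))"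
proof -
  have Z: "Z \<in> borel_measurable M"
    using assms by (auto simp: distributed_def)
  have "(\<integral>\<omega>. iexp (t * Z \<omega>) \<partial>M) = (\<integral>x. iexp (t * x) \<partial>distr M lborel Z)"
    by (subst integral_distr) (use Z in auto)
  also have "distr M lborel Z = density lborel (\<lambda>x. ennreal (std_normal_density x))"
    using assms by (simp add: distributed_def)
  also have "(\<integral>x. iexp (t * x) \<partial>\<dots>) = char std_normal_distribution t"
    by (simp add: char_def)
  also have "\<dots> = of_real (exp (- (t\<^sup>2) / 2))"
    by (simp add: char_std_normal_distribution)
  finally show ?thesis .
qed

lemma iexp_add: "iexp (a + b) = iexp a * iexp b"
  by (simp add: distrib_left exp_add)

text \<open>Characteristic functions put the degenerate case v = 0 on a par with densities; they are
  also what Levy's theorem delivers and what passes to limits.\<close>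

lemma (in prob_space) gaussian_rv_iff_char:
  "gaussian_rv M X \<longleftrightarrow> X \<in> borel_measurable M \<and>
     (\<exists>m v. v \<ge> 0 \<and> (\<forall>u. (\<integral>\<omega>. iexp (u * X \<omega>) \<partial>M) = iexp (u * m) * of_real (exp (- (u\<^sup>2 * v / 2)))))"
proof (intro iffI conjI)
  assume G: "gaussian_rv M X"
  then show X [measurable]: "X \<in> borel_measurable M" by (simp add: gaussian_rv_def)
  from G consider m where "AE \<omega> in M. X \<omega> = m"
    | m \<sigma> where "\<sigma> > 0" "distributed M lborel X (\<lambda>x. ennreal (normal_density m \<sigma> x))"
    by (auto simp: gaussian_rv_def)
  then show "\<exists>m v. v \<ge> 0 \<and> (\<forall>u. (\<integral>\<omega>. iexp (u * X \<omega>) \<partial>M) = iexp (u * m) * of_real (exp (- (u\<^sup>2 * v / 2))))"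
  proof cases
    case 1
    have "(\<integral>\<omega>. iexp (u * X \<omega>) \<partial>M) = (\<integral>\<omega>. iexp (u * m) \<partial>M)" for u
      by (rule integral_cong_AE) (use 1 in auto)
    then show ?thesis by (intro exI[of _ m] exI[of _ 0]) (simp add: prob_space)
  next
    case 2
    define Z where "Z \<omega> = (X \<omega> - m) / \<sigma>" for \<omega>
    have Z: "distributed M lborel Z (\<lambda>x. ennreal (std_normal_density x))"
      using normal_standard_normal_convert[OF 2(1), of X m] 2(2) by (simp add: Z_def[abs_def])
    have "(\<integral>\<omega>. iexp (u * X \<omega>) \<partial>M) = iexp (u * m) * of_real (exp (- (u\<^sup>2 * \<sigma>\<^sup>2 / 2)))" for u
    proof -
      have "(\<integral>\<omega>. iexp (u * X \<omega>) \<partial>M) = (\<integral>\<omega>. iexp (u * m) * iexp ((u * \<sigma>) * Z \<omega>) \<partial>M)"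
      proof (intro Bochner_Integration.integral_cong refl)
        fix \<omega>
        have "\<sigma> * Z \<omega> = X \<omega> - m" using 2(1) by (simp add: Z_def)
        then have "u * X \<omega> = u * m + u * \<sigma> * Z \<omega>" by (simp add: mult.assoc right_diff_distrib)
        then show "iexp (u * X \<omega>) = iexp (u * m) * iexp (u * \<sigma> * Z \<omega>)" by (simp only: iexp_add)
      qed
      also have "\<dots> = iexp (u * m) * of_real (exp (- ((u * \<sigma>)\<^sup>2) / 2))"
        by (simp only: integral_mult_right_zero char_std_normal[OF Z])
      finally show ?thesis by (simp add: power_mult_distrib)
    qed
    then show ?thesis by (intro exI[of _ m] exI[of _ "\<sigma>\<^sup>2"]) simp
  qed
next
  assume "X \<in> borel_measurable M \<and>
     (\<exists>m v. v \<ge> 0 \<and> (\<forall>u. (\<integral>\<omega>. iexp (u * X \<omega>) \<partial>M) = iexp (u * m) * of_real (exp (- (u\<^sup>2 * v / 2)))))"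
  then obtain m v where X [measurable]: "X \<in> borel_measurable M" and v: "v \<ge> 0"
    and c: "\<And>u. (\<integral>\<omega>. iexp (u * X \<omega>) \<partial>M) = iexp (u * m) * of_real (exp (- (u\<^sup>2 * v / 2)))"
    by auto
  have char: "char (distr M borel Y) u = (\<integral>\<omega>. iexp (u * Y \<omega>) \<partial>M)" if "Y \<in> borel_measurable M" for Y u
    unfolding char_def by (subst integral_distr) (use that in auto)
  show "gaussian_rv M X"
  proof (cases "v = 0")
    case True
    have mc: "(\<lambda>\<omega>. m) \<in> borel_measurable M" by simp
    have "char (distr M borel X) u = char (distr M borel (\<lambda>\<omega>. m)) u" for u
      unfolding char[OF X] char[OF mc] c
      by (simp add: True prob_space)
    then have "distr M borel X = distr M borel (\<lambda>\<omega>. m)"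
      by (intro Levy_uniqueness real_distribution_distr ext) auto
    moreover have "AE x in distr M borel (\<lambda>\<omega>. m). x \<in> {m}" by (subst AE_distr_iff) auto
    ultimately have "AE x in distr M borel X. x \<in> {m}" by metis
    then have "AE \<omega> in M. X \<omega> = m" by (subst (asm) AE_distr_iff) auto
    then show ?thesis using X by (auto simp: gaussian_rv_def)
  next
    case False
    define \<sigma> where "\<sigma> = sqrt v"
    have \<sigma>: "\<sigma> > 0" "\<sigma>\<^sup>2 = v" using v False by (auto simp: \<sigma>_def)
    define Z where "Z \<omega> = (X \<omega> - m) / \<sigma>" for \<omega>
    have Z [measurable]: "Z \<in> borel_measurable M" by (simp add: Z_def[abs_def])
    have "char (distr M borel Z) t = char std_normal_distribution t" for t
    proof -
      have "(\<integral>\<omega>. iexp (t * Z \<omega>) \<partial>M) = (\<integral>\<omega>. iexp (- (t / \<sigma> * m)) * iexp ((t / \<sigma>) * X \<omega>) \<partial>M)"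
      proof (intro Bochner_Integration.integral_cong refl)
        fix \<omega>
        have "t * Z \<omega> = - (t / \<sigma> * m) + t / \<sigma> * X \<omega>"
          by (simp add: Z_def diff_divide_distrib right_diff_distrib)
        then show "iexp (t * Z \<omega>) = iexp (- (t / \<sigma> * m)) * iexp (t / \<sigma> * X \<omega>)" by (simp only: iexp_add)
      qed
      also have "\<dots> = iexp (- (t / \<sigma> * m)) * (iexp (t / \<sigma> * m) * of_real (exp (- ((t / \<sigma>)\<^sup>2 * v / 2))))"
        by (simp only: integral_mult_right_zero c)
      also have "\<dots> = of_real (exp (- ((t / \<sigma>)\<^sup>2 * v / 2)))"
        unfolding mult.assoc[symmetric] iexp_add[symmetric] by simp
      also have "(t / \<sigma>)\<^sup>2 * v = t\<^sup>2" using \<sigma>(1) by (simp add: power_divide flip: \<sigma>(2))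
      finally show ?thesis by (simp add: char[OF Z] char_std_normal_distribution)
    qed
    then have eq: "distr M borel Z = std_normal_distribution"
      by (intro Levy_uniqueness real_distribution_distr real_dist_normal_dist ext) auto
    have "distr M lborel Z = distr M borel Z" by (rule distr_cong) auto
    then have "distributed M lborel Z (\<lambda>x. ennreal (std_normal_density x))"
      using eq by (auto simp: distributed_def)
    then have "distributed M lborel X (\<lambda>x. ennreal (normal_density m \<sigma> x))"
      using normal_standard_normal_convert[OF \<sigma>(1), of X m] by (simp add: Z_def[abs_def])
    then show ?thesis using X \<sigma>(1) by (auto simp: gaussian_rv_def)
  qed
qed

text \<open>A single phase iexp (u m) determines u m only modulo a period. Integration over u
  removes the ambiguity: m times i \<integral> iexp (u m) du over [0, h] equals iexp (h m) - 1, and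
  the integrals converge to a nonzero limit, so one can divide by them.\<close>

lemma convergent_of_iexp:
  fixes m :: "nat \<Rightarrow> real" and \<rho> :: "real \<Rightarrow> complex"
  assumes lim: "\<And>u. (\<lambda>n. iexp (u * m n)) \<longlonglongrightarrow> \<rho> u" and cont: "isCont \<rho> 0"
    and meas [measurable]: "\<rho> \<in> borel_measurable borel"
  shows "convergent m"
proof -
  have "\<rho> 0 = 1" using LIMSEQ_unique[OF lim[of 0]] by simp
  then obtain d where d: "d > 0" "\<And>u. \<bar>u\<bar> < d \<Longrightarrow> cmod (\<rho> u - 1) < 1/2"
    using cont[unfolded continuous_at_eps_delta, rule_format, of "1/2"] by (auto simp: dist_norm)
  \<comment> \<open>On [0, h] the limit has real part at least 1/2, which keeps its integral away
    from 0.\<close>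
  define h where "h = d / 2"
  have h: "h > 0" "\<And>u. u \<in> {0..h} \<Longrightarrow> Re (\<rho> u) \<ge> 1/2"
  proof -
    show "h > 0" using d by (simp add: h_def)
    show "Re (\<rho> u) \<ge> 1/2" if "u \<in> {0..h}" for u
      using d(2)[of u] that d(1) abs_Re_le_cmod[of "\<rho> u - 1"] by (auto simp: h_def)
  qed
  have nrm: "cmod (\<rho> u) = 1" for u
  proof -
    have "(\<lambda>n. cmod (iexp (u * m n))) \<longlonglongrightarrow> cmod (\<rho> u)" by (intro tendsto_norm lim)
    then have "(\<lambda>n. 1) \<longlonglongrightarrow> cmod (\<rho> u)" by simp
    then show ?thesis by (simp add: LIMSEQ_const_iff)
  qed
  define G where "G n = (\<integral>u. indicator {0..h} u *\<^sub>R iexp (u * m n) \<partial>lborel)" for n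
  define G0 where "G0 = (\<integral>u. indicator {0..h} u *\<^sub>R \<rho> u \<partial>lborel)"
  have ind: "integrable lborel (\<lambda>u. indicator {0..h} u :: real)"
    by (simp add: integrable_indicator_iff emeasure_lborel_Icc_eq)
  have "G \<longlonglongrightarrow> G0"
    unfolding G_def G0_def
  proof (rule integral_dominated_convergence[where w = "indicator {0..h}"])
    show "integrable lborel (indicator {0..h} :: real \<Rightarrow> real)" using ind .
    show "AE u in lborel. (\<lambda>n. indicator {0..h} u *\<^sub>R iexp (u * m n)) \<longlonglongrightarrow> indicator {0..h} u *\<^sub>R \<rho> u"
      by (intro AE_I2 tendsto_scaleR tendsto_const lim)
    show "AE u in lborel. norm (indicator {0..h} u *\<^sub>R iexp (u * m n)) \<le> indicator {0..h} u" for n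
      by (intro AE_I2) (simp add: indicator_def)
  qed auto
  have "G0 \<noteq> 0"
  proof -
    have i: "integrable lborel (\<lambda>u. indicator {0..h} u *\<^sub>R \<rho> u)"
      by (rule Bochner_Integration.integrable_bound[OF ind]) (auto simp: nrm indicator_def)
    have "Re G0 = (\<integral>u. Re (indicator {0..h} u *\<^sub>R \<rho> u) \<partial>lborel)"
      unfolding G0_def using integral_Re[OF i] by simp
    also have "\<dots> \<ge> (\<integral>u. indicator {0..h} u * (1/2) \<partial>lborel)"
      using ind integrable_Re[OF i] h(2) by (intro integral_mono) (auto simp: indicator_def)
    finally have "Re G0 \<ge> h / 2" using h by simp
    then show ?thesis using h(1) by auto
  qed
  have FTC: "of_real (m n) * (\<i> * G n) = iexp (h * m n) - 1" for n
  proof -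
    have "(\<integral>u. indicator {0..h} u *\<^sub>R (\<i> * of_real (m n) * iexp (u * m n)) \<partial>lborel) = iexp (h * m n) - iexp (0 * m n)"
    proof (rule integral_FTC_atLeastAtMost)
      show "0 \<le> h" using h by simp
      show "((\<lambda>u. iexp (u * m n)) has_vector_derivative (\<i> * of_real (m n) * iexp (x * m n))) (at x within {0..h})" for x
      proof -
        have "((\<lambda>z. exp (\<i> * (z * of_real (m n)))) has_field_derivative
            (\<i> * of_real (m n) * exp (\<i> * (of_real x * of_real (m n))))) (at (of_real x))"
          by (auto intro!: derivative_eq_intros)
        from has_vector_derivative_real_field[OF this, of "{0..h}"] show ?thesis by simp
      qed
      show "continuous_on {0..h} (\<lambda>u. \<i> * of_real (m n) * iexp (u * m n))"
        by (intro continuous_intros)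
    qed
    moreover have "(\<integral>u. indicator {0..h} u *\<^sub>R (\<i> * of_real (m n) * iexp (u * m n)) \<partial>lborel)
       = \<i> * of_real (m n) * G n"
      unfolding G_def integral_mult_right_zero[symmetric] by (intro Bochner_Integration.integral_cong) auto
    ultimately show ?thesis by (simp add: mult_ac)
  qed
  have "(\<lambda>n. (iexp (h * m n) - 1) / (\<i> * G n)) \<longlonglongrightarrow> (\<rho> h - 1) / (\<i> * G0)"
    using \<open>G \<longlonglongrightarrow> G0\<close> \<open>G0 \<noteq> 0\<close> by (intro tendsto_intros lim) auto
  moreover have "\<forall>\<^sub>F n in sequentially. (iexp (h * m n) - 1) / (\<i> * G n) = of_real (m n)"
    using tendsto_imp_eventually_ne[OF \<open>G \<longlonglongrightarrow> G0\<close> \<open>G0 \<noteq> 0\<close>]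
    by eventually_elim (unfold FTC[symmetric], simp)
  ultimately have "(\<lambda>n. complex_of_real (m n)) \<longlonglongrightarrow> (\<rho> h - 1) / (\<i> * G0)"
    by (rule Lim_transform_eventually)
  from tendsto_Re[OF this] show ?thesis by (auto simp: convergent_def)
qed

section \<open>Convergence in probability\<close>

lemma min_one_triangle: "min 1 \<bar>a - c\<bar> \<le> min 1 \<bar>a - b\<bar> + min 1 \<bar>b - c :: real\<bar>"
  by (auto simp: min_def abs_if)

lemma (in prob_space) integrable_min_one:
  "X \<in> borel_measurable M \<Longrightarrow> Y \<in> borel_measurable M \<Longrightarrow> integrable M (\<lambda>\<omega>. min 1 \<bar>X \<omega> - Y \<omega> :: real\<bar>)"
  by (rule integrable_const_bound[of _ 1]) auto

text \<open>The closure in the topology of convergence in probability.\<close>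

definition L0_closure :: "'a measure \<Rightarrow> ('a \<Rightarrow> real) set \<Rightarrow> ('a \<Rightarrow> real) set" where
  "L0_closure P V = {Z \<in> borel_measurable P. \<forall>\<epsilon>>0. \<exists>X\<in>V. (\<integral>\<omega>. min 1 \<bar>X \<omega> - Z \<omega>\<bar> \<partial>P) < \<epsilon>}"

text \<open>Characteristic functions converge pointwise. Their moduli determine the limit of the
  variances, and the phases that remain determine the limit of the means; neither is assumed to
  converge.\<close>

lemma (in prob_space) gaussian_L0_closure:
  assumes V: "\<And>X. X \<in> V \<Longrightarrow> gaussian_rv M X" and Z: "Z \<in> L0_closure M V"
  shows "gaussian_rv M Z"
proof -
  have Zm [measurable]: "Z \<in> borel_measurable M" using Z by (simp add: L0_closure_def)
  have "\<exists>X\<in>V. (\<integral>\<omega>. min 1 \<bar>X \<omega> - Z \<omega>\<bar> \<partial>M) < 1 / real (Suc n)" for n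
    using Z by (auto simp: L0_closure_def)
  then obtain X where X: "\<And>n. X n \<in> V" "\<And>n. (\<integral>\<omega>. min 1 \<bar>X n \<omega> - Z \<omega>\<bar> \<partial>M) < 1 / real (Suc n)"
    by metis
  have Xm [measurable]: "X n \<in> borel_measurable M" for n using V[OF X(1)] by (simp add: gaussian_rv_def)
  have "\<exists>m v. v \<ge> 0 \<and> (\<forall>u. (\<integral>\<omega>. iexp (u * X n \<omega>) \<partial>M) = iexp (u * m) * of_real (exp (- (u\<^sup>2 * v / 2))))" for n
    using V[OF X(1)] by (simp add: gaussian_rv_iff_char)
  then obtain m v where v: "\<And>n. v n \<ge> 0"
    and c: "\<And>n u. (\<integral>\<omega>. iexp (u * X n \<omega>) \<partial>M) = iexp (u * m n) * of_real (exp (- (u\<^sup>2 * v n / 2)))"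
    by metis
  define \<psi> where "\<psi> u = (\<integral>\<omega>. iexp (u * Z \<omega>) \<partial>M)" for u
  have i: "integrable M (\<lambda>\<omega>. iexp (u * Y \<omega>))" if [measurable]: "Y \<in> borel_measurable M" for u Y
    by (rule integrable_const_bound[of _ 1]) auto
  have lim: "(\<lambda>n. \<integral>\<omega>. iexp (u * X n \<omega>) \<partial>M) \<longlonglongrightarrow> \<psi> u" for u
  proof (rule LIM_zero_cancel, rule Lim_null_comparison)
    \<comment> \<open>The character is bounded and |u|-Lipschitz, so two of its values differ by at
      most max 2 |u| times the truncated distance.\<close>
    show "\<forall>\<^sub>F n in sequentially. cmod ((\<integral>\<omega>. iexp (u * X n \<omega>) \<partial>M) - \<psi> u) \<le> max 2 \<bar>u\<bar> * (1 / real (Suc n))"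
    proof (rule always_eventually, rule allI)
      fix n
      have "cmod ((\<integral>\<omega>. iexp (u * X n \<omega>) \<partial>M) - \<psi> u) = cmod (\<integral>\<omega>. iexp (u * X n \<omega>) - iexp (u * Z \<omega>) \<partial>M)"
        unfolding \<psi>_def using i by (subst Bochner_Integration.integral_diff) auto
      also have "\<dots> \<le> (\<integral>\<omega>. max 2 \<bar>u\<bar> * min 1 \<bar>X n \<omega> - Z \<omega>\<bar> \<partial>M)"
      proof (rule norm_integral_le)
        show "integrable M (\<lambda>\<omega>. iexp (u * X n \<omega>) - iexp (u * Z \<omega>))" using i by auto
        show "integrable M (\<lambda>\<omega>. max 2 \<bar>u\<bar> * min 1 \<bar>X n \<omega> - Z \<omega>\<bar>)"
          by (intro integrable_mult_right integrable_min_one) auto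
        fix \<omega>
        have a: "cmod (iexp (u * X n \<omega>) - iexp (u * Z \<omega>)) \<le> 2"
          by (rule order_trans[OF norm_triangle_ineq4]) simp
        have "iexp (u * X n \<omega>) = iexp (u * Z \<omega>) * iexp (u * (X n \<omega> - Z \<omega>))"
          unfolding iexp_add[symmetric] by (simp add: algebra_simps)
        then have "iexp (u * X n \<omega>) - iexp (u * Z \<omega>) = iexp (u * Z \<omega>) * (iexp (u * (X n \<omega> - Z \<omega>)) - 1)"
          by (simp only: right_diff_distrib mult_1_right)
        then have "cmod (iexp (u * X n \<omega>) - iexp (u * Z \<omega>)) = cmod (iexp (u * (X n \<omega> - Z \<omega>)) - 1)"
          by (simp add: norm_mult)
        also have "\<dots> \<le> \<bar>u * (X n \<omega> - Z \<omega>)\<bar>"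
          using iexp_approx1[of "u * (X n \<omega> - Z \<omega>)" 0] by simp
        finally have b: "cmod (iexp (u * X n \<omega>) - iexp (u * Z \<omega>)) \<le> \<bar>u\<bar> * \<bar>X n \<omega> - Z \<omega>\<bar>"
          by (simp add: abs_mult)
        show "cmod (iexp (u * X n \<omega>) - iexp (u * Z \<omega>)) \<le> max 2 \<bar>u\<bar> * min 1 \<bar>X n \<omega> - Z \<omega>\<bar>"
        proof (cases "\<bar>X n \<omega> - Z \<omega>\<bar> \<le> 1")
          case True
          have "\<bar>u\<bar> * \<bar>X n \<omega> - Z \<omega>\<bar> \<le> max 2 \<bar>u\<bar> * \<bar>X n \<omega> - Z \<omega>\<bar>" by (intro mult_right_mono) auto
          then show ?thesis using b True by (simp add: min_def)
        next
          case False
          then show ?thesis using a by (simp add: min_def)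
        qed
      qed
      also have "\<dots> \<le> max 2 \<bar>u\<bar> * (1 / real (Suc n))"
        using X(2)[of n] by (simp only: integral_mult_right_zero) (intro mult_left_mono, auto)
      finally show "cmod ((\<integral>\<omega>. iexp (u * X n \<omega>) \<partial>M) - \<psi> u) \<le> max 2 \<bar>u\<bar> * (1 / real (Suc n))" .
    qed
    show "(\<lambda>n. max 2 \<bar>u\<bar> * (1 / real (Suc n))) \<longlonglongrightarrow> 0"
      by (intro tendsto_mult_right_zero LIMSEQ_Suc[OF lim_1_over_n])
  qed
  have \<psi>: "\<psi> = char (distr M borel Z)"
    unfolding \<psi>_def char_def by (rule ext, subst integral_distr) auto
  interpret Z: real_distribution "distr M borel Z" by (rule real_distribution_distr) simp
  have \<psi>c: "isCont \<psi> u" for u unfolding \<psi> by (rule Z.isCont_char)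
  have "\<psi> 0 = 1" unfolding \<psi> by (rule Z.char_zero)
  then obtain d where d: "d > 0" "\<And>u. \<bar>u\<bar> < d \<Longrightarrow> cmod (\<psi> u - 1) < 1"
    using \<psi>c[of 0, unfolded continuous_at_eps_delta, rule_format, of 1] by (auto simp: dist_norm)
  \<comment> \<open>A frequency at which the limit does not vanish, so that the logarithm of the
    modulus recovers the variances from it.\<close>
  define h where "h = d / 2"
  have h: "h > 0" "\<psi> h \<noteq> 0" using d(1) d(2)[of h] by (auto simp: h_def)
  have "(\<lambda>n. cmod (\<integral>\<omega>. iexp (h * X n \<omega>) \<partial>M)) \<longlonglongrightarrow> cmod (\<psi> h)"
    by (intro tendsto_norm lim)
  then have "(\<lambda>n. exp (- (h\<^sup>2 * v n / 2))) \<longlonglongrightarrow> cmod (\<psi> h)"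
    unfolding c by (simp add: norm_mult)
  then have "(\<lambda>n. ln (exp (- (h\<^sup>2 * v n / 2)))) \<longlonglongrightarrow> ln (cmod (\<psi> h))"
    using h by (intro tendsto_ln) auto
  then have "(\<lambda>n. - 2 / h\<^sup>2 * ln (exp (- (h\<^sup>2 * v n / 2)))) \<longlonglongrightarrow> - 2 / h\<^sup>2 * ln (cmod (\<psi> h))"
    by (intro tendsto_mult_left)
  moreover have "- 2 / h\<^sup>2 * ln (exp (- (h\<^sup>2 * v n / 2))) = v n" for n using h by (simp add: field_simps)
  ultimately obtain w where w: "v \<longlonglongrightarrow> w" by auto
  have w0: "w \<ge> 0" using LIMSEQ_le_const[OF w] v by blast
  \<comment> \<open>The limit of the pure phases iexp (u m n), after the Gaussian moduli have been
    divided out.\<close>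
  define \<rho> where "\<rho> u = \<psi> u * of_real (exp (u\<^sup>2 * w / 2))" for u
  have m_lim: "(\<lambda>n. iexp (u * m n)) \<longlonglongrightarrow> \<rho> u" for u
  proof -
    have "(\<lambda>n. (\<integral>\<omega>. iexp (u * X n \<omega>) \<partial>M) * of_real (exp (u\<^sup>2 * v n / 2))) \<longlonglongrightarrow> \<rho> u"
      unfolding \<rho>_def by (intro tendsto_intros lim w) auto
    moreover have "(\<integral>\<omega>. iexp (u * X n \<omega>) \<partial>M) * of_real (exp (u\<^sup>2 * v n / 2)) = iexp (u * m n)" for n
      unfolding c by (simp add: mult.assoc flip: of_real_mult exp_add)
    ultimately show ?thesis by simp
  qed
  have "isCont \<rho> u" for u unfolding \<rho>_def by (intro continuous_intros \<psi>c) auto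
  then have "convergent m"
    using m_lim by (intro convergent_of_iexp[of m \<rho>] borel_measurable_continuous_onI continuous_at_imp_continuous_on) auto
  then obtain m0 where m0: "m \<longlonglongrightarrow> m0" by (auto simp: convergent_def)
  have "\<psi> u = iexp (u * m0) * of_real (exp (- (u\<^sup>2 * w / 2)))" for u
  proof (rule LIMSEQ_unique[OF lim])
    show "(\<lambda>n. \<integral>\<omega>. iexp (u * X n \<omega>) \<partial>M) \<longlonglongrightarrow> iexp (u * m0) * of_real (exp (- (u\<^sup>2 * w / 2)))"
      unfolding c by (intro tendsto_intros m0 w) auto
  qed
  then show ?thesis unfolding gaussian_rv_iff_char \<psi>_def using w0 by auto
qed

section \<open>Linear spans and their closure\<close>

definition lincomb :: "'i set \<Rightarrow> ('i \<Rightarrow> 'a \<Rightarrow> real) \<Rightarrow> ('a \<Rightarrow> real) set" where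
  "lincomb I B = {\<lambda>\<omega>. \<Sum>i\<in>J. c i * B i \<omega> | J c. finite J \<and> J \<subseteq> I}"

lemma lincomb_base: "i \<in> I \<Longrightarrow> B i \<in> lincomb I B"
  unfolding lincomb_def
  by (rule CollectI, rule exI[of _ "{i}"], rule exI[of _ "\<lambda>_. 1"]) auto

lemma lincomb_zero: "(\<lambda>\<omega>. 0) \<in> lincomb I B"
  unfolding lincomb_def by (rule CollectI, rule exI[of _ "{}"]) auto

lemma lincomb_add:
  assumes "X \<in> lincomb I B" "Y \<in> lincomb I B"
  shows "(\<lambda>\<omega>. X \<omega> + Y \<omega>) \<in> lincomb I B"
proof -
  obtain J c K d where *: "finite J" "J \<subseteq> I" "finite K" "K \<subseteq> I"
    "X = (\<lambda>\<omega>. \<Sum>i\<in>J. c i * B i \<omega>)" "Y = (\<lambda>\<omega>. \<Sum>i\<in>K. d i * B i \<omega>)"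
    using assms unfolding lincomb_def by blast
  define e where "e i = (if i \<in> J then c i else 0) + (if i \<in> K then d i else 0)" for i
  have "(\<Sum>i\<in>J \<union> K. e i * B i \<omega>) = X \<omega> + Y \<omega>" for \<omega>
  proof -
    have "(\<Sum>i\<in>J \<union> K. e i * B i \<omega>)
      = (\<Sum>i\<in>J \<union> K. if i \<in> J then c i * B i \<omega> else 0) + (\<Sum>i\<in>J \<union> K. if i \<in> K then d i * B i \<omega> else 0)"
      unfolding sum.distrib[symmetric] by (rule sum.cong) (auto simp: e_def distrib_right)
    also have "\<dots> = X \<omega> + Y \<omega>"
      using * by (simp add: sum.If_cases Int_absorb1)
    finally show ?thesis .
  qed
  then show ?thesis using * unfolding lincomb_def
    by (intro CollectI exI[of _ "J \<union> K"] exI[of _ e]) auto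
qed

lemma lincomb_scale:
  assumes "X \<in> lincomb I B"
  shows "(\<lambda>\<omega>. a * X \<omega>) \<in> lincomb I B"
proof -
  obtain J c where *: "finite J" "J \<subseteq> I" "X = (\<lambda>\<omega>. \<Sum>i\<in>J. c i * B i \<omega>)"
    using assms unfolding lincomb_def by blast
  then show ?thesis unfolding lincomb_def
    by (intro CollectI exI[of _ J] exI[of _ "\<lambda>i. a * c i"]) (auto simp: sum_distrib_left mult.assoc)
qed

lemma gaussian_family_iff_lincomb:
  "gaussian_family P I B \<longleftrightarrow> (\<forall>X\<in>lincomb I B. gaussian_rv P X)"
  unfolding gaussian_family_def lincomb_def by blast

context prob_space
begin

lemma L0_closure_measurable: "Z \<in> L0_closure M V \<Longrightarrow> Z \<in> borel_measurable M"
  by (simp add: L0_closure_def)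

lemma L0_closure_base:
  assumes "X \<in> V" "X \<in> borel_measurable M"
  shows "X \<in> L0_closure M V"
  using assms unfolding L0_closure_def by (auto intro!: bexI[of _ X])

lemma L0_closure_add:
  assumes V: "\<And>X Y. X \<in> V \<Longrightarrow> Y \<in> V \<Longrightarrow> (\<lambda>\<omega>. X \<omega> + Y \<omega>) \<in> V" and Vm: "V \<subseteq> borel_measurable M"
    and Z: "Z \<in> L0_closure M V" and W: "W \<in> L0_closure M V"
  shows "(\<lambda>\<omega>. Z \<omega> + W \<omega>) \<in> L0_closure M V"
  unfolding L0_closure_def
proof (rule CollectI, intro conjI allI impI)
  note [measurable] = L0_closure_measurable[OF Z] L0_closure_measurable[OF W]
  show "(\<lambda>\<omega>. Z \<omega> + W \<omega>) \<in> borel_measurable M" by measurable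
  fix \<epsilon> :: real assume "\<epsilon> > 0"
  note half = half_gt_zero[OF this]
  obtain X where X: "X \<in> V" "(\<integral>\<omega>. min 1 \<bar>X \<omega> - Z \<omega>\<bar> \<partial>M) < \<epsilon> / 2"
    using Z half unfolding L0_closure_def by blast
  obtain Y where Y: "Y \<in> V" "(\<integral>\<omega>. min 1 \<bar>Y \<omega> - W \<omega>\<bar> \<partial>M) < \<epsilon> / 2"
    using W half unfolding L0_closure_def by blast
  have [measurable]: "X \<in> borel_measurable M" "Y \<in> borel_measurable M" using X Y Vm by auto
  have "(\<integral>\<omega>. min 1 \<bar>(X \<omega> + Y \<omega>) - (Z \<omega> + W \<omega>)\<bar> \<partial>M)
     \<le> (\<integral>\<omega>. min 1 \<bar>X \<omega> - Z \<omega>\<bar> + min 1 \<bar>Y \<omega> - W \<omega>\<bar> \<partial>M)"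
  proof (rule integral_mono)
    show "min 1 \<bar>(X \<omega> + Y \<omega>) - (Z \<omega> + W \<omega>)\<bar> \<le> min 1 \<bar>X \<omega> - Z \<omega>\<bar> + min 1 \<bar>Y \<omega> - W \<omega>\<bar>" for \<omega>
      using min_one_triangle[of "X \<omega> + Y \<omega>" "Z \<omega> + W \<omega>" "Z \<omega> + Y \<omega>"] by simp
  qed (auto intro!: integrable_min_one)
  also have "\<dots> = (\<integral>\<omega>. min 1 \<bar>X \<omega> - Z \<omega>\<bar> \<partial>M) + (\<integral>\<omega>. min 1 \<bar>Y \<omega> - W \<omega>\<bar> \<partial>M)"
    by (intro Bochner_Integration.integral_add integrable_min_one) auto
  also have "\<dots> < \<epsilon>" using X(2) Y(2) by simp
  finally show "\<exists>X\<in>V. (\<integral>\<omega>. min 1 \<bar>X \<omega> - (Z \<omega> + W \<omega>)\<bar> \<partial>M) < \<epsilon>"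
    using V[OF X(1) Y(1)] by (auto intro!: bexI[of _ "\<lambda>\<omega>. X \<omega> + Y \<omega>"])
qed

lemma L0_closure_scale:
  assumes V: "\<And>X. X \<in> V \<Longrightarrow> (\<lambda>\<omega>. a * X \<omega>) \<in> V" and Vm: "V \<subseteq> borel_measurable M"
    and Z: "Z \<in> L0_closure M V"
  shows "(\<lambda>\<omega>. a * Z \<omega>) \<in> L0_closure M V"
  unfolding L0_closure_def
proof (rule CollectI, intro conjI allI impI)
  note [measurable] = L0_closure_measurable[OF Z]
  show "(\<lambda>\<omega>. a * Z \<omega>) \<in> borel_measurable M" by measurable
  fix \<epsilon> :: real assume "\<epsilon> > 0"
  define K where "K = max 1 \<bar>a\<bar>"
  have K: "K > 0" by (simp add: K_def)
  obtain X where X: "X \<in> V" "(\<integral>\<omega>. min 1 \<bar>X \<omega> - Z \<omega>\<bar> \<partial>M) < \<epsilon> / K"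
    using Z divide_pos_pos[OF \<open>\<epsilon> > 0\<close> K] unfolding L0_closure_def by auto
  have [measurable]: "X \<in> borel_measurable M" using X Vm by auto
  have "(\<integral>\<omega>. min 1 \<bar>a * X \<omega> - a * Z \<omega>\<bar> \<partial>M) \<le> (\<integral>\<omega>. K * min 1 \<bar>X \<omega> - Z \<omega>\<bar> \<partial>M)"
  proof (rule integral_mono)
    fix \<omega>
    have "\<bar>a\<bar> * \<bar>X \<omega> - Z \<omega>\<bar> \<le> K * \<bar>X \<omega> - Z \<omega>\<bar>" by (intro mult_right_mono) (auto simp: K_def)
    moreover have "\<bar>a * X \<omega> - a * Z \<omega>\<bar> = \<bar>a\<bar> * \<bar>X \<omega> - Z \<omega>\<bar>" by (simp add: abs_mult flip: right_diff_distrib)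
    moreover have "1 \<le> K" by (simp add: K_def)
    ultimately show "min 1 \<bar>a * X \<omega> - a * Z \<omega>\<bar> \<le> K * min 1 \<bar>X \<omega> - Z \<omega>\<bar>"
      by (cases "\<bar>X \<omega> - Z \<omega>\<bar> \<le> 1") (simp_all add: min_le_iff_disj)
  qed (auto intro!: integrable_min_one)
  also have "\<dots> < \<epsilon>" using X(2) K by (simp add: pos_less_divide_eq mult.commute)
  finally show "\<exists>X\<in>V. (\<integral>\<omega>. min 1 \<bar>X \<omega> - a * Z \<omega>\<bar> \<partial>M) < \<epsilon>"
    using V[OF X(1)] by (auto intro!: bexI[of _ "\<lambda>\<omega>. a * X \<omega>"])
qed

text \<open>The limit is required at every sample point, which is what the path properties of Y
  provide; truncation at 1 supplies the dominating function.\<close>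

lemma L0_closure_limit:
  assumes Vm: "V \<subseteq> borel_measurable M" and Zn: "\<And>n. Z n \<in> L0_closure M V"
    and lim: "\<And>\<omega>. \<omega> \<in> space M \<Longrightarrow> (\<lambda>n. Z n \<omega>) \<longlonglongrightarrow> W \<omega>"
  shows "W \<in> L0_closure M V"
  unfolding L0_closure_def
proof (rule CollectI, intro conjI allI impI)
  have [measurable]: "Z n \<in> borel_measurable M" for n by (rule L0_closure_measurable[OF Zn])
  show [measurable]: "W \<in> borel_measurable M" by (rule borel_measurable_LIMSEQ_metric[OF _ lim]) auto
  fix \<epsilon> :: real assume \<epsilon>: "\<epsilon> > 0"
  have "(\<lambda>n. \<integral>\<omega>. min 1 \<bar>Z n \<omega> - W \<omega>\<bar> \<partial>M) \<longlonglongrightarrow> (\<integral>\<omega>. 0 \<partial>M)"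
  proof (rule integral_dominated_convergence[where w = "\<lambda>_. 1"])
    show "AE \<omega> in M. (\<lambda>n. min 1 \<bar>Z n \<omega> - W \<omega>\<bar>) \<longlonglongrightarrow> 0"
    proof (rule AE_I2)
      fix \<omega> assume "\<omega> \<in> space M"
      then have "(\<lambda>n. min 1 \<bar>Z n \<omega> - W \<omega>\<bar>) \<longlonglongrightarrow> min 1 \<bar>W \<omega> - W \<omega>\<bar>"
        by (intro tendsto_intros lim)
      then show "(\<lambda>n. min 1 \<bar>Z n \<omega> - W \<omega>\<bar>) \<longlonglongrightarrow> 0" by simp
    qed
  qed auto
  then have "\<forall>\<^sub>F n in sequentially. (\<integral>\<omega>. min 1 \<bar>Z n \<omega> - W \<omega>\<bar> \<partial>M) < \<epsilon> / 2"
    using \<epsilon> by (intro order_tendstoD(2)) auto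
  then obtain n where n: "(\<integral>\<omega>. min 1 \<bar>Z n \<omega> - W \<omega>\<bar> \<partial>M) < \<epsilon> / 2"
    unfolding eventually_sequentially by blast
  obtain X where X: "X \<in> V" "(\<integral>\<omega>. min 1 \<bar>X \<omega> - Z n \<omega>\<bar> \<partial>M) < \<epsilon> / 2"
    using Zn[of n] \<epsilon> half_gt_zero[OF \<epsilon>] unfolding L0_closure_def by blast
  have [measurable]: "X \<in> borel_measurable M" using X Vm by auto
  have "(\<integral>\<omega>. min 1 \<bar>X \<omega> - W \<omega>\<bar> \<partial>M) \<le> (\<integral>\<omega>. min 1 \<bar>X \<omega> - Z n \<omega>\<bar> + min 1 \<bar>Z n \<omega> - W \<omega>\<bar> \<partial>M)"
    by (rule integral_mono) (auto intro!: integrable_min_one min_one_triangle)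
  also have "\<dots> = (\<integral>\<omega>. min 1 \<bar>X \<omega> - Z n \<omega>\<bar> \<partial>M) + (\<integral>\<omega>. min 1 \<bar>Z n \<omega> - W \<omega>\<bar> \<partial>M)"
    by (intro Bochner_Integration.integral_add integrable_min_one) auto
  also have "\<dots> < \<epsilon>" using X(2) n by simp
  finally show "\<exists>X\<in>V. (\<integral>\<omega>. min 1 \<bar>X \<omega> - W \<omega>\<bar> \<partial>M) < \<epsilon>" using X(1) by blast
qed

lemma L0_closure_sum:
  assumes add: "\<And>X Y. X \<in> V \<Longrightarrow> Y \<in> V \<Longrightarrow> (\<lambda>\<omega>. X \<omega> + Y \<omega>) \<in> V" and zero: "(\<lambda>\<omega>. 0) \<in> V"
    and sc: "\<And>a X. X \<in> V \<Longrightarrow> (\<lambda>\<omega>. a * X \<omega>) \<in> V" and Vm: "V \<subseteq> borel_measurable M"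
    and fin: "finite J"
  shows "(\<And>i. i \<in> J \<Longrightarrow> Z i \<in> L0_closure M V) \<Longrightarrow> (\<lambda>\<omega>. \<Sum>i\<in>J. c i * Z i \<omega>) \<in> L0_closure M V"
  using fin
proof (induction J rule: finite_induct)
  case empty
  then show ?case using L0_closure_base[OF zero] by simp
next
  case (insert i J)
  have "(\<lambda>\<omega>. c i * Z i \<omega> + (\<Sum>i\<in>J. c i * Z i \<omega>)) \<in> L0_closure M V"
    using insert by (intro L0_closure_add[OF add Vm] L0_closure_scale[OF sc Vm]) auto
  then show ?case using insert by simp
qed

text \<open>The closure of the span is a vector space, so a finite combination of its members is a
  single limit of Gaussian variables: joint Gaussianity needs no multidimensional argument.\<close>

lemma gaussian_family_L0_closure:
  assumes B: "gaussian_family M I B" and X: "\<And>i. i \<in> I' \<Longrightarrow> X i \<in> L0_closure M (lincomb I B)"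
  shows "gaussian_family M I' X"
  unfolding gaussian_family_def
proof (intro allI impI)
  fix J and c :: "_ \<Rightarrow> real" assume J: "finite J \<and> J \<subseteq> I'"
  have G: "gaussian_rv M Y" if "Y \<in> lincomb I B" for Y
    using B that by (simp add: gaussian_family_iff_lincomb)
  have "lincomb I B \<subseteq> borel_measurable M" using G by (auto simp: gaussian_rv_def)
  then have "(\<lambda>\<omega>. \<Sum>i\<in>J. c i * X i \<omega>) \<in> L0_closure M (lincomb I B)"
    using J X by (intro L0_closure_sum lincomb_add lincomb_zero lincomb_scale) auto
  then show "gaussian_rv M (\<lambda>\<omega>. \<Sum>i\<in>J. c i * X i \<omega>)"
    using gaussian_L0_closure[OF G] by blast
qed

end

section \<open>Joint Gaussianity of martingales and initial data\<close>

text \<open>The assumption \<open>lin\<close> replaces polarisation: a combination of martingales of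
  the family belongs to the family and has its own deterministic quadratic variation. How q depends
  on the index does not matter, only its sign.\<close>

locale linear_martingale_family = filtered_prob_space P T F for P :: "'a measure" and T F +
  fixes S :: "'h set" and M :: "real \<Rightarrow> 'h \<Rightarrow> 'a \<Rightarrow> real" and q :: "'h \<Rightarrow> real"
  assumes mart: "\<And>H. H \<in> S \<Longrightarrow> martingale P T F (\<lambda>t. M t H)"
    and qv: "\<And>H. H \<in> S \<Longrightarrow> quadratic_variation P T (\<lambda>t. M t H) (\<lambda>t \<omega>. q H * t)"
    and q0: "\<And>H. H \<in> S \<Longrightarrow> q H \<ge> 0"
    and lin: "\<And>H H' a. H \<in> S \<Longrightarrow> H' \<in> S \<Longrightarrow> \<exists>K\<in>S. \<forall>t\<in>{0..T}. \<forall>\<omega>\<in>space P. M t K \<omega> = M t H \<omega> + a * M t H' \<omega>"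
    and M0: "\<And>H \<omega>. H \<in> S \<Longrightarrow> \<omega> \<in> space P \<Longrightarrow> M 0 H \<omega> = 0"
    and T0: "0 \<le> T"
begin

lemma lin_sum:
  assumes "finite J" "\<And>i. i \<in> J \<Longrightarrow> h i \<in> S" "S \<noteq> {}"
  shows "\<exists>K\<in>S. \<forall>t\<in>{0..T}. \<forall>\<omega>\<in>space P. M t K \<omega> = (\<Sum>i\<in>J. c i * M t (h i) \<omega>)"
  using assms
proof (induction J rule: finite_induct)
  case empty
  then obtain H where "H \<in> S" by auto
  then show ?case using lin[of H H "-1"] by auto
next
  case (insert i J)
  then have "\<exists>K\<in>S. \<forall>t\<in>{0..T}. \<forall>\<omega>\<in>space P. M t K \<omega> = (\<Sum>i\<in>J. c i * M t (h i) \<omega>)"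
    by simp
  then obtain K where K: "K \<in> S" "\<And>t \<omega>. t \<in> {0..T} \<Longrightarrow> \<omega> \<in> space P \<Longrightarrow> M t K \<omega> = (\<Sum>i\<in>J. c i * M t (h i) \<omega>)"
    by (elim bexE) simp
  then obtain K' where "K' \<in> S" "\<forall>t\<in>{0..T}. \<forall>\<omega>\<in>space P. M t K' \<omega> = M t K \<omega> + c i * M t (h i) \<omega>"
    using lin[of K "h i" "c i"] insert by auto
  then show ?case using K insert by (intro bexI[of _ K']) auto
qed

text \<open>Levy's theorem removes the last increment; the character of all earlier ones, times V,
  is a bounded weight known at time \<open>s n\<close>. The martingale may change from one interval
  to the next.\<close>

lemma increments_char:
  fixes s :: "nat \<Rightarrow> real" and V :: "'a \<Rightarrow> complex"
  assumes s: "mono s" "s 0 = 0" and H: "\<And>j. j < n \<Longrightarrow> H j \<in> S" and sT: "s n \<le> T"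
    and V: "V \<in> borel_measurable (F 0)" "\<And>\<omega>. \<omega> \<in> space P \<Longrightarrow> cmod (V \<omega>) \<le> 1"
  shows "(\<integral>\<omega>. V \<omega> * iexp (u * (\<Sum>j<n. M (s (Suc j)) (H j) \<omega> - M (s j) (H j) \<omega>)) \<partial>P)
     = of_real (exp (- (u\<^sup>2 * (\<Sum>j<n. q (H j) * (s (Suc j) - s j)) / 2))) * (\<integral>\<omega>. V \<omega> \<partial>P)"
  using H sT
proof (induction n)
  case 0
  then show ?case by simp
next
  case (Suc n)
  have Hn: "H n \<in> S" using Suc by simp
  have sle: "s i \<le> s j" if "i \<le> j" for i j using s(1) that by (auto dest: monoD)
  have s0: "0 \<le> s j" for j using sle[of 0 j] s(2) by simp
  have sn: "0 \<le> s n" "s n \<le> s (Suc n)" "s (Suc n) \<le> T" "s n \<le> T"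
    using s0 sle[of n "Suc n"] Suc.prems by auto
  interpret X: real_martingale P T F "\<lambda>t. M t (H n)"
    by unfold_locales (rule mart[OF Hn])
  define V' where "V' \<omega> = V \<omega> * iexp (u * (\<Sum>j<n. M (s (Suc j)) (H j) \<omega> - M (s j) (H j) \<omega>))" for \<omega>
  have V'm: "V' \<in> borel_measurable (F (s n))"
  proof -
    have "M (s i) (H j) \<in> borel_measurable (F (s n))" if "j < n" "i \<le> Suc j" for i j
    proof (rule measurable_F_mono[of "s i"])
      show "s i \<le> s n" using sle[of i n] that by simp
      have "H j \<in> S" "s i \<in> {0..T}" using Suc.prems that s0 sle[of i "Suc n"] by auto
      then show "M (s i) (H j) \<in> borel_measurable (F (s i))"
        using mart[of "H j"] by (auto simp: martingale_def)
    qed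
    then have [measurable]: "(\<lambda>\<omega>. \<Sum>j<n. M (s (Suc j)) (H j) \<omega> - M (s j) (H j) \<omega>) \<in> borel_measurable (F (s n))"
      by (intro borel_measurable_sum borel_measurable_diff) auto
    have [measurable]: "V \<in> borel_measurable (F (s n))" using measurable_F_mono[OF s0 V(1)] .
    show ?thesis unfolding V'_def by measurable
  qed
  have V'1: "cmod (V' \<omega>) \<le> 1" if "\<omega> \<in> space P" for \<omega>
    using V(2)[OF that] by (simp add: V'_def norm_mult)
  have "(\<integral>\<omega>. V \<omega> * iexp (u * (\<Sum>j<Suc n. M (s (Suc j)) (H j) \<omega> - M (s j) (H j) \<omega>)) \<partial>P)
     = (\<integral>\<omega>. V' \<omega> * iexp (u * (M (s (Suc n)) (H n) \<omega> - M (s n) (H n) \<omega>)) \<partial>P)"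
    unfolding V'_def sum.lessThan_Suc distrib_left[of u] iexp_add by (simp only: mult.assoc)
  also have "\<dots> = of_real (exp (- (u\<^sup>2 * (q (H n) * (s (Suc n) - s n)) / 2))) * (\<integral>\<omega>. V' \<omega> \<partial>P)"
    by (rule X.levy_characterisation[OF qv[OF Hn] q0[OF Hn] sn(1-3) V'm V'1])
  also have "(\<integral>\<omega>. V' \<omega> \<partial>P) = of_real (exp (- (u\<^sup>2 * (\<Sum>j<n. q (H j) * (s (Suc j) - s j)) / 2))) * (\<integral>\<omega>. V \<omega> \<partial>P)"
    unfolding V'_def using Suc.IH Suc.prems sn by simp
  also have "of_real (exp (- (u\<^sup>2 * (q (H n) * (s (Suc n) - s n)) / 2))) *
      (of_real (exp (- (u\<^sup>2 * (\<Sum>j<n. q (H j) * (s (Suc j) - s j)) / 2))) * (\<integral>\<omega>. V \<omega> \<partial>P))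
     = of_real (exp (- (u\<^sup>2 * (\<Sum>j<Suc n. q (H j) * (s (Suc j) - s j)) / 2))) * (\<integral>\<omega>. V \<omega> \<partial>P)"
    unfolding mult.assoc[symmetric] of_real_mult[symmetric] exp_add[symmetric]
    by (simp add: distrib_left add_divide_distrib)
  finally show ?case .
qed

text \<open>The character of the initial part is a weight known at time 0, so it factors out of the
  characteristic function of the sum: initial data and noise behave as independent variables, and
  the variances v and w add.\<close>

lemma joint_gaussian:
  fixes Y :: "'g \<Rightarrow> 'a \<Rightarrow> real" and S' :: "'g set"
  assumes Y: "gaussian_family P S' Y" and YF: "\<And>G. G \<in> S' \<Longrightarrow> Y G \<in> borel_measurable (F 0)"
  shows "gaussian_family P (S' <+> ({0..T} \<times> S)) (case_sum Y (\<lambda>(t, H). M t H))"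
  unfolding gaussian_family_def
proof (intro allI impI)
  fix J :: "('g + real \<times> 'h) set" and c :: "'g + real \<times> 'h \<Rightarrow> real"
  assume J: "finite J \<and> J \<subseteq> S' <+> ({0..T} \<times> S)"
  define J1 where "J1 = Inl -` J"
  define J2 where "J2 = Inr -` J"
  have fin: "finite J1" "finite J2" using J by (auto simp: J1_def J2_def intro: finite_vimageI)
  have J1S: "J1 \<subseteq> S'" and J2S: "J2 \<subseteq> {0..T} \<times> S" using J by (auto simp: J1_def J2_def)
  have Jeq: "J = Inl ` J1 \<union> Inr ` J2"
  proof (rule set_eqI)
    fix i show "i \<in> J \<longleftrightarrow> i \<in> Inl ` J1 \<union> Inr ` J2"
      by (cases i) (auto simp: J1_def J2_def)
  qed
  define U where "U \<omega> = (\<Sum>G\<in>J1. c (Inl G) * Y G \<omega>)" for \<omega>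
  define R where "R \<omega> = (\<Sum>(t, H)\<in>J2. c (Inr (t, H)) * M t H \<omega>)" for \<omega>
  have split: "(\<Sum>i\<in>J. c i * case_sum Y (\<lambda>(t, H). M t H) i \<omega>) = U \<omega> + R \<omega>" for \<omega>
    unfolding Jeq U_def R_def
    by (subst sum.union_disjoint) (auto simp: fin sum.reindex case_prod_beta)
  have UG: "gaussian_rv P U"
    using Y[unfolded gaussian_family_def, rule_format, of J1 "\<lambda>G. c (Inl G)"] fin(1) J1S
    unfolding U_def by simp
  have UF: "U \<in> borel_measurable (F 0)"
    unfolding U_def using YF J1S by (intro borel_measurable_sum borel_measurable_times) auto
  have Rm: "R \<in> borel_measurable P"
    unfolding R_def case_prod_beta
  proof (intro borel_measurable_sum borel_measurable_times)
    fix p assume "p \<in> J2"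
    then have "snd p \<in> S" "fst p \<in> {0..T}" using J2S by auto
    then show "M (fst p) (snd p) \<in> borel_measurable P"
      using mart[of "snd p"] by (auto simp: martingale_def)
  qed auto
  \<comment> \<open>The time 0 is inserted so that the grid starts there in any case; M vanishes at
    0.\<close>
  define ts where "ts = sorted_list_of_set (insert 0 (fst ` J2))"
  define n where "n = length ts - 1"
  have "finite (insert 0 (fst ` J2))" using fin by simp
  from set_sorted_list_of_set[OF this] have set_ts: "set ts = insert 0 (fst ` J2)"
    unfolding ts_def .
  have ts: "sorted ts" "set ts = insert 0 (fst ` J2)" "ts \<noteq> []"
    using set_ts unfolding ts_def[symmetric] by (auto simp: ts_def simp del: sorted_list_of_set_insert_remove)
  \<comment> \<open>Constant beyond the last grid point, because \<open>increments_char\<close>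
    takes a monotone function on all natural numbers.\<close>
  define s where "s j = ts ! min j n" for j
  have len: "length ts = Suc n" using ts(3) by (cases ts) (auto simp: n_def)
  have s_mono: "mono s" by (rule monoI) (auto simp: s_def len intro!: sorted_nth_mono[OF ts(1)])
  have s_set: "s j \<in> insert 0 (fst ` J2)" for j
    unfolding s_def ts(2)[symmetric] by (rule nth_mem) (simp add: len)
  have sT: "s j \<in> {0..T}" for j using s_set[of j] J2S T0 by auto
  have s0: "s 0 = 0"
  proof -
    have "0 \<in> set ts" using ts(2) by simp
    then obtain i where "i < length ts" "ts ! i = 0" by (auto simp: in_set_conv_nth)
    then have "s i = 0" by (simp add: s_def len min_def)
    then show ?thesis using monoD[OF s_mono, of 0 i] sT[of 0] by auto
  qed
  have "\<forall>p\<in>J2. \<exists>k\<le>n. s k = fst p"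
  proof
    fix p assume "p \<in> J2"
    then have "fst p \<in> set ts" using ts(2) by auto
    then obtain i where "i < length ts" "ts ! i = fst p" by (auto simp: in_set_conv_nth)
    then show "\<exists>k\<le>n. s k = fst p" by (intro exI[of _ i]) (auto simp: s_def len min_def)
  qed
  then obtain k where k: "\<And>p. p \<in> J2 \<Longrightarrow> k p \<le> n \<and> s (k p) = fst p" by metis
  have "\<exists>w\<ge>0. \<forall>u. (\<integral>\<omega>. iexp (u * U \<omega>) * iexp (u * R \<omega>) \<partial>P) = of_real (exp (- (u\<^sup>2 * w / 2))) * (\<integral>\<omega>. iexp (u * U \<omega>) \<partial>P)"
  proof (cases "J2 = {}")
    case True
    then show ?thesis by (intro exI[of _ 0]) (simp add: R_def)
  next
    case False
    then have S: "S \<noteq> {}" using J2S by auto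
    \<comment> \<open>Summation by parts: the j-th interval contributes to exactly those terms whose
      time lies beyond it (j < k p), and by linearity these terms merge into one martingale of the
      family.\<close>
    have "\<forall>j. \<exists>K. K \<in> S \<and> (\<forall>t\<in>{0..T}. \<forall>\<omega>\<in>space P. M t K \<omega> = (\<Sum>p\<in>{p\<in>J2. j < k p}. c (Inr p) * M t (snd p) \<omega>))"
      using lin_sum[of "{p\<in>J2. j < k p}" snd "\<lambda>p. c (Inr p)" for j] fin J2S S by (fastforce simp: Bex_def)
    from choice[OF this] obtain H where H': "\<forall>j. H j \<in> S \<and> (\<forall>t\<in>{0..T}. \<forall>\<omega>\<in>space P. M t (H j) \<omega> = (\<Sum>p\<in>{p\<in>J2. j < k p}. c (Inr p) * M t (snd p) \<omega>))"
      by (rule exE)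
    have H: "H j \<in> S"
      "t \<in> {0..T} \<Longrightarrow> \<omega> \<in> space P \<Longrightarrow> M t (H j) \<omega> = (\<Sum>p\<in>{p\<in>J2. j < k p}. c (Inr p) * M t (snd p) \<omega>)" for j t \<omega>
      using H' by blast+
    have R: "R \<omega> = (\<Sum>j<n. M (s (Suc j)) (H j) \<omega> - M (s j) (H j) \<omega>)" if w: "\<omega> \<in> space P" for \<omega>
    proof -
      have "(\<Sum>j<n. M (s (Suc j)) (H j) \<omega> - M (s j) (H j) \<omega>)
        = (\<Sum>j<n. \<Sum>p\<in>J2. if j < k p then c (Inr p) * (M (s (Suc j)) (snd p) \<omega> - M (s j) (snd p) \<omega>) else 0)"
      proof (intro sum.cong refl)
        fix j
        have "M (s (Suc j)) (H j) \<omega> - M (s j) (H j) \<omega>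
          = (\<Sum>p\<in>{p\<in>J2. j < k p}. c (Inr p) * (M (s (Suc j)) (snd p) \<omega> - M (s j) (snd p) \<omega>))"
          using H(2)[OF sT w] by (simp add: sum_subtractf right_diff_distrib)
        also have "\<dots> = (\<Sum>p\<in>J2. if j < k p then c (Inr p) * (M (s (Suc j)) (snd p) \<omega> - M (s j) (snd p) \<omega>) else 0)"
          by (rule sum.inter_filter[OF fin(2)])
        finally show "M (s (Suc j)) (H j) \<omega> - M (s j) (H j) \<omega> = \<dots>" .
      qed
      also have "\<dots> = (\<Sum>p\<in>J2. \<Sum>j<n. if j < k p then c (Inr p) * (M (s (Suc j)) (snd p) \<omega> - M (s j) (snd p) \<omega>) else 0)"
        by (rule sum.swap)
      also have "\<dots> = (\<Sum>p\<in>J2. c (Inr p) * M (fst p) (snd p) \<omega>)"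
      proof (rule sum.cong[OF refl])
        fix p assume p: "p \<in> J2"
        then have pS: "snd p \<in> S" using J2S by auto
        have "{..<n} \<inter> {j. j < k p} = {..<k p}" using k[OF p] by auto
        then have "(\<Sum>j<n. if j < k p then c (Inr p) * (M (s (Suc j)) (snd p) \<omega> - M (s j) (snd p) \<omega>) else 0)
          = (\<Sum>j<k p. c (Inr p) * (M (s (Suc j)) (snd p) \<omega> - M (s j) (snd p) \<omega>))"
          by (simp add: sum.If_cases)
        also have "\<dots> = c (Inr p) * (\<Sum>j<k p. M (s (Suc j)) (snd p) \<omega> - M (s j) (snd p) \<omega>)"
          by (rule sum_distrib_left[symmetric])
        also have "\<dots> = c (Inr p) * (M (s (k p)) (snd p) \<omega> - M (s 0) (snd p) \<omega>)"
          using sum_lessThan_telescope[of "\<lambda>j. M (s j) (snd p) \<omega>" "k p"] by simp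
        also have "\<dots> = c (Inr p) * M (fst p) (snd p) \<omega>"
          using k[OF p] M0[OF pS w] s0 by simp
        finally show "(\<Sum>j<n. if j < k p then c (Inr p) * (M (s (Suc j)) (snd p) \<omega> - M (s j) (snd p) \<omega>) else 0)
          = c (Inr p) * M (fst p) (snd p) \<omega>" .
      qed
      finally show ?thesis by (simp add: R_def case_prod_beta)
    qed
    define w where "w = (\<Sum>j<n. q (H j) * (s (Suc j) - s j))"
    have "w \<ge> 0" unfolding w_def using q0[OF H(1)] s_mono by (intro sum_nonneg mult_nonneg_nonneg) (auto intro: monoD[OF s_mono])
    moreover have "(\<integral>\<omega>. iexp (u * U \<omega>) * iexp (u * R \<omega>) \<partial>P) = of_real (exp (- (u\<^sup>2 * w / 2))) * (\<integral>\<omega>. iexp (u * U \<omega>) \<partial>P)" for u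
    proof -
      have "(\<integral>\<omega>. iexp (u * U \<omega>) * iexp (u * R \<omega>) \<partial>P)
        = (\<integral>\<omega>. iexp (u * U \<omega>) * iexp (u * (\<Sum>j<n. M (s (Suc j)) (H j) \<omega> - M (s j) (H j) \<omega>)) \<partial>P)"
        by (intro Bochner_Integration.integral_cong refl) (simp only: R)
      also have "\<dots> = of_real (exp (- (u\<^sup>2 * w / 2))) * (\<integral>\<omega>. iexp (u * U \<omega>) \<partial>P)"
        unfolding w_def
      proof (rule increments_char[OF s_mono s0 H(1)])
        show "(\<lambda>\<omega>. iexp (u * U \<omega>)) \<in> borel_measurable (F 0)" using UF by measurable
      qed (use sT in auto)
      finally show ?thesis .
    qed
    ultimately show ?thesis by blast
  qed
  then obtain w where w: "w \<ge> 0"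
    "\<And>u. (\<integral>\<omega>. iexp (u * U \<omega>) * iexp (u * R \<omega>) \<partial>P) = of_real (exp (- (u\<^sup>2 * w / 2))) * (\<integral>\<omega>. iexp (u * U \<omega>) \<partial>P)"
    by blast
  obtain m v where v: "v \<ge> 0" "\<And>u. (\<integral>\<omega>. iexp (u * U \<omega>) \<partial>P) = iexp (u * m) * of_real (exp (- (u\<^sup>2 * v / 2)))"
    using UG unfolding gaussian_rv_iff_char by blast
  have "U \<in> borel_measurable P" using UG by (simp add: gaussian_rv_def)
  then have meas: "(\<lambda>\<omega>. U \<omega> + R \<omega>) \<in> borel_measurable P" using Rm by simp
  have char: "(\<integral>\<omega>. iexp (u * (U \<omega> + R \<omega>)) \<partial>P) = iexp (u * m) * of_real (exp (- (u\<^sup>2 * (v + w) / 2)))" for u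
  proof -
    have "(\<integral>\<omega>. iexp (u * (U \<omega> + R \<omega>)) \<partial>P) = (\<integral>\<omega>. iexp (u * U \<omega>) * iexp (u * R \<omega>) \<partial>P)"
      by (simp only: distrib_left[of u] iexp_add)
    also have "\<dots> = iexp (u * m) * of_real (exp (- (u\<^sup>2 * v / 2)) * exp (- (u\<^sup>2 * w / 2)))"
      unfolding w(2) v(2) by (simp only: of_real_mult mult_ac)
    also have "exp (- (u\<^sup>2 * v / 2)) * exp (- (u\<^sup>2 * w / 2)) = exp (- (u\<^sup>2 * (v + w) / 2))"
      by (simp add: distrib_left add_divide_distrib flip: exp_add)
    finally show ?thesis .
  qed
  show "gaussian_rv P (\<lambda>\<omega>. \<Sum>i\<in>J. c i * case_sum Y (\<lambda>(t, H). M t H) i \<omega>)"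
    unfolding split gaussian_rv_iff_char
    by (rule conjI[OF meas], rule exI[of _ m], rule exI[of _ "v + w"]) (use v w char in auto)
qed

end

section \<open>The torus and the one-dimensional operators\<close>

lemma cube_borel [measurable]: "cube \<in> sets (borel :: (real ^ 'd::finite) measure)"
proof -
  have "{x \<in> space borel. \<forall>k\<in>UNIV. 0 < x $ k \<and> x $ k \<le> 1} \<in> sets (borel :: (real ^ 'd) measure)"
    by measurable
  then show ?thesis by (simp add: cube_def)
qed

text \<open>Lebesgue measure as an image of a product measure lets integrals of tensor products over
  the torus factor into one-dimensional ones.\<close>

lemma lborel_vec:
  "(lborel :: (real ^ 'd::finite) measure) = distr (\<Pi>\<^sub>M k\<in>UNIV. lborel) borel (\<lambda>f. \<chi> k. f k)"
proof (rule lborel_eqI)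
  interpret product_sigma_finite "\<lambda>_::'d. lborel :: real measure" ..
  have meas: "(\<lambda>f. \<chi> k. f k) \<in> measurable (\<Pi>\<^sub>M k\<in>UNIV. lborel) (borel :: (real ^ 'd) measure)"
    by (subst borel_measurable_euclidean_space) (auto simp: Basis_vec_def inner_axis)
  fix l u :: "real ^ 'd" assume le: "\<And>b. b \<in> Basis \<Longrightarrow> l \<bullet> b \<le> u \<bullet> b"
  have le': "l $ k \<le> u $ k" for k using le[of "axis k 1"] by (simp add: inner_axis axis_in_Basis_iff)
  have "(\<lambda>f. \<chi> k. f k) -` box l u \<inter> space (\<Pi>\<^sub>M k\<in>UNIV. lborel) = (\<Pi>\<^sub>E k\<in>UNIV. {l $ k<..<u $ k})"
    by (auto simp: mem_box_cart space_PiM PiE_iff)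
  then have "emeasure (distr (\<Pi>\<^sub>M k\<in>UNIV. lborel) borel (\<lambda>f. \<chi> k. f k)) (box l u)
      = emeasure (\<Pi>\<^sub>M k\<in>UNIV. lborel) (\<Pi>\<^sub>E k\<in>UNIV. {l $ k<..<u $ k})"
    by (subst emeasure_distr[OF meas]) auto
  also have "\<dots> = (\<Prod>k\<in>UNIV. emeasure lborel {l $ k<..<u $ k})"
    by (rule emeasure_PiM) auto
  also have "\<dots> = (\<Prod>k\<in>UNIV. ennreal (u $ k - l $ k))" using le' by simp
  also have "\<dots> = ennreal (\<Prod>k\<in>UNIV. u $ k - l $ k)" using le' by (intro prod_ennreal) auto
  also have "(\<Prod>k\<in>UNIV. u $ k - l $ k) = (\<Prod>b\<in>Basis. (u - l) \<bullet> b)"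
  proof -
    have B: "(Basis :: (real ^ 'd) set) = range (\<lambda>k. axis k 1)" by (auto simp: Basis_vec_def)
    have "inj (\<lambda>k::'d. axis k (1::real))" by (auto simp: inj_on_def axis_eq_axis)
    then show ?thesis unfolding B by (simp add: prod.reindex inner_axis inner_diff_left)
  qed
  finally show "emeasure (distr (\<Pi>\<^sub>M k\<in>UNIV. lborel) borel (\<lambda>f. \<chi> k. f k)) (box l u) = (\<Prod>b\<in>Basis. (u - l) \<bullet> b)" .
qed simp

lemma torus_integral_prod:
  fixes h :: "'d::finite \<Rightarrow> real \<Rightarrow> real"
  assumes h: "\<And>k. set_integrable lborel {0<..1} (h k)"
  shows "integrable torus_measure (\<lambda>x. \<Prod>k\<in>UNIV. h k (x $ k))"
    and "(\<integral>x. (\<Prod>k\<in>UNIV. h k (x $ k)) \<partial>torus_measure) = (\<Prod>k\<in>UNIV. LBINT u:{0<..1}. h k u)"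
proof -
  interpret product_sigma_finite "\<lambda>_::'d. lborel :: real measure" ..
  define H where "H k u = indicator {0<..1} u *\<^sub>R h k u" for k u
  have H: "integrable lborel (H k)" for k using h[of k] by (simp add: set_integrable_def H_def[abs_def])
  have [measurable]: "H k \<in> borel_measurable borel" for k using borel_measurable_integrable[OF H[of k]] by simp
  have meas: "(\<lambda>f. \<chi> k. f k) \<in> measurable (\<Pi>\<^sub>M k\<in>UNIV. lborel) (borel :: (real ^ 'd) measure)"
    by (subst borel_measurable_euclidean_space) (auto simp: Basis_vec_def inner_axis)
  \<comment> \<open>The indicator of the cube is itself a product and is absorbed factor by factor;
    outside the cube some factor vanishes.\<close>
  have ind: "indicator cube x *\<^sub>R (\<Prod>k\<in>UNIV. h k (x $ k)) = (\<Prod>k\<in>UNIV. H k (x $ k))" for x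
  proof (cases "x \<in> cube")
    case True
    then show ?thesis by (simp add: H_def cube_def indicator_def)
  next
    case False
    then obtain k where "\<not> (0 < x $ k \<and> x $ k \<le> 1)" by (auto simp: cube_def)
    then have "H k (x $ k) = 0" by (auto simp: H_def indicator_def)
    then have "(\<Prod>k\<in>UNIV. H k (x $ k)) = 0" by (subst prod_zero_iff) auto
    then show ?thesis using False by simp
  qed
  have c: "(cube :: (real ^ 'd) set) \<inter> space lborel \<in> sets lborel" using cube_borel by simp
  have i1: "integrable (\<Pi>\<^sub>M k\<in>UNIV. lborel) (\<lambda>f. \<Prod>k\<in>UNIV. H k (f k))"
    using H by (intro product_integrable_prod) auto
  have mH: "(\<lambda>x. \<Prod>k\<in>UNIV. H k (x $ k)) \<in> borel_measurable borel" by measurable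
  show "integrable torus_measure (\<lambda>x. \<Prod>k\<in>UNIV. h k (x $ k))"
    unfolding torus_measure_def integrable_restrict_space[OF c] ind
    by (subst lborel_vec, subst integrable_distr_eq[OF meas mH]) (use i1 in simp)
  have e: "(LBINT u:{0<..1}. h k u) = integral\<^sup>L lborel (H k)" for k
    by (simp add: set_lebesgue_integral_def H_def[abs_def])
  show "(\<integral>x. (\<Prod>k\<in>UNIV. h k (x $ k)) \<partial>torus_measure) = (\<Prod>k\<in>UNIV. LBINT u:{0<..1}. h k u)"
    unfolding torus_measure_def integral_restrict_space[OF c] ind e
    by (subst lborel_vec, subst integral_distr[OF meas mH]) (simp add: product_integral_prod[OF finite H])
qed

text \<open>Averaging over translations in the direction of the slices replaces the Fubini theorem for
  the decomposition of \<open>real ^ 'd\<close> into one coordinate and the others.\<close>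

lemma slices_null_imp_null:
  fixes v :: "real ^ 'd::finite \<Rightarrow> real"
  assumes v [measurable]: "v \<in> borel_measurable borel"
    and slice: "\<And>x. AE u in lborel. u \<in> {0<..1} \<longrightarrow> v (\<chi> i. if i = k then u else x $ i) = 0"
  shows "AE x in torus_measure. v x = 0"
proof -
  define S where "S = {x \<in> cube. v x \<noteq> 0}"
  have S [measurable]: "S \<in> sets borel"
  proof -
    have "S = cube \<inter> {x \<in> space borel. v x \<noteq> 0}" by (auto simp: S_def)
    also have "\<dots> \<in> sets borel" by measurable
    finally show ?thesis .
  qed
  define e :: "real ^ 'd" where "e = axis k 1"
  have em [measurable]: "(\<lambda>p :: (real ^ 'd) \<times> real. indicator S (fst p + snd p *\<^sub>R e) :: ennreal) \<in> borel_measurable (borel \<Otimes>\<^sub>M borel)"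
    by measurable
  have zero: "(\<integral>\<^sup>+s. indicator S (x + s *\<^sub>R e) * indicator {0..1} s \<partial>lborel) = 0" for x
  proof -
    \<comment> \<open>The substitution u = x_k + s turns the hypothesis on the slice through x into
      a statement about displacements of x along e.\<close>
    have "AE u in distr lborel borel ((+) (x $ k)). u \<in> {0<..1} \<longrightarrow> v (\<chi> i. if i = k then u else x $ i) = 0"
      unfolding lborel_distr_plus by (rule slice)
    moreover have [measurable]: "(\<lambda>u. \<chi> i. if i = k then u else x $ i) \<in> borel_measurable borel"
      by (subst borel_measurable_euclidean_space) (auto simp: Basis_vec_def inner_axis)
    ultimately have "AE s in lborel. x $ k + s \<in> {0<..1} \<longrightarrow> v (\<chi> i. if i = k then x $ k + s else x $ i) = 0"
      by (subst (asm) AE_distr_iff) auto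
    then have "AE s in lborel. indicator S (x + s *\<^sub>R e) * indicator {0..1} s = (0 :: ennreal)"
    proof eventually_elim
      case (elim s)
      have eq: "(\<chi> i. if i = k then x $ k + s else x $ i) = x + s *\<^sub>R e"
        by (auto simp: vec_eq_iff e_def axis_def)
      have "x + s *\<^sub>R e \<notin> S"
      proof
        assume S: "x + s *\<^sub>R e \<in> S"
        have "0 < (x + s *\<^sub>R e) $ k \<and> (x + s *\<^sub>R e) $ k \<le> 1" "v (x + s *\<^sub>R e) \<noteq> 0"
          using S unfolding S_def cube_def by blast+
        then show False using elim unfolding eq by (simp add: e_def)
      qed
      then show ?case by simp
    qed
    from nn_integral_cong_AE[OF this] show ?thesis by simp
  qed
  have shift: "emeasure lborel {x. x + s *\<^sub>R e \<in> S} = emeasure lborel S" for s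
  proof -
    have "emeasure lborel S = emeasure (distr lborel borel ((+) (s *\<^sub>R e))) S" unfolding lborel_distr_plus ..
    also have "\<dots> = emeasure lborel {x. x + s *\<^sub>R e \<in> S}"
      by (subst emeasure_distr) (auto intro!: arg_cong[where f = "emeasure lborel"] simp: add.commute)
    finally show ?thesis ..
  qed
  have "emeasure lborel S = (\<integral>\<^sup>+s. emeasure lborel {x. x + s *\<^sub>R e \<in> S} * indicator {0..1::real} s \<partial>lborel)"
    unfolding shift by (simp add: nn_integral_cmult)
  also have "\<dots> = (\<integral>\<^sup>+s. (\<integral>\<^sup>+x. indicator S (x + s *\<^sub>R e) * indicator {0..1} s \<partial>lborel) \<partial>lborel)"
  proof (rule nn_integral_cong)
    fix s :: real
    have "{x. x + s *\<^sub>R e \<in> S} = (\<lambda>x. x + s *\<^sub>R e) -` S \<inter> space borel" by auto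
    also have "\<dots> \<in> sets borel" by measurable
    finally have m: "{x. x + s *\<^sub>R e \<in> S} \<in> sets borel" .
    have "(\<integral>\<^sup>+x. indicator S (x + s *\<^sub>R e) * indicator {0..1} s \<partial>lborel)
      = (\<integral>\<^sup>+x. indicator {x. x + s *\<^sub>R e \<in> S} x * indicator {0..1} s \<partial>lborel)"
      by (intro nn_integral_cong) (auto simp: indicator_def)
    also have "\<dots> = emeasure lborel {x. x + s *\<^sub>R e \<in> S} * indicator {0..1} s"
      using m by (simp add: nn_integral_multc)
    finally show "emeasure lborel {x. x + s *\<^sub>R e \<in> S} * indicator {0..1} s
      = (\<integral>\<^sup>+x. indicator S (x + s *\<^sub>R e) * indicator {0..1} s \<partial>lborel)" ..
  qed
  also have "\<dots> = (\<integral>\<^sup>+x. (\<integral>\<^sup>+s. indicator S (x + s *\<^sub>R e) * indicator {0..1} s \<partial>lborel) \<partial>lborel)"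
    by (rule lborel_pair.Fubini') measurable
  also have "\<dots> = 0" unfolding zero by simp
  finally have "emeasure lborel S = 0" .
  then have "AE x in lborel. x \<notin> S" by (intro AE_not_in) auto
  then show ?thesis
    unfolding torus_measure_def
    by (subst AE_restrict_space_iff) (auto simp: S_def elim: eventually_mono)
qed

text \<open>The positive and the negative part of g are densities of two finite measures with the
  same distribution function, hence of the same measure; uniqueness of densities concludes, in place
  of differentiating the integral.\<close>

lemma AE_zero_of_indefinite_integral:
  fixes g :: "real \<Rightarrow> real"
  assumes g: "set_integrable lborel {0<..1} g" and zero: "\<And>y. y \<in> {0..1} \<Longrightarrow> (LBINT z:{0<..y}. g z) = 0"
  shows "AE u in lborel. u \<in> {0<..1} \<longrightarrow> g u = 0"
proof -
  define G where "G u = indicator {0<..1} u * g u" for u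
  have G: "integrable lborel G" using g by (simp add: set_integrable_def G_def[abs_def])
  have [measurable]: "G \<in> borel_measurable borel" using borel_measurable_integrable[OF G] by simp
  define A B where "A u = max 0 (G u)" and "B u = max 0 (- G u)" for u
  have [measurable]: "A \<in> borel_measurable borel" "B \<in> borel_measurable borel"
    unfolding A_def B_def by measurable
  have AB: "integrable lborel A" "integrable lborel B" "\<And>u. A u \<ge> 0" "\<And>u. B u \<ge> 0" "\<And>u. A u - B u = G u"
    using G unfolding A_def B_def by (auto intro!: integrable_max)
  have fin: "finite_borel_measure (density lborel (\<lambda>u. ennreal (C u)))" if "integrable lborel C" "\<And>u. C u \<ge> 0" for C
  proof (rule finite_borel_measure.intro)
    show "finite_measure (density lborel (\<lambda>u. ennreal (C u)))"
    proof (rule finite_measureI)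
      have "emeasure (density lborel (\<lambda>u. ennreal (C u))) UNIV = ennreal (integral\<^sup>L lborel C)"
        using that by (subst emeasure_density) (auto simp: nn_integral_eq_integral)
      then show "emeasure (density lborel (\<lambda>u. ennreal (C u))) (space (density lborel (\<lambda>u. ennreal (C u)))) \<noteq> \<infinity>"
        by simp
    qed
  qed (simp add: finite_borel_measure_axioms_def)
  have cdf: "cdf (density lborel (\<lambda>u. ennreal (C u))) y = (LBINT u:{..y}. C u)"
    if "integrable lborel C" "\<And>u. C u \<ge> 0" for C y
  proof -
    have C [measurable]: "C \<in> borel_measurable borel" using borel_measurable_integrable[OF that(1)] by simp
    have "integrable lborel (\<lambda>u. indicator {..y} u * C u)"
      using integrable_mult_indicator[OF _ that(1), of "{..y}"] by simp
    then have "emeasure (density lborel (\<lambda>u. ennreal (C u))) {..y} = ennreal (LBINT u:{..y}. C u)"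
      using that(2)
      by (subst emeasure_density)
         (auto simp: set_lebesgue_integral_def nn_integral_eq_integral[symmetric] indicator_def intro!: nn_integral_cong)
    moreover have "(LBINT u:{..y}. C u) \<ge> 0" using that(2)
      unfolding set_lebesgue_integral_def by (intro integral_nonneg_AE) auto
    ultimately show ?thesis by (simp add: cdf_def measure_def)
  qed
  have Gy: "(LBINT u:{..y}. G u) = 0" for y
  proof -
    \<comment> \<open>G vanishes outside (0, 1], so clamping y to [0, 1] does not change the
      integral.\<close>
    have "(LBINT u:{..y}. G u) = (LBINT z:{0<..max 0 (min y 1)}. g z)"
      unfolding set_lebesgue_integral_def
      by (intro Bochner_Integration.integral_cong) (auto simp: G_def indicator_def max_def min_def)
    then show ?thesis using zero[of "max 0 (min y 1)"] by simp
  qed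
  have "cdf (density lborel (\<lambda>u. ennreal (A u))) y = cdf (density lborel (\<lambda>u. ennreal (B u))) y" for y
  proof -
    have "(LBINT u:{..y}. A u) - (LBINT u:{..y}. B u) = (LBINT u:{..y}. A u - B u)"
      using AB(1,2) by (intro set_integral_diff(2)[symmetric]) (auto simp: set_integrable_def intro!: integrable_mult_indicator[where 'b = real, simplified])
    then show ?thesis using AB Gy[of y] by (simp add: cdf)
  qed
  then have "density lborel (\<lambda>u. ennreal (A u)) = density lborel (\<lambda>u. ennreal (B u))"
    using AB by (intro cdf_unique' fin ext) auto
  then have "AE u in lborel. ennreal (A u) = ennreal (B u)"
    by (intro sigma_finite_measure.density_unique[OF sigma_finite_lborel]) auto
  then show ?thesis
  proof eventually_elim
    case (elim u)
    then have "A u = B u" using AB by simp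
    then show ?case using AB(5)[of u] by (auto simp: G_def)
  qed
qed

section \<open>One-dimensional operators on the circle\<close>

lemma L2_circle_integrable:
  assumes "g \<in> L2_circle"
  shows "set_integrable lborel {0<..1} g"
proof -
  have [measurable]: "g \<in> borel_measurable borel" and i: "set_integrable lborel {0<..1} (\<lambda>u. (g u)\<^sup>2)"
    using assms by (auto simp: L2_circle_def)
  have "set_integrable lborel {0<..1::real} (\<lambda>u. 1 :: real)"
    unfolding set_integrable_def by simp
  then have "set_integrable lborel {0<..1} (\<lambda>u. 1 + (g u)\<^sup>2)"
    using i by (intro set_integral_add)
  then show ?thesis
    unfolding set_integrable_def
  proof (rule Bochner_Integration.integrable_bound)
    show "AE u in lborel. norm (indicator {0<..1} u *\<^sub>R g u) \<le> norm (indicator {0<..1} u *\<^sub>R (1 + (g u)\<^sup>2))"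
    proof (rule AE_I2)
      fix u
      have "0 \<le> (\<bar>g u\<bar> - 1)\<^sup>2" by simp
      then have "2 * \<bar>g u\<bar> \<le> 1 + (g u)\<^sup>2" by (simp add: power2_diff)
      then show "norm (indicator {0<..1} u *\<^sub>R g u) \<le> norm (indicator {0<..1} u *\<^sub>R (1 + (g u)\<^sup>2))"
        by (auto simp: indicator_def)
    qed
  qed simp
qed

lemma L2_circle_lin:
  assumes f: "f \<in> L2_circle" and g: "g \<in> L2_circle"
  shows "(\<lambda>u. a * f u + g u) \<in> L2_circle"
proof -
  have [measurable]: "f \<in> borel_measurable borel" "g \<in> borel_measurable borel"
    and i: "set_integrable lborel {0<..1} (\<lambda>u. (f u)\<^sup>2)" "set_integrable lborel {0<..1} (\<lambda>u. (g u)\<^sup>2)"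
    using f g by (auto simp: L2_circle_def)
  have "set_integrable lborel {0<..1} (\<lambda>u. 2 * a\<^sup>2 * (f u)\<^sup>2 + 2 * (g u)\<^sup>2)"
    using i by (intro set_integral_add set_integrable_mult_right) auto
  then have "set_integrable lborel {0<..1} (\<lambda>u. (a * f u + g u)\<^sup>2)"
    unfolding set_integrable_def
  proof (rule Bochner_Integration.integrable_bound)
    show "AE u in lborel. norm (indicator {0<..1} u *\<^sub>R (a * f u + g u)\<^sup>2)
        \<le> norm (indicator {0<..1} u *\<^sub>R (2 * a\<^sup>2 * (f u)\<^sup>2 + 2 * (g u)\<^sup>2))"
    proof (rule AE_I2)
      fix u
      have "0 \<le> (a * f u - g u)\<^sup>2" by simp
      then have "(a * f u + g u)\<^sup>2 \<le> 2 * a\<^sup>2 * (f u)\<^sup>2 + 2 * (g u)\<^sup>2"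
        by (simp add: power2_diff power2_sum power_mult_distrib)
      then show "norm (indicator {0<..1} u *\<^sub>R (a * f u + g u)\<^sup>2)
        \<le> norm (indicator {0<..1} u *\<^sub>R (2 * a\<^sup>2 * (f u)\<^sup>2 + 2 * (g u)\<^sup>2))"
        by (auto simp: indicator_def intro: order_trans[OF _ abs_ge_self])
    qed
  qed simp
  then show ?thesis using f g by (simp add: L2_circle_def)
qed

lemma primitive_continuous:
  fixes g :: "real \<Rightarrow> real"
  assumes g: "set_integrable lborel {0<..1} g"
  shows "continuous_on {0..1} (\<lambda>y. LBINT z:{0<..y}. g z)"
proof -
  define G where "G u = indicator {0<..1} u * g u" for u
  have G: "integrable lborel G" using g by (simp add: set_integrable_def G_def[abs_def])
  have GS: "set_integrable lborel {0..y} G" for y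
    unfolding set_integrable_def by (intro integrable_mult_indicator G) auto
  have eq: "(LBINT z:{0<..y}. g z) = integral {0..y} G" if "y \<in> {0..1}" for y
  proof -
    have "(LBINT z:{0<..y}. g z) = (LBINT z:{0..y}. G z)"
      unfolding set_lebesgue_integral_def
      by (intro Bochner_Integration.integral_cong) (use that in \<open>auto simp: G_def indicator_def\<close>)
    also have "\<dots> = integral {0..y} G" by (rule set_borel_integral_eq_integral(2)[OF GS])
    finally show ?thesis .
  qed
  have "continuous_on {0..1} (\<lambda>y. integral {0..y} G)"
    by (rule indefinite_integral_continuous_1) (rule set_borel_integral_eq_integral(1)[OF GS])
  then show ?thesis using eq by (subst continuous_on_cong[OF refl]) auto
qed

locale stieltjes =
  fixes w :: "real \<Rightarrow> real"
  assumes w_mono: "strict_mono w" and w_cont: "\<And>u. continuous (at_right u) w"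
begin

lemma emeasure_w: "a \<le> b \<Longrightarrow> emeasure (interval_measure w) {a<..b} = ennreal (w b - w a)"
  using w_mono w_cont by (intro emeasure_interval_measure_Ioc) (auto dest: strict_monoD intro: less_imp_le simp: strict_mono_less_eq)

lemma measure_w: "a \<le> b \<Longrightarrow> measure (interval_measure w) {a<..b} = w b - w a"
  using emeasure_w[of a b] w_mono by (simp add: measure_def strict_mono_less_eq)

lemma continuous_integrable_w:
  assumes h: "continuous_on {0..1} h" and ab: "0 \<le> a" "b \<le> 1"
  shows "set_integrable (interval_measure w) {a<..b} (h :: real \<Rightarrow> real)"
proof (cases "a \<le> b")
  case True
  have "compact (h ` {0..1})" using h by (intro compact_continuous_image) auto
  from compact_imp_bounded[OF this] obtain B where "\<forall>y\<in>h ` {0..1}. norm y \<le> B"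
    unfolding bounded_iff by blast
  then have B: "\<bar>h u\<bar> \<le> B" if "u \<in> {0..1}" for u using that by auto
  have m0: "(\<lambda>u. indicator {0..1} u *\<^sub>R h u) \<in> borel_measurable borel"
    using h by (intro borel_measurable_continuous_on_indicator) auto
  have "(\<lambda>u. indicator {a<..b} u *\<^sub>R (indicator {0..1} u *\<^sub>R h u)) \<in> borel_measurable borel"
    using m0 by measurable
  then have m: "(\<lambda>u. indicator {a<..b} u *\<^sub>R h u) \<in> borel_measurable borel"
    by (rule measurable_cong[THEN iffD1, rotated]) (use ab in \<open>auto simp: indicator_def\<close>)
  show ?thesis
    unfolding set_integrable_def
  proof (rule Bochner_Integration.integrable_bound)
    show "integrable (interval_measure w) (\<lambda>u. indicator {a<..b} u *\<^sub>R B)"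
      using emeasure_w[OF True] by (intro integrable_scaleR_left) auto
    show "(\<lambda>u. indicator {a<..b} u *\<^sub>R h u) \<in> borel_measurable (interval_measure w)" using m by simp
    show "AE u in interval_measure w. norm (indicator {a<..b} u *\<^sub>R h u) \<le> norm (indicator {a<..b} u *\<^sub>R B)"
      using B ab by (intro AE_I2) (auto simp: indicator_def intro: order_trans[OF _ abs_ge_self])
  qed
qed (simp add: set_integrable_def)

lemma primitive_integrable_w:
  "g \<in> L2_circle \<Longrightarrow> x \<in> {0..1} \<Longrightarrow> set_integrable (interval_measure w) {0<..x} (\<lambda>y. LBINT z:{0<..y}. g z)"
  by (intro continuous_integrable_w primitive_continuous L2_circle_integrable) auto

lemma const_integrable_w: "x \<in> {0..1} \<Longrightarrow> set_integrable (interval_measure w) {0<..x} (\<lambda>y. c :: real)"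
  by (intro continuous_integrable_w) auto

lemma LW_graph_lin:
  assumes f: "LW_graph w f g" and f': "LW_graph w f' g'"
  shows "LW_graph w (\<lambda>u. r * f u + f' u) (\<lambda>u. r * g u + g' u)"
proof -
  have g: "g \<in> L2_circle" "g' \<in> L2_circle" using f f' by (auto simp: LW_graph_def)
  note gi = g[THEN L2_circle_integrable]
  have gy: "set_integrable lborel {0<..y} g" "set_integrable lborel {0<..y} g'" if "y \<in> {0..1}" for y
    using that by (auto intro!: set_integrable_subset[OF gi(1)] set_integrable_subset[OF gi(2)])
  have lin: "(LBINT z:{0<..y}. r * g z + g' z) = r * (LBINT z:{0<..y}. g z) + (LBINT z:{0<..y}. g' z)"
    if "y \<in> {0..1}" for y
    using gy[OF that] by (subst set_integral_add(2)) (auto intro!: set_integrable_mult_right)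
  obtain a c where ac: "(LINT y:{0<..1}|interval_measure w. c + (LBINT z:{0<..y}. g z)) = 0"
    "\<And>x. x \<in> {0..1} \<Longrightarrow> f x = a + c * w x + (LINT y:{0<..x}|interval_measure w. (LBINT z:{0<..y}. g z))"
    using f unfolding LW_graph_def by blast
  obtain a' c' where ac': "(LINT y:{0<..1}|interval_measure w. c' + (LBINT z:{0<..y}. g' z)) = 0"
    "\<And>x. x \<in> {0..1} \<Longrightarrow> f' x = a' + c' * w x + (LINT y:{0<..x}|interval_measure w. (LBINT z:{0<..y}. g' z))"
    using f' unfolding LW_graph_def by blast
  have cong: "(LINT y:{0<..x}|interval_measure w. C + (LBINT z:{0<..y}. r * g z + g' z))
     = (LINT y:{0<..x}|interval_measure w. C + (r * (LBINT z:{0<..y}. g z) + (LBINT z:{0<..y}. g' z)))"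
    if "x \<in> {0..1}" for x C
    unfolding set_lebesgue_integral_def
    by (intro Bochner_Integration.integral_cong refl)
       (use that lin[unfolded set_lebesgue_integral_def] in \<open>auto simp: indicator_def\<close>)
  note I = primitive_integrable_w[OF g(1)] primitive_integrable_w[OF g(2)]
  have H1: "(LINT y:{0<..1}|interval_measure w. (r * c + c') + (LBINT z:{0<..y}. r * g z + g' z)) = 0"
  proof -
    have "(LINT y:{0<..1}|interval_measure w. (r * c + c') + (LBINT z:{0<..y}. r * g z + g' z))
      = (LINT y:{0<..1}|interval_measure w. r * (c + (LBINT z:{0<..y}. g z)) + (c' + (LBINT z:{0<..y}. g' z)))"
      by (subst cong) (auto simp: algebra_simps)
    also have "\<dots> = r * (LINT y:{0<..1}|interval_measure w. c + (LBINT z:{0<..y}. g z))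
       + (LINT y:{0<..1}|interval_measure w. c' + (LBINT z:{0<..y}. g' z))"
      using I[of 1] const_integrable_w[of 1]
      by (subst set_integral_add(2)) (auto intro!: set_integrable_mult_right set_integral_add)
    finally show ?thesis using ac(1) ac'(1) by simp
  qed
  have H2: "r * f x + f' x = (r * a + a') + (r * c + c') * w x
        + (LINT y:{0<..x}|interval_measure w. (LBINT z:{0<..y}. r * g z + g' z))" if x: "x \<in> {0..1}" for x
  proof -
      have "(LINT y:{0<..x}|interval_measure w. (LBINT z:{0<..y}. r * g z + g' z))
        = r * (LINT y:{0<..x}|interval_measure w. (LBINT z:{0<..y}. g z))
         + (LINT y:{0<..x}|interval_measure w. (LBINT z:{0<..y}. g' z))"
        using I[OF x] cong[OF x, of 0] by (simp add: set_integral_add(2) set_integrable_mult_right)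
      then show ?thesis
        using ac(2)[OF x] ac'(2)[OF x] by (simp add: algebra_simps)
  qed
  show ?thesis
    unfolding LW_graph_def
  proof (intro conjI)
    show "\<forall>u. r * f (u + 1) + f' (u + 1) = r * f u + f' u" using f f' by (auto simp: LW_graph_def)
    show "(\<lambda>u. r * g u + g' u) \<in> L2_circle" by (rule L2_circle_lin[OF g])
    show "(LBINT z:{0<..1}. r * g z + g' z) = 0" using f f' lin[of 1] by (auto simp: LW_graph_def)
    show "\<exists>a c. (LINT y:{0<..1}|interval_measure w. c + (LBINT z:{0<..y}. r * g z + g' z)) = 0 \<and>
        (\<forall>x\<in>{0..1}. r * f x + f' x = a + c * w x
          + (LINT y:{0<..x}|interval_measure w. (LBINT z:{0<..y}. r * g z + g' z)))"
      by (rule exI[of _ "r * a + a'"], rule exI[of _ "r * c + c'"]) (use H1 H2 in blast)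
  qed
qed

text \<open>This makes the operator single-valued. The function h = c + primitive of g is continuous
  and its dw-integral over every (x, y] vanishes; as dw charges every such interval, h = 0 on (0,
  1].\<close>

lemma LW_graph_zero_unique:
  assumes "LW_graph w (\<lambda>u. 0) g"
  shows "AE u in lborel. u \<in> {0<..1} \<longrightarrow> g u = 0"
proof -
  have g: "g \<in> L2_circle" and g1: "(LBINT z:{0<..1}. g z) = 0" using assms by (auto simp: LW_graph_def)
  obtain a c where ac: "\<And>x. x \<in> {0..1} \<Longrightarrow> 0 = a + c * w x + (LINT y:{0<..x}|interval_measure w. (LBINT z:{0<..y}. g z))"
    using assms unfolding LW_graph_def by blast
  define h where "h y = c + (LBINT z:{0<..y}. g z)" for y
  have hc: "continuous_on {0..1} h"
    unfolding h_def using L2_circle_integrable[OF g] by (intro continuous_intros primitive_continuous)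
  have hI: "set_integrable (interval_measure w) {x<..y} h" if "0 \<le> x" "y \<le> 1" for x y
    by (rule continuous_integrable_w[OF hc that])
  have int0: "(LINT y:{0<..x}|interval_measure w. h y) = 0" if x: "x \<in> {0..1}" for x
  proof -
    have "(LINT y:{0<..x}|interval_measure w. h y)
      = (LINT y:{0<..x}|interval_measure w. c) + (LINT y:{0<..x}|interval_measure w. (LBINT z:{0<..y}. g z))"
      unfolding h_def using primitive_integrable_w[OF g x] const_integrable_w[OF x] by (intro set_integral_add(2))
    also have "(LINT y:{0<..x}|interval_measure w. c) = c * (w x - w 0)"
      using measure_w[of 0 x] emeasure_w[of 0 x] x by (simp add: set_lebesgue_integral_def)
    finally show ?thesis using ac[OF x] ac[of 0] by (simp add: set_lebesgue_integral_def algebra_simps)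
  qed
  have int: "(LINT y:{x<..y}|interval_measure w. h y) = 0" if xy: "0 \<le> x" "x \<le> y" "y \<le> 1" for x y
  proof -
    have "{0<..y} = {0<..x} \<union> {x<..y}" using xy by auto
    then have "(LINT y:{0<..y}|interval_measure w. h y)
      = (LINT y:{0<..x}|interval_measure w. h y) + (LINT y:{x<..y}|interval_measure w. h y)"
      using hI[of 0 x] hI[of x y] xy by (simp add: set_integral_Un)
    then show ?thesis using int0[of x] int0[of y] xy by simp
  qed
  have h0: "h y = 0" if y: "y \<in> {0<..1}" for y
  proof (rule ccontr)
    assume nz: "h y \<noteq> 0"
    have "continuous (at y within {0..1}) h" using hc y by (auto simp: continuous_on_eq_continuous_within)
    from this[unfolded continuous_within_eps_delta, rule_format, of "\<bar>h y\<bar> / 2"]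
    obtain d where d: "d > 0" "\<And>z. z \<in> {0..1} \<Longrightarrow> \<bar>z - y\<bar> < d \<Longrightarrow> \<bar>h z - h y\<bar> < \<bar>h y\<bar> / 2"
      using nz by (auto simp: dist_real_def)
    \<comment> \<open>The interval (x, y] approaches y from the left, so it is available also at y =
      1; strict monotonicity of w gives it positive mass.\<close>
    define x where "x = max 0 (y - d / 2)"
    have x: "0 \<le> x" "x < y" "y - d < x" using y d(1) by (auto simp: x_def)
    have low: "(h y)\<^sup>2 / 2 \<le> h y * h z" if z: "z \<in> {x<..y}" for z
    proof -
      have "\<bar>h z - h y\<bar> \<le> \<bar>h y\<bar> / 2" using d(2)[of z] z x y by auto
      then have "\<bar>h y\<bar> * \<bar>h z - h y\<bar> \<le> \<bar>h y\<bar> * (\<bar>h y\<bar> / 2)" by (intro mult_left_mono) auto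
      then have "\<bar>h y * (h z - h y)\<bar> \<le> (h y)\<^sup>2 / 2" by (simp add: abs_mult power2_eq_square)
      moreover have "h y * (h z - h y) = h y * h z - (h y)\<^sup>2" by (simp add: right_diff_distrib power2_eq_square)
      ultimately show ?thesis by linarith
    qed
    have "0 < (h y)\<^sup>2 / 2 * (w y - w x)"
      using nz x strict_monoD[OF w_mono x(2)] by (intro mult_pos_pos) auto
    also have "\<dots> = (LINT z:{x<..y}|interval_measure w. (h y)\<^sup>2 / 2)"
      using measure_w[of x y] emeasure_w[of x y] x by (simp add: set_lebesgue_integral_def)
    also have "\<dots> \<le> (LINT z:{x<..y}|interval_measure w. h y * h z)"
      using low x y
      by (intro set_integral_mono continuous_integrable_w continuous_on_const continuous_on_mult_left hc) auto
    also have "\<dots> = h y * (LINT z:{x<..y}|interval_measure w. h z)" by simp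
    also have "\<dots> = 0" using int[of x y] x y by simp
    finally show False by simp
  qed
  \<comment> \<open>At y = 1 the primitive is the integral of g over the whole circle, which is 0
    for members of the graph.\<close>
  have "c = 0" using h0[of 1] g1 by (simp add: h_def)
  show ?thesis
  proof (rule AE_zero_of_indefinite_integral[OF L2_circle_integrable[OF g]])
    fix y :: real assume "y \<in> {0..1}"
    then show "(LBINT z:{0<..y}. g z) = 0"
      using h0[of y] \<open>c = 0\<close> by (cases "y = 0") (auto simp: h_def set_lebesgue_integral_def)
  qed
qed

end

section \<open>Spectral coordinates\<close>

lemma space_torus [simp]: "space torus_measure = cube"
  by (simp add: torus_measure_def space_restrict_space)

lemma borel_measurable_torus:
  "f \<in> borel_measurable borel \<Longrightarrow> f \<in> borel_measurable torus_measure"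
  unfolding torus_measure_def by (rule measurable_restrict_space1) simp

lemma L2_measurable: "f \<in> L2 torus_measure \<Longrightarrow> f \<in> borel_measurable torus_measure"
  by (auto simp: L2_def intro: borel_measurable_torus)

lemma L2_sq_integrable: "f \<in> L2 torus_measure \<Longrightarrow> integrable torus_measure (\<lambda>x. (f x)\<^sup>2)"
  by (auto simp: L2_def)

lemma L2_mult_integrable:
  assumes f: "f \<in> L2 torus_measure" and g: "g \<in> L2 torus_measure"
  shows "integrable torus_measure (\<lambda>x. f x * g x)"
proof (rule Bochner_Integration.integrable_bound)
  show "integrable torus_measure (\<lambda>x. (f x)\<^sup>2 + (g x)\<^sup>2)" using f g by (intro Bochner_Integration.integrable_add L2_sq_integrable)
  show "(\<lambda>x. f x * g x) \<in> borel_measurable torus_measure"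
    using L2_measurable[OF f] L2_measurable[OF g] by measurable
  show "AE x in torus_measure. norm (f x * g x) \<le> norm ((f x)\<^sup>2 + (g x)\<^sup>2)"
  proof (rule AE_I2)
    fix x
    have "0 \<le> (\<bar>f x\<bar> - \<bar>g x\<bar>)\<^sup>2" by simp
    then have "2 * (\<bar>f x\<bar> * \<bar>g x\<bar>) \<le> (f x)\<^sup>2 + (g x)\<^sup>2" by (simp add: power2_diff)
    moreover have "0 \<le> \<bar>f x\<bar> * \<bar>g x\<bar>" by simp
    ultimately show "norm (f x * g x) \<le> norm ((f x)\<^sup>2 + (g x)\<^sup>2)" unfolding real_norm_def abs_mult by linarith
  qed
qed

lemma L2_lin:
  assumes f: "f \<in> L2 torus_measure" and g: "g \<in> L2 torus_measure"
  shows "(\<lambda>x. a * f x + g x) \<in> L2 torus_measure"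
proof -
  have "integrable torus_measure (\<lambda>x. a\<^sup>2 * (f x)\<^sup>2 + 2 * a * (f x * g x) + (g x)\<^sup>2)"
    using f g by (intro Bochner_Integration.integrable_add integrable_mult_right L2_sq_integrable L2_mult_integrable)
  moreover have "(a * f x + g x)\<^sup>2 = a\<^sup>2 * (f x)\<^sup>2 + 2 * a * (f x * g x) + (g x)\<^sup>2" for x
    by (simp add: power2_sum power_mult_distrib)
  ultimately show ?thesis using f g by (auto simp: L2_def torus_fun_def)
qed

lemma L2_zero: "(\<lambda>x. 0) \<in> L2 torus_measure"
  by (simp add: L2_def torus_fun_def)

lemma L2_scale: "f \<in> L2 torus_measure \<Longrightarrow> (\<lambda>x. a * f x) \<in> L2 torus_measure"
  using L2_lin[of f "\<lambda>x. 0" a] L2_zero by simp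

lemma L2_diff: "f \<in> L2 torus_measure \<Longrightarrow> g \<in> L2 torus_measure \<Longrightarrow> (\<lambda>x. f x - g x) \<in> L2 torus_measure"
  using L2_lin[of g f "-1"] by simp

lemma L2_sum: "finite K \<Longrightarrow> (\<And>k. k \<in> K \<Longrightarrow> f k \<in> L2 torus_measure) \<Longrightarrow> (\<lambda>x. \<Sum>k\<in>K. c k * f k x) \<in> L2 torus_measure"
  by (induction K rule: finite_induct) (auto intro!: L2_lin L2_zero)

section \<open>The tensor product basis\<close>

locale spectral_basis =
  fixes W :: "'d::finite \<Rightarrow> real \<Rightarrow> real" and E :: "'d \<Rightarrow> (real \<Rightarrow> real) set"
    and \<phi> :: "nat \<Rightarrow> real ^ 'd \<Rightarrow> real" and \<alpha> :: "nat \<Rightarrow> real"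
  assumes cond: "conductance W"
    and eig: "\<And>k. eigenbasis (W k) (E k)"
    and spec: "spectral_enumeration W E \<phi> \<alpha>"
begin

lemma stieltjes_W: "stieltjes (W k)"
  using cond by unfold_locales (auto simp: conductance_def)

lemma E_L2: "f \<in> E k \<Longrightarrow> f \<in> L2_circle"
  using eig[of k] by (auto simp: eigenbasis_def)

lemma E_orth: "f \<in> E k \<Longrightarrow> g \<in> E k \<Longrightarrow> ip_circle f g = (if f = g then 1 else 0)"
  using eig[of k] unfolding eigenbasis_def by blast

lemma phi_AW: "k \<ge> 1 \<Longrightarrow> \<phi> k \<in> AW E"
  using spec by (auto simp: spectral_enumeration_def bij_betw_def)

lemma AW_phi: "g \<in> AW E \<Longrightarrow> \<exists>k\<ge>1. g = \<phi> k"
  using spec by (fastforce simp: spectral_enumeration_def bij_betw_def)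

lemma phi_inj: "k \<ge> 1 \<Longrightarrow> l \<ge> 1 \<Longrightarrow> \<phi> k = \<phi> l \<Longrightarrow> k = l"
  using spec by (auto simp: spectral_enumeration_def bij_betw_def inj_on_def)

definition factor :: "nat \<Rightarrow> 'd \<Rightarrow> real \<Rightarrow> real" where
  "factor k = (SOME f. (\<forall>i. f i \<in> E i) \<and> \<phi> k = (\<lambda>x. \<Prod>i\<in>UNIV. f i (x $ i)))"

lemma factor: "k \<ge> 1 \<Longrightarrow> factor k i \<in> E i" "k \<ge> 1 \<Longrightarrow> \<phi> k = (\<lambda>x. \<Prod>i\<in>UNIV. factor k i (x $ i))"
proof -
  have "(\<forall>i. factor k i \<in> E i) \<and> \<phi> k = (\<lambda>x. \<Prod>i\<in>UNIV. factor k i (x $ i))" if "k \<ge> 1"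
  proof -
    have "\<exists>f. (\<forall>i. f i \<in> E i) \<and> \<phi> k = (\<lambda>x. \<Prod>i\<in>UNIV. f i (x $ i))"
      using phi_AW[OF that] unfolding AW_def by blast
    from someI_ex[OF this] show ?thesis unfolding factor_def .
  qed
  then show "k \<ge> 1 \<Longrightarrow> factor k i \<in> E i" "k \<ge> 1 \<Longrightarrow> \<phi> k = (\<lambda>x. \<Prod>i\<in>UNIV. factor k i (x $ i))" by auto
qed

lemma E_mult_integrable: "f \<in> E k \<Longrightarrow> g \<in> E k \<Longrightarrow> set_integrable lborel {0<..1} (\<lambda>u. f u * g u)"
proof -
  assume "f \<in> E k" "g \<in> E k"
  then have fg: "f \<in> L2_circle" "g \<in> L2_circle" using E_L2 by auto
  have s: "(\<lambda>u. 1 * f u + g u) \<in> L2_circle" by (rule L2_circle_lin[OF fg])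
  have "set_integrable lborel {0<..1} (\<lambda>u. 1/2 * ((1 * f u + g u)\<^sup>2 - (f u)\<^sup>2 - (g u)\<^sup>2))"
    using fg s by (intro set_integrable_mult_right set_integral_diff) (auto simp: L2_circle_def)
  moreover have "1/2 * ((1 * f u + g u)\<^sup>2 - (f u)\<^sup>2 - (g u)\<^sup>2) = f u * g u" for u
    by (simp add: power2_sum)
  ultimately show ?thesis by simp
qed

lemma phi_L2: assumes k: "k \<ge> 1" shows "\<phi> k \<in> L2 torus_measure"
  unfolding L2_def
proof (intro CollectI conjI)
  note fac = factor(1)[OF k]
  have per: "factor k i (u + 1) = factor k i u" and [measurable]: "factor k i \<in> borel_measurable borel" for i u
    using E_L2[OF fac[of i]] by (auto simp: L2_circle_def)
  show "torus_fun (\<phi> k)"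
    unfolding torus_fun_def factor(2)[OF k]
    by (intro allI prod.cong refl) (auto simp: axis_def per)
  show "\<phi> k \<in> borel_measurable borel" unfolding factor(2)[OF k] by measurable
  have "integrable torus_measure (\<lambda>x. \<Prod>i\<in>UNIV. factor k i (x $ i) * factor k i (x $ i))"
    by (rule torus_integral_prod(1)[where h = "\<lambda>i u. factor k i u * factor k i u"]) (rule E_mult_integrable[OF fac fac])
  then show "integrable torus_measure (\<lambda>x. (\<phi> k x)\<^sup>2)"
    unfolding factor(2)[OF k] power2_eq_square prod.distrib .
qed

lemma phi_orth:
  assumes k: "k \<ge> 1" and l: "l \<ge> 1"
  shows "(\<integral>x. \<phi> k x * \<phi> l x \<partial>torus_measure) = (if k = l then 1 else 0)"
proof -
  have "(\<integral>x. \<phi> k x * \<phi> l x \<partial>torus_measure) = (\<integral>x. (\<Prod>i\<in>UNIV. factor k i (x $ i) * factor l i (x $ i)) \<partial>torus_measure)"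
    unfolding factor(2)[OF k] factor(2)[OF l] prod.distrib ..
  also have "\<dots> = (\<Prod>i\<in>UNIV. LBINT u:{0<..1}. factor k i u * factor l i u)"
    by (rule torus_integral_prod(2)[where h = "\<lambda>i u. factor k i u * factor l i u"])
       (rule E_mult_integrable[OF factor(1)[OF k] factor(1)[OF l]])
  also have "\<dots> = (\<Prod>i\<in>UNIV. if factor k i = factor l i then 1 else 0)"
    using E_orth[OF factor(1)[OF k] factor(1)[OF l]] by (simp add: ip_circle_def)
  also have "\<dots> = (if k = l then 1 else 0)"
  proof (cases "k = l")
    case False
    then have "\<phi> k \<noteq> \<phi> l" using phi_inj[OF k l] by auto
    then have "factor k \<noteq> factor l"
      using factor(2)[OF k] factor(2)[OF l] by auto
    then obtain i where "factor k i \<noteq> factor l i" by (auto simp: fun_eq_iff)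
    then have "(\<Prod>i\<in>UNIV. if factor k i = factor l i then 1 else 0 :: real) = 0"
      by (subst prod_zero_iff) auto
    then show ?thesis using False by simp
  qed simp
  finally show ?thesis .
qed

text \<open>The basis is enumerated from 1 and \<phi> 0 is arbitrary; the value 0 at index 0 allows
  series over all natural numbers.\<close>

definition coef :: "(real ^ 'd \<Rightarrow> real) \<Rightarrow> nat \<Rightarrow> real" where
  "coef f k = (if k = 0 then 0 else (\<integral>x. f x * \<phi> k x \<partial>torus_measure))"

lemma coef_lin:
  "f \<in> L2 torus_measure \<Longrightarrow> g \<in> L2 torus_measure \<Longrightarrow> coef (\<lambda>x. a * f x + g x) k = a * coef f k + coef g k"
  using L2_mult_integrable[OF _ phi_L2, of f k] L2_mult_integrable[OF _ phi_L2, of g k]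
  by (simp add: coef_def distrib_right mult.assoc)

lemma coef_zero: "coef (\<lambda>x. 0) k = 0"
  by (simp add: coef_def)

lemma coef_diff: "f \<in> L2 torus_measure \<Longrightarrow> g \<in> L2 torus_measure \<Longrightarrow> coef (\<lambda>x. f x - g x) k = coef f k - coef g k"
  using coef_lin[of g f "-1" k] by simp

lemma coef_scale: "f \<in> L2 torus_measure \<Longrightarrow> coef (\<lambda>x. a * f x) k = a * coef f k"
  using coef_lin[of f "\<lambda>x. 0" a k] by (simp add: L2_zero coef_zero)

lemma coef_phi: "l \<ge> 1 \<Longrightarrow> coef (\<phi> l) k = (if k = l then 1 else 0)"
  using phi_orth[of l k] by (auto simp: coef_def)

lemma coef_sum:
  "finite K \<Longrightarrow> (\<And>i. i \<in> K \<Longrightarrow> f i \<in> L2 torus_measure) \<Longrightarrow> coef (\<lambda>x. \<Sum>i\<in>K. c i * f i x) k = (\<Sum>i\<in>K. c i * coef (f i) k)"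
proof (induction K rule: finite_induct)
  case empty
  then show ?case by (simp add: coef_zero)
next
  case (insert i K)
  then show ?case using coef_lin[of "f i" "\<lambda>x. \<Sum>i\<in>K. c i * f i x" "c i" k] by (simp add: L2_sum)
qed

definition partial :: "nat \<Rightarrow> (nat \<Rightarrow> real) \<Rightarrow> real ^ 'd \<Rightarrow> real" where
  "partial N a = (\<lambda>x. \<Sum>k\<in>{1..N}. a k * \<phi> k x)"

lemma partial_L2: "partial N a \<in> L2 torus_measure"
  unfolding partial_def by (rule L2_sum) (auto intro: phi_L2)

lemma coef_partial: "coef (partial N a) k = (if k \<in> {1..N} then a k else 0)"
proof -
  have "coef (partial N a) k = (\<Sum>i\<in>{1..N}. a i * coef (\<phi> i) k)"
    unfolding partial_def by (rule coef_sum) (auto intro: phi_L2)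
  also have "\<dots> = (\<Sum>i\<in>{1..N}. if i = k then a i else 0)"
    by (rule sum.cong) (auto simp: coef_phi)
  finally show ?thesis by (simp add: sum.delta)
qed

lemma integral_mult_partial:
  assumes "f \<in> L2 torus_measure"
  shows "(\<integral>x. f x * partial N a x \<partial>torus_measure) = (\<Sum>k\<in>{1..N}. a k * coef f k)"
proof -
  have "(\<integral>x. f x * partial N a x \<partial>torus_measure) = (\<integral>x. (\<Sum>k\<in>{1..N}. a k * (f x * \<phi> k x)) \<partial>torus_measure)"
    unfolding partial_def sum_distrib_left by (simp add: mult_ac)
  also have "\<dots> = (\<Sum>k\<in>{1..N}. \<integral>x. a k * (f x * \<phi> k x) \<partial>torus_measure)"
    by (intro Bochner_Integration.integral_sum integrable_mult_right L2_mult_integrable assms phi_L2) auto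
  also have "\<dots> = (\<Sum>k\<in>{1..N}. a k * coef f k)"
    by (intro sum.cong) (auto simp: coef_def)
  finally show ?thesis .
qed

definition sq :: "(real ^ 'd \<Rightarrow> real) \<Rightarrow> real" where
  "sq f = (\<integral>x. (f x)\<^sup>2 \<partial>torus_measure)"

lemma sq_nonneg: "sq f \<ge> 0"
  unfolding sq_def by (rule integral_nonneg_AE) auto

lemma L2_norm_of_sq: "L2_norm_of torus_measure f = sqrt (sq f)"
  by (simp add: L2_norm_of_def sq_def)

lemma bessel_identity:
  assumes f: "f \<in> L2 torus_measure"
  shows "sq (\<lambda>x. f x - partial N (coef f) x) = sq f - (\<Sum>k\<in>{1..N}. (coef f k)\<^sup>2)"
proof -
  let ?p = "partial N (coef f)"
  have "sq (\<lambda>x. f x - ?p x) = (\<integral>x. (f x)\<^sup>2 - 2 * (f x * ?p x) + ?p x * ?p x \<partial>torus_measure)"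
    unfolding sq_def by (intro Bochner_Integration.integral_cong) (auto simp: power2_eq_square algebra_simps)
  also have "\<dots> = sq f - 2 * (\<integral>x. f x * ?p x \<partial>torus_measure) + (\<integral>x. ?p x * ?p x \<partial>torus_measure)"
    unfolding sq_def using f partial_L2 L2_sq_integrable[OF f] L2_mult_integrable[OF f partial_L2] L2_mult_integrable[OF partial_L2 partial_L2]
    by simp
  also have "(\<integral>x. ?p x * ?p x \<partial>torus_measure) = (\<Sum>k\<in>{1..N}. (coef f k)\<^sup>2)"
    unfolding integral_mult_partial[OF partial_L2] by (intro sum.cong) (auto simp: coef_partial power2_eq_square)
  also have "(\<integral>x. f x * ?p x \<partial>torus_measure) = (\<Sum>k\<in>{1..N}. (coef f k)\<^sup>2)"
    unfolding integral_mult_partial[OF f] by (simp add: power2_eq_square)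
  finally show ?thesis by simp
qed

lemma coef_sq_le:
  assumes "f \<in> L2 torus_measure"
  shows "(coef f k)\<^sup>2 \<le> sq f"
proof (cases "k = 0")
  case False
  then have "(coef f k)\<^sup>2 \<le> (\<Sum>k\<in>{1..k}. (coef f k)\<^sup>2)" by (intro member_le_sum) auto
  then show ?thesis using bessel_identity[OF assms, of k] sq_nonneg[of "\<lambda>x. f x - partial k (coef f) x"] by simp
qed (simp add: coef_def sq_nonneg)

lemma coef_tendsto:
  assumes u: "\<And>i. u i \<in> L2 torus_measure" and f: "f \<in> L2 torus_measure"
    and lim: "(\<lambda>i. sq (\<lambda>x. u i x - f x)) \<longlonglongrightarrow> 0"
  shows "(\<lambda>i. coef (u i) k) \<longlonglongrightarrow> coef f k"
proof (rule LIM_zero_cancel, rule Lim_null_comparison)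
  show "\<forall>\<^sub>F i in sequentially. norm (coef (u i) k - coef f k) \<le> sqrt (sq (\<lambda>x. u i x - f x))"
  proof (rule always_eventually, rule allI)
    fix i
    have "(coef (u i) k - coef f k)\<^sup>2 \<le> sq (\<lambda>x. u i x - f x)"
      using coef_sq_le[OF L2_diff[OF u f], of i k] coef_diff[OF u f, of i k] by simp
    then show "norm (coef (u i) k - coef f k) \<le> sqrt (sq (\<lambda>x. u i x - f x))"
      by (simp add: real_le_rsqrt)
  qed
  show "(\<lambda>i. sqrt (sq (\<lambda>x. u i x - f x))) \<longlonglongrightarrow> 0" using tendsto_real_sqrt[OF lim] by simp
qed

lemma DW_form:
  assumes "u \<in> DW E"
  shows "\<exists>N a. u = partial N a \<and> (\<forall>k. k \<notin> {1..N} \<longrightarrow> a k = 0)"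
proof -
  obtain G c where G: "finite G" "G \<subseteq> AW E" "u = (\<lambda>x. \<Sum>g\<in>G. c g * g x)"
    using assms unfolding DW_def by blast
  have "bij_betw \<phi> {1..} (AW E)" using spec by (simp add: spectral_enumeration_def)
  define K where "K = {k. k \<ge> 1 \<and> \<phi> k \<in> G}"
  have KG: "\<phi> ` K = G" using G(2) AW_phi unfolding K_def by fastforce
  have inj: "inj_on \<phi> K" by (rule inj_onI) (auto simp: K_def intro: phi_inj)
  have fin: "finite K" using finite_image_iff[OF inj] KG G(1) by simp
  define N where "N = Max (insert 0 K)"
  have KN: "K \<subseteq> {1..N}" unfolding N_def using fin by (auto simp: K_def)
  define a where "a k = (if k \<in> K then c (\<phi> k) else 0)" for k
  have "u x = partial N a x" for x
  proof -
    have "u x = (\<Sum>k\<in>K. c (\<phi> k) * \<phi> k x)" unfolding G(3) KG[symmetric] by (simp add: sum.reindex[OF inj])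
    also have "\<dots> = (\<Sum>k\<in>{1..N}. a k * \<phi> k x)"
      using KN by (intro sum.mono_neutral_cong_left) (auto simp: a_def)
    finally show ?thesis by (simp add: partial_def)
  qed
  then show ?thesis using KN by (intro exI[of _ N] exI[of _ a]) (auto simp: a_def)
qed

lemma partial_DW: "partial N a \<in> DW E"
proof -
  have inj: "inj_on \<phi> {1..N}" by (rule inj_onI) (auto intro: phi_inj)
  define c where "c g = a (inv_into {1..N} \<phi> g)" for g
  have "(\<Sum>g\<in>\<phi> ` {1..N}. c g * g x) = partial N a x" for x
    unfolding partial_def by (simp add: sum.reindex[OF inj] c_def inv_into_f_f[OF inj] del: One_nat_def)
  then have "partial N a = (\<lambda>x. \<Sum>g\<in>\<phi> ` {1..N}. c g * g x)" by auto
  then show ?thesis unfolding DW_def using phi_AW by (intro CollectI exI[of _ "\<phi> ` {1..N}"] exI[of _ c]) auto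
qed

lemma DW_L2: "u \<in> DW E \<Longrightarrow> u \<in> L2 torus_measure"
  using DW_form partial_L2 by metis

lemma DW_partial_coef:
  assumes "u \<in> DW E"
  shows "\<exists>N. (\<forall>k>N. coef u k = 0) \<and> (\<forall>n\<ge>N. partial n (coef u) = u)"
proof -
  obtain N a where u: "u = partial N a" "\<And>k. k \<notin> {1..N} \<Longrightarrow> a k = 0" using DW_form[OF assms] by blast
  have c: "coef u k = a k" for k using u by (auto simp: coef_partial)
  have "partial n (coef u) = u" if "n \<ge> N" for n
  proof
    fix x
    have "partial n (coef u) x = (\<Sum>k\<in>{1..n}. a k * \<phi> k x)" by (simp add: partial_def c)
    also have "\<dots> = (\<Sum>k\<in>{1..N}. a k * \<phi> k x)" using that u(2) by (intro sum.mono_neutral_right) auto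
    finally show "partial n (coef u) x = u x" by (simp add: u(1) partial_def)
  qed
  then show ?thesis using c u(2) by (intro exI[of _ N]) auto
qed

end

section \<open>The nuclear space\<close>

lemma suminf_tail_tendsto_zero:
  fixes a :: "nat \<Rightarrow> real"
  assumes a: "summable a"
  shows "summable (\<lambda>k. if k \<le> N then 0 else a k)"
    and "(\<lambda>N. \<Sum>k. if k \<le> N then 0 else a k) \<longlonglongrightarrow> 0"
proof -
  have fin: "(\<lambda>k. if k \<in> {..N} then a k else 0) sums (\<Sum>k\<le>N. a k)" for N
    by (rule sums_If_finite_set) simp
  have eq: "(if k \<le> N then 0 else a k) = a k - (if k \<in> {..N} then a k else 0)" for k N by simp
  have sums: "(\<lambda>k. if k \<le> N then 0 else a k) sums (suminf a - (\<Sum>k\<le>N. a k))" for N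
    unfolding eq by (intro sums_diff summable_sums a fin)
  then show "summable (\<lambda>k. if k \<le> N then 0 else a k)" by (rule sums_summable)
  have "(\<lambda>N. suminf a - (\<Sum>k\<le>N. a k)) \<longlonglongrightarrow> suminf a - suminf a"
    by (intro tendsto_intros summable_LIMSEQ' a)
  moreover have "(\<Sum>k. if k \<le> N then 0 else a k) = suminf a - (\<Sum>k\<le>N. a k)" for N
    using sums_unique[OF sums] by simp
  ultimately show "(\<lambda>N. \<Sum>k. if k \<le> N then 0 else a k) \<longlonglongrightarrow> 0" by simp
qed

context spectral_basis
begin

lemma alpha_nonneg: "k \<ge> 1 \<Longrightarrow> \<alpha> k \<ge> 0"
  using spec unfolding spectral_enumeration_def by (metis order_refl)

text \<open>The product of lambda_k and k. Both enter the n-th norm with the exponent 2 n, so in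
  terms of coefficients this norm is a weighted l2 norm with weight
  \<open>weight k ^ n\<close>.\<close>

definition weight :: "nat \<Rightarrow> real" where "weight k = (1 + \<alpha> k) * real k"

lemma weight_ge: "k \<ge> 1 \<Longrightarrow> weight k \<ge> real k" "k \<ge> 1 \<Longrightarrow> weight k \<ge> 1 + \<alpha> k" "k \<ge> 1 \<Longrightarrow> weight k \<ge> 1"
proof -
  assume k: "k \<ge> 1"
  have a: "\<alpha> k \<ge> 0" "real k \<ge> 1" using alpha_nonneg[OF k] k by auto
  then show 1: "weight k \<ge> real k" "weight k \<ge> 1 + \<alpha> k"
    unfolding weight_def using mult_right_mono[of 1 "1 + \<alpha> k" "real k"] mult_left_mono[of 1 "real k" "1 + \<alpha> k"] by auto
  then show "weight k \<ge> 1" using a by simp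
qed

definition wterm :: "nat \<Rightarrow> (real ^ 'd \<Rightarrow> real) \<Rightarrow> nat \<Rightarrow> real" where
  "wterm n f k = (coef f k)\<^sup>2 * weight k ^ (2 * n)"

lemma wterm_nonneg [simp]: "wterm n f k \<ge> 0"
  unfolding wterm_def by (simp add: power_mult)

lemma wterm_0 [simp]: "wterm n f 0 = 0"
  by (simp add: wterm_def coef_def)

lemma coef_sq_le_wterm: "(coef f k)\<^sup>2 \<le> wterm n f k"
proof (cases "k = 0")
  case False
  then have "1 \<le> weight k ^ (2 * n)" using weight_ge(3)[of k] by simp
  then have "(coef f k)\<^sup>2 * 1 \<le> (coef f k)\<^sup>2 * weight k ^ (2 * n)" by (intro mult_left_mono) auto
  then show ?thesis by (simp add: wterm_def)
qed (simp add: coef_def)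

lemma wterm_mono: "m \<le> n \<Longrightarrow> wterm m f k \<le> wterm n f k"
proof (cases "k = 0")
  case False
  assume "m \<le> n"
  then show ?thesis unfolding wterm_def
    using weight_ge(3)[of k] False by (intro mult_left_mono power_increasing) auto
qed simp

text \<open>Without summability the infinite sum in \<open>norm_n\<close> is a default value; this
  is why every statement on norms below is accompanied by one on summability.\<close>

lemma norm_n_eq:
  assumes "summable (wterm n f)"
  shows "norm_n \<phi> \<alpha> n f = sqrt (\<Sum>k. wterm n f k)"
proof -
  have t: "(L2_norm_of torus_measure (Proj \<phi> k f))\<^sup>2 * (1 + \<alpha> k) ^ (2 * n) * real k ^ (2 * n) = wterm n f k"
    if "k \<in> {1..}" for k
  proof -
    have k: "k \<ge> 1" using that by simp
    have "sq (Proj \<phi> k f) = (\<integral>x. (coef f k)\<^sup>2 * (\<phi> k x * \<phi> k x) \<partial>torus_measure)"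
      unfolding sq_def Proj_def using k
      by (intro Bochner_Integration.integral_cong) (auto simp: coef_def power2_eq_square)
    also have "\<dots> = (coef f k)\<^sup>2" using phi_orth[OF k k] by simp
    finally show ?thesis
      by (simp add: L2_norm_of_sq sq_nonneg wterm_def weight_def power_mult_distrib)
  qed
  have "(wterm n f has_sum (\<Sum>k. wterm n f k)) UNIV"
    using assms by (intro norm_summable_imp_has_sum summable_sums) auto
  then have "(\<Sum>\<^sub>\<infinity>k\<in>UNIV. wterm n f k) = (\<Sum>k. wterm n f k)" by (rule infsumI)
  moreover have "(\<Sum>\<^sub>\<infinity>k\<in>{1..}. wterm n f k) = (\<Sum>\<^sub>\<infinity>k\<in>UNIV. wterm n f k)"
  proof (rule infsum_cong_neutral)
    show "wterm n f k = 0" if "k \<in> UNIV - {1..}" for k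
    proof -
      have "k = 0" using that by auto
      then show ?thesis by simp
    qed
  qed auto
  moreover have "(\<Sum>\<^sub>\<infinity>k\<in>{1..}. (L2_norm_of torus_measure (Proj \<phi> k f))\<^sup>2 * (1 + \<alpha> k) ^ (2 * n) * real k ^ (2 * n))
      = (\<Sum>\<^sub>\<infinity>k\<in>{1..}. wterm n f k)"
    by (rule infsum_cong) (rule t)
  ultimately show ?thesis unfolding norm_n_def by simp
qed

lemma summable_wterm_finite: "(\<And>k. k > N \<Longrightarrow> coef f k = 0) \<Longrightarrow> summable (wterm n f)"
  by (rule summable_finite[of "{..N}"]) (auto simp: wterm_def)

lemma wterm_lin_le:
  assumes "f \<in> L2 torus_measure" "g \<in> L2 torus_measure"
  shows "wterm n (\<lambda>x. a * f x + g x) k \<le> 2 * a\<^sup>2 * wterm n f k + 2 * wterm n g k"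
proof -
  have "0 \<le> (a * coef f k - coef g k)\<^sup>2" by simp
  then have "(a * coef f k + coef g k)\<^sup>2 \<le> 2 * a\<^sup>2 * (coef f k)\<^sup>2 + 2 * (coef g k)\<^sup>2"
    by (simp add: power2_sum power2_diff power_mult_distrib)
  then have "(a * coef f k + coef g k)\<^sup>2 * weight k ^ (2 * n) \<le> (2 * a\<^sup>2 * (coef f k)\<^sup>2 + 2 * (coef g k)\<^sup>2) * weight k ^ (2 * n)"
    by (intro mult_right_mono) (auto simp: power_mult)
  then show ?thesis unfolding wterm_def coef_lin[OF assms] by (simp add: algebra_simps)
qed

lemma summable_wterm_lin:
  assumes "f \<in> L2 torus_measure" "g \<in> L2 torus_measure" "summable (wterm n f)" "summable (wterm n g)"
  shows "summable (wterm n (\<lambda>x. a * f x + g x))"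
proof (rule summable_comparison_test')
  show "summable (\<lambda>k. 2 * a\<^sup>2 * wterm n f k + 2 * wterm n g k)"
    using assms by (intro summable_add summable_mult)
  show "norm (wterm n (\<lambda>x. a * f x + g x) k) \<le> 2 * a\<^sup>2 * wterm n f k + 2 * wterm n g k" if "k \<ge> 0" for k
    using wterm_lin_le[OF assms(1,2)] by simp
qed

definition approx :: "nat \<Rightarrow> (real ^ 'd \<Rightarrow> real) \<Rightarrow> real ^ 'd \<Rightarrow> real" where
  "approx N f = partial N (coef f)"

lemma approx_L2: "approx N f \<in> L2 torus_measure"
  by (simp add: approx_def partial_L2)

lemma coef_approx: "coef (approx N f) k = (if k \<le> N then coef f k else 0)"
  unfolding approx_def coef_partial by (cases "k = 0") (auto simp: coef_def[of f 0])

lemma coef_diff_approx: "f \<in> L2 torus_measure \<Longrightarrow> coef (\<lambda>x. f x - approx N f x) k = (if k \<le> N then 0 else coef f k)"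
  by (simp add: coef_diff approx_L2 coef_approx)

lemma approx_lin:
  "f \<in> L2 torus_measure \<Longrightarrow> g \<in> L2 torus_measure \<Longrightarrow> approx N (\<lambda>x. a * f x + g x) x = a * approx N f x + approx N g x"
  by (simp add: approx_def partial_def coef_lin distrib_right sum.distrib sum_distrib_left mult.assoc)

lemma sq_diff_approx_le: "f \<in> L2 torus_measure \<Longrightarrow> sq (\<lambda>x. f x - approx N f x) \<le> sq f"
  unfolding approx_def bessel_identity by (simp add: sum_nonneg)

lemma sq_lin_le:
  assumes "f \<in> L2 torus_measure" "g \<in> L2 torus_measure"
  shows "sq (\<lambda>x. a * f x + g x) \<le> 2 * a\<^sup>2 * sq f + 2 * sq g"
proof -
  have "sq (\<lambda>x. a * f x + g x) \<le> (\<integral>x. 2 * a\<^sup>2 * (f x)\<^sup>2 + 2 * (g x)\<^sup>2 \<partial>torus_measure)"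
    unfolding sq_def
  proof (rule integral_mono)
    show "integrable torus_measure (\<lambda>x. (a * f x + g x)\<^sup>2)" by (intro L2_sq_integrable L2_lin assms)
    show "integrable torus_measure (\<lambda>x. 2 * a\<^sup>2 * (f x)\<^sup>2 + 2 * (g x)\<^sup>2)"
      using assms by (intro Bochner_Integration.integrable_add integrable_mult_right L2_sq_integrable)
    show "(a * f x + g x)\<^sup>2 \<le> 2 * a\<^sup>2 * (f x)\<^sup>2 + 2 * (g x)\<^sup>2" for x
    proof -
      have "0 \<le> (a * f x - g x)\<^sup>2" by simp
      then show ?thesis by (simp add: power2_sum power2_diff power_mult_distrib)
    qed
  qed
  also have "\<dots> = 2 * a\<^sup>2 * sq f + 2 * sq g"
    unfolding sq_def using assms L2_sq_integrable by (subst Bochner_Integration.integral_add) auto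
  finally show ?thesis .
qed

text \<open>Summability in each norm passes from the Cauchy sequence to its limit. The expansion of
  f converges because f is an L2 limit of finite combinations: truncation reproduces these for large
  N, and the remainder of the difference is no larger than the difference.\<close>

lemma SW_D:
  assumes "f \<in> SW E \<phi> \<alpha>"
  shows "f \<in> L2 torus_measure" "summable (wterm n f)" "(\<lambda>N. sq (\<lambda>x. f x - approx N f x)) \<longlonglongrightarrow> 0"
proof -
  have fn: "f \<in> Sn E \<phi> \<alpha> n" for n using assms by (simp add: SW_def)
  show f: "f \<in> L2 torus_measure" using fn[of 0] by (simp add: Sn_def)
  have "\<forall>n. \<exists>u. (\<forall>i. u i \<in> DW E) \<and>
      (\<forall>\<epsilon>>0. \<exists>I. \<forall>i\<ge>I. \<forall>j\<ge>I. norm_n \<phi> \<alpha> n (\<lambda>x. u i x - u j x) < \<epsilon>) \<and>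
      (\<lambda>i. L2_norm_of torus_measure (\<lambda>x. u i x - f x)) \<longlonglongrightarrow> 0"
    using fn unfolding Sn_def by simp
  from choice[OF this] obtain U where U: "\<forall>n. (\<forall>i. U n i \<in> DW E) \<and>
      (\<forall>\<epsilon>>0. \<exists>I. \<forall>i\<ge>I. \<forall>j\<ge>I. norm_n \<phi> \<alpha> n (\<lambda>x. U n i x - U n j x) < \<epsilon>) \<and>
      (\<lambda>i. L2_norm_of torus_measure (\<lambda>x. U n i x - f x)) \<longlonglongrightarrow> 0"
    by (rule exE)
  then have DW: "U n i \<in> DW E"
    and Cauchy: "\<epsilon> > 0 \<Longrightarrow> \<exists>I. \<forall>i\<ge>I. \<forall>j\<ge>I. norm_n \<phi> \<alpha> n (\<lambda>x. U n i x - U n j x) < \<epsilon>"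
    and lim: "(\<lambda>i. L2_norm_of torus_measure (\<lambda>x. U n i x - f x)) \<longlonglongrightarrow> 0" for n i \<epsilon>
    by blast+
  have UL2: "U n i \<in> L2 torus_measure" for n i by (rule DW_L2[OF DW])
  have sq_lim: "(\<lambda>i. sq (\<lambda>x. U n i x - f x)) \<longlonglongrightarrow> 0" for n
    using tendsto_power[OF lim[of n], of 2] by (simp add: L2_norm_of_sq sq_nonneg)
  have c_lim: "(\<lambda>i. coef (U n i) k) \<longlonglongrightarrow> coef f k" for n k
    by (rule coef_tendsto[OF UL2 f sq_lim])
  show "summable (wterm n f)"
  proof -
    obtain I where I: "\<And>i. i \<ge> I \<Longrightarrow> norm_n \<phi> \<alpha> n (\<lambda>x. U n i x - U n I x) < 1"
      using Cauchy[of 1 n] by auto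
    \<comment> \<open>The Cauchy property bounds the whole series uniformly in i; a finite section
      involves finitely many coefficients, so the bound survives the limit in i.\<close>
    have bd: "(\<Sum>k<K. wterm n (\<lambda>x. f x - U n I x) k) \<le> 1" for K
    proof (rule LIMSEQ_le_const2)
      show "(\<lambda>i. \<Sum>k<K. wterm n (\<lambda>x. U n i x - U n I x) k) \<longlonglongrightarrow> (\<Sum>k<K. wterm n (\<lambda>x. f x - U n I x) k)"
        unfolding wterm_def coef_diff[OF UL2 UL2] coef_diff[OF f UL2] by (intro tendsto_intros c_lim)
      show "\<exists>N. \<forall>i\<ge>N. (\<Sum>k<K. wterm n (\<lambda>x. U n i x - U n I x) k) \<le> 1"
      proof (intro exI[of _ I] allI impI)
        fix i assume i: "i \<ge> I"
        obtain N1 N2 where "\<forall>k>N1. coef (U n i) k = 0" "\<forall>k>N2. coef (U n I) k = 0"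
          using DW_partial_coef[OF DW] by metis
        then have s: "summable (wterm n (\<lambda>x. U n i x - U n I x))"
          by (intro summable_wterm_finite[of "max N1 N2"]) (simp add: coef_diff UL2)
        have "sqrt (\<Sum>k. wterm n (\<lambda>x. U n i x - U n I x) k) < 1" using I[OF i] norm_n_eq[OF s] by simp
        then have "(\<Sum>k. wterm n (\<lambda>x. U n i x - U n I x) k) < 1" by simp
        then show "(\<Sum>k<K. wterm n (\<lambda>x. U n i x - U n I x) k) \<le> 1"
          using sum_le_suminf[OF s, of "{..<K}"] by simp
      qed
    qed
    have s1: "summable (wterm n (\<lambda>x. f x - U n I x))" by (rule summableI_nonneg_bounded[OF wterm_nonneg bd])
    obtain N where "\<forall>k>N. coef (U n I) k = 0" using DW_partial_coef[OF DW] by metis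
    then have s2: "summable (wterm n (U n I))" by (intro summable_wterm_finite[of N]) auto
    have "summable (wterm n (\<lambda>x. 1 * (f x - U n I x) + U n I x))"
      by (rule summable_wterm_lin[OF L2_diff[OF f UL2] UL2 s1 s2])
    then show ?thesis by simp
  qed
  show "(\<lambda>N. sq (\<lambda>x. f x - approx N f x)) \<longlonglongrightarrow> 0"
  proof (rule LIMSEQ_I)
    fix r :: real assume "r > 0"
    then obtain i where i: "sq (\<lambda>x. U 0 i x - f x) < r"
      using LIMSEQ_D[OF sq_lim[of 0], of r] sq_nonneg by fastforce
    obtain N where N: "\<And>n. n \<ge> N \<Longrightarrow> partial n (coef (U 0 i)) = U 0 i"
      using DW_partial_coef[OF DW[of 0 i]] by blast
    have "sq (\<lambda>x. f x - approx n f x) < r" if "n \<ge> N" for n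
    proof -
      have g: "(\<lambda>x. f x - U 0 i x) \<in> L2 torus_measure" by (rule L2_diff[OF f UL2])
      have "approx n f x = approx n (\<lambda>x. 1 * (f x - U 0 i x) + U 0 i x) x" for x by simp
      also have "\<dots> x = approx n (\<lambda>x. f x - U 0 i x) x + U 0 i x" for x
        using approx_lin[OF g UL2, of n 1 0 i x] N[OF that] by (simp add: approx_def)
      finally have "sq (\<lambda>x. f x - approx n f x) = sq (\<lambda>x. (f x - U 0 i x) - approx n (\<lambda>x. f x - U 0 i x) x)"
        by (simp add: algebra_simps)
      also have "\<dots> \<le> sq (\<lambda>x. f x - U 0 i x)" by (rule sq_diff_approx_le[OF g])
      also have "\<dots> = sq (\<lambda>x. U 0 i x - f x)" unfolding sq_def by (simp add: power2_commute)
      finally show ?thesis using i by simp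
    qed
    then show "\<exists>no. \<forall>n\<ge>no. norm (sq (\<lambda>x. f x - approx n f x) - 0) < r"
      by (intro exI[of _ N]) (simp add: sq_nonneg)
  qed
qed

text \<open>The truncations \<open>approx N f\<close> serve for all n at once, because the tails of
  the weighted series make them Cauchy in every norm.\<close>

lemma SW_I:
  assumes f: "f \<in> L2 torus_measure" and s: "\<And>n. summable (wterm n f)"
    and lim: "(\<lambda>N. sq (\<lambda>x. f x - approx N f x)) \<longlonglongrightarrow> 0"
  shows "f \<in> SW E \<phi> \<alpha>"
  unfolding SW_def
proof (rule INT_I)
  fix n
  show "f \<in> Sn E \<phi> \<alpha> n"
    unfolding Sn_def
  proof (intro CollectI conjI f exI[of _ "\<lambda>N. approx N f"] allI impI)
    show "approx i f \<in> DW E" for i by (simp add: approx_def partial_DW)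
    have "(\<lambda>N. sqrt (sq (\<lambda>x. f x - approx N f x))) \<longlonglongrightarrow> 0" using tendsto_real_sqrt[OF lim] by simp
    then show "(\<lambda>i. L2_norm_of torus_measure (\<lambda>x. approx i f x - f x)) \<longlonglongrightarrow> 0"
      unfolding L2_norm_of_sq by (simp add: sq_def power2_commute)
    fix \<epsilon> :: real assume \<epsilon>: "\<epsilon> > 0"
    obtain I where I: "(\<Sum>k. if k \<le> I then 0 else wterm n f k) < \<epsilon>\<^sup>2"
    proof -
      have "\<forall>\<^sub>F N in sequentially. (\<Sum>k. if k \<le> N then 0 else wterm n f k) < \<epsilon>\<^sup>2"
        using order_tendstoD(2)[OF suminf_tail_tendsto_zero(2)[OF s[of n]], of "\<epsilon>\<^sup>2"] \<epsilon> by simp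
      then show ?thesis using that by (auto simp: eventually_sequentially)
    qed
    show "\<exists>I. \<forall>i\<ge>I. \<forall>j\<ge>I. norm_n \<phi> \<alpha> n (\<lambda>x. approx i f x - approx j f x) < \<epsilon>"
    proof (intro exI[of _ I] allI impI)
      fix i j assume ij: "i \<ge> I" "j \<ge> I"
      have le: "wterm n (\<lambda>x. approx i f x - approx j f x) k \<le> (if k \<le> I then 0 else wterm n f k)" for k
        using ij unfolding wterm_def coef_diff[OF approx_L2 approx_L2] coef_approx by (auto simp: power_mult)
      have s1: "summable (wterm n (\<lambda>x. approx i f x - approx j f x))"
        by (rule summable_comparison_test'[OF suminf_tail_tendsto_zero(1)[OF s[of n], of I]]) (use le in auto)
      have "(\<Sum>k. wterm n (\<lambda>x. approx i f x - approx j f x) k) \<le> (\<Sum>k. if k \<le> I then 0 else wterm n f k)"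
        by (rule suminf_le[OF le s1 suminf_tail_tendsto_zero(1)[OF s[of n]]])
      then have "(\<Sum>k. wterm n (\<lambda>x. approx i f x - approx j f x) k) < \<epsilon>\<^sup>2" using I by simp
      then show "norm_n \<phi> \<alpha> n (\<lambda>x. approx i f x - approx j f x) < \<epsilon>"
        unfolding norm_n_eq[OF s1] using \<epsilon> by (intro real_less_lsqrt) auto
    qed
  qed
qed

lemma SW_lin:
  assumes f: "f \<in> SW E \<phi> \<alpha>" and g: "g \<in> SW E \<phi> \<alpha>"
  shows "(\<lambda>x. a * f x + g x) \<in> SW E \<phi> \<alpha>"
proof (rule SW_I)
  note fL = SW_D(1)[OF f] and gL = SW_D(1)[OF g]
  show "(\<lambda>x. a * f x + g x) \<in> L2 torus_measure" by (rule L2_lin[OF fL gL])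
  show "summable (wterm n (\<lambda>x. a * f x + g x))" for n
    by (rule summable_wterm_lin[OF fL gL SW_D(2)[OF f] SW_D(2)[OF g]])
  let ?r = "\<lambda>N. 2 * a\<^sup>2 * sq (\<lambda>x. f x - approx N f x) + 2 * sq (\<lambda>x. g x - approx N g x)"
  show "(\<lambda>N. sq (\<lambda>x. a * f x + g x - approx N (\<lambda>x. a * f x + g x) x)) \<longlonglongrightarrow> 0"
  proof (rule tendsto_sandwich[of "\<lambda>_. 0" _ _ ?r])
    have "?r \<longlonglongrightarrow> 2 * a\<^sup>2 * 0 + 2 * 0" by (intro tendsto_intros SW_D(3) f g)
    then show "?r \<longlonglongrightarrow> 0" by simp
    show "\<forall>\<^sub>F N in sequentially. sq (\<lambda>x. a * f x + g x - approx N (\<lambda>x. a * f x + g x) x) \<le> ?r N"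
    proof (rule always_eventually, rule allI)
      fix N
      have "sq (\<lambda>x. a * f x + g x - approx N (\<lambda>x. a * f x + g x) x)
        = sq (\<lambda>x. a * (f x - approx N f x) + (g x - approx N g x))"
        unfolding approx_lin[OF fL gL] by (simp add: algebra_simps)
      also have "\<dots> \<le> ?r N" by (intro sq_lin_le L2_diff fL gL approx_L2)
      finally show "sq (\<lambda>x. a * f x + g x - approx N (\<lambda>x. a * f x + g x) x) \<le> ?r N" .
    qed
  qed (auto simp: sq_nonneg)
qed

lemma DW_SW:
  assumes u: "u \<in> DW E"
  shows "u \<in> SW E \<phi> \<alpha>"
proof (rule SW_I)
  show "u \<in> L2 torus_measure" by (rule DW_L2[OF u])
  obtain N where N: "\<And>k. k > N \<Longrightarrow> coef u k = 0" "\<And>n. n \<ge> N \<Longrightarrow> partial n (coef u) = u"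
    using DW_partial_coef[OF u] by blast
  show "summable (wterm n u)" for n using N by (intro summable_wterm_finite[of N]) auto
  have "\<forall>\<^sub>F n in sequentially. sq (\<lambda>x. u x - approx n u x) = 0"
    using eventually_ge_at_top[of N] by eventually_elim (simp add: approx_def N(2) sq_def)
  then show "(\<lambda>n. sq (\<lambda>x. u x - approx n u x)) \<longlonglongrightarrow> 0" by (rule tendsto_eventually)
qed

lemma SW_zero: "(\<lambda>x. 0) \<in> SW E \<phi> \<alpha>"
  using DW_SW[OF partial_DW[of 0 "\<lambda>_. 0"]] by (simp add: partial_def)

lemma SW_add: "f \<in> SW E \<phi> \<alpha> \<Longrightarrow> g \<in> SW E \<phi> \<alpha> \<Longrightarrow> (\<lambda>x. f x + g x) \<in> SW E \<phi> \<alpha>"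
  using SW_lin[of f g 1] by simp

lemma SW_scale: "f \<in> SW E \<phi> \<alpha> \<Longrightarrow> (\<lambda>x. a * f x) \<in> SW E \<phi> \<alpha>"
  using SW_lin[of f "\<lambda>x. 0" a] SW_zero by simp

lemma SW_diff: "f \<in> SW E \<phi> \<alpha> \<Longrightarrow> g \<in> SW E \<phi> \<alpha> \<Longrightarrow> (\<lambda>x. f x - g x) \<in> SW E \<phi> \<alpha>"
  using SW_lin[of g f "-1"] by simp

lemma SW_sum: "finite K \<Longrightarrow> (\<And>k. k \<in> K \<Longrightarrow> f k \<in> SW E \<phi> \<alpha>) \<Longrightarrow> (\<lambda>x. \<Sum>k\<in>K. c k * f k x) \<in> SW E \<phi> \<alpha>"
  by (induction K rule: finite_induct) (auto intro!: SW_lin SW_zero)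

lemma phi_SW: "k \<ge> 1 \<Longrightarrow> \<phi> k \<in> SW E \<phi> \<alpha>"
proof -
  assume k: "k \<ge> 1"
  have "partial k (\<lambda>i. if i = k then 1 else 0) = \<phi> k"
    using k by (auto simp: partial_def fun_eq_iff sum.delta if_distrib[of "\<lambda>c. c * _"] cong: if_cong)
  then show ?thesis using DW_SW[OF partial_DW, of k "\<lambda>i. if i = k then 1 else 0"] by simp
qed

lemma approx_SW: "approx N f \<in> SW E \<phi> \<alpha>"
  by (simp add: approx_def DW_SW partial_DW)

section \<open>Comparison of the norms with the metric\<close>

abbreviation nrm :: "nat \<Rightarrow> (real ^ 'd \<Rightarrow> real) \<Rightarrow> real" where
  "nrm \<equiv> norm_n \<phi> \<alpha>"

lemma nrm_eq: "f \<in> SW E \<phi> \<alpha> \<Longrightarrow> nrm n f = sqrt (\<Sum>k. wterm n f k)"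
  by (intro norm_n_eq SW_D)

lemma nrm_nonneg: "f \<in> SW E \<phi> \<alpha> \<Longrightarrow> nrm n f \<ge> 0"
  by (simp add: nrm_eq suminf_nonneg SW_D)

lemma nrm_mono: "f \<in> SW E \<phi> \<alpha> \<Longrightarrow> m \<le> n \<Longrightarrow> nrm m f \<le> nrm n f"
  unfolding nrm_eq by (intro real_sqrt_le_mono suminf_le wterm_mono SW_D)

lemma nrm_scale: "f \<in> SW E \<phi> \<alpha> \<Longrightarrow> nrm n (\<lambda>x. a * f x) = \<bar>a\<bar> * nrm n f"
proof -
  assume f: "f \<in> SW E \<phi> \<alpha>"
  have "wterm n (\<lambda>x. a * f x) k = a\<^sup>2 * wterm n f k" for k
    by (simp add: wterm_def coef_scale[OF SW_D(1)[OF f]] power_mult_distrib)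
  then have "(\<Sum>k. wterm n (\<lambda>x. a * f x) k) = a\<^sup>2 * (\<Sum>k. wterm n f k)"
    by (simp add: suminf_mult SW_D(2)[OF f])
  then show ?thesis by (simp add: nrm_eq f SW_scale real_sqrt_mult)
qed

lemma coef_le_nrm: "f \<in> SW E \<phi> \<alpha> \<Longrightarrow> \<bar>coef f k\<bar> \<le> nrm n f"
proof -
  assume f: "f \<in> SW E \<phi> \<alpha>"
  have "(coef f k)\<^sup>2 \<le> wterm n f k" by (rule coef_sq_le_wterm)
  also have "\<dots> \<le> (\<Sum>k. wterm n f k)" using sum_le_suminf[OF SW_D(2)[OF f], of "{k}"] by simp
  finally show ?thesis unfolding nrm_eq[OF f] by (simp add: real_le_rsqrt)
qed

lemma nrm_diff_approx: 
  assumes f: "f \<in> SW E \<phi> \<alpha>"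
  shows "(\<lambda>N. nrm n (\<lambda>x. f x - approx N f x)) \<longlonglongrightarrow> 0"
proof -
  have "wterm n (\<lambda>x. f x - approx N f x) k = (if k \<le> N then 0 else wterm n f k)" for N k
    by (simp add: wterm_def coef_diff_approx[OF SW_D(1)[OF f]])
  then have "nrm n (\<lambda>x. f x - approx N f x) = sqrt (\<Sum>k. if k \<le> N then 0 else wterm n f k)" for N
    by (simp add: nrm_eq SW_diff f approx_SW)
  then show ?thesis
    using tendsto_real_sqrt[OF suminf_tail_tendsto_zero(2)[OF SW_D(2)[OF f, of n]]] by simp
qed

lemma summable_dist: "f \<in> SW E \<phi> \<alpha> \<Longrightarrow> summable (\<lambda>n. (1 / 2 ^ n) * (nrm n f / (1 + nrm n f)))"
proof (rule summable_comparison_test')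
  show "summable (\<lambda>n. (1/2 :: real) ^ n)" by (rule summable_geometric) simp
  fix n assume f: "f \<in> SW E \<phi> \<alpha>"
  define q where "q = nrm n f / (1 + nrm n f)"
  have q: "0 \<le> q" "q \<le> 1" unfolding q_def using nrm_nonneg[OF f, of n] by auto
  have "(1 / 2 ^ n) * q \<le> (1 / 2 ^ n) * 1" using q by (intro mult_left_mono) auto
  then have "norm ((1 / 2 ^ n) * q) \<le> (1/2) ^ n" using q by (simp add: power_one_over)
  then show "norm ((1 / 2 ^ n) * (nrm n f / (1 + nrm n f))) \<le> (1/2) ^ n" by (simp only: q_def)
qed

definition dyadic_tail :: "nat \<Rightarrow> real" where
  "dyadic_tail N = (\<Sum>n. if n \<le> N then 0 else (1/2) ^ n)"

lemma dyadic_tail_tendsto: "dyadic_tail \<longlonglongrightarrow> 0"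
  unfolding dyadic_tail_def[abs_def] by (rule suminf_tail_tendsto_zero(2)) (rule summable_geometric, simp)

text \<open>The norms increase with their index, so the terms up to N are controlled by the N-th
  norm, with total weight at most 2; each later term is at most its dyadic weight. A metric ball
  therefore contains a ball of a single norm.\<close>

lemma dist_SW_le:
  assumes f: "f \<in> SW E \<phi> \<alpha>" and g: "g \<in> SW E \<phi> \<alpha>"
  shows "dist_SW \<phi> \<alpha> f g \<le> 2 * nrm N (\<lambda>x. f x - g x) + dyadic_tail N"
proof -
  define r where "r n = nrm n (\<lambda>x. f x - g x)" for n
  have d: "(\<lambda>x. f x - g x) \<in> SW E \<phi> \<alpha>" by (rule SW_diff[OF f g])
  have r0: "r n \<ge> 0" and rm: "n \<le> N \<Longrightarrow> r n \<le> r N" for n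
    using nrm_nonneg[OF d] nrm_mono[OF d] by (auto simp: r_def)
  have geo: "summable (\<lambda>n. (1/2 :: real) ^ n)" by (rule summable_geometric) simp
  have s2: "summable (\<lambda>n. (1/2) ^ n * r N)" by (intro summable_mult2 geo)
  have s3: "summable (\<lambda>n. if n \<le> N then 0 else (1/2 :: real) ^ n)" by (rule suminf_tail_tendsto_zero(1)[OF geo])
  have le: "(1 / 2 ^ n) * (r n / (1 + r n)) \<le> (1/2) ^ n * r N + (if n \<le> N then 0 else (1/2) ^ n)" for n
  proof (cases "n \<le> N")
    case True
    have "r n / (1 + r n) \<le> r n" using r0[of n] by (simp add: divide_le_eq mult_le_cancel_left1)
    also have "\<dots> \<le> r N" using rm[OF True] .
    finally have "(1/2) ^ n * (r n / (1 + r n)) \<le> (1/2) ^ n * r N" by (intro mult_left_mono) auto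
    then show ?thesis using True by (simp add: power_one_over)
  next
    case False
    have "r n / (1 + r n) \<le> 1" using r0[of n] by simp
    then have "(1/2) ^ n * (r n / (1 + r n)) \<le> (1/2) ^ n * 1" by (intro mult_left_mono) auto
    moreover have "0 \<le> (1/2) ^ n * r N" using r0 by simp
    ultimately show ?thesis using False by (simp add: power_one_over)
  qed
  have "dist_SW \<phi> \<alpha> f g \<le> (\<Sum>n. (1/2) ^ n * r N + (if n \<le> N then 0 else (1/2) ^ n))"
    unfolding dist_SW_def r_def[symmetric]
    by (rule suminf_le[OF le]) (use summable_dist[OF d] s2 s3 in \<open>auto simp: r_def intro: summable_add\<close>)
  also have "\<dots> = (\<Sum>n. (1/2) ^ n * r N) + dyadic_tail N"
    unfolding dyadic_tail_def by (rule suminf_add[OF s2 s3, symmetric])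
  also have "(\<Sum>n. (1/2) ^ n * r N) = 2 * r N"
    using suminf_mult2[OF geo, of "r N"] suminf_geometric[of "1/2 :: real"] by simp
  finally show ?thesis by (simp add: r_def)
qed

lemma nrm_le_dist:
  assumes f: "f \<in> SW E \<phi> \<alpha>" and g: "g \<in> SW E \<phi> \<alpha>"
  shows "nrm n (\<lambda>x. f x - g x) / (1 + nrm n (\<lambda>x. f x - g x)) \<le> 2 ^ n * dist_SW \<phi> \<alpha> f g"
proof -
  let ?r = "\<lambda>n. nrm n (\<lambda>x. f x - g x)"
  have d: "(\<lambda>x. f x - g x) \<in> SW E \<phi> \<alpha>" by (rule SW_diff[OF f g])
  define q where "q = ?r n / (1 + ?r n)"
  have "(\<Sum>m\<in>{n}. (1 / 2 ^ m) * (?r m / (1 + ?r m))) \<le> dist_SW \<phi> \<alpha> f g"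
    unfolding dist_SW_def using nrm_nonneg[OF d] by (intro sum_le_suminf summable_dist[OF d]) auto
  then have "(1 / 2 ^ n) * q \<le> dist_SW \<phi> \<alpha> f g" by (simp add: q_def)
  then have "q \<le> 2 ^ n * dist_SW \<phi> \<alpha> f g" by (simp add: field_simps)
  then show ?thesis by (simp only: q_def)
qed

lemma dist_tendsto_nrm:
  assumes u: "\<And>i. u i \<in> SW E \<phi> \<alpha>" and G: "G \<in> SW E \<phi> \<alpha>" and lim: "(\<lambda>i. dist_SW \<phi> \<alpha> (u i) G) \<longlonglongrightarrow> 0"
  shows "(\<lambda>i. nrm n (\<lambda>x. u i x - G x)) \<longlonglongrightarrow> 0"
proof -
  define r where "r i = nrm n (\<lambda>x. u i x - G x)" for i
  have r0: "r i \<ge> 0" for i unfolding r_def by (intro nrm_nonneg SW_diff u G)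
  have y: "(\<lambda>i. r i / (1 + r i)) \<longlonglongrightarrow> 0"
  proof (rule tendsto_sandwich[of "\<lambda>_. 0"])
    show "(\<lambda>i. 2 ^ n * dist_SW \<phi> \<alpha> (u i) G) \<longlonglongrightarrow> 0" using tendsto_mult_left[OF lim, of "2 ^ n"] by simp
    show "\<forall>\<^sub>F i in sequentially. r i / (1 + r i) \<le> 2 ^ n * dist_SW \<phi> \<alpha> (u i) G"
      unfolding r_def by (intro always_eventually allI nrm_le_dist u G)
  qed (use r0 in auto)
  \<comment> \<open>The map r \<mapsto> r / (1 + r) has the inverse y \<mapsto> y / (1 - y), which
    is continuous at 0.\<close>
  have "(\<lambda>i. (r i / (1 + r i)) / (1 - r i / (1 + r i))) \<longlonglongrightarrow> 0 / (1 - 0)"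
    by (intro tendsto_intros y) auto
  moreover have "(r i / (1 + r i)) / (1 - r i / (1 + r i)) = r i" for i
  proof -
    have "1 - r i / (1 + r i) = 1 / (1 + r i)" using r0[of i] by (simp add: field_simps)
    then show ?thesis using r0[of i] by simp
  qed
  ultimately show ?thesis by (simp add: r_def)
qed

lemma nrm_tendsto_dist:
  assumes u: "\<And>i. u i \<in> SW E \<phi> \<alpha>" and G: "G \<in> SW E \<phi> \<alpha>" and lim: "\<And>n. (\<lambda>i. nrm n (\<lambda>x. u i x - G x)) \<longlonglongrightarrow> 0"
  shows "(\<lambda>i. dist_SW \<phi> \<alpha> (u i) G) \<longlonglongrightarrow> 0"
proof (rule LIMSEQ_I)
  fix e :: real assume e: "e > 0"
  obtain N where N: "dyadic_tail N < e / 2"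
    using order_tendstoD(2)[OF dyadic_tail_tendsto, of "e / 2"] e by (auto simp: eventually_sequentially)
  have "\<forall>\<^sub>F i in sequentially. nrm N (\<lambda>x. u i x - G x) < e / 4"
    using e by (intro order_tendstoD(2)[OF lim]) auto
  then obtain I where I: "\<And>i. i \<ge> I \<Longrightarrow> nrm N (\<lambda>x. u i x - G x) < e / 4" by (auto simp: eventually_sequentially)
  have "dist_SW \<phi> \<alpha> (u i) G \<ge> 0" for i
    unfolding dist_SW_def using nrm_nonneg[OF SW_diff[OF u G]] by (intro suminf_nonneg summable_dist SW_diff u G) auto
  moreover have "dist_SW \<phi> \<alpha> (u i) G < e" if "i \<ge> I" for i
    using dist_SW_le[OF u G, of i N] I[OF that] N by linarith
  ultimately show "\<exists>I. \<forall>i\<ge>I. norm (dist_SW \<phi> \<alpha> (u i) G - 0) < e" by (intro exI[of _ I]) auto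
qed

lemma coef_tendsto_dist:
  assumes u: "\<And>i. u i \<in> SW E \<phi> \<alpha>" and G: "G \<in> SW E \<phi> \<alpha>" and lim: "(\<lambda>i. dist_SW \<phi> \<alpha> (u i) G) \<longlonglongrightarrow> 0"
  shows "(\<lambda>i. coef (u i) k) \<longlonglongrightarrow> coef G k"
proof (rule LIM_zero_cancel, rule Lim_null_comparison)
  show "\<forall>\<^sub>F i in sequentially. norm (coef (u i) k - coef G k) \<le> nrm 0 (\<lambda>x. u i x - G x)"
    using coef_le_nrm[OF SW_diff[OF u G], of _ k 0] by (intro always_eventually allI) (simp add: coef_diff SW_D(1) u G)
  show "(\<lambda>i. nrm 0 (\<lambda>x. u i x - G x)) \<longlonglongrightarrow> 0" by (rule dist_tendsto_nrm[OF u G lim])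
qed

subsection \<open>Continuous functionals\<close>

lemma dual_add: "l \<in> SW_dual E \<phi> \<alpha> \<Longrightarrow> f \<in> SW E \<phi> \<alpha> \<Longrightarrow> g \<in> SW E \<phi> \<alpha> \<Longrightarrow> l (\<lambda>x. f x + g x) = l f + l g"
  by (auto simp: SW_dual_def)

lemma dual_scale: "l \<in> SW_dual E \<phi> \<alpha> \<Longrightarrow> f \<in> SW E \<phi> \<alpha> \<Longrightarrow> l (\<lambda>x. a * f x) = a * l f"
  by (auto simp: SW_dual_def)

lemma dual_diff: "l \<in> SW_dual E \<phi> \<alpha> \<Longrightarrow> f \<in> SW E \<phi> \<alpha> \<Longrightarrow> g \<in> SW E \<phi> \<alpha> \<Longrightarrow> l (\<lambda>x. f x - g x) = l f - l g"
  using dual_add[of l f "\<lambda>x. - 1 * g x"] dual_scale[of l g "-1"] SW_scale[of g "-1"] by simp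

lemma dual_zero: "l \<in> SW_dual E \<phi> \<alpha> \<Longrightarrow> l (\<lambda>x. 0) = 0"
  using dual_scale[of l "\<lambda>x. 0" 0] SW_zero by simp

lemma dual_sum:
  assumes l: "l \<in> SW_dual E \<phi> \<alpha>" and fin: "finite K"
  shows "(\<And>k. k \<in> K \<Longrightarrow> f k \<in> SW E \<phi> \<alpha>) \<Longrightarrow> l (\<lambda>x. \<Sum>k\<in>K. c k * f k x) = (\<Sum>k\<in>K. c k * l (f k))"
  using fin
proof (induction K rule: finite_induct)
  case empty
  then show ?case by (simp add: dual_zero[OF l])
next
  case (insert i K)
  have "l (\<lambda>x. c i * f i x + (\<Sum>k\<in>K. c k * f k x)) = c i * l (f i) + (\<Sum>k\<in>K. c k * l (f k))"
    using insert by (subst dual_add[OF l]) (auto intro!: SW_scale SW_sum simp: dual_scale[OF l])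
  then show ?case using insert by simp
qed

text \<open>Continuity at 0 gives |l g| < 1 on a metric ball, hence on a ball of one norm, and
  homogeneity does the rest. A tail below \<delta>/2 and a norm below \<delta>/4 add up to a
  distance below \<delta>; the constant 8/\<delta> leaves a factor 2 to spare.\<close>

lemma dual_bound:
  assumes l: "l \<in> SW_dual E \<phi> \<alpha>"
  shows "\<exists>C n. C \<ge> 0 \<and> (\<forall>f\<in>SW E \<phi> \<alpha>. \<bar>l f\<bar> \<le> C * nrm n f)"
proof -
  have "\<forall>f\<in>SW E \<phi> \<alpha>. \<forall>\<epsilon>>0. \<exists>\<delta>>0. \<forall>g\<in>SW E \<phi> \<alpha>. dist_SW \<phi> \<alpha> f g < \<delta> \<longrightarrow> \<bar>l f - l g\<bar> < \<epsilon>"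
    using l by (simp add: SW_dual_def)
  from bspec[OF this SW_zero, rule_format, of 1]
  obtain \<delta> where \<delta>: "\<delta> > 0" "\<And>g. g \<in> SW E \<phi> \<alpha> \<Longrightarrow> dist_SW \<phi> \<alpha> (\<lambda>x. 0) g < \<delta> \<Longrightarrow> \<bar>l (\<lambda>x. 0) - l g\<bar> < 1"
    by auto
  obtain N where N: "dyadic_tail N < \<delta> / 2"
    using order_tendstoD(2)[OF dyadic_tail_tendsto, of "\<delta> / 2"] \<delta>(1) by (auto simp: eventually_sequentially)
  have small: "\<bar>l g\<bar> < 1" if g: "g \<in> SW E \<phi> \<alpha>" and s: "nrm N g < \<delta> / 4" for g
  proof -
    have "nrm N (\<lambda>x. 0 - g x) = nrm N g" using nrm_scale[OF g, of N "-1"] by simp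
    then have "dist_SW \<phi> \<alpha> (\<lambda>x. 0) g < \<delta>" using dist_SW_le[OF SW_zero g, of N] s N by simp
    from \<delta>(2)[OF g this] show ?thesis by (simp add: dual_zero[OF l])
  qed
  have "\<bar>l f\<bar> \<le> 8 / \<delta> * nrm N f" if f: "f \<in> SW E \<phi> \<alpha>" for f
  proof (rule ccontr)
    assume "\<not> \<bar>l f\<bar> \<le> 8 / \<delta> * nrm N f"
    then have less: "8 / \<delta> * nrm N f < \<bar>l f\<bar>" by simp
    have n0: "nrm N f \<ge> 0" by (rule nrm_nonneg[OF f])
    have lpos: "\<bar>l f\<bar> > 0" using less n0 \<delta>(1) by (intro le_less_trans[OF _ less]) auto
    define a where "a = 1 / \<bar>l f\<bar>"
    have a: "a > 0" using lpos by (simp add: a_def)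
    have "nrm N (\<lambda>x. a * f x) = a * nrm N f" using nrm_scale[OF f] a by simp
    also have "\<dots> < \<delta> / 4" using less lpos \<delta>(1) n0 by (simp add: a_def field_simps)
    finally have "\<bar>l (\<lambda>x. a * f x)\<bar> < 1" by (rule small[OF SW_scale[OF f]])
    moreover have "\<bar>l (\<lambda>x. a * f x)\<bar> = 1" unfolding dual_scale[OF l f] using lpos by (simp add: a_def abs_mult)
    ultimately show False by simp
  qed
  then show ?thesis using \<delta>(1) by (intro exI[of _ "8 / \<delta>"] exI[of _ N]) auto
qed

lemma dual_I:
  assumes ext: "l \<in> extensional (SW E \<phi> \<alpha>)"
    and add: "\<And>f g. f \<in> SW E \<phi> \<alpha> \<Longrightarrow> g \<in> SW E \<phi> \<alpha> \<Longrightarrow> l (\<lambda>x. f x + g x) = l f + l g"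
    and scale: "\<And>f a. f \<in> SW E \<phi> \<alpha> \<Longrightarrow> l (\<lambda>x. a * f x) = a * l f"
    and bound: "\<And>f. f \<in> SW E \<phi> \<alpha> \<Longrightarrow> \<bar>l f\<bar> \<le> C * nrm n f" and C: "C \<ge> 0"
  shows "l \<in> SW_dual E \<phi> \<alpha>"
  unfolding SW_dual_def
proof (intro CollectI conjI ballI allI impI ext add scale)
  fix f :: "real ^ 'd \<Rightarrow> real" and \<epsilon> :: real assume f: "f \<in> SW E \<phi> \<alpha>" and \<epsilon>: "\<epsilon> > 0"
  define t where "t = \<epsilon> / (C + 1)"
  have t: "t > 0" using \<epsilon> C by (simp add: t_def)
  show "\<exists>\<delta>>0. \<forall>g\<in>SW E \<phi> \<alpha>. dist_SW \<phi> \<alpha> f g < \<delta> \<longrightarrow> \<bar>l f - l g\<bar> < \<epsilon>"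
  \<comment> \<open>The radius inverts \<open>nrm_le_dist\<close>: r / (1 + r) < t / (1 + t) means r
    < t. The denominator C + 1 in t covers C = 0.\<close>
  proof (intro exI[of _ "t / (1 + t) / 2 ^ n"] conjI ballI impI)
    show "0 < t / (1 + t) / 2 ^ n" using t by simp
    fix g assume g: "g \<in> SW E \<phi> \<alpha>" and d: "dist_SW \<phi> \<alpha> f g < t / (1 + t) / 2 ^ n"
    define r where "r = nrm n (\<lambda>x. f x - g x)"
    have r0: "r \<ge> 0" unfolding r_def by (rule nrm_nonneg[OF SW_diff[OF f g]])
    have "r / (1 + r) \<le> 2 ^ n * dist_SW \<phi> \<alpha> f g" unfolding r_def by (rule nrm_le_dist[OF f g])
    also have "\<dots> < t / (1 + t)" using mult_strict_left_mono[OF d, of "2 ^ n"] by simp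
    finally have "r < t" using r0 t by (simp add: divide_simps algebra_simps)
    have "l (\<lambda>x. f x - g x) = l f - l g"
      using add[OF f SW_scale[OF g, of "-1"]] scale[OF g, of "-1"] by simp
    then have "\<bar>l f - l g\<bar> \<le> C * r" using bound[OF SW_diff[OF f g]] by (simp add: r_def)
    also have "\<dots> \<le> (C + 1) * r" using r0 by (simp add: mult_right_mono)
    also have "\<dots> < (C + 1) * t" using C \<open>r < t\<close> by simp
    also have "\<dots> = \<epsilon>" using C by (simp add: t_def)
    finally show "\<bar>l f - l g\<bar> < \<epsilon>" .
  qed
qed

text \<open>A difference without coefficients has all norms 0. This is what makes functions defined
  by choice, such as \<open>LW_ext\<close>, harmless inside a functional.\<close>

lemma dual_cong:
  assumes l: "l \<in> SW_dual E \<phi> \<alpha>" and f: "f \<in> SW E \<phi> \<alpha>" and g: "g \<in> SW E \<phi> \<alpha>"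
    and eq: "\<And>k. coef f k = coef g k"
  shows "l f = l g"
proof -
  obtain C n where C: "C \<ge> 0" "\<And>f. f \<in> SW E \<phi> \<alpha> \<Longrightarrow> \<bar>l f\<bar> \<le> C * nrm n f" using dual_bound[OF l] by blast
  have "nrm n (\<lambda>x. f x - g x) = 0"
    using eq by (simp add: nrm_eq SW_diff f g wterm_def coef_diff SW_D(1))
  then show ?thesis using C(2)[OF SW_diff[OF f g]] dual_diff[OF l f g] by simp
qed

lemma dual_approx_tendsto:
  assumes l: "l \<in> SW_dual E \<phi> \<alpha>" and f: "f \<in> SW E \<phi> \<alpha>"
  shows "(\<lambda>N. l (approx N f)) \<longlonglongrightarrow> l f"
proof -
  obtain C n where C: "C \<ge> 0" "\<And>f. f \<in> SW E \<phi> \<alpha> \<Longrightarrow> \<bar>l f\<bar> \<le> C * nrm n f" using dual_bound[OF l] by blast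
  show ?thesis
  proof (rule LIM_zero_cancel, rule Lim_null_comparison)
  show "\<forall>\<^sub>F N in sequentially. norm (l (approx N f) - l f) \<le> C * nrm n (\<lambda>x. f x - approx N f x)"
    using C(2)[OF SW_diff[OF f approx_SW]]
    by (intro always_eventually allI) (simp add: dual_diff[OF l f approx_SW] abs_minus_commute)
  show "(\<lambda>N. C * nrm n (\<lambda>x. f x - approx N f x)) \<longlonglongrightarrow> 0"
    using tendsto_mult_left[OF nrm_diff_approx[OF f, of n], of C] by simp
qed
qed

lemma dual_approx: "l \<in> SW_dual E \<phi> \<alpha> \<Longrightarrow> l (approx N f) = (\<Sum>k\<in>{1..N}. coef f k * l (\<phi> k))"
  unfolding approx_def partial_def by (rule dual_sum) (auto intro: phi_SW)

lemma dual_eqI: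
  assumes l: "l \<in> SW_dual E \<phi> \<alpha>" "l' \<in> SW_dual E \<phi> \<alpha>" and eq: "\<And>k. k \<ge> 1 \<Longrightarrow> l (\<phi> k) = l' (\<phi> k)"
  shows "l = l'"
proof
  fix f
  show "l f = l' f"
  proof (cases "f \<in> SW E \<phi> \<alpha>")
    case True
    have "l (approx N f) = l' (approx N f)" for N using eq by (simp add: dual_approx l)
    then show ?thesis
      using LIMSEQ_unique[OF dual_approx_tendsto[OF l(1) True]] dual_approx_tendsto[OF l(2) True] by simp
  next
    case False
    then show ?thesis using l by (simp add: SW_dual_def extensional_def)
  qed
qed

text \<open>The convergence of the series is almost everywhere absolute, which makes the completeness of
  \<open>L\<^sup>2\<close> unnecessary.\<close>

lemma series_exists:
  assumes a0: "a 0 = 0" and s: "\<And>n. summable (\<lambda>k. (a k)\<^sup>2 * weight k ^ (2 * n))"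
  shows "\<exists>H\<in>SW E \<phi> \<alpha>. \<forall>k. coef H k = a k"
proof -
  have sa: "summable (\<lambda>k. \<bar>a k\<bar>)"
  proof (rule summable_comparison_test')
    \<comment> \<open>From 2 |a| \<le> a^2 w^2 + 1/w^2 and weight k \<ge> k: finiteness of the first
      norm already forces absolute summability of the coefficients.\<close>
    show "summable (\<lambda>k. (a k)\<^sup>2 * weight k ^ (2 * 1) + inverse (real k ^ 2))"
      by (intro summable_add s inverse_power_summable) simp
    fix k :: nat
    show "norm \<bar>a k\<bar> \<le> (a k)\<^sup>2 * weight k ^ (2 * 1) + inverse (real k ^ 2)"
    proof (cases "k = 0")
      case False
      then have w: "weight k \<ge> real k" "real k > 0" "weight k > 0" using weight_ge(1,3)[of k] by auto
      have "0 \<le> (\<bar>a k\<bar> * weight k - inverse (weight k))\<^sup>2" by simp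
      also have "\<dots> = (a k)\<^sup>2 * weight k ^ 2 - 2 * \<bar>a k\<bar> + (inverse (weight k))\<^sup>2"
        using w(3) by (simp add: power2_diff power_mult_distrib)
      finally have "2 * \<bar>a k\<bar> \<le> (a k)\<^sup>2 * weight k ^ 2 + (inverse (weight k))\<^sup>2" by simp
      also have "(inverse (weight k))\<^sup>2 \<le> (inverse (real k))\<^sup>2"
        using w by (intro power_mono le_imp_inverse_le) auto
      finally show ?thesis by (simp add: power_inverse)
    qed (simp add: a0)
  qed
  define \<psi> where "\<psi> k x = (if k = 0 then 0 else \<phi> k x)" for k x
  have \<psi>b [measurable]: "\<psi> k \<in> borel_measurable borel" for k
    using phi_L2[of k] by (cases "k = 0") (auto simp: \<psi>_def[abs_def] L2_def)
  have \<psi>m [measurable]: "\<psi> k \<in> borel_measurable torus_measure" for k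
    by (rule borel_measurable_torus[OF \<psi>b])
  have \<psi>sq: "(\<integral>\<^sup>+x. ennreal ((\<psi> k x)\<^sup>2) \<partial>torus_measure) \<le> 1" for k
  proof (cases "k = 0")
    case False
    then have k: "k \<ge> 1" by simp
    have "(\<integral>\<^sup>+x. ennreal ((\<psi> k x)\<^sup>2) \<partial>torus_measure) = ennreal (\<integral>x. (\<phi> k x)\<^sup>2 \<partial>torus_measure)"
      using False L2_sq_integrable[OF phi_L2[OF k]] by (simp add: \<psi>_def nn_integral_eq_integral)
    also have "(\<integral>x. (\<phi> k x)\<^sup>2 \<partial>torus_measure) = 1" using phi_orth[OF k k] by (simp add: power2_eq_square)
    finally show ?thesis by simp
  qed (simp add: \<psi>_def)
  define H where "H x = (\<Sum>k. a k * \<psi> k x)" for x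
  have Hb [measurable]: "H \<in> borel_measurable borel" unfolding H_def by measurable
  have Hm [measurable]: "H \<in> borel_measurable torus_measure" by (rule borel_measurable_torus[OF Hb])
  have Ht: "torus_fun H"
    unfolding torus_fun_def H_def
  proof (intro allI arg_cong[where f = suminf] ext)
    fix x k j
    show "a k * \<psi> k (x + axis j 1) = a k * \<psi> k x"
      using phi_L2[of k] by (cases "k = 0") (auto simp: \<psi>_def L2_def torus_fun_def)
  qed
  define b where "b N k = (if k \<le> N then 0 else \<bar>a k\<bar>)" for N k
  define \<tau> where "\<tau> N = (\<Sum>k. b N k)" for N
  have b0: "b N k \<ge> 0" for N k by (simp add: b_def)
  have sb: "summable (b N)" for N unfolding b_def[abs_def] by (rule suminf_tail_tendsto_zero(1)[OF sa])
  have \<tau>lim: "\<tau> \<longlonglongrightarrow> 0" unfolding \<tau>_def[abs_def] b_def by (rule suminf_tail_tendsto_zero(2)[OF sa])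
  have \<tau>0: "\<tau> N \<ge> 0" for N unfolding \<tau>_def by (rule suminf_nonneg[OF sb b0])
  have le\<tau>: "(\<integral>\<^sup>+x. (\<Sum>k. ennreal (b N k * (\<psi> k x)\<^sup>2)) \<partial>torus_measure) \<le> ennreal (\<tau> N)" for N
  proof -
    have "(\<integral>\<^sup>+x. (\<Sum>k. ennreal (b N k * (\<psi> k x)\<^sup>2)) \<partial>torus_measure) = (\<Sum>k. \<integral>\<^sup>+x. ennreal (b N k * (\<psi> k x)\<^sup>2) \<partial>torus_measure)"
      by (rule nn_integral_suminf) measurable
    also have "\<dots> = (\<Sum>k. ennreal (b N k) * (\<integral>\<^sup>+x. ennreal ((\<psi> k x)\<^sup>2) \<partial>torus_measure))"
      using b0 by (intro suminf_cong) (simp add: ennreal_mult nn_integral_cmult)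
    also have "\<dots> \<le> (\<Sum>k. ennreal (b N k) * 1)"
      by (intro suminf_le mult_left_mono \<psi>sq) auto
    also have "\<dots> = ennreal (\<tau> N)"
      unfolding \<tau>_def using suminf_ennreal2[OF b0 sb] by simp
    finally show ?thesis .
  qed
  have AEs: "AE x in torus_measure. summable (\<lambda>k. b N k * (\<psi> k x)\<^sup>2)" for N
  proof -
    have "AE x in torus_measure. (\<Sum>k. ennreal (b N k * (\<psi> k x)\<^sup>2)) \<noteq> \<infinity>"
    proof (rule nn_integral_PInf_AE)
      show "(\<integral>\<^sup>+x. (\<Sum>k. ennreal (b N k * (\<psi> k x)\<^sup>2)) \<partial>torus_measure) \<noteq> \<infinity>"
        using le\<tau>[of N] by (auto simp: top_unique)
    qed measurable
    then show ?thesis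
      by eventually_elim (rule summable_suminf_not_top, use b0 in auto)
  qed
  \<comment> \<open>Cauchy-Schwarz, with |a_k| split evenly between the two factors: one side sums
    to the tail \<tau> N, and the integral of the other is at most \<tau> N because the basis
    functions are normalised.\<close>
  have point: "(H x - partial N a x)\<^sup>2 \<le> \<tau> N * (\<Sum>k. b N k * (\<psi> k x)\<^sup>2)"
    if sx: "summable (\<lambda>k. b N k * (\<psi> k x)\<^sup>2)" for N x
  proof -
    have "summable (\<lambda>k. norm (if k \<le> N then 0 else a k * \<psi> k x))"
    proof (rule summable_comparison_test')
      show "summable (\<lambda>k. b N k + b N k * (\<psi> k x)\<^sup>2)" by (intro summable_add sb sx)
      fix k
      have "0 \<le> (\<bar>\<psi> k x\<bar> - 1)\<^sup>2" by simp
      then have "2 * \<bar>\<psi> k x\<bar> \<le> 1 + (\<psi> k x)\<^sup>2" by (simp add: power2_diff)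
      then have "\<bar>a k\<bar> * \<bar>\<psi> k x\<bar> \<le> \<bar>a k\<bar> * (1 + (\<psi> k x)\<^sup>2)" by (intro mult_left_mono) auto
      then show "norm (norm (if k \<le> N then 0 else a k * \<psi> k x)) \<le> b N k + b N k * (\<psi> k x)\<^sup>2"
        by (simp add: b_def abs_mult algebra_simps)
    qed
    then have s1: "summable (\<lambda>k. if k \<le> N then 0 else a k * \<psi> k x)" by (rule summable_norm_cancel)
    have fin: "(\<lambda>k. if k \<in> {1..N} then a k * \<psi> k x else 0) sums (\<Sum>k\<in>{1..N}. a k * \<psi> k x)"
      by (rule sums_If_finite_set) simp
    have fin': "(\<Sum>k\<in>{1..N}. a k * \<psi> k x) = partial N a x"
      unfolding partial_def by (intro sum.cong) (auto simp: \<psi>_def)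
    have "(\<lambda>k. (if k \<le> N then 0 else a k * \<psi> k x) + (if k \<in> {1..N} then a k * \<psi> k x else 0)) sums
      ((\<Sum>k. if k \<le> N then 0 else a k * \<psi> k x) + partial N a x)"
      using fin unfolding fin' by (intro sums_add summable_sums s1)
    moreover have "(\<lambda>k. (if k \<le> N then 0 else a k * \<psi> k x) + (if k \<in> {1..N} then a k * \<psi> k x else 0)) = (\<lambda>k. a k * \<psi> k x)"
      using a0 by (auto simp: fun_eq_iff not_le Suc_le_eq)
    ultimately have "(\<lambda>k. a k * \<psi> k x) sums ((\<Sum>k. if k \<le> N then 0 else a k * \<psi> k x) + partial N a x)" by simp
    from sums_unique[OF this]
    have "H x = (\<Sum>k. if k \<le> N then 0 else a k * \<psi> k x) + partial N a x" by (simp add: H_def)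
    then have Hd: "H x - partial N a x = (\<Sum>k. if k \<le> N then 0 else a k * \<psi> k x)" by simp
    have "(\<Sum>k<K. if k \<le> N then 0 else a k * \<psi> k x)\<^sup>2 \<le> \<tau> N * (\<Sum>k. b N k * (\<psi> k x)\<^sup>2)" for K
    proof -
      have eqs: "(\<Sum>k<K. if k \<le> N then 0 else a k * \<psi> k x) = (\<Sum>k<K. (sgn (a k) * sqrt (b N k)) * (sqrt (b N k) * \<psi> k x))"
        by (intro sum.cong refl) (auto simp: b_def sgn_if real_sqrt_mult_self abs_if mult.assoc[symmetric])
      have "(\<Sum>k<K. if k \<le> N then 0 else a k * \<psi> k x)\<^sup>2
          \<le> (\<Sum>k<K. (sgn (a k) * sqrt (b N k))\<^sup>2) * (\<Sum>k<K. (sqrt (b N k) * \<psi> k x)\<^sup>2)"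
        unfolding eqs by (rule Cauchy_Schwarz_ineq_sum)
      also have "\<dots> \<le> \<tau> N * (\<Sum>k. b N k * (\<psi> k x)\<^sup>2)"
      proof (rule mult_mono)
        have "(\<Sum>k<K. (sgn (a k) * sqrt (b N k))\<^sup>2) \<le> (\<Sum>k<K. b N k)"
          using b0 by (intro sum_mono) (auto simp: power_mult_distrib sgn_if)
        also have "\<dots> \<le> \<tau> N" unfolding \<tau>_def using sum_le_suminf[OF sb] b0 by simp
        finally show "(\<Sum>k<K. (sgn (a k) * sqrt (b N k))\<^sup>2) \<le> \<tau> N" .
        have "(\<Sum>k<K. (sqrt (b N k) * \<psi> k x)\<^sup>2) = (\<Sum>k<K. b N k * (\<psi> k x)\<^sup>2)"
          using b0 by (intro sum.cong) (auto simp: power_mult_distrib)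
        also have "\<dots> \<le> (\<Sum>k. b N k * (\<psi> k x)\<^sup>2)" using sum_le_suminf[OF sx] b0 by simp
        finally show "(\<Sum>k<K. (sqrt (b N k) * \<psi> k x)\<^sup>2) \<le> (\<Sum>k. b N k * (\<psi> k x)\<^sup>2)" .
      qed (use \<tau>0 in \<open>auto intro: sum_nonneg\<close>)
      finally show ?thesis .
    qed
    moreover have "(\<lambda>K. (\<Sum>k<K. if k \<le> N then 0 else a k * \<psi> k x)\<^sup>2) \<longlonglongrightarrow> (H x - partial N a x)\<^sup>2"
      unfolding Hd by (intro tendsto_power summable_LIMSEQ s1)
    ultimately show ?thesis by (intro LIMSEQ_le_const2) auto
  qed
  have nn: "(\<integral>\<^sup>+x. ennreal ((H x - partial N a x)\<^sup>2) \<partial>torus_measure) \<le> ennreal ((\<tau> N)\<^sup>2)" for N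
  proof -
    have "(\<integral>\<^sup>+x. ennreal ((H x - partial N a x)\<^sup>2) \<partial>torus_measure)
      \<le> (\<integral>\<^sup>+x. ennreal (\<tau> N) * (\<Sum>k. ennreal (b N k * (\<psi> k x)\<^sup>2)) \<partial>torus_measure)"
    proof (rule nn_integral_mono_AE, use AEs[of N] in eventually_elim)
      case (elim x)
      have "ennreal ((H x - partial N a x)\<^sup>2) \<le> ennreal (\<tau> N * (\<Sum>k. b N k * (\<psi> k x)\<^sup>2))"
        using point[OF elim] by (rule ennreal_leI)
      also have "\<dots> = ennreal (\<tau> N) * ennreal (\<Sum>k. b N k * (\<psi> k x)\<^sup>2)"
        using \<tau>0 b0 by (intro ennreal_mult suminf_nonneg elim) auto
      also have "ennreal (\<Sum>k. b N k * (\<psi> k x)\<^sup>2) = (\<Sum>k. ennreal (b N k * (\<psi> k x)\<^sup>2))"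
        using b0 by (intro suminf_ennreal2[symmetric] elim) auto
      finally show ?case .
    qed
    also have "\<dots> = ennreal (\<tau> N) * (\<integral>\<^sup>+x. (\<Sum>k. ennreal (b N k * (\<psi> k x)\<^sup>2)) \<partial>torus_measure)"
      by (rule nn_integral_cmult) measurable
    also have "\<dots> \<le> ennreal (\<tau> N) * ennreal (\<tau> N)" by (intro mult_left_mono le\<tau>) auto
    also have "\<dots> = ennreal ((\<tau> N)\<^sup>2)" using \<tau>0 by (simp add: power2_eq_square ennreal_mult)
    finally show ?thesis .
  qed
  have pL2: "partial N a \<in> L2 torus_measure" for N by (rule partial_L2)
  have int: "integrable torus_measure (\<lambda>x. (H x - partial N a x)\<^sup>2)" for N
  proof (rule integrableI_bounded)
    show "(\<lambda>x. (H x - partial N a x)\<^sup>2) \<in> borel_measurable torus_measure" using L2_measurable[OF pL2] by measurable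
    have "(\<integral>\<^sup>+x. ennreal (norm ((H x - partial N a x)\<^sup>2)) \<partial>torus_measure) \<le> ennreal ((\<tau> N)\<^sup>2)"
      using nn[of N] by simp
    also have "\<dots> < \<infinity>" by simp
    finally show "(\<integral>\<^sup>+x. ennreal (norm ((H x - partial N a x)\<^sup>2)) \<partial>torus_measure) < \<infinity>" .
  qed
  have sqle: "sq (\<lambda>x. H x - partial N a x) \<le> (\<tau> N)\<^sup>2" for N
    unfolding sq_def using nn[of N] nn_integral_eq_integral[OF int[of N]] by simp
  have sqlim: "(\<lambda>N. sq (\<lambda>x. H x - partial N a x)) \<longlonglongrightarrow> 0"
  proof (rule tendsto_sandwich[of "\<lambda>_. 0"])
    show "(\<lambda>N. (\<tau> N)\<^sup>2) \<longlonglongrightarrow> 0" using tendsto_power[OF \<tau>lim, of 2] by simp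
  qed (auto simp: sq_nonneg sqle)
  have HL2: "H \<in> L2 torus_measure"
  proof -
    \<comment> \<open>For N = 0 the partial sum vanishes, so the general estimate becomes square
      integrability of H itself.\<close>
    have "partial 0 a = (\<lambda>x. 0)" by (simp add: partial_def)
    then show ?thesis using int[of 0] Hb Ht by (simp add: L2_def)
  qed
  have cH: "coef H k = a k" for k
  proof -
    have l1: "(\<lambda>N. coef (partial N a) k) \<longlonglongrightarrow> coef H k"
      using sqlim by (intro coef_tendsto pL2 HL2) (simp add: sq_def power2_commute)
    have l2: "\<forall>\<^sub>F N in sequentially. coef (partial N a) k = a k"
      using eventually_ge_at_top[of k] by eventually_elim (auto simp: coef_partial a0 not_less_eq_eq)
    show ?thesis by (rule LIMSEQ_unique[OF l1 tendsto_eventually[OF l2]])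
  qed
  have "H \<in> SW E \<phi> \<alpha>"
  proof (rule SW_I[OF HL2])
    show "summable (wterm n H)" for n using s[of n] by (simp add: wterm_def[abs_def] cH)
    have "coef H = a" using cH by auto
    then show "(\<lambda>N. sq (\<lambda>x. H x - approx N H x)) \<longlonglongrightarrow> 0" using sqlim by (simp add: approx_def)
  qed
  then show ?thesis using cH by blast
qed

subsection \<open>The operator on the nuclear space\<close>

lemma LW_dir_lin: "LW_dir W i f g \<Longrightarrow> LW_dir W i f' g' \<Longrightarrow> LW_dir W i (\<lambda>x. r * f x + f' x) (\<lambda>x. r * g x + g' x)"
  using stieltjes.LW_graph_lin[OF stieltjes_W, of i] unfolding LW_dir_def by (auto intro!: L2_lin)

lemma LW_dir_zero: "LW_dir W i (\<lambda>x. 0) v \<Longrightarrow> AE x in torus_measure. v x = 0"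
proof (rule slices_null_imp_null)
  assume v: "LW_dir W i (\<lambda>x. 0) v"
  then show "v \<in> borel_measurable borel" by (auto simp: LW_dir_def L2_def)
  show "AE u in lborel. u \<in> {0<..1} \<longrightarrow> v (\<chi> j. if j = i then u else x $ j) = 0" for x
    by (rule stieltjes.LW_graph_zero_unique[OF stieltjes_W]) (use v in \<open>auto simp: LW_dir_def\<close>)
qed

lemma LW_dir_unique:
  assumes "LW_dir W i f g" "LW_dir W i f g'"
  shows "AE x in torus_measure. g x = g' x"
proof -
  have "LW_dir W i (\<lambda>x. 0) (\<lambda>x. -1 * g x + g' x)" using LW_dir_lin[OF assms, of "-1"] by simp
  from LW_dir_zero[OF this] show ?thesis by eventually_elim simp
qed

lemma LW_dir_prod:
  assumes k: "k \<ge> 1" and f: "\<And>j. f j \<in> E j" "\<phi> k = (\<lambda>x. \<Prod>j\<in>UNIV. f j (x $ j))"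
    and \<nu>: "LW_graph (W i) (f i) (\<lambda>u. \<nu> * f i u)"
  shows "LW_dir W i (\<phi> k) (\<lambda>x. \<nu> * \<phi> k x)"
  unfolding LW_dir_def
proof (intro conjI allI phi_L2[OF k] L2_scale)
  fix x :: "real ^ 'd"
  define c where "c = (\<Prod>j\<in>UNIV - {i}. f j (x $ j))"
  have slice: "\<phi> k (\<chi> j. if j = i then u else x $ j) = c * f i u" for u
  proof -
    have "\<phi> k (\<chi> j. if j = i then u else x $ j)
      = f i u * (\<Prod>j\<in>UNIV - {i}. f j ((\<chi> j. if j = i then u else x $ j) $ j))"
      unfolding f(2) by (subst prod.remove[of UNIV i]) auto
    also have "(\<Prod>j\<in>UNIV - {i}. f j ((\<chi> j. if j = i then u else x $ j) $ j)) = c"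
      unfolding c_def by (intro prod.cong) auto
    finally show ?thesis by simp
  qed
  \<comment> \<open>Linearity is available in the form r f + f', so the multiple c f is written as
    (c - 1) f + f.\<close>
  have "LW_graph (W i) (\<lambda>u. (c - 1) * f i u + f i u) (\<lambda>u. (c - 1) * (\<nu> * f i u) + \<nu> * f i u)"
    by (rule stieltjes.LW_graph_lin[OF stieltjes_W \<nu> \<nu>])
  then show "LW_graph (W i) (\<lambda>u. \<phi> k (\<chi> j. if j = i then u else x $ j)) (\<lambda>u. \<nu> * \<phi> k (\<chi> j. if j = i then u else x $ j))"
    unfolding slice by (simp add: algebra_simps)
qed

text \<open>The enumeration only asserts that some images \<open>g i\<close> under the directional
  operators add up to - \<alpha> k \<phi> k. Since these operators are single-valued,
  \<open>g i\<close> must be \<nu> i \<phi> k almost everywhere, and pairing with \<phi> k compares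
  the numbers.\<close>

lemma alpha_eq_sum:
  assumes k: "k \<ge> 1" and f: "\<And>j. f j \<in> E j" "\<phi> k = (\<lambda>x. \<Prod>j\<in>UNIV. f j (x $ j))"
    and \<nu>: "\<And>i. LW_graph (W i) (f i) (\<lambda>u. \<nu> i * f i u)"
  shows "\<alpha> k = - (\<Sum>i\<in>UNIV. \<nu> i)"
proof -
  obtain g where g: "\<And>i. LW_dir W i (\<phi> k) (g i)" "AE x in torus_measure. - (\<Sum>i\<in>UNIV. g i x) = \<alpha> k * \<phi> k x"
    using spec k unfolding spectral_enumeration_def by blast
  have "AE x in torus_measure. \<forall>i\<in>UNIV. g i x = \<nu> i * \<phi> k x"
    by (intro AE_finite_allI) (auto intro: LW_dir_unique[OF g(1) LW_dir_prod[OF k f \<nu>]])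
  with g(2) have AE: "AE x in torus_measure. (\<alpha> k + (\<Sum>i\<in>UNIV. \<nu> i)) * (\<phi> k x * \<phi> k x) = 0"
  proof eventually_elim
    case (elim x)
    then have "(\<alpha> k + (\<Sum>i\<in>UNIV. \<nu> i)) * \<phi> k x = 0" by (simp add: distrib_right sum_distrib_right)
    then show ?case by auto
  qed
  have "(\<integral>x. (\<alpha> k + (\<Sum>i\<in>UNIV. \<nu> i)) * (\<phi> k x * \<phi> k x) \<partial>torus_measure) = 0"
    by (rule integral_eq_zero_AE[OF AE])
  then show ?thesis using phi_orth[OF k k] by simp
qed

definition eigval :: "nat \<Rightarrow> 'd \<Rightarrow> real" where
  "eigval k i = (SOME \<nu>. LW_graph (W i) (factor k i) (\<lambda>u. \<nu> * factor k i u))"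

lemma eigval: "k \<ge> 1 \<Longrightarrow> LW_graph (W i) (factor k i) (\<lambda>u. eigval k i * factor k i u)"
  unfolding eigval_def
  by (rule someI_ex) (use factor(1)[of k i] eig[of i] in \<open>auto simp: eigenbasis_def\<close>)

lemma alpha_eq: "k \<ge> 1 \<Longrightarrow> \<alpha> k = - (\<Sum>i\<in>UNIV. eigval k i)"
  by (rule alpha_eq_sum[of k "factor k" "eigval k"]) (auto intro: factor eigval)

text \<open>Replacing one factor of the ground state by another eigenfunction yields a function of
  the basis, whose eigenvalue is nonnegative: hence the factors of the ground state have the largest
  eigenvalue in every direction.\<close>

lemma eigval_le: assumes k: "k \<ge> 1" shows "eigval k i \<le> eigval 1 i"
proof -
  define f where "f = (factor 1)(i := factor k i)"
  define \<nu> where "\<nu> = (eigval 1)(i := eigval k i)"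
  have f: "f j \<in> E j" for j using factor(1)[of 1 j] factor(1)[OF k, of i] by (simp add: f_def)
  have "(\<lambda>x. \<Prod>j\<in>UNIV. f j (x $ j)) \<in> AW E" unfolding AW_def using f by blast
  then obtain l where l: "l \<ge> 1" "\<phi> l = (\<lambda>x. \<Prod>j\<in>UNIV. f j (x $ j))" using AW_phi by metis
  have "\<alpha> l = - (\<Sum>j\<in>UNIV. \<nu> j)"
  proof (rule alpha_eq_sum[OF l(1) f l(2)])
    show "LW_graph (W j) (f j) (\<lambda>u. \<nu> j * f j u)" for j
      using eigval[of 1 j] eigval[OF k, of i] by (cases "j = i") (auto simp: f_def \<nu>_def)
  qed
  also have "(\<Sum>j\<in>UNIV. \<nu> j) = eigval k i + (\<Sum>j\<in>UNIV - {i}. eigval 1 j)"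
    by (subst sum.remove[of UNIV i]) (auto simp: \<nu>_def intro: sum.cong)
  also have "(\<Sum>j\<in>UNIV - {i}. eigval 1 j) = (\<Sum>j\<in>UNIV. eigval 1 j) - eigval 1 i"
    by (subst sum.remove[of UNIV i]) auto
  also have "(\<Sum>j\<in>UNIV. eigval 1 j) = 0"
    using alpha_eq[of 1] spec by (simp add: spectral_enumeration_def)
  finally show ?thesis using alpha_nonneg[OF l(1)] by simp
qed

definition eigval_const :: real where "eigval_const = 1 + (\<Sum>i\<in>UNIV. \<bar>eigval 1 i\<bar>)"

lemma eigval_const_ge: "eigval_const \<ge> 1"
  unfolding eigval_const_def by (simp add: sum_nonneg)

text \<open>The differences between the eigenvalues of the ground state and those of \<phi> k are
  nonnegative and add up to \<alpha> k, so each is at most \<alpha> k. The condition \<alpha> 1 = 0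
  fixes only the sum of the ground state's eigenvalues, hence their absolute values in
  \<open>eigval_const\<close>.\<close>

lemma eigval_bound: assumes k: "k \<ge> 1" shows "\<bar>eigval k i\<bar> \<le> eigval_const * weight k"
proof -
  have "0 \<le> eigval 1 i - eigval k i" using eigval_le[OF k] by simp
  have "eigval 1 i - eigval k i \<le> (\<Sum>j\<in>UNIV. eigval 1 j - eigval k j)"
    by (rule member_le_sum) (use eigval_le[OF k] in auto)
  also have "\<dots> = \<alpha> k"
    using alpha_eq[OF k] alpha_eq[of 1] spec by (simp add: sum_subtractf spectral_enumeration_def)
  finally have "\<bar>eigval k i\<bar> \<le> \<alpha> k + \<bar>eigval 1 i\<bar>" using eigval_le[OF k, of i] by linarith
  also have "\<bar>eigval 1 i\<bar> \<le> (\<Sum>i\<in>UNIV. \<bar>eigval 1 i\<bar>)" by (rule member_le_sum) auto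
  finally have "\<bar>eigval k i\<bar> \<le> \<alpha> k + (eigval_const - 1)" by (simp add: eigval_const_def)
  also have "\<dots> \<le> eigval_const * (1 + \<alpha> k)"
    using eigval_const_ge alpha_nonneg[OF k] mult_right_mono[of 1 eigval_const "\<alpha> k"] by (simp add: algebra_simps)
  also have "\<dots> \<le> eigval_const * weight k" using eigval_const_ge weight_ge(2)[OF k] by (intro mult_left_mono) auto
  finally show ?thesis .
qed

lemma LW_dir_partial: "LW_dir W i (partial N a) (partial N (\<lambda>k. eigval k i * a k))"
proof (induction N)
  case 0
  \<comment> \<open>The empty sum is reached as \<phi> 1 - \<phi> 1.\<close>
  have "LW_dir W i (\<phi> 1) (\<lambda>x. eigval 1 i * \<phi> 1 x)"
    by (rule LW_dir_prod[of 1 "factor 1"]) (auto intro: factor eigval)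
  from LW_dir_lin[OF this this, of "-1"] show ?case by (simp add: partial_def)
next
  case (Suc N)
  have "LW_dir W i (\<phi> (Suc N)) (\<lambda>x. eigval (Suc N) i * \<phi> (Suc N) x)"
    by (rule LW_dir_prod[of "Suc N" "factor (Suc N)"]) (auto intro: factor eigval)
  from LW_dir_lin[OF this Suc, of "a (Suc N)"] show ?case
    by (simp add: partial_def add.commute mult_ac)
qed

lemma coef_cong_AE:
  assumes "f \<in> L2 torus_measure" "g \<in> L2 torus_measure" "AE x in torus_measure. f x = g x"
  shows "coef f k = coef g k"
proof (cases "k = 0")
  case False
  then have "\<phi> k \<in> borel_measurable torus_measure" using L2_measurable[OF phi_L2] by simp
  then have "(\<integral>x. f x * \<phi> k x \<partial>torus_measure) = (\<integral>x. g x * \<phi> k x \<partial>torus_measure)"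
    using assms L2_measurable[of f] L2_measurable[of g] by (intro integral_cong_AE) auto
  then show ?thesis by (simp add: coef_def)
qed (simp add: coef_def)

text \<open>A multiplier of the size of \<open>weight\<close> costs exactly one norm index.\<close>

lemma summable_weighted:
  assumes G: "G \<in> SW E \<phi> \<alpha>" and c: "\<And>k. k \<ge> 1 \<Longrightarrow> \<bar>c k\<bar> \<le> B * weight k"
  shows "summable (\<lambda>k. (c k * coef G k)\<^sup>2 * weight k ^ (2 * n))"
    and "(\<Sum>k. (c k * coef G k)\<^sup>2 * weight k ^ (2 * n)) \<le> B\<^sup>2 * (\<Sum>k. wterm (Suc n) G k)"
proof -
  have le: "(c k * coef G k)\<^sup>2 * weight k ^ (2 * n) \<le> B\<^sup>2 * wterm (Suc n) G k" for k
  proof (cases "k = 0")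
    case False
    then have "\<bar>c k\<bar>\<^sup>2 \<le> (B * weight k)\<^sup>2" using c[of k] by (intro power_mono) auto
    then have "(c k)\<^sup>2 * ((coef G k)\<^sup>2 * weight k ^ (2 * n)) \<le> (B * weight k)\<^sup>2 * ((coef G k)\<^sup>2 * weight k ^ (2 * n))"
      by (intro mult_right_mono) (auto simp: power_mult)
    then show ?thesis by (simp add: wterm_def power_mult_distrib power2_eq_square mult_ac)
  qed (simp add: coef_def)
  have s: "summable (\<lambda>k. B\<^sup>2 * wterm (Suc n) G k)" by (intro summable_mult SW_D(2)[OF G])
  show s1: "summable (\<lambda>k. (c k * coef G k)\<^sup>2 * weight k ^ (2 * n))"
    by (rule summable_comparison_test'[OF s]) (use le in \<open>auto simp: power_mult\<close>)
  have "(\<Sum>k. (c k * coef G k)\<^sup>2 * weight k ^ (2 * n)) \<le> (\<Sum>k. B\<^sup>2 * wterm (Suc n) G k)"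
    by (rule suminf_le[OF le s1 s])
  then show "(\<Sum>k. (c k * coef G k)\<^sup>2 * weight k ^ (2 * n)) \<le> B\<^sup>2 * (\<Sum>k. wterm (Suc n) G k)"
    using suminf_mult[OF SW_D(2)[OF G]] by simp
qed

lemma approx_tendsto_dist: 
  assumes G: "G \<in> SW E \<phi> \<alpha>"
  shows "(\<lambda>N. dist_SW \<phi> \<alpha> (approx N G) G) \<longlonglongrightarrow> 0"
proof (rule nrm_tendsto_dist[OF approx_SW G])
  fix n
  have "nrm n (\<lambda>x. approx N G x - G x) = nrm n (\<lambda>x. G x - approx N G x)" for N
    using nrm_scale[OF SW_diff[OF G approx_SW], of n "-1" N] by simp
  then show "(\<lambda>N. nrm n (\<lambda>x. approx N G x - G x)) \<longlonglongrightarrow> 0" using nrm_diff_approx[OF G] by simp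
qed

text \<open>\<open>LW_ext\<close> is a choice, so both existence and determination of the
  coefficients must be shown. Existence: the series with coefficients eigval times coef,
  approximated by truncations. Determination: on \<open>DW\<close> the operator is single-valued
  almost everywhere and diagonal, and coefficients are continuous for the metric.\<close>

lemma LW_ext:
  assumes G: "G \<in> SW E \<phi> \<alpha>"
  shows "LW_ext W E \<phi> \<alpha> i G \<in> SW E \<phi> \<alpha>" "coef (LW_ext W E \<phi> \<alpha> i G) k = eigval k i * coef G k"
proof -
  let ?Q = "\<lambda>H. H \<in> SW E \<phi> \<alpha> \<and> (\<exists>u v. (\<forall>j. u j \<in> DW E \<and> v j \<in> SW E \<phi> \<alpha> \<and> LW_dir W i (u j) (v j)) \<and>
            (\<lambda>j. dist_SW \<phi> \<alpha> (u j) G) \<longlonglongrightarrow> 0 \<and> (\<lambda>j. dist_SW \<phi> \<alpha> (v j) H) \<longlonglongrightarrow> 0)"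
  have "\<exists>H\<in>SW E \<phi> \<alpha>. \<forall>k. coef H k = eigval k i * coef G k"
    by (rule series_exists) (use summable_weighted(1)[OF G eigval_bound] in \<open>auto simp: coef_def\<close>)
  then obtain H where H: "H \<in> SW E \<phi> \<alpha>" "\<And>k. coef H k = eigval k i * coef G k" by blast
  have "approx N H = partial N (\<lambda>k. eigval k i * coef G k)" for N
    using H(2) by (simp add: approx_def partial_def)
  then have "LW_dir W i (approx N G) (approx N H)" for N
    using LW_dir_partial[of i N "coef G"] by (simp add: approx_def[of N G])
  then have "?Q H"
    using H(1) approx_tendsto_dist[OF G] approx_tendsto_dist[OF H(1)] approx_SW
    by (intro conjI exI[of _ "\<lambda>N. approx N G"] exI[of _ "\<lambda>N. approx N H"]) (auto simp: approx_def partial_DW)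
  then have "\<exists>H. ?Q H" by blast
  from someI_ex[OF this] have Q: "?Q (LW_ext W E \<phi> \<alpha> i G)" unfolding LW_ext_def .
  then show L: "LW_ext W E \<phi> \<alpha> i G \<in> SW E \<phi> \<alpha>" by blast
  from Q obtain u v where uv: "\<And>j. u j \<in> DW E" "\<And>j. v j \<in> SW E \<phi> \<alpha>" "\<And>j. LW_dir W i (u j) (v j)"
    "(\<lambda>j. dist_SW \<phi> \<alpha> (u j) G) \<longlonglongrightarrow> 0" "(\<lambda>j. dist_SW \<phi> \<alpha> (v j) (LW_ext W E \<phi> \<alpha> i G)) \<longlonglongrightarrow> 0"
    by blast
  have cv: "coef (v j) k = eigval k i * coef (u j) k" for j
  proof -
    obtain N a where u: "u j = partial N a" "\<And>k. k \<notin> {1..N} \<Longrightarrow> a k = 0" using DW_form[OF uv(1)] by metis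
    have "AE x in torus_measure. v j x = partial N (\<lambda>k. eigval k i * a k) x"
      using uv(3)[of j] LW_dir_partial[of i N a] unfolding u(1) by (rule LW_dir_unique)
    then have "coef (v j) k = coef (partial N (\<lambda>k. eigval k i * a k)) k"
      by (rule coef_cong_AE[OF SW_D(1)[OF uv(2)] partial_L2])
    then show ?thesis by (simp add: coef_partial u(1))
  qed
  have "(\<lambda>j. coef (v j) k) \<longlonglongrightarrow> coef (LW_ext W E \<phi> \<alpha> i G) k" by (rule coef_tendsto_dist[OF uv(2) L uv(5)])
  moreover have "(\<lambda>j. coef (v j) k) \<longlonglongrightarrow> eigval k i * coef G k"
    unfolding cv by (intro tendsto_intros coef_tendsto_dist[OF DW_SW[OF uv(1)] G uv(4)])
  ultimately show "coef (LW_ext W E \<phi> \<alpha> i G) k = eigval k i * coef G k" by (rule LIMSEQ_unique)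
qed

definition div_eigval :: "('d \<Rightarrow> real) \<Rightarrow> nat \<Rightarrow> real" where
  "div_eigval A k = (\<Sum>i\<in>UNIV. A i * eigval k i)"

lemma div_form_SW: "G \<in> SW E \<phi> \<alpha> \<Longrightarrow> div_form W E \<phi> \<alpha> A G \<in> SW E \<phi> \<alpha>"
  unfolding div_form_def by (rule SW_sum) (auto intro: LW_ext)

lemma coef_div_form:
  assumes G: "G \<in> SW E \<phi> \<alpha>"
  shows "coef (div_form W E \<phi> \<alpha> A G) k = div_eigval A k * coef G k"
proof -
  have "coef (div_form W E \<phi> \<alpha> A G) k = (\<Sum>i\<in>UNIV. A i * coef (LW_ext W E \<phi> \<alpha> i G) k)"
    unfolding div_form_def by (rule coef_sum) (auto intro: SW_D(1) LW_ext(1)[OF G])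
  then show ?thesis by (simp add: LW_ext(2)[OF G] div_eigval_def sum_distrib_right mult.assoc)
qed

lemma nrm_div_form_le:
  assumes G: "G \<in> SW E \<phi> \<alpha>"
  shows "nrm n (div_form W E \<phi> \<alpha> A G) \<le> (\<Sum>i\<in>UNIV. \<bar>A i\<bar>) * eigval_const * nrm (Suc n) G"
proof -
  define B where "B = (\<Sum>i\<in>UNIV. \<bar>A i\<bar>) * eigval_const"
  have B: "B \<ge> 0" unfolding B_def using eigval_const_ge by (intro mult_nonneg_nonneg sum_nonneg) auto
  have b: "\<bar>div_eigval A k\<bar> \<le> B * weight k" if k: "k \<ge> 1" for k
  proof -
    have "\<bar>div_eigval A k\<bar> \<le> (\<Sum>i\<in>UNIV. \<bar>A i * eigval k i\<bar>)" unfolding div_eigval_def by (rule sum_abs)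
    also have "\<dots> \<le> (\<Sum>i\<in>UNIV. \<bar>A i\<bar> * (eigval_const * weight k))"
      unfolding abs_mult by (intro sum_mono mult_left_mono eigval_bound k) auto
    also have "\<dots> = B * weight k" by (simp add: B_def sum_distrib_right mult.assoc)
    finally show ?thesis .
  qed
  have "(\<Sum>k. wterm n (div_form W E \<phi> \<alpha> A G) k) \<le> B\<^sup>2 * (\<Sum>k. wterm (Suc n) G k)"
    using summable_weighted(2)[OF G b, of n] by (simp add: wterm_def coef_div_form[OF G])
  then have "sqrt (\<Sum>k. wterm n (div_form W E \<phi> \<alpha> A G) k) \<le> sqrt (B\<^sup>2 * (\<Sum>k. wterm (Suc n) G k))"
    by (rule real_sqrt_le_mono)
  then show ?thesis
    using B by (simp add: nrm_eq div_form_SW G real_sqrt_mult B_def)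
qed

lemma dual_div_form_phi:
  assumes l: "l \<in> SW_dual E \<phi> \<alpha>" and k: "k \<ge> 1"
  shows "l (div_form W E \<phi> \<alpha> A (\<phi> k)) = div_eigval A k * l (\<phi> k)"
proof -
  have "l (div_form W E \<phi> \<alpha> A (\<phi> k)) = l (\<lambda>x. div_eigval A k * \<phi> k x)"
    by (rule dual_cong[OF l div_form_SW SW_scale])
       (use k phi_SW in \<open>auto simp: coef_div_form coef_scale phi_L2 coef_phi\<close>)
  then show ?thesis by (simp add: dual_scale[OF l phi_SW[OF k]])
qed

lemma dual_div_form_lin:
  assumes l: "l \<in> SW_dual E \<phi> \<alpha>" and f: "f \<in> SW E \<phi> \<alpha>" and g: "g \<in> SW E \<phi> \<alpha>"
  shows "l (div_form W E \<phi> \<alpha> A (\<lambda>x. a * f x + g x)) = a * l (div_form W E \<phi> \<alpha> A f) + l (div_form W E \<phi> \<alpha> A g)"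
proof -
  have "l (div_form W E \<phi> \<alpha> A (\<lambda>x. a * f x + g x)) = l (\<lambda>x. a * div_form W E \<phi> \<alpha> A f x + div_form W E \<phi> \<alpha> A g x)"
  proof (rule dual_cong[OF l div_form_SW[OF SW_lin[OF f g]] SW_lin[OF div_form_SW[OF f] div_form_SW[OF g]]])
    show "coef (div_form W E \<phi> \<alpha> A (\<lambda>x. a * f x + g x)) k = coef (\<lambda>x. a * div_form W E \<phi> \<alpha> A f x + div_form W E \<phi> \<alpha> A g x) k" for k
      unfolding coef_div_form[OF SW_lin[OF f g]] coef_lin[OF SW_D(1)[OF f] SW_D(1)[OF g]]
        coef_lin[OF SW_D(1)[OF div_form_SW[OF f]] SW_D(1)[OF div_form_SW[OF g]]] coef_div_form[OF f] coef_div_form[OF g]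
      by (simp add: algebra_simps)
  qed
  also have "\<dots> = a * l (div_form W E \<phi> \<alpha> A f) + l (div_form W E \<phi> \<alpha> A g)"
    by (simp add: dual_add[OF l] dual_scale[OF l] SW_scale div_form_SW f g)
  finally show ?thesis .
qed

end

section \<open>Scalar linear equations\<close>

text \<open>The point of the grid of step \<open>h\<close> on \<open>[0,t]\<close> that strictly follows \<open>s\<close>; the
  truncation keeps it in \<open>[0,t]\<close> for every \<open>s\<close>.\<close>

definition next_pt :: "real \<Rightarrow> real \<Rightarrow> real \<Rightarrow> real" where
  "next_pt h t s = max 0 (min t (h * (real_of_int \<lfloor>s / h\<rfloor> + 1)))"

lemma next_pt_range: "0 \<le> t \<Longrightarrow> next_pt h t s \<in> {0..t}"
  by (auto simp: next_pt_def)

lemma next_pt_gt: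
  assumes "h > 0"
  shows "s < h * (real_of_int \<lfloor>s / h\<rfloor> + 1)" "h * (real_of_int \<lfloor>s / h\<rfloor> + 1) \<le> s + h"
proof -
  have "s / h < real_of_int \<lfloor>s / h\<rfloor> + 1" by linarith
  then show "s < h * (real_of_int \<lfloor>s / h\<rfloor> + 1)"
    using assms by (simp only: pos_divide_less_eq mult.commute)
  have "real_of_int \<lfloor>s / h\<rfloor> \<le> s / h" by linarith
  then have "h * real_of_int \<lfloor>s / h\<rfloor> \<le> s"
    using assms by (simp only: pos_le_divide_eq mult.commute)
  then show "h * (real_of_int \<lfloor>s / h\<rfloor> + 1) \<le> s + h"
    unfolding distrib_left mult_1_right by linarith
qed

text \<open>For s < t the sample points approach s strictly from the right, so right continuity
  suffices; at s = t the truncation returns t itself.\<close>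

lemma next_pt_tendsto:
  fixes f :: "real \<Rightarrow> real"
  assumes h: "\<And>n. h n > 0" "h \<longlonglongrightarrow> 0" and s: "s \<in> {0..t}"
    and f: "s < t \<Longrightarrow> (f \<longlongrightarrow> f s) (at_right s)"
  shows "(\<lambda>n. f (next_pt (h n) t s)) \<longlonglongrightarrow> f s"
proof (cases "s < t")
  case True
  have gt: "s < next_pt (h n) t s" for n
    using next_pt_gt[OF h(1)[of n], of s] True by (auto simp: next_pt_def)
  have le: "next_pt (h n) t s \<le> s + h n" for n
    using next_pt_gt[OF h(1)[of n], of s] s h(1)[of n] by (auto simp: next_pt_def)
  have "(\<lambda>n. next_pt (h n) t s) \<longlonglongrightarrow> s"
  proof (rule tendsto_sandwich[of "\<lambda>_. s" _ _ "\<lambda>n. s + h n"])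
    show "(\<lambda>n. s + h n) \<longlonglongrightarrow> s" using tendsto_add[OF tendsto_const h(2), of s] by simp
  qed (use gt le in \<open>auto intro!: always_eventually less_imp_le\<close>)
  then have "filterlim (\<lambda>n. next_pt (h n) t s) (at_right s) sequentially"
    using gt less_imp_neq[OF gt, THEN not_sym] by (auto simp: filterlim_at intro!: always_eventually)
  then show ?thesis by (rule filterlim_compose[OF f[OF True]])
next
  case False
  then have "s = t" "0 \<le> t" using s by auto
  then have "next_pt (h n) t s = s" for n
    using next_pt_gt[OF h(1)[of n], of s] by (auto simp: next_pt_def)
  then show ?thesis by simp
qed

lemma borel_measurable_next_pt: "(\<lambda>s. f (next_pt h t s)) \<in> borel_measurable (borel :: real measure)"
  for f :: "real \<Rightarrow> real"
proof -
  have fl: "(\<lambda>s. \<lfloor>s / h\<rfloor>) \<in> borel \<rightarrow>\<^sub>M count_space UNIV"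
    by (rule measurable_compose[OF _ measurable_real_floor]) simp
  have "(\<lambda>s. (\<lambda>i. f (max 0 (min t (h * (real_of_int i + 1))))) \<lfloor>s / h\<rfloor>) \<in> borel_measurable borel"
    by (rule measurable_compose[OF fl]) simp
  then show ?thesis by (simp add: next_pt_def)
qed

lemma LIMSEQ_divide_Suc: "(\<lambda>n. t / real (Suc n)) \<longlonglongrightarrow> 0"
  using tendsto_mult_left[OF LIMSEQ_Suc[OF lim_1_over_n], of t] by simp

lemma right_continuous_borel:
  fixes f :: "real \<Rightarrow> real"
  assumes t: "0 \<le> t" and f: "\<And>s. s \<in> {0..<t} \<Longrightarrow> (f \<longlongrightarrow> f s) (at_right s)"
  shows "(\<lambda>s. indicator {0..t} s *\<^sub>R f s) \<in> borel_measurable borel"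
proof (rule borel_measurable_LIMSEQ_metric)
  show "(\<lambda>s. indicator {0..t} s *\<^sub>R f (next_pt (1 / real (Suc n)) t s)) \<in> borel_measurable borel" for n
    using borel_measurable_next_pt[of f "1 / real (Suc n)" t] by measurable
  show "(\<lambda>n. indicator {0..t} s *\<^sub>R f (next_pt (1 / real (Suc n)) t s)) \<longlonglongrightarrow> indicator {0..t} s *\<^sub>R f s" for s
  proof (cases "s \<in> {0..t}")
    case True
    then have "(\<lambda>n. f (next_pt (1 / real (Suc n)) t s)) \<longlonglongrightarrow> f s"
      by (intro next_pt_tendsto LIMSEQ_divide_Suc f) auto
    then show ?thesis by (intro tendsto_scaleR tendsto_const)
  qed simp
qed

lemma bounded_set_integrable:
  fixes f :: "real \<Rightarrow> real"
  assumes m: "(\<lambda>s. indicator {0..t} s *\<^sub>R f s) \<in> borel_measurable borel"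
    and b: "\<And>s. s \<in> {0..t} \<Longrightarrow> \<bar>f s\<bar> \<le> K"
  shows "set_integrable lborel {0..t} f"
  unfolding set_integrable_def
proof (rule Bochner_Integration.integrable_bound)
  show "integrable lborel (\<lambda>s. indicator {0..t} s *\<^sub>R K)"
    by (intro integrable_scaleR_left) (simp add: emeasure_lborel_Icc_eq)
  show "AE s in lborel. norm (indicator {0..t} s *\<^sub>R f s) \<le> norm (indicator {0..t} s *\<^sub>R K)"
    using b by (intro AE_I2) (auto simp: indicator_def intro: order_trans[OF _ abs_ge_self])
qed (use m in simp)

lemma right_continuous_set_integrable:
  fixes f :: "real \<Rightarrow> real"
  assumes "0 \<le> t" "\<And>s. s \<in> {0..<t} \<Longrightarrow> (f \<longlongrightarrow> f s) (at_right s)" "\<And>s. s \<in> {0..t} \<Longrightarrow> \<bar>f s\<bar> \<le> K"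
  shows "set_integrable lborel {0..t} f"
  using assms by (intro bounded_set_integrable right_continuous_borel)

text \<open>z is only integrable a priori, but the equation makes it continuous. Its primitive Z
  then solves Z' = \<beta> Z with Z(0) = 0, and the integrating factor finishes.\<close>

lemma linear_volterra_zero:
  fixes z :: "real \<Rightarrow> real"
  assumes z: "\<And>t. t \<in> {0..T} \<Longrightarrow> set_integrable lborel {0..t} z"
    and eq: "\<And>t. t \<in> {0..T} \<Longrightarrow> z t = \<beta> * (LBINT s:{0..t}. z s)" and t: "t \<in> {0..T}"
  shows "z t = 0"
proof -
  define Z where "Z t = integral {0..t} z" for t
  have T: "T \<in> {0..T}" using t by simp
  have zZ: "z t = \<beta> * Z t" if "t \<in> {0..T}" for t
    using eq[OF that] set_borel_integral_eq_integral(2)[OF z[OF that]] by (simp add: Z_def)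
  have "continuous_on {0..T} Z"
    unfolding Z_def by (rule indefinite_integral_continuous_1[OF set_borel_integral_eq_integral(1)[OF z[OF T]]])
  then have "continuous_on {0..T} (\<lambda>t. \<beta> * Z t)" by (intro continuous_intros)
  then have zc: "continuous_on {0..T} z" using zZ by (subst continuous_on_cong[OF refl zZ]) auto
  have dZ: "(Z has_real_derivative \<beta> * Z t) (at t within {0..T})" if "t \<in> {0..T}" for t
    using integral_has_real_derivative[OF zc that] zZ[OF that] by (simp add: Z_def[abs_def])
  have "\<exists>c. \<forall>x\<in>{0..T}. Z x * exp (- \<beta> * x) = c"
  proof (rule has_field_derivative_zero_constant)
    show "((\<lambda>x. Z x * exp (- \<beta> * x)) has_field_derivative 0) (at x within {0..T})" if "x \<in> {0..T}" for x
      by (rule derivative_eq_intros dZ[OF that] refl | simp)+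
  qed auto
  then obtain c where c: "\<And>x. x \<in> {0..T} \<Longrightarrow> Z x * exp (- \<beta> * x) = c" by blast
  have "c = 0" using c[of 0] t by (auto simp: Z_def)
  then have "Z t = 0" using c[OF t] by simp
  then show ?thesis using zZ[OF t] by simp
qed

text \<open>The drift is taken at the new point: the next value v' solves (1 - \<beta> h) v' = v +
  increment of m. The scheme is linear in m and v0 for every h; where \<beta> h = 1 the inverse is
  0, which does not matter in the limit of small h.\<close>

fun euler :: "real \<Rightarrow> real \<Rightarrow> (real \<Rightarrow> real) \<Rightarrow> real \<Rightarrow> nat \<Rightarrow> real" where
  "euler \<beta> h m v0 0 = v0"
| "euler \<beta> h m v0 (Suc i) = inverse (1 - \<beta> * h) * (euler \<beta> h m v0 i + (m (real (Suc i) * h) - m (real i * h)))"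

text \<open>The implicit scheme samples \<open>y\<close> at the right end points of the grid intervals, so that
  right continuity suffices for the convergence.\<close>

lemma euler_tendsto:
  fixes y m :: "real \<Rightarrow> real"
  assumes t: "t > 0" and rc: "\<And>s. s \<in> {0..<t} \<Longrightarrow> (y \<longlongrightarrow> y s) (at_right s)"
    and K: "\<And>s. s \<in> {0..t} \<Longrightarrow> \<bar>y s\<bar> \<le> K"
    and eq: "\<And>s. s \<in> {0..t} \<Longrightarrow> y s = y 0 + \<beta> * (LBINT r:{0..s}. y r) + m s"
  shows "(\<lambda>n. euler \<beta> (t / real (Suc n)) m (y 0) (Suc n)) \<longlonglongrightarrow> y t"
proof -
  define h where "h n = t / real (Suc n)" for n
  have h: "h n > 0" for n using t by (simp add: h_def)
  have hlim: "h \<longlonglongrightarrow> 0" unfolding h_def[abs_def] by (rule LIMSEQ_divide_Suc)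
  have hn: "real (Suc n) * h n = t" for n by (simp add: h_def)
  have yS: "set_integrable lborel {0..t} y" using t rc K by (intro right_continuous_set_integrable) auto
  have yI: "y integrable_on {0..t}" by (rule set_borel_integral_eq_integral(1)[OF yS])
  \<comment> \<open>The local error of sampling at the next grid point; its integral tends to 0 by
    dominated convergence.\<close>
  define D where "D n s = \<bar>y s - y (next_pt (h n) t s)\<bar>" for n s
  have Dm: "(\<lambda>s. indicator {0..t} s *\<^sub>R D n s) \<in> borel_measurable borel" for n
  proof -
    have [measurable]: "(\<lambda>s. indicator {0..t} s *\<^sub>R y s) \<in> borel_measurable borel"
      using t rc by (intro right_continuous_borel) auto
    have [measurable]: "(\<lambda>s. y (next_pt (h n) t s)) \<in> borel_measurable borel" by (rule borel_measurable_next_pt)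
    have "(\<lambda>s. indicator {0..t} s *\<^sub>R D n s) = (\<lambda>s. indicator {0..t} s * \<bar>indicator {0..t} s *\<^sub>R y s - y (next_pt (h n) t s)\<bar>)"
      by (auto simp: D_def indicator_def)
    also have "\<dots> \<in> borel_measurable borel" by measurable
    finally show ?thesis .
  qed
  have Db: "\<bar>D n s\<bar> \<le> 2 * K" if "s \<in> {0..t}" for n s
    using K[OF that] K[OF next_pt_range[of t "h n" s]] t by (simp add: D_def)
  have DS: "set_integrable lborel {0..t} (D n)" for n by (rule bounded_set_integrable[OF Dm Db])
  have DI: "D n integrable_on {0..t}" for n by (rule set_borel_integral_eq_integral(1)[OF DS])
  have Dlim: "(\<lambda>n. integral {0..t} (D n)) \<longlonglongrightarrow> 0"
  proof -
    have "(\<lambda>n. \<integral>s. indicator {0..t} s *\<^sub>R D n s \<partial>lborel) \<longlonglongrightarrow> (\<integral>s. 0 \<partial>(lborel :: real measure))"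
    proof (rule integral_dominated_convergence[where w = "\<lambda>s. indicator {0..t} s *\<^sub>R (2 * K)"])
      show "integrable lborel (\<lambda>s. indicator {0..t} s *\<^sub>R (2 * K))"
        by (intro integrable_scaleR_left) (simp add: emeasure_lborel_Icc_eq)
      show "AE s in lborel. (\<lambda>n. indicator {0..t} s *\<^sub>R D n s) \<longlonglongrightarrow> 0"
      proof (rule AE_I2)
        fix s
        show "(\<lambda>n. indicator {0..t} s *\<^sub>R D n s) \<longlonglongrightarrow> 0"
        proof (cases "s \<in> {0..t}")
          case True
          have "(\<lambda>n. y (next_pt (h n) t s)) \<longlonglongrightarrow> y s"
            using True by (intro next_pt_tendsto h hlim rc) auto
          then have "(\<lambda>n. D n s) \<longlonglongrightarrow> \<bar>y s - y s\<bar>" unfolding D_def by (intro tendsto_intros)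
          then show ?thesis using True by simp
        qed simp
      qed
      show "AE s in lborel. norm (indicator {0..t} s *\<^sub>R D n s) \<le> indicator {0..t} s *\<^sub>R (2 * K)" for n
        using Db by (intro AE_I2) (auto simp: indicator_def)
    qed (use Dm in simp_all)
    then show ?thesis
      using set_borel_integral_eq_integral(2)[OF DS] by (simp add: set_lebesgue_integral_def)
  qed
  have sub: "f integrable_on {a..b}" if "f integrable_on {0..t}" "0 \<le> a" "b \<le> t" for f :: "real \<Rightarrow> real" and a b
    using that by (intro integrable_subinterval_real[OF that(1)]) auto
  have eqI: "y s = y 0 + \<beta> * integral {0..s} y + m s" if "s \<in> {0..t}" for s
  proof -
    have "set_integrable lborel {0..s} y" using that by (intro set_integrable_subset[OF yS]) auto
    then show ?thesis using eq[OF that] by (simp add: set_borel_integral_eq_integral(2))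
  qed
  \<comment> \<open>A discrete Gronwall estimate, in which the consistency errors of the steps add
    up to the integral of \<open>D n\<close>.\<close>
  have err: "\<bar>y (real i * h n) - euler \<beta> (h n) m (y 0) i\<bar> \<le> exp (2 * \<bar>\<beta>\<bar> * (real i * h n)) * (\<bar>\<beta>\<bar> * integral {0..real i * h n} (D n))"
    if small: "\<bar>\<beta>\<bar> * h n \<le> 1/2" and i: "i \<le> Suc n" for n i
    using i
  proof (induction i)
    case 0
    then show ?case by simp
  next
    case (Suc i)
    define a b where "a = real i * h n" and "b = real (Suc i) * h n"
    have b: "b = a + h n" by (simp add: a_def b_def algebra_simps)
    have a0: "0 \<le> a" using h[of n] by (simp add: a_def)
    have bt: "b \<le> t"
      unfolding b_def hn[of n, symmetric] using Suc.prems h[of n] by (intro mult_right_mono) auto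
    have ab: "a < b" using b h[of n] by simp
    have at: "a \<in> {0..t}" "b \<in> {0..t}" using a0 ab bt by auto
    define ea where "ea = y a - euler \<beta> (h n) m (y 0) i"
    define eb where "eb = y b - euler \<beta> (h n) m (y 0) (Suc i)"
    define x where "x = \<bar>\<beta>\<bar> * h n"
    have x: "0 \<le> x" "x \<le> 1/2" using small h[of n] by (auto simp: x_def)
    have bx: "\<beta> * h n \<le> x" using abs_ge_self[of "\<beta> * h n"] h[of n] by (simp add: x_def abs_mult)
    have pos: "1 - x \<le> 1 - \<beta> * h n" "0 < 1 - x" using bx x by auto
    have IH: "\<bar>ea\<bar> \<le> exp (2 * \<bar>\<beta>\<bar> * a) * (\<bar>\<beta>\<bar> * integral {0..a} (D n))"
      using Suc by (simp add: a_def ea_def)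
    have iy: "integral {0..a} y + integral {a..b} y = integral {0..b} y"
      using a0 ab bt by (intro Henstock_Kurzweil_Integration.integral_combine sub[OF yI]) auto
    have iD: "integral {0..a} (D n) + integral {a..b} (D n) = integral {0..b} (D n)"
      using a0 ab bt by (intro Henstock_Kurzweil_Integration.integral_combine sub[OF DI]) auto
    have yb: "y b - y a = \<beta> * integral {a..b} y + (m b - m a)"
      using eqI[OF at(1)] eqI[OF at(2)] iy[symmetric] by (simp add: distrib_left)
    have ib: "integral {a..b} (\<lambda>s. y s - y b) = integral {a..b} y - h n * y b"
      using sub[OF yI a0 bt] ab b by (subst Henstock_Kurzweil_Integration.integral_diff) auto
    have "(1 - \<beta> * h n) * euler \<beta> (h n) m (y 0) (Suc i) = euler \<beta> (h n) m (y 0) i + (m b - m a)"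
      using pos by (simp add: a_def b_def)
    then have rec: "(1 - \<beta> * h n) * eb = ea + \<beta> * integral {a..b} (\<lambda>s. y s - y b)"
      unfolding eb_def ea_def ib using yb by (simp add: algebra_simps)
    have "\<bar>integral {a..b} (\<lambda>s. y s - y b)\<bar> \<le> integral {a..b} (D n)"
    proof -
      \<comment> \<open>For s in [a, b) the next grid point is b, so this is an equality; at s = b
        the left side is 0.\<close>
      have "norm (y s - y b) \<le> D n s" if s: "s \<in> {a..b}" for s
      proof (cases "s = b")
        case False
        then have "s < b" using s by simp
        have "real i \<le> s / h n" "s / h n < real i + 1"
          using s \<open>s < b\<close> h[of n] unfolding a_def b_def by (auto simp: pos_le_divide_eq pos_divide_less_eq algebra_simps)
        then have "\<lfloor>s / h n\<rfloor> = int i" by (intro floor_unique) auto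
        then have "next_pt (h n) t s = b" using bt a0 ab by (simp add: next_pt_def b_def mult.commute add.commute)
        then show ?thesis by (simp add: D_def)
      qed (simp add: D_def)
      then have "norm (integral {a..b} (\<lambda>s. y s - y b)) \<le> integral {a..b} (D n)"
        using sub[OF yI a0 bt] sub[OF DI a0 bt]
        by (intro Henstock_Kurzweil_Integration.integral_norm_bound_integral Henstock_Kurzweil_Integration.integrable_diff) auto
      then show ?thesis by simp
    qed
    then have "\<bar>\<beta> * integral {a..b} (\<lambda>s. y s - y b)\<bar> \<le> \<bar>\<beta>\<bar> * integral {a..b} (D n)"
      unfolding abs_mult by (intro mult_left_mono) auto
    then have step: "\<bar>(1 - \<beta> * h n) * eb\<bar> \<le> \<bar>ea\<bar> + \<bar>\<beta>\<bar> * integral {a..b} (D n)" unfolding rec by linarith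
    have "(1 - x) * \<bar>eb\<bar> \<le> (1 - \<beta> * h n) * \<bar>eb\<bar>" using pos by (intro mult_right_mono) auto
    also have "\<dots> = \<bar>(1 - \<beta> * h n) * eb\<bar>" using pos by (simp add: abs_mult)
    also note step
    finally have s1: "(1 - x) * \<bar>eb\<bar> \<le> \<bar>ea\<bar> + \<bar>\<beta>\<bar> * integral {a..b} (D n)" .
    \<comment> \<open>For x \<le> 1/2 the amplification 1 / (1 - x) of an implicit step is at most 1
      + 2 x \<le> exp (2 x): the origin of the 2 in the growth rate.\<close>
    have ex: "1 \<le> exp (2 * x) * (1 - x)"
    proof -
      have "x * (2 * x) \<le> x * 1" using x by (intro mult_left_mono) auto
      then have "1 \<le> (1 + 2 * x) * (1 - x)" by (simp add: algebra_simps)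
      also have "\<dots> \<le> exp (2 * x) * (1 - x)" using pos by (intro mult_right_mono exp_ge_add_one_self) auto
      finally show ?thesis .
    qed
    have Dab: "0 \<le> integral {a..b} (D n)"
      by (rule Henstock_Kurzweil_Integration.integral_nonneg[OF sub[OF DI a0 bt]]) (simp add: D_def)
    have "1 * \<bar>eb\<bar> \<le> exp (2 * x) * (1 - x) * \<bar>eb\<bar>" using ex by (intro mult_right_mono) auto
    also have "\<dots> \<le> exp (2 * x) * (\<bar>ea\<bar> + \<bar>\<beta>\<bar> * integral {a..b} (D n))"
      unfolding mult.assoc using s1 by (intro mult_left_mono) auto
    also have "\<dots> \<le> exp (2 * x) * (exp (2 * \<bar>\<beta>\<bar> * a) * (\<bar>\<beta>\<bar> * integral {0..a} (D n)) + exp (2 * \<bar>\<beta>\<bar> * a) * (\<bar>\<beta>\<bar> * integral {a..b} (D n)))"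
    proof (intro mult_left_mono add_mono IH)
      have "1 * (\<bar>\<beta>\<bar> * integral {a..b} (D n)) \<le> exp (2 * \<bar>\<beta>\<bar> * a) * (\<bar>\<beta>\<bar> * integral {a..b} (D n))"
        using Dab a0 by (intro mult_right_mono) auto
      then show "\<bar>\<beta>\<bar> * integral {a..b} (D n) \<le> exp (2 * \<bar>\<beta>\<bar> * a) * (\<bar>\<beta>\<bar> * integral {a..b} (D n))" by simp
    qed simp
    also have "\<dots> = exp (2 * x) * exp (2 * \<bar>\<beta>\<bar> * a) * (\<bar>\<beta>\<bar> * integral {0..b} (D n))"
      unfolding iD[symmetric] by (simp add: algebra_simps)
    also have "exp (2 * x) * exp (2 * \<bar>\<beta>\<bar> * a) = exp (2 * \<bar>\<beta>\<bar> * b)"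
      by (simp add: b x_def algebra_simps flip: exp_add)
    finally show ?case by (simp add: eb_def b_def)
  qed
  have small: "\<forall>\<^sub>F n in sequentially. \<bar>\<beta>\<bar> * h n \<le> 1/2"
  proof -
    have "(\<lambda>n. \<bar>\<beta>\<bar> * h n) \<longlonglongrightarrow> 0" using tendsto_mult_left[OF hlim, of "\<bar>\<beta>\<bar>"] by simp
    then have "\<forall>\<^sub>F n in sequentially. \<bar>\<beta>\<bar> * h n < 1/2" by (rule order_tendstoD(2)) simp
    then show ?thesis by eventually_elim simp
  qed
  have "(\<lambda>n. euler \<beta> (h n) m (y 0) (Suc n) - y t) \<longlonglongrightarrow> 0"
  proof (rule Lim_null_comparison)
    show "\<forall>\<^sub>F n in sequentially. norm (euler \<beta> (h n) m (y 0) (Suc n) - y t) \<le> exp (2 * \<bar>\<beta>\<bar> * t) * (\<bar>\<beta>\<bar> * integral {0..t} (D n))"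
      using small
    proof eventually_elim
      case (elim n)
      from err[OF elim, of "Suc n"] show ?case unfolding hn by (simp add: abs_minus_commute)
    qed
    have "(\<lambda>n. exp (2 * \<bar>\<beta>\<bar> * t) * (\<bar>\<beta>\<bar> * integral {0..t} (D n))) \<longlonglongrightarrow> exp (2 * \<bar>\<beta>\<bar> * t) * (\<bar>\<beta>\<bar> * 0)"
      by (intro tendsto_intros Dlim)
    then show "(\<lambda>n. exp (2 * \<bar>\<beta>\<bar> * t) * (\<bar>\<beta>\<bar> * integral {0..t} (D n))) \<longlonglongrightarrow> 0" by simp
  qed
  then show ?thesis unfolding h_def by (rule LIM_zero_cancel)
qed

section \<open>Paths in the dual of the nuclear space\<close>

context spectral_basis
begin

lemma strong_limit_uniform:
  assumes lim: "limitin (strong_topology E \<phi> \<alpha>) y l F" and B: "SW_bounded E \<phi> \<alpha> B" and e: "\<epsilon> > 0"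
  shows "l \<in> SW_dual E \<phi> \<alpha>" "\<forall>\<^sub>F s in F. y s \<in> SW_dual E \<phi> \<alpha> \<and> (\<forall>f\<in>B. \<bar>y s f - l f\<bar> < \<epsilon>)"
proof -
  have "l \<in> topspace (strong_topology E \<phi> \<alpha>)" using lim by (simp add: limitin_def)
  then show l: "l \<in> SW_dual E \<phi> \<alpha>" by (auto simp: topspace_def strong_open_def)
  \<comment> \<open>A uniform margin e < \<epsilon> is demanded: over an infinite set B the
    pointwise strict inequalities alone would leave no room for a neighbourhood.\<close>
  define U where "U = {l' \<in> SW_dual E \<phi> \<alpha>. \<exists>e<\<epsilon>. \<forall>f\<in>B. \<bar>l' f - l f\<bar> \<le> e}"
  have "strong_open E \<phi> \<alpha> U"
    unfolding strong_open_def
  proof (intro conjI ballI)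
    show "U \<subseteq> SW_dual E \<phi> \<alpha>" by (auto simp: U_def)
    fix l' assume "l' \<in> U"
    then obtain e where e: "e < \<epsilon>" "\<And>f. f \<in> B \<Longrightarrow> \<bar>l' f - l f\<bar> \<le> e" by (auto simp: U_def)
    have "l'' \<in> U" if l'': "l'' \<in> SW_dual E \<phi> \<alpha>" "\<And>f. f \<in> B \<Longrightarrow> \<bar>l'' f - l' f\<bar> < (\<epsilon> - e) / 2" for l''
    proof -
      have "\<bar>l'' f - l f\<bar> \<le> e + (\<epsilon> - e) / 2" if "f \<in> B" for f
        using e(2)[OF that] l''(2)[OF that] by linarith
      moreover have "e + (\<epsilon> - e) / 2 < \<epsilon>" using e(1) by (simp add: field_simps)
      ultimately show ?thesis using l''(1) by (auto simp: U_def)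
    qed
    then show "\<exists>C \<delta>. SW_bounded E \<phi> \<alpha> C \<and> \<delta> > 0 \<and>
        (\<forall>l''\<in>SW_dual E \<phi> \<alpha>. (\<forall>f\<in>C. \<bar>l'' f - l' f\<bar> < \<delta>) \<longrightarrow> l'' \<in> U)"
      using B e(1) by (intro exI[of _ B] exI[of _ "(\<epsilon> - e) / 2"]) auto
  qed
  moreover have "l \<in> U" using l e by (auto simp: U_def intro!: exI[of _ 0])
  ultimately have "\<forall>\<^sub>F s in F. y s \<in> U" using lim by (simp add: limitin_def)
  then show "\<forall>\<^sub>F s in F. y s \<in> SW_dual E \<phi> \<alpha> \<and> (\<forall>f\<in>B. \<bar>y s f - l f\<bar> < \<epsilon>)"
    by eventually_elim (auto simp: U_def)
qed

lemma SW_bounded_single: "G \<in> SW E \<phi> \<alpha> \<Longrightarrow> SW_bounded E \<phi> \<alpha> {G}"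
  by (simp add: SW_bounded_def)

lemma strong_limit_eval:
  assumes "limitin (strong_topology E \<phi> \<alpha>) y l F" "G \<in> SW E \<phi> \<alpha>"
  shows "((\<lambda>s. y s G) \<longlongrightarrow> l G) F"
proof (rule tendstoI)
  fix e :: real assume "e > 0"
  from strong_limit_uniform(2)[OF assms(1) SW_bounded_single[OF assms(2)] this]
  show "\<forall>\<^sub>F s in F. dist (y s G) (l G) < e" by eventually_elim (simp add: dist_real_def)
qed

lemma dual_bounded:
  assumes l: "l \<in> SW_dual E \<phi> \<alpha>" and B: "SW_bounded E \<phi> \<alpha> B"
  shows "\<exists>K. \<forall>f\<in>B. \<bar>l f\<bar> \<le> K"
proof -
  obtain C n where C: "C \<ge> 0" "\<And>f. f \<in> SW E \<phi> \<alpha> \<Longrightarrow> \<bar>l f\<bar> \<le> C * nrm n f" using dual_bound[OF l] by blast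
  obtain K where K: "\<And>f. f \<in> B \<Longrightarrow> nrm n f \<le> K" using B by (fastforce simp: SW_bounded_def bdd_above_def)
  have "\<bar>l f\<bar> \<le> C * K" if "f \<in> B" for f
    using C(2)[of f] mult_left_mono[OF K[OF that] C(1)] that B by (auto simp: SW_bounded_def)
  then show ?thesis by blast
qed

lemma strong_limit_locally_bounded:
  assumes lim: "limitin (strong_topology E \<phi> \<alpha>) y l F" and B: "SW_bounded E \<phi> \<alpha> B"
  shows "\<exists>K. \<forall>\<^sub>F s in F. \<forall>f\<in>B. \<bar>y s f\<bar> \<le> K"
proof -
  obtain K where K: "\<And>f. f \<in> B \<Longrightarrow> \<bar>l f\<bar> \<le> K"
    using dual_bounded[OF strong_limit_uniform(1)[OF lim B zero_less_one] B] by blast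
  have "\<forall>\<^sub>F s in F. \<forall>f\<in>B. \<bar>y s f\<bar> \<le> K + 1"
    using strong_limit_uniform(2)[OF lim B zero_less_one]
  proof eventually_elim
    case (elim s)
    then show ?case using K by fastforce
  qed
  then show ?thesis by blast
qed

text \<open>Near each time the right limit, the left limit and the value itself contribute one bound
  each; compactness of [0, T] makes the bound global.\<close>

lemma cadlag_bounded:
  assumes y: "cadlag_path T E \<phi> \<alpha> y" and B: "SW_bounded E \<phi> \<alpha> B"
  shows "\<exists>K. \<forall>s\<in>{0..T}. \<forall>f\<in>B. \<bar>y s f\<bar> \<le> K"
proof -
  have loc: "\<exists>d K. d > 0 \<and> (\<forall>s\<in>{0..T}. \<bar>s - t\<bar> < d \<longrightarrow> (\<forall>f\<in>B. \<bar>y s f\<bar> \<le> K))" if t: "t \<in> {0..T}" for t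
  proof -
    obtain K0 where K0: "\<And>f. f \<in> B \<Longrightarrow> \<bar>y t f\<bar> \<le> K0"
      using dual_bounded[OF _ B] y t unfolding cadlag_path_def by blast
    have "\<exists>d1 K1. d1 > 0 \<and> (\<forall>s\<in>{0..T}. t < s \<and> s < t + d1 \<longrightarrow> (\<forall>f\<in>B. \<bar>y s f\<bar> \<le> K1))"
    proof (cases "t < T")
      case True
      then have "limitin (strong_topology E \<phi> \<alpha>) y (y t) (at_right t)" using y t by (auto simp: cadlag_path_def)
      from strong_limit_locally_bounded[OF this B] obtain K1 b where "b > t" "\<And>s. t < s \<Longrightarrow> s < b \<Longrightarrow> \<forall>f\<in>B. \<bar>y s f\<bar> \<le> K1"
        unfolding eventually_at_right_field by blast
      then show ?thesis by (intro exI[of _ "b - t"] exI[of _ K1]) auto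
    next
      case False
      then show ?thesis using t by (intro exI[of _ 1] exI[of _ 0]) auto
    qed
    then obtain d1 K1 where d1: "d1 > 0" "\<And>s f. s \<in> {0..T} \<Longrightarrow> t < s \<Longrightarrow> s < t + d1 \<Longrightarrow> f \<in> B \<Longrightarrow> \<bar>y s f\<bar> \<le> K1" by blast
    have "\<exists>d2 K2. d2 > 0 \<and> (\<forall>s\<in>{0..T}. t - d2 < s \<and> s < t \<longrightarrow> (\<forall>f\<in>B. \<bar>y s f\<bar> \<le> K2))"
    proof (cases "0 < t")
      case True
      then have "t \<in> {0<..T}" using t by simp
      then obtain l where "limitin (strong_topology E \<phi> \<alpha>) y l (at_left t)" using y unfolding cadlag_path_def by blast
      from strong_limit_locally_bounded[OF this B] obtain K2 b where "b < t" "\<And>s. b < s \<Longrightarrow> s < t \<Longrightarrow> \<forall>f\<in>B. \<bar>y s f\<bar> \<le> K2"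
        unfolding eventually_at_left_field by blast
      then show ?thesis by (intro exI[of _ "t - b"] exI[of _ K2]) auto
    next
      case False
      then show ?thesis using t by (intro exI[of _ 1] exI[of _ 0]) auto
    qed
    then obtain d2 K2 where d2: "d2 > 0" "\<And>s f. s \<in> {0..T} \<Longrightarrow> t - d2 < s \<Longrightarrow> s < t \<Longrightarrow> f \<in> B \<Longrightarrow> \<bar>y s f\<bar> \<le> K2" by blast
    show ?thesis
    proof (rule exI[of _ "min d1 d2"], rule exI[of _ "max K0 (max K1 K2)"], intro conjI ballI impI)
      show "min d1 d2 > 0" using d1 d2 by simp
      fix s f assume s: "s \<in> {0..T}" "\<bar>s - t\<bar> < min d1 d2" and f: "f \<in> B"
      consider "s = t" | "t < s" | "s < t" by linarith
      then show "\<bar>y s f\<bar> \<le> max K0 (max K1 K2)"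
      proof cases
        case 1 then show ?thesis using K0[OF f] by (simp add: le_max_iff_disj)
      next
        case 2 then show ?thesis using d1(2)[OF s(1) _ _ f] s(2) by (auto simp: le_max_iff_disj)
      next
        case 3 then show ?thesis using d2(2)[OF s(1) _ _ f] s(2) by (auto simp: le_max_iff_disj)
      qed
    qed
  qed
  then have "\<forall>t\<in>{0..T}. \<exists>p. fst p > 0 \<and> (\<forall>s\<in>{0..T}. \<bar>s - t\<bar> < fst p \<longrightarrow> (\<forall>f\<in>B. \<bar>y s f\<bar> \<le> snd p))" by simp
  from bchoice[OF this] obtain p where p: "\<forall>t\<in>{0..T}. fst (p t) > 0 \<and> (\<forall>s\<in>{0..T}. \<bar>s - t\<bar> < fst (p t) \<longrightarrow> (\<forall>f\<in>B. \<bar>y s f\<bar> \<le> snd (p t)))"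
    by (rule exE)
  have cover: "{0..T} \<subseteq> (\<Union>t\<in>{0..T}. ball t (fst (p t)))"
    using p by (auto intro!: bexI)
  obtain C where C: "C \<subseteq> {0..T}" "finite C" "{0..T} \<subseteq> (\<Union>t\<in>C. ball t (fst (p t)))"
    by (rule compactE_image[OF compact_Icc _ cover]) auto
  have "\<bar>y s f\<bar> \<le> Max (insert 0 ((\<lambda>t. snd (p t)) ` C))" if s: "s \<in> {0..T}" and f: "f \<in> B" for s f
  proof -
    obtain t where t: "t \<in> C" "s \<in> ball t (fst (p t))" using C(3) s by blast
    then have "\<bar>s - t\<bar> < fst (p t)" by (simp add: dist_real_def abs_minus_commute)
    then have "\<bar>y s f\<bar> \<le> snd (p t)" using p t(1) C(1) s f by blast
    also have "\<dots> \<le> Max (insert 0 ((\<lambda>t. snd (p t)) ` C))" using C(2) t(1) by (intro Max_ge) auto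
    finally show ?thesis .
  qed
  then show ?thesis by blast
qed

text \<open>The norms increase with their index, so a violation of equicontinuity at every level
  yields a single bounded sequence on which the path is unbounded; no category argument is needed.\<close>

lemma cadlag_equicontinuous:
  assumes y: "cadlag_path T E \<phi> \<alpha> y"
  shows "\<exists>C n. C \<ge> 0 \<and> (\<forall>s\<in>{0..T}. \<forall>f\<in>SW E \<phi> \<alpha>. \<bar>y s f\<bar> \<le> C * nrm n f)"
proof (rule ccontr)
  assume neg: "\<not> ?thesis"
  have "\<exists>s\<in>{0..T}. \<exists>g\<in>SW E \<phi> \<alpha>. nrm n g \<le> 1 \<and> \<bar>y s g\<bar> = real n + 1" for n
  proof -
    have "\<not> (\<forall>s\<in>{0..T}. \<forall>f\<in>SW E \<phi> \<alpha>. \<bar>y s f\<bar> \<le> (real n + 1) * nrm n f)"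
    proof
      assume "\<forall>s\<in>{0..T}. \<forall>f\<in>SW E \<phi> \<alpha>. \<bar>y s f\<bar> \<le> (real n + 1) * nrm n f"
      moreover have "0 \<le> real n + 1" by simp
      ultimately show False using neg by blast
    qed
    then obtain s f where sf: "s \<in> {0..T}" "f \<in> SW E \<phi> \<alpha>" "(real n + 1) * nrm n f < \<bar>y s f\<bar>" by (auto simp: not_le)
    have ys: "y s \<in> SW_dual E \<phi> \<alpha>" using y sf(1) by (auto simp: cadlag_path_def)
    have n0: "nrm n f \<ge> 0" by (rule nrm_nonneg[OF sf(2)])
    have pos: "\<bar>y s f\<bar> > 0" using sf(3) n0 by (intro le_less_trans[OF _ sf(3)]) auto
    \<comment> \<open>Normalised so that the value becomes n + 1 while the n-th norm stays at most
      1.\<close>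
    define a where "a = (real n + 1) / \<bar>y s f\<bar>"
    have a: "a > 0" using pos by (simp add: a_def)
    have "nrm n (\<lambda>x. a * f x) = a * nrm n f" using nrm_scale[OF sf(2)] a by simp
    also have "\<dots> \<le> 1" using sf(3) pos by (simp add: a_def divide_le_eq)
    finally have "nrm n (\<lambda>x. a * f x) \<le> 1" .
    moreover have "\<bar>y s (\<lambda>x. a * f x)\<bar> = real n + 1"
      unfolding dual_scale[OF ys sf(2)] using pos by (simp add: a_def abs_mult)
    ultimately show ?thesis using sf(1) SW_scale[OF sf(2)] by blast
  qed
  then have "\<forall>n. \<exists>q. fst q \<in> {0..T} \<and> snd q \<in> SW E \<phi> \<alpha> \<and> nrm n (snd q) \<le> 1 \<and> \<bar>y (fst q) (snd q)\<bar> = real n + 1"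
    by fastforce
  from choice[OF this] obtain q where q: "\<forall>n. fst (q n) \<in> {0..T} \<and> snd (q n) \<in> SW E \<phi> \<alpha> \<and> nrm n (snd (q n)) \<le> 1 \<and> \<bar>y (fst (q n)) (snd (q n))\<bar> = real n + 1"
    by (rule exE)
  define B where "B = range (\<lambda>n. snd (q n))"
  have "SW_bounded E \<phi> \<alpha> B"
    unfolding SW_bounded_def
  proof (intro conjI allI)
    show "B \<subseteq> SW E \<phi> \<alpha>" using q by (auto simp: B_def)
    fix m
    have "nrm m f \<le> Max (insert 1 ((\<lambda>n. nrm m (snd (q n))) ` {..m}))" if "f \<in> B" for f
    proof -
      obtain n where n: "f = snd (q n)" using \<open>f \<in> B\<close> unfolding B_def by blast
      show ?thesis
      proof (cases "n \<le> m")
        case True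
        then show ?thesis unfolding n by (intro Max_ge) auto
      next
        case False
        then have "nrm m f \<le> nrm n f" using q n by (intro nrm_mono) auto
        also have "\<dots> \<le> 1" using q n by simp
        also have "1 \<le> Max (insert 1 ((\<lambda>n. nrm m (snd (q n))) ` {..m}))" by (intro Max_ge) auto
        finally show ?thesis .
      qed
    qed
    then show "bdd_above (norm_n \<phi> \<alpha> m ` B)" by (intro bdd_aboveI2) auto
  qed
  from cadlag_bounded[OF y this] obtain K where K: "\<And>s f. s \<in> {0..T} \<Longrightarrow> f \<in> B \<Longrightarrow> \<bar>y s f\<bar> \<le> K" by blast
  obtain n where "K < real n" using reals_Archimedean2 by blast
  moreover have "real n + 1 \<le> K" using K[of "fst (q n)" "snd (q n)"] q by (auto simp: B_def)
  ultimately show False by simp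
qed

lemma cadlag_right_cont: "cadlag_path T E \<phi> \<alpha> y \<Longrightarrow> G \<in> SW E \<phi> \<alpha> \<Longrightarrow> s \<in> {0..<T} \<Longrightarrow> ((\<lambda>s. y s G) \<longlongrightarrow> y s G) (at_right s)"
  by (rule strong_limit_eval) (auto simp: cadlag_path_def)

lemma cadlag_eval_bounded: "cadlag_path T E \<phi> \<alpha> y \<Longrightarrow> G \<in> SW E \<phi> \<alpha> \<Longrightarrow> \<exists>K. \<forall>s\<in>{0..T}. \<bar>y s G\<bar> \<le> K"
  using cadlag_bounded[OF _ SW_bounded_single, of T y G] by simp

lemma cadlag_integrable:
  assumes y: "cadlag_path T E \<phi> \<alpha> y" and G: "G \<in> SW E \<phi> \<alpha>" and t: "t \<in> {0..T}"
  shows "set_integrable lborel {0..t} (\<lambda>s. y s G)"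
proof -
  obtain K where "\<forall>s\<in>{0..T}. \<bar>y s G\<bar> \<le> K" using cadlag_eval_bounded[OF y G] by blast
  then show ?thesis
    using t cadlag_right_cont[OF y G] by (intro right_continuous_set_integrable[of t _ K]) auto
qed

text \<open>Equicontinuity in time lets the integral inherit a bound by a single norm. The operator
  costs one index, hence \<open>Suc n\<close>; the constant collects the two values of Y and the
  integral over [0, t].\<close>

lemma mart_part_dual:
  assumes y: "cadlag_path T E \<phi> \<alpha> (\<lambda>t. Y t \<omega>)" and t: "t \<in> {0..T}"
  shows "mart_part W E \<phi> \<alpha> A \<kappa> Y t \<omega> \<in> SW_dual E \<phi> \<alpha>"
proof -
  obtain C n where C: "C \<ge> 0" "\<And>s f. s \<in> {0..T} \<Longrightarrow> f \<in> SW E \<phi> \<alpha> \<Longrightarrow> \<bar>Y s \<omega> f\<bar> \<le> C * nrm n f"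
    using cadlag_equicontinuous[OF y] by blast
  have ld: "Y s \<omega> \<in> SW_dual E \<phi> \<alpha>" if "s \<in> {0..T}" for s using y that by (auto simp: cadlag_path_def)
  have zT: "0 \<in> {0..T}" using t by simp
  define J where "J G = (LBINT s:{0..t}. Y s \<omega> (div_form W E \<phi> \<alpha> A G))" for G
  have int: "set_integrable lborel {0..t} (\<lambda>s. Y s \<omega> (div_form W E \<phi> \<alpha> A G))" if "G \<in> SW E \<phi> \<alpha>" for G
    by (rule cadlag_integrable[OF y div_form_SW[OF that] t])
  have Jlin: "J (\<lambda>x. a * f x + g x) = a * J f + J g" if f: "f \<in> SW E \<phi> \<alpha>" and g: "g \<in> SW E \<phi> \<alpha>" for a f g
  proof -
    have "J (\<lambda>x. a * f x + g x) = (LBINT s:{0..t}. a * Y s \<omega> (div_form W E \<phi> \<alpha> A f) + Y s \<omega> (div_form W E \<phi> \<alpha> A g))"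
      unfolding J_def using t ld
      by (intro set_lebesgue_integral_cong) (auto simp: dual_div_form_lin f g)
    also have "\<dots> = a * J f + J g"
      unfolding J_def using int[OF f] int[OF g] by (subst set_integral_add(2)) (auto intro: set_integrable_mult_right)
    finally show ?thesis .
  qed
  have J0: "J (\<lambda>x. 0) = 0" using Jlin[OF SW_zero SW_zero, of "-1"] by simp
  define N where "N = mart_part W E \<phi> \<alpha> A \<kappa> Y t \<omega>"
  have N: "N G = Y t \<omega> G - Y 0 \<omega> G - \<kappa> * J G" if "G \<in> SW E \<phi> \<alpha>" for G
    using that by (simp add: N_def mart_part_def J_def)
  define B where "B = (\<Sum>i\<in>UNIV. \<bar>A i\<bar>) * eigval_const"
  have B: "B \<ge> 0" unfolding B_def using eigval_const_ge by (intro mult_nonneg_nonneg sum_nonneg) auto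
  have "N \<in> SW_dual E \<phi> \<alpha>"
  proof (rule dual_I[where C = "2 * C + \<bar>\<kappa>\<bar> * (t * (C * B))" and n = "Suc n"])
    show "N \<in> extensional (SW E \<phi> \<alpha>)" by (simp add: N_def mart_part_def)
    show "N (\<lambda>x. f x + g x) = N f + N g" if "f \<in> SW E \<phi> \<alpha>" "g \<in> SW E \<phi> \<alpha>" for f g
      using that Jlin[of f g 1] by (simp add: N SW_add dual_add[OF ld[OF t]] dual_add[OF ld[OF zT]] algebra_simps)
    show "N (\<lambda>x. a * f x) = a * N f" if "f \<in> SW E \<phi> \<alpha>" for f a
      using that Jlin[of f "\<lambda>x. 0" a] SW_zero J0
      by (simp add: N SW_scale dual_scale[OF ld[OF t]] dual_scale[OF ld[OF zT]] algebra_simps)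
    show "0 \<le> 2 * C + \<bar>\<kappa>\<bar> * (t * (C * B))" using C B t by simp
    fix f assume f: "f \<in> SW E \<phi> \<alpha>"
    have m: "nrm n f \<le> nrm (Suc n) f" by (rule nrm_mono[OF f]) simp
    have Yb: "\<bar>Y s \<omega> f\<bar> \<le> C * nrm (Suc n) f" if "s \<in> {0..T}" for s
      using C(2)[OF that f] mult_left_mono[OF m C(1)] by simp
    have Db: "\<bar>Y s \<omega> (div_form W E \<phi> \<alpha> A f)\<bar> \<le> C * (B * nrm (Suc n) f)" if "s \<in> {0..t}" for s
    proof -
      have "\<bar>Y s \<omega> (div_form W E \<phi> \<alpha> A f)\<bar> \<le> C * nrm n (div_form W E \<phi> \<alpha> A f)"
        using C(2)[OF _ div_form_SW[OF f]] that t by auto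
      also have "\<dots> \<le> C * (B * nrm (Suc n) f)"
        unfolding B_def using C(1) by (intro mult_left_mono nrm_div_form_le[OF f])
      finally show ?thesis .
    qed
    have "\<bar>J f\<bar> \<le> (LBINT s:{0..t}. C * (B * nrm (Suc n) f))"
    proof -
      have "norm (J f) \<le> (\<integral>s. norm (indicator {0..t} s *\<^sub>R Y s \<omega> (div_form W E \<phi> \<alpha> A f)) \<partial>lborel)"
        unfolding J_def set_lebesgue_integral_def by (rule integral_norm_bound)
      also have "\<dots> \<le> (\<integral>s. indicator {0..t} s *\<^sub>R (C * (B * nrm (Suc n) f)) \<partial>lborel)"
      proof (rule integral_mono)
        show "integrable lborel (\<lambda>s. norm (indicator {0..t} s *\<^sub>R Y s \<omega> (div_form W E \<phi> \<alpha> A f)))"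
          using int[OF f] by (simp add: set_integrable_def integrable_norm)
        show "integrable lborel (\<lambda>s. indicator {0..t} s *\<^sub>R (C * (B * nrm (Suc n) f)))"
          by (intro integrable_scaleR_left) (simp add: emeasure_lborel_Icc_eq)
        show "norm (indicator {0..t} s *\<^sub>R Y s \<omega> (div_form W E \<phi> \<alpha> A f)) \<le> indicator {0..t} s *\<^sub>R (C * (B * nrm (Suc n) f))" for s
          using Db[of s] by (auto simp: indicator_def)
      qed
      finally show ?thesis by (simp only: set_lebesgue_integral_def real_norm_def)
    qed
    also have "\<dots> = t * (C * (B * nrm (Suc n) f))" using t by (simp add: set_lebesgue_integral_def)
    finally have Jb: "\<bar>\<kappa>\<bar> * \<bar>J f\<bar> \<le> \<bar>\<kappa>\<bar> * (t * (C * (B * nrm (Suc n) f)))" by (rule mult_left_mono) simp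
    have "\<bar>N f\<bar> \<le> \<bar>Y t \<omega> f\<bar> + \<bar>Y 0 \<omega> f\<bar> + \<bar>\<kappa>\<bar> * \<bar>J f\<bar>" unfolding N[OF f] abs_mult[symmetric] by linarith
    also have "\<dots> \<le> C * nrm (Suc n) f + C * nrm (Suc n) f + \<bar>\<kappa>\<bar> * (t * (C * (B * nrm (Suc n) f)))"
      by (intro add_mono Yb t zT Jb)
    also have "\<dots> = (2 * C + \<bar>\<kappa>\<bar> * (t * (C * B))) * nrm (Suc n) f" by (simp add: algebra_simps)
    finally show "\<bar>N f\<bar> \<le> (2 * C + \<bar>\<kappa>\<bar> * (t * (C * B))) * nrm (Suc n) f" .
  qed
  then show ?thesis by (simp add: N_def)
qed

subsection \<open>Measurability\<close>

lemma space_SW_dual_M [simp]: "space (SW_dual_M E \<phi> \<alpha>) = SW_dual E \<phi> \<alpha>"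
  by (simp add: SW_dual_M_def space_measure_of_conv)

lemma eval_measurable: "G \<in> SW E \<phi> \<alpha> \<Longrightarrow> (\<lambda>l. l G) \<in> borel_measurable (SW_dual_M E \<phi> \<alpha>)"
proof (rule measurableI)
  fix A :: "real set" assume G: "G \<in> SW E \<phi> \<alpha>" and A: "A \<in> sets borel"
  have "{l \<in> SW_dual E \<phi> \<alpha>. l G \<in> A} \<in> sets (SW_dual_M E \<phi> \<alpha>)"
    unfolding SW_dual_M_def using G A by (intro in_measure_of) auto
  moreover have "(\<lambda>l. l G) -` A \<inter> space (SW_dual_M E \<phi> \<alpha>) = {l \<in> SW_dual E \<phi> \<alpha>. l G \<in> A}" by auto
  ultimately show "(\<lambda>l. l G) -` A \<inter> space (SW_dual_M E \<phi> \<alpha>) \<in> sets (SW_dual_M E \<phi> \<alpha>)" by simp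
qed auto

lemma measurable_SW_dual_M:
  assumes dual: "\<And>\<omega>. \<omega> \<in> space N \<Longrightarrow> f \<omega> \<in> SW_dual E \<phi> \<alpha>"
    and eval: "\<And>G. G \<in> SW E \<phi> \<alpha> \<Longrightarrow> (\<lambda>\<omega>. f \<omega> G) \<in> borel_measurable N"
  shows "f \<in> measurable N (SW_dual_M E \<phi> \<alpha>)"
  unfolding SW_dual_M_def
proof (rule measurable_measure_of)
  show "f \<in> space N \<rightarrow> SW_dual E \<phi> \<alpha>" using dual by auto
  fix S assume "S \<in> {{l \<in> SW_dual E \<phi> \<alpha>. l G \<in> A} | G A. G \<in> SW E \<phi> \<alpha> \<and> A \<in> sets borel}"
  then obtain G A where S: "S = {l \<in> SW_dual E \<phi> \<alpha>. l G \<in> A}" "G \<in> SW E \<phi> \<alpha>" "A \<in> sets borel" by blast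
  have "f -` S \<inter> space N = (\<lambda>\<omega>. f \<omega> G) -` A \<inter> space N" using dual by (auto simp: S(1))
  then show "f -` S \<inter> space N \<in> sets N" using measurable_sets[OF eval[OF S(2)] S(3)] by simp
qed auto

text \<open>Sampling at the next grid point, truncated at t, never looks beyond t, so each
  approximation is measurable for F t; right continuity gives the limit.\<close>

lemma progressively_measurable_cadlag:
  assumes fs: "filtered_prob_space P T F"
    and y: "\<And>\<omega>. \<omega> \<in> space P \<Longrightarrow> cadlag_path T E \<phi> \<alpha> (\<lambda>t. Y t \<omega>)"
    and Ym: "\<And>t. t \<in> {0..T} \<Longrightarrow> Y t \<in> measurable (F t) (SW_dual_M E \<phi> \<alpha>)"
  shows "progressively_measurable T F (SW_dual_M E \<phi> \<alpha>) Y"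
  unfolding progressively_measurable_def
proof (intro ballI measurable_SW_dual_M)
  interpret filtered_prob_space P T F by (rule fs)
  fix t assume t: "t \<in> {0..T}"
  let ?N = "restrict_space borel {0..t} \<Otimes>\<^sub>M F t"
  have sp: "space ?N = {0..t} \<times> space P" by (simp add: space_pair_measure space_restrict_space space_F)
  show "(case p of (s, \<omega>) \<Rightarrow> Y s \<omega>) \<in> SW_dual E \<phi> \<alpha>" if "p \<in> space ?N" for p
    using that y t unfolding sp by (auto simp: cadlag_path_def)
  fix G assume G: "G \<in> SW E \<phi> \<alpha>"
  show "(\<lambda>p. (case p of (s, \<omega>) \<Rightarrow> Y s \<omega>) G) \<in> borel_measurable ?N"
  proof (rule borel_measurable_LIMSEQ_metric)
    fix n
    let ?h = "1 / real (Suc n)"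
    \<comment> \<open>The sample times are indexed by the integers, so the joint function is glued
      from countably many measurable ones.\<close>
    let ?v = "\<lambda>i :: int. max 0 (min t (?h * (real_of_int i + 1)))"
    have Yi: "(\<lambda>p. Y (?v i) (snd p) G) \<in> borel_measurable ?N" for i
    proof -
      have v: "?v i \<in> {0..T}" "?v i \<le> t" using t by auto
      have "Y (?v i) \<in> measurable (F t) (SW_dual_M E \<phi> \<alpha>)" by (rule measurable_F_mono[OF v(2) Ym[OF v(1)]])
      then have "(\<lambda>\<omega>. Y (?v i) \<omega> G) \<in> borel_measurable (F t)" by (rule measurable_compose[OF _ eval_measurable[OF G]])
      then show ?thesis by (rule measurable_compose[OF measurable_snd])
    qed
    have fl: "(\<lambda>p. \<lfloor>fst p / ?h\<rfloor>) \<in> measurable ?N (count_space UNIV)"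
    proof -
      have "(\<lambda>s. \<lfloor>s / ?h\<rfloor>) \<in> measurable borel (count_space UNIV)"
        by (rule measurable_compose[OF _ measurable_real_floor]) simp
      then have "(\<lambda>s. \<lfloor>s / ?h\<rfloor>) \<in> measurable (restrict_space borel {0..t}) (count_space UNIV)"
        by (rule measurable_restrict_space1)
      then show ?thesis by (rule measurable_compose[OF measurable_fst])
    qed
    show "(\<lambda>p. Y (next_pt ?h t (fst p)) (snd p) G) \<in> borel_measurable ?N"
      using measurable_compose_countable[OF Yi fl] by (simp add: next_pt_def)
  next
    fix p assume p: "p \<in> space ?N"
    then have w: "snd p \<in> space P" and s: "fst p \<in> {0..t}" unfolding sp by auto
    have "(\<lambda>n. Y (next_pt (1 / real (Suc n)) t (fst p)) (snd p) G) \<longlonglongrightarrow> Y (fst p) (snd p) G"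
      using s t cadlag_right_cont[OF y[OF w] G]
      by (intro next_pt_tendsto[where f = "\<lambda>s. Y s (snd p) G"] LIMSEQ_divide_Suc) auto
    then show "(\<lambda>n. Y (next_pt (1 / real (Suc n)) t (fst p)) (snd p) G) \<longlonglongrightarrow> (case p of (s, \<omega>) \<Rightarrow> Y s \<omega>) G"
      by (simp add: case_prod_beta)
  qed
qed

end

section \<open>The fluctuation field\<close>

lemma euler_lincomb:
  assumes m: "\<And>j. j \<le> n \<Longrightarrow> (\<lambda>\<omega>. m \<omega> (real j * h)) \<in> lincomb I B" and v0: "v0 \<in> lincomb I B"
  shows "i \<le> n \<Longrightarrow> (\<lambda>\<omega>. euler \<beta> h (m \<omega>) (v0 \<omega>) i) \<in> lincomb I B"
proof (induction i)
  case 0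
  then show ?case using v0 by simp
next
  case (Suc i)
  have "(\<lambda>\<omega>. inverse (1 - \<beta> * h) * (euler \<beta> h (m \<omega>) (v0 \<omega>) i + (m \<omega> (real (Suc i) * h) + (-1) * m \<omega> (real i * h)))) \<in> lincomb I B"
    using Suc m[of i] m[of "Suc i"] by (intro lincomb_scale lincomb_add) auto
  then show ?case by simp
qed

lemma set_lebesgue_integral_singleton: "(LBINT s:{a..a}. f s) = 0"
  for a :: real and f :: "real \<Rightarrow> real"
proof -
  have "AE s in lborel. indicator {a} s *\<^sub>R f s = 0"
    using AE_lborel_singleton[of a] by eventually_elim simp
  then show ?thesis
    unfolding set_lebesgue_integral_def atLeastAtMost_singleton by (rule integral_eq_zero_AE)
qed

locale fluctuation_field = spectral_basis W E \<phi> \<alpha> + filtered_prob_space P T F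
  for W :: "'d::finite \<Rightarrow> real \<Rightarrow> real" and E \<phi> \<alpha> and P :: "'a measure" and T F +
  fixes A :: "'d \<Rightarrow> real" and \<kappa> :: real and q :: "(real ^ 'd \<Rightarrow> real) \<Rightarrow> real"
    and Y M :: "real \<Rightarrow> 'a \<Rightarrow> (real ^ 'd \<Rightarrow> real) \<Rightarrow> real"
  assumes T_pos: "T > 0"
    and Y_path: "\<And>\<omega>. \<omega> \<in> space P \<Longrightarrow> cadlag_path T E \<phi> \<alpha> (\<lambda>t. Y t \<omega>)"
    and Y_meas: "\<And>t. t \<in> {0..T} \<Longrightarrow> Y t \<in> measurable (F t) (SW_dual_M E \<phi> \<alpha>)"
    and Y_init: "gaussian_family P (SW E \<phi> \<alpha>) (\<lambda>G \<omega>. Y 0 \<omega> G)"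
    and M_def: "M = mart_part W E \<phi> \<alpha> A \<kappa> Y"
    and M_mart: "\<And>G. G \<in> SW E \<phi> \<alpha> \<Longrightarrow> martingale P T F (\<lambda>t \<omega>. M t \<omega> G)"
    and M_qv: "\<And>G. G \<in> SW E \<phi> \<alpha> \<Longrightarrow> quadratic_variation P T (\<lambda>t \<omega>. M t \<omega> G) (\<lambda>t \<omega>. q G * t)"
    and q_nonneg: "\<And>G. G \<in> SW E \<phi> \<alpha> \<Longrightarrow> q G \<ge> 0"
begin

section \<open>The martingale part, the solution property and uniqueness\<close>

lemma Y_dual: "t \<in> {0..T} \<Longrightarrow> \<omega> \<in> space P \<Longrightarrow> Y t \<omega> \<in> SW_dual E \<phi> \<alpha>"
  using Y_path by (auto simp: cadlag_path_def)

lemma M_dual: "t \<in> {0..T} \<Longrightarrow> \<omega> \<in> space P \<Longrightarrow> M t \<omega> \<in> SW_dual E \<phi> \<alpha>"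
  unfolding M_def by (rule mart_part_dual[OF Y_path])

lemma M_eq: "G \<in> SW E \<phi> \<alpha> \<Longrightarrow> M t \<omega> G = Y t \<omega> G - Y 0 \<omega> G - \<kappa> * (LBINT s:{0..t}. Y s \<omega> (div_form W E \<phi> \<alpha> A G))"
  by (simp add: M_def mart_part_def)

lemma M_0: "G \<in> SW E \<phi> \<alpha> \<Longrightarrow> M 0 \<omega> G = 0"
  by (simp only: M_eq set_lebesgue_integral_singleton)

lemma M_meas: "t \<in> {0..T} \<Longrightarrow> M t \<in> measurable (F t) (SW_dual_M E \<phi> \<alpha>)"
  by (rule measurable_SW_dual_M) (use M_dual space_F M_mart in \<open>auto simp: martingale_def\<close>)

lemma M_mean:
  assumes G: "G \<in> SW E \<phi> \<alpha>" and t: "t \<in> {0..T}"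
  shows "(\<integral>\<omega>. M t \<omega> G \<partial>P) = 0"
proof -
  interpret X: real_martingale P T F "\<lambda>t \<omega>. M t \<omega> G" by unfold_locales (rule M_mart[OF G])
  have "(\<integral>\<omega>. 1 * (M t \<omega> G - M 0 \<omega> G) \<partial>P) = 0"
    by (rule X.increment_mean_real[where B = 1]) (use t in auto)
  then show ?thesis by (simp add: M_0[OF G])
qed

lemma Y_div_integrable: "\<omega> \<in> space P \<Longrightarrow> G \<in> SW E \<phi> \<alpha> \<Longrightarrow> t \<in> {0..T} \<Longrightarrow> set_integrable lborel {0..t} (\<lambda>s. Y s \<omega> (div_form W E \<phi> \<alpha> A G))"
  by (rule cadlag_integrable[OF Y_path div_form_SW])

lemma solution:
  assumes \<sigma>: "\<And>G. G \<in> SW E \<phi> \<alpha> \<Longrightarrow> q G = (\<Sum>j\<in>UNIV. \<integral>x. (\<sigma> j * grad_W W E G j x)\<^sup>2 \<partial>dir_measure W j)"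
  shows "SDE_solution P T F W E \<phi> \<alpha> A \<kappa> \<sigma> M Y"
  unfolding SDE_solution_def driving_martingale_def
proof (intro conjI ballI)
  show "M t \<in> measurable (F t) (SW_dual_M E \<phi> \<alpha>)" "Y t \<in> measurable (F t) (SW_dual_M E \<phi> \<alpha>)" if "t \<in> {0..T}" for t
    using that by (auto intro: M_meas Y_meas)
  show "progressively_measurable T F (SW_dual_M E \<phi> \<alpha>) Y"
    by (rule progressively_measurable_cadlag[OF filtered_prob_space_axioms Y_path Y_meas])
  show "AE \<omega> in P. \<forall>G\<in>SW E \<phi> \<alpha>. \<forall>t\<in>{0..T}.
        set_integrable lborel {0..t} (\<lambda>s. Y s \<omega> (div_form W E \<phi> \<alpha> A G)) \<and>
        Y t \<omega> G = Y 0 \<omega> G + \<kappa> * (LBINT s:{0..t}. Y s \<omega> (div_form W E \<phi> \<alpha> A G)) + M t \<omega> G"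
    using Y_div_integrable by (intro AE_I2) (simp add: M_eq)
next
  fix G assume G: "G \<in> SW E \<phi> \<alpha>"
  show "AE \<omega> in P. M 0 \<omega> G = 0" by (simp add: M_0[OF G])
  show "martingale P T F (\<lambda>t \<omega>. M t \<omega> G)" by (rule M_mart[OF G])
  show "(\<integral>\<omega>. M t \<omega> G \<partial>P) = 0" if "t \<in> {0..T}" for t by (rule M_mean[OF G that])
  show "quadratic_variation P T (\<lambda>t \<omega>. M t \<omega> G)
          (\<lambda>t \<omega>. t * (\<Sum>j\<in>UNIV. \<integral>x. (\<sigma> j * grad_W W E G j x)\<^sup>2 \<partial>dir_measure W j))"
    using M_qv[OF G] unfolding \<sigma>[OF G] by (simp add: mult.commute)
qed

text \<open>The difference of two solutions with the same noise solves a linear Volterra equation in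
  every spectral coordinate.\<close>

lemma unique:
  assumes Y': "SDE_solution P T F W E \<phi> \<alpha> A \<kappa> \<sigma> M Y'" and init: "AE \<omega> in P. Y' 0 \<omega> = Y 0 \<omega>"
  shows "AE \<omega> in P. \<forall>t\<in>{0..T}. Y' t \<omega> = Y t \<omega>"
proof -
  have Y'd: "Y' t \<omega> \<in> SW_dual E \<phi> \<alpha>" if "t \<in> {0..T}" "\<omega> \<in> space P" for t \<omega>
    using Y' that measurable_space[of "Y' t" "F t" "SW_dual_M E \<phi> \<alpha>" \<omega>] space_F by (auto simp: SDE_solution_def)
  have "AE \<omega> in P. \<forall>G\<in>SW E \<phi> \<alpha>. \<forall>t\<in>{0..T}.
        set_integrable lborel {0..t} (\<lambda>s. Y' s \<omega> (div_form W E \<phi> \<alpha> A G)) \<and>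
        Y' t \<omega> G = Y' 0 \<omega> G + \<kappa> * (LBINT s:{0..t}. Y' s \<omega> (div_form W E \<phi> \<alpha> A G)) + M t \<omega> G"
    using Y' by (simp add: SDE_solution_def)
  with init AE_space show ?thesis
  proof eventually_elim
    case (elim \<omega>)
    have w: "\<omega> \<in> space P" using elim by simp
    show ?case
    proof (intro ballI dual_eqI Y'd Y_dual w)
      fix t and k :: nat assume t: "t \<in> {0..T}" and k: "k \<ge> 1"
      define D where "D = div_form W E \<phi> \<alpha> A (\<phi> k)"
      define l where "l = div_eigval A k"
      \<comment> \<open>The difference is tested at the image of \<phi> k under the operator: a
        competing solution need not be cadlag, and only along such images is its integrability in
        time part of the notion of solution.\<close>
      define z where "z s = Y' s \<omega> D - Y s \<omega> D" for s
      have int': "set_integrable lborel {0..s} (\<lambda>s. Y' s \<omega> D)"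
        and int: "set_integrable lborel {0..s} (\<lambda>s. Y s \<omega> D)" if "s \<in> {0..T}" for s
        using elim(3) Y_div_integrable[OF w] phi_SW[OF k] that by (auto simp: D_def)
      have diff: "Y' s \<omega> (\<phi> k) - Y s \<omega> (\<phi> k) = \<kappa> * (LBINT r:{0..s}. z r)" if s: "s \<in> {0..T}" for s
      proof -
        have "Y' s \<omega> (\<phi> k) = Y' 0 \<omega> (\<phi> k) + \<kappa> * (LBINT r:{0..s}. Y' r \<omega> D) + M s \<omega> (\<phi> k)"
          unfolding D_def by (rule elim(3)[rule_format, OF phi_SW[OF k] s, THEN conjunct2])
        moreover have "Y' 0 \<omega> (\<phi> k) = Y 0 \<omega> (\<phi> k)" using elim(1) by simp
        moreover have "M s \<omega> (\<phi> k) = Y s \<omega> (\<phi> k) - Y 0 \<omega> (\<phi> k) - \<kappa> * (LBINT r:{0..s}. Y r \<omega> D)"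
          using M_eq[OF phi_SW[OF k], of s \<omega>] by (simp add: D_def)
        moreover have "(LBINT r:{0..s}. z r) = (LBINT r:{0..s}. Y' r \<omega> D) - (LBINT r:{0..s}. Y r \<omega> D)"
          unfolding z_def by (rule set_integral_diff(2)[OF int'[OF s] int[OF s]])
        ultimately show ?thesis by (simp add: right_diff_distrib)
      qed
      have zl: "z s = (l * \<kappa>) * (LBINT r:{0..s}. z r)" if s: "s \<in> {0..T}" for s
      proof -
        have "z s = l * (Y' s \<omega> (\<phi> k) - Y s \<omega> (\<phi> k))"
          unfolding z_def D_def l_def dual_div_form_phi[OF Y'd[OF s w] k] dual_div_form_phi[OF Y_dual[OF s w] k]
          by (simp add: right_diff_distrib)
        then show ?thesis using diff[OF s] by simp
      qed
      have "z s = 0" if "s \<in> {0..T}" for s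
      proof (rule linear_volterra_zero[OF _ zl that])
        show "set_integrable lborel {0..r} z" if "r \<in> {0..T}" for r
          unfolding z_def by (rule set_integral_diff(1)[OF int'[OF that] int[OF that]])
      qed auto
      \<comment> \<open>The eigenvalue l may be 0, so one returns to \<phi> k through the integral
        equation \<open>diff\<close> and not by dividing.\<close>
      then have "(LBINT r:{0..t}. z r) = (LBINT r:{0..t}. 0)"
        using t by (intro set_lebesgue_integral_cong) auto
      then have "(LBINT r:{0..t}. z r) = 0" by (simp add: set_lebesgue_integral_def)
      then show "Y' t \<omega> (\<phi> k) = Y t \<omega> (\<phi> k)" using diff[OF t] by simp
    qed auto
  qed
qed

section \<open>Gaussianity of the field\<close>

definition noise_index :: "((real ^ 'd \<Rightarrow> real) + real \<times> (real ^ 'd \<Rightarrow> real)) set" where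
  "noise_index = SW E \<phi> \<alpha> <+> ({0..T} \<times> SW E \<phi> \<alpha>)"

definition noise_family :: "(real ^ 'd \<Rightarrow> real) + real \<times> (real ^ 'd \<Rightarrow> real) \<Rightarrow> 'a \<Rightarrow> real" where
  "noise_family = case_sum (\<lambda>G \<omega>. Y 0 \<omega> G) (\<lambda>(t, H). (\<lambda>\<omega>. M t \<omega> H))"

lemma noise_gaussian: "gaussian_family P noise_index noise_family"
proof -
  interpret linear_martingale_family P T F "SW E \<phi> \<alpha>" "\<lambda>t H \<omega>. M t \<omega> H" q
  proof unfold_locales
    show "\<exists>K\<in>SW E \<phi> \<alpha>. \<forall>t\<in>{0..T}. \<forall>\<omega>\<in>space P. M t \<omega> K = M t \<omega> H + a * M t \<omega> H'"
      if "H \<in> SW E \<phi> \<alpha>" "H' \<in> SW E \<phi> \<alpha>" for H H' a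
    proof (intro bexI[of _ "\<lambda>x. H x + a * H' x"] ballI)
      show "(\<lambda>x. H x + a * H' x) \<in> SW E \<phi> \<alpha>" using that by (intro SW_add SW_scale)
      show "M t \<omega> (\<lambda>x. H x + a * H' x) = M t \<omega> H + a * M t \<omega> H'" if "t \<in> {0..T}" "\<omega> \<in> space P" for t \<omega>
        by (simp only: dual_add[OF M_dual[OF that] \<open>H \<in> _\<close> SW_scale[OF \<open>H' \<in> _\<close>]] dual_scale[OF M_dual[OF that] \<open>H' \<in> _\<close>])
    qed
  qed (use M_mart M_qv q_nonneg M_0 T_pos in auto)
  have "(\<lambda>\<omega>. Y 0 \<omega> G) \<in> borel_measurable (F 0)" if "G \<in> SW E \<phi> \<alpha>" for G
    by (rule measurable_compose[OF Y_meas eval_measurable[OF that]]) (use T_pos in simp)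
  from joint_gaussian[OF Y_init this] show ?thesis by (simp add: noise_index_def noise_family_def)
qed

text \<open>Two successive limits stay in the closure of the Gaussian span: the time step gives the
  coordinates Y_t(\<phi> k), and the expansion of G in the basis then gives Y_t(G).\<close>

lemma Y_gaussian: "gaussian_family P ({0..T} \<times> SW E \<phi> \<alpha>) (\<lambda>(t, G) \<omega>. Y t \<omega> G)"
proof (rule gaussian_family_L0_closure[OF noise_gaussian])
  define V where "V = lincomb noise_index noise_family"
  have Vm: "V \<subseteq> borel_measurable P"
    using noise_gaussian by (auto simp: V_def gaussian_family_iff_lincomb gaussian_rv_def)
  have base0: "(\<lambda>\<omega>. Y 0 \<omega> G) \<in> V" if "G \<in> SW E \<phi> \<alpha>" for G
  proof -
    have "Inl G \<in> noise_index" using that by (auto simp: noise_index_def)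
    from lincomb_base[OF this, of noise_family] show ?thesis by (simp add: V_def noise_family_def)
  qed
  have baseM: "(\<lambda>\<omega>. M t \<omega> G) \<in> V" if "G \<in> SW E \<phi> \<alpha>" "t \<in> {0..T}" for t G
  proof -
    have "Inr (t, G) \<in> noise_index" using that by (auto simp: noise_index_def)
    from lincomb_base[OF this, of noise_family] show ?thesis by (simp add: V_def noise_family_def)
  qed
  have coord: "(\<lambda>\<omega>. Y t \<omega> (\<phi> k)) \<in> L0_closure P V" if t: "t \<in> {0..T}" and k: "k \<ge> 1" for t k
  proof (cases "t = 0")
    case True
    then show ?thesis using base0[OF phi_SW[OF k]] Vm by (auto intro: L0_closure_base)
  next
    case False
    then have t0: "t > 0" using t by simp
    define \<beta> where "\<beta> = \<kappa> * div_eigval A k"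
    show ?thesis
    proof (rule L0_closure_limit[OF Vm])
      show "(\<lambda>\<omega>. euler \<beta> (t / real (Suc n)) (\<lambda>s. M s \<omega> (\<phi> k)) (Y 0 \<omega> (\<phi> k)) (Suc n)) \<in> L0_closure P V" for n
      proof -
        have "(\<lambda>\<omega>. M (real j * (t / real (Suc n))) \<omega> (\<phi> k)) \<in> V" if "j \<le> Suc n" for j
        proof (rule baseM[OF phi_SW[OF k]])
          have "real j * (t / real (Suc n)) \<le> real (Suc n) * (t / real (Suc n))"
            using that t0 by (intro mult_right_mono) auto
          then show "real j * (t / real (Suc n)) \<in> {0..T}" using t t0 by auto
        qed
        then have "(\<lambda>\<omega>. euler \<beta> (t / real (Suc n)) (\<lambda>s. M s \<omega> (\<phi> k)) (Y 0 \<omega> (\<phi> k)) (Suc n)) \<in> V"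
          unfolding V_def
          by (intro euler_lincomb[where n = "Suc n" and m = "\<lambda>\<omega> s. M s \<omega> (\<phi> k)"] base0[OF phi_SW[OF k], unfolded V_def]) auto
        then show ?thesis using Vm by (intro L0_closure_base) auto
      qed
      fix \<omega> assume w: "\<omega> \<in> space P"
      obtain K where K: "\<forall>s\<in>{0..T}. \<bar>Y s \<omega> (\<phi> k)\<bar> \<le> K"
        using cadlag_eval_bounded[OF Y_path[OF w] phi_SW[OF k]] by blast
      show "(\<lambda>n. euler \<beta> (t / real (Suc n)) (\<lambda>s. M s \<omega> (\<phi> k)) (Y 0 \<omega> (\<phi> k)) (Suc n)) \<longlonglongrightarrow> Y t \<omega> (\<phi> k)"
      proof (rule euler_tendsto[where y = "\<lambda>s. Y s \<omega> (\<phi> k)" and K = K, OF t0])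
        show "((\<lambda>s. Y s \<omega> (\<phi> k)) \<longlongrightarrow> Y s \<omega> (\<phi> k)) (at_right s)" if "s \<in> {0..<t}" for s
          using that t by (intro cadlag_right_cont[OF Y_path[OF w] phi_SW[OF k]]) auto
        show "\<bar>Y s \<omega> (\<phi> k)\<bar> \<le> K" if "s \<in> {0..t}" for s using K that t by auto
        fix s assume s: "s \<in> {0..t}"
        have "(LBINT r:{0..s}. Y r \<omega> (div_form W E \<phi> \<alpha> A (\<phi> k))) = (LBINT r:{0..s}. div_eigval A k * Y r \<omega> (\<phi> k))"
          using s t by (intro set_lebesgue_integral_cong) (auto intro!: dual_div_form_phi Y_dual w k)
        then show "Y s \<omega> (\<phi> k) = Y 0 \<omega> (\<phi> k) + \<beta> * (LBINT r:{0..s}. Y r \<omega> (\<phi> k)) + M s \<omega> (\<phi> k)"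
          by (simp add: M_eq[OF phi_SW[OF k]] \<beta>_def)
      qed
    qed
  qed
  fix i assume "i \<in> {0..T} \<times> SW E \<phi> \<alpha>"
  then obtain t G where i: "i = (t, G)" and t: "t \<in> {0..T}" and G: "G \<in> SW E \<phi> \<alpha>" by auto
  have "(\<lambda>\<omega>. Y t \<omega> G) \<in> L0_closure P V"
  proof (rule L0_closure_limit[OF Vm])
    show "(\<lambda>\<omega>. \<Sum>k\<in>{1..N}. coef G k * Y t \<omega> (\<phi> k)) \<in> L0_closure P V" for N
      using coord[OF t] Vm unfolding V_def
      by (intro L0_closure_sum lincomb_add lincomb_zero lincomb_scale) auto
    fix \<omega> assume w: "\<omega> \<in> space P"
    show "(\<lambda>N. \<Sum>k\<in>{1..N}. coef G k * Y t \<omega> (\<phi> k)) \<longlonglongrightarrow> Y t \<omega> G"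
      using dual_approx_tendsto[OF Y_dual[OF t w] G] unfolding dual_approx[OF Y_dual[OF t w]] .
  qed
  then show "(case i of (t, G) \<Rightarrow> \<lambda>\<omega>. Y t \<omega> G) \<in> L0_closure P (lincomb noise_index noise_family)"
    by (simp add: i V_def)
qed

end

theorem theorem4p7:
  fixes T \<rho> b \<theta> :: real
    and W :: "'d::finite \<Rightarrow> real \<Rightarrow> real"
    and E :: "'d \<Rightarrow> (real \<Rightarrow> real) set"
    and \<phi> :: "nat \<Rightarrow> real ^ 'd \<Rightarrow> real" and \<alpha> :: "nat \<Rightarrow> real"
    and \<mu> :: "'e::polish_space measure" and \<tau> :: "int ^ 'd \<Rightarrow> 'e \<Rightarrow> 'e" and a :: "'d \<Rightarrow> 'e \<Rightarrow> real"
    and A :: "'d \<Rightarrow> real"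
    and P :: "'a measure" and F :: "real \<Rightarrow> 'a measure"
    and Y M :: "real \<Rightarrow> 'a \<Rightarrow> (real ^ 'd \<Rightarrow> real) \<Rightarrow> real"
  assumes "T > 0" and "0 < \<rho>" and "\<rho> \<le> 1" and "b > - 1 / 2"
    and "conductance W"
    and "\<And>k. eigenbasis (W k) (E k)"
    and "spectral_enumeration W E \<phi> \<alpha>"
    and "random_environment \<mu> \<tau> a \<theta>"
    and "\<And>j. A j > 0"
    and "AE \<omega> in \<mu>. homogenization W E (\<lambda>N j x. a j (\<tau> x \<omega>)) A"
    and "prob_space P" and "filtration (space P) F" and "\<And>t. t \<in> {0..T} \<Longrightarrow> subalgebra P (F t)"
    and "\<And>\<omega>. \<omega> \<in> space P \<Longrightarrow> cadlag_path T E \<phi> \<alpha> (\<lambda>t. Y t \<omega>)"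
    and "\<And>t. t \<in> {0..T} \<Longrightarrow> Y t \<in> measurable (F t) (SW_dual_M E \<phi> \<alpha>)"
    and "gaussian_family P (SW E \<phi> \<alpha>) (\<lambda>G \<omega>. Y 0 \<omega> G)"
    and "M = mart_part W E \<phi> \<alpha> A (phi' b \<rho>) Y"
    and "\<And>G. G \<in> SW E \<phi> \<alpha> \<Longrightarrow> martingale P T F (\<lambda>t \<omega>. M t \<omega> G)"
    and "\<And>G. G \<in> SW E \<phi> \<alpha> \<Longrightarrow> quadratic_variation P T (\<lambda>t \<omega>. M t \<omega> G)
           (\<lambda>t \<omega>. 2 * t * chi \<rho> * phi' b \<rho> *
              (\<Sum>j\<in>UNIV. \<integral>x. A j * (grad_W W E G j x)\<^sup>2 \<partial>dir_measure W j))"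
  shows "SDE_solution P T F W E \<phi> \<alpha> A (phi' b \<rho>) (\<lambda>j. sqrt (2 * chi \<rho> * phi' b \<rho> * A j)) M Y
    \<and> (\<forall>Y'. SDE_solution P T F W E \<phi> \<alpha> A (phi' b \<rho>) (\<lambda>j. sqrt (2 * chi \<rho> * phi' b \<rho> * A j)) M Y'
            \<and> (AE \<omega> in P. Y' 0 \<omega> = Y 0 \<omega>)
          \<longrightarrow> (AE \<omega> in P. \<forall>t\<in>{0..T}. Y' t \<omega> = Y t \<omega>))
    \<and> gaussian_family P ({0..T} \<times> SW E \<phi> \<alpha>) (\<lambda>(t, G) \<omega>. Y t \<omega> G)"
proof -
  define c where "c = 2 * chi \<rho> * phi' b \<rho>"
  define q where "q G = (\<Sum>j\<in>UNIV. \<integral>x. (sqrt (c * A j) * grad_W W E G j x)\<^sup>2 \<partial>dir_measure W j)" for G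
  \<comment> \<open>From b > - 1/2 and \<rho> \<le> 1: 1 + 2 b \<rho> \<ge> 1 - \<rho> \<ge> 0. The
    sign is needed for the square roots in the noise coefficient to square back to the given
    quadratic variation.\<close>
  have "phi' b \<rho> \<ge> 0"
  proof -
    have "b * \<rho> \<ge> - 1 / 2 * \<rho>" using assms(2,4) by (intro mult_right_mono) auto
    then show ?thesis using assms(3) by (simp add: phi'_def)
  qed
  then have c: "c \<ge> 0" using assms(2,3) by (simp add: c_def chi_def)
  have q_eq: "q G * t = 2 * t * chi \<rho> * phi' b \<rho> * (\<Sum>j\<in>UNIV. \<integral>x. A j * (grad_W W E G j x)\<^sup>2 \<partial>dir_measure W j)" for G t
  proof -
    have "c * A j \<ge> 0" for j using c assms(9)[of j] by simp
    then have "q G = c * (\<Sum>j\<in>UNIV. \<integral>x. A j * (grad_W W E G j x)\<^sup>2 \<partial>dir_measure W j)"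
      unfolding q_def sum_distrib_left by (simp add: power_mult_distrib mult.assoc)
    then show ?thesis by (simp add: c_def mult_ac)
  qed
  interpret fluctuation_field W E \<phi> \<alpha> P T F A "phi' b \<rho>" q Y M
  proof (intro fluctuation_field.intro spectral_basis.intro filtered_prob_space.intro
      filtered_prob_space_axioms.intro fluctuation_field_axioms.intro)
    show "quadratic_variation P T (\<lambda>t \<omega>. M t \<omega> G) (\<lambda>t \<omega>. q G * t)" if "G \<in> SW E \<phi> \<alpha>" for G
      unfolding q_eq by (rule assms(19)[OF that])
    show "q G \<ge> 0" for G unfolding q_def by (intro sum_nonneg integral_nonneg_AE) auto
  qed (use assms in auto)
  have sol: "SDE_solution P T F W E \<phi> \<alpha> A (phi' b \<rho>) (\<lambda>j. sqrt (2 * chi \<rho> * phi' b \<rho> * A j)) M Y"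
    by (rule solution) (simp add: q_def c_def)
  show ?thesis using sol unique Y_gaussian by blast
qed

end
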